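(* Let $G$ be a finitely generated Abelian group. Then $G$ acts freely, isometrically and properly discontinuously on the unit sphere of every infinite dimensional real Hilbert space if and only if the torsion subgroup of $G$ is of the form $$\mathbb{Z}_{p_1^{\alpha_1}} \oplus \cdots \oplus \mathbb{Z}_{p_m^{\alpha_m}},$$ where $m\geq 0$, $p_1,\dots,p_m$ are pairwise distinct primes and $\alpha_i\geq 1$. In particular, if the torsion subgroup of $G$ is of this form, there exists a complete Hilbert manifold, which may be chosen to be modeled on $l_2$, with positive constant sectional curvature, whose fundamental group is (isomorphic to) $G$.
   Context: $l_2$ is the separable infinite dimensional real Hilbert space of square-summable real sequences; $\mathbb{Z}_n$ is the cyclic group of order $n$. The unit sphere of a Hilbert space carries the Riemannian metric induced from the Hilbert space. "$G$ acts on a space with given properties" means there exists an action of $G$ with these properties; the action is isometric if every element acts as an isometry. A group $G$ acts properly discontinuously on a topological space $X$ if: (1) whenever $x,y\in X$ and $y\notin Gx$, there are neighborhoods $U$ of $x$ and $V$ of $y$ such that $gU\cap V=\emptyset$ for every $g\in G$; (2) for every $x\in X$ the stabilizer $G_x=\{g\in G: gx=x\}$ is finite; (3) every $x\in X$ has a neighborhood $U$, stable under $G_x$, such that $gU\cap U=\emptyset$ for every $g\in G\setminus G_x$. The action is free if $G_x=\{e\}$ for every $x\in X$. A Hilbert manifold is a manifold modeled on a Hilbert space $\mathbb{H}$ equipped with an inner product on each tangent space $T_pM\cong\mathbb{H}$, depending smoothly on $p$ and inducing a norm equivalent to that of $\mathbb{H}$ (a Riemannian metric). It is complete if it is a complete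 metric space for the distance induced by the Riemannian metric. *)

theory Defs
  imports
    "HOL-Analysis.Analysis"
    "HOL-Algebra.Generated_Groups"
    "HOL-Algebra.Group_Action"
    "HOL-Algebra.Product_Groups"
    "HOL-Computational_Algebra.Primes"
begin

section \<open>The Hilbert space of square-summable real sequences\<close>

typedef l2 = "{f :: nat \<Rightarrow> real. summable (\<lambda>n. (f n)\<^sup>2)}"
  morphisms l2_nth Abs_l2
  by (rule exI[of _ "\<lambda>_. 0"]) simp

setup_lifting type_definition_l2

lemma summable_l2_nth: "summable (\<lambda>n. (l2_nth x n)\<^sup>2)"
  using l2_nth[of x] by simp

lemma summable_mult_of_squares:
  fixes f g :: "nat \<Rightarrow> real"
  assumes "summable (\<lambda>n. (f n)\<^sup>2)" "summable (\<lambda>n. (g n)\<^sup>2)"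
  shows "summable (\<lambda>n. f n * g n)"
proof (rule summable_comparison_test')
  show "summable (\<lambda>n. (f n)\<^sup>2 + (g n)\<^sup>2)"
    by (intro summable_add assms)
  fix n :: nat
  have "2 * (\<bar>f n\<bar> * \<bar>g n\<bar>) \<le> (f n)\<^sup>2 + (g n)\<^sup>2"
    using sum_squares_bound[of "\<bar>f n\<bar>" "\<bar>g n\<bar>"] by simp
  moreover have "0 \<le> \<bar>f n\<bar> * \<bar>g n\<bar>"
    by simp
  ultimately show "norm (f n * g n) \<le> (f n)\<^sup>2 + (g n)\<^sup>2"
    unfolding real_norm_def abs_mult by linarith
qed

lemma summable_square_add:
  fixes f g :: "nat \<Rightarrow> real"
  assumes "summable (\<lambda>n. (f n)\<^sup>2)" "summable (\<lambda>n. (g n)\<^sup>2)"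
  shows "summable (\<lambda>n. (f n + g n)\<^sup>2)"
proof -
  have "summable (\<lambda>n. (f n)\<^sup>2 + (g n)\<^sup>2 + 2 * (f n * g n))"
    by (intro summable_add summable_mult summable_mult_of_squares assms)
  then show ?thesis
    by (simp add: power2_sum mult.assoc)
qed

instantiation l2 :: real_inner
begin

lift_definition zero_l2 :: l2 is "\<lambda>_. 0" by simp
lift_definition plus_l2 :: "l2 \<Rightarrow> l2 \<Rightarrow> l2" is "\<lambda>f g n. f n + g n"
  by (rule summable_square_add)
lift_definition uminus_l2 :: "l2 \<Rightarrow> l2" is "\<lambda>f n. - f n" by simp
lift_definition scaleR_l2 :: "real \<Rightarrow> l2 \<Rightarrow> l2" is "\<lambda>r f n. r * f n"
  by (simp add: power_mult_distrib summable_mult)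
definition minus_l2 :: "l2 \<Rightarrow> l2 \<Rightarrow> l2" where "x - y = x + - (y :: l2)"
definition inner_l2 :: "l2 \<Rightarrow> l2 \<Rightarrow> real" where "inner_l2 x y = (\<Sum>n. l2_nth x n * l2_nth y n)"
definition norm_l2 :: "l2 \<Rightarrow> real" where "norm x = sqrt (inner x (x :: l2))"
definition sgn_l2 :: "l2 \<Rightarrow> l2" where "sgn x = inverse (norm x) *\<^sub>R (x :: l2)"
definition dist_l2 :: "l2 \<Rightarrow> l2 \<Rightarrow> real" where "dist x y = norm (x - (y :: l2))"
definition uniformity_l2 :: "(l2 \<times> l2) filter" where
  "uniformity = (INF e\<in>{0 <..}. principal {(x, y). dist x (y :: l2) < e})"
definition open_l2 :: "l2 set \<Rightarrow> bool" where
  "open U = (\<forall>x\<in>U. eventually (\<lambda>(x', y). x' = x \<longrightarrow> y \<in> U) (uniformity :: (l2 \<times> l2) filter))"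

instance
proof
  fix x y z :: l2 and a b r :: real
  have sm: "summable (\<lambda>n. l2_nth u n * l2_nth v n)" for u v
    by (intro summable_mult_of_squares summable_l2_nth)
  show "x + y + z = x + (y + z)" "x + y = y + x" "0 + x = x" "- x + x = 0"
    "a *\<^sub>R (x + y) = a *\<^sub>R x + a *\<^sub>R y" "(a + b) *\<^sub>R x = a *\<^sub>R x + b *\<^sub>R x"
    "a *\<^sub>R b *\<^sub>R x = (a * b) *\<^sub>R x" "1 *\<^sub>R x = x"
    by (transfer; simp add: algebra_simps fun_eq_iff)+
  show "x - y = x + - y" by (rule minus_l2_def)
  show "sgn x = inverse (norm x) *\<^sub>R x" by (rule sgn_l2_def)
  show "dist x y = norm (x - y)" by (rule dist_l2_def)
  show "uniformity = (INF e\<in>{0 <..}. principal {(x, y). dist x (y :: l2) < e})"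
    by (rule uniformity_l2_def)
  show "open U = (\<forall>x\<in>U. eventually (\<lambda>(x', y). x' = x \<longrightarrow> y \<in> U) uniformity)" for U :: "l2 set"
    by (rule open_l2_def)
  show "norm x = sqrt (inner x x)" by (rule norm_l2_def)
  show "inner x y = inner y x" by (simp add: inner_l2_def mult.commute)
  show "inner (x + y) z = inner x z + inner y z"
    unfolding inner_l2_def plus_l2.rep_eq distrib_right
    by (rule suminf_add[symmetric]; rule sm)
  show "inner (r *\<^sub>R x) y = r * inner x y"
    unfolding inner_l2_def scaleR_l2.rep_eq mult.assoc by (rule suminf_mult[OF sm])
  show "0 \<le> inner x x"
    unfolding inner_l2_def by (rule suminf_nonneg[OF sm]) simp
  show "inner x x = 0 \<longleftrightarrow> x = 0"
  proof -
    have "inner x x = 0 \<longleftrightarrow> (\<forall>n. l2_nth x n * l2_nth x n = 0)"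
      unfolding inner_l2_def by (rule suminf_eq_zero_iff[OF sm]) simp
    also have "\<dots> \<longleftrightarrow> x = 0"
      by (transfer; auto simp: fun_eq_iff)
    finally show ?thesis .
  qed
qed

end

lemma l2_nth_diff: "l2_nth (x - y) n = l2_nth x n - l2_nth y n"
  unfolding minus_l2_def plus_l2.rep_eq uminus_l2.rep_eq by simp

lemma norm_l2_square: "(norm (x :: l2))\<^sup>2 = (\<Sum>n. (l2_nth x n)\<^sup>2)"
  unfolding power2_norm_eq_inner by (simp add: inner_l2_def power2_eq_square)

lemma sum_le_norm_l2_square: "(\<Sum>i<k. (l2_nth x i)\<^sup>2) \<le> (norm x)\<^sup>2"
  unfolding norm_l2_square by (intro sum_le_suminf summable_l2_nth) auto

lemma abs_l2_nth_le_norm: "\<bar>l2_nth x n\<bar> \<le> norm x"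
proof -
  have "(l2_nth x n)\<^sup>2 \<le> (\<Sum>i<Suc n. (l2_nth x i)\<^sup>2)"
    by (simp add: sum_nonneg)
  also have "\<dots> \<le> (norm x)\<^sup>2" by (rule sum_le_norm_l2_square)
  finally show ?thesis by (metis abs_le_square_iff abs_norm_cancel)
qed

instance l2 :: complete_space
proof
  fix X :: "nat \<Rightarrow> l2"
  assume X: "Cauchy X"
  have "Cauchy (\<lambda>m. l2_nth (X m) i)" for i
  proof (rule metric_CauchyI)
    fix e :: real assume "e > 0"
    with X obtain M where M: "\<forall>m\<ge>M. \<forall>n\<ge>M. dist (X m) (X n) < e"
      unfolding Cauchy_def by blast
    have "dist (l2_nth (X m) i) (l2_nth (X n) i) \<le> dist (X m) (X n)" for m n
      using abs_l2_nth_le_norm[of "X m - X n" i] by (simp add: dist_norm l2_nth_diff)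
    with M show "\<exists>M. \<forall>m\<ge>M. \<forall>n\<ge>M. dist (l2_nth (X m) i) (l2_nth (X n) i) < e"
      by (meson le_less_trans)
  qed
  then have "\<forall>i. \<exists>l. (\<lambda>m. l2_nth (X m) i) \<longlonglongrightarrow> l"
    using Cauchy_convergent_iff convergent_def by blast
  then obtain a where a: "\<And>i. (\<lambda>m. l2_nth (X m) i) \<longlonglongrightarrow> a i" by metis
  have tail: "\<exists>M. \<forall>m\<ge>M. \<forall>k. (\<Sum>i<k. (l2_nth (X m) i - a i)\<^sup>2) \<le> e\<^sup>2" if "e > 0" for e
  proof -
    from X that obtain M where M: "\<forall>m\<ge>M. \<forall>n\<ge>M. dist (X m) (X n) < e"
      unfolding Cauchy_def by blast
    have "(\<Sum>i<k. (l2_nth (X m) i - a i)\<^sup>2) \<le> e\<^sup>2" if "m \<ge> M" for m k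
    proof (rule LIMSEQ_le_const2)
      show "(\<lambda>n. \<Sum>i<k. (l2_nth (X m) i - l2_nth (X n) i)\<^sup>2) \<longlonglongrightarrow> (\<Sum>i<k. (l2_nth (X m) i - a i)\<^sup>2)"
        by (intro tendsto_intros a)
      show "\<exists>N. \<forall>n\<ge>N. (\<Sum>i<k. (l2_nth (X m) i - l2_nth (X n) i)\<^sup>2) \<le> e\<^sup>2"
      proof (intro exI allI impI)
        fix n assume "n \<ge> M"
        have "(\<Sum>i<k. (l2_nth (X m) i - l2_nth (X n) i)\<^sup>2) \<le> (norm (X m - X n))\<^sup>2"
          using sum_le_norm_l2_square[of "X m - X n" k] by (simp add: l2_nth_diff)
        also have "\<dots> \<le> e\<^sup>2"
          using M \<open>m \<ge> M\<close> \<open>n \<ge> M\<close> by (intro power_mono) (auto simp: dist_norm less_imp_le)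
        finally show "(\<Sum>i<k. (l2_nth (X m) i - l2_nth (X n) i)\<^sup>2) \<le> e\<^sup>2" .
      qed
    qed
    then show ?thesis by blast
  qed
  have summ: "summable (\<lambda>i. (l2_nth (X m) i - a i)\<^sup>2)"
    if "\<forall>k. (\<Sum>i<k. (l2_nth (X m) i - a i)\<^sup>2) \<le> C" for m C
    using that by (intro summableI_nonneg_bounded[where x = C]) auto
  obtain M1 where "\<forall>k. (\<Sum>i<k. (l2_nth (X M1) i - a i)\<^sup>2) \<le> 1\<^sup>2"
    using tail[of 1] by auto
  from summ[OF this] have "summable (\<lambda>i. (- (l2_nth (X M1) i - a i) + l2_nth (X M1) i)\<^sup>2)"
    by (intro summable_square_add summable_l2_nth) (simp add: power2_commute)
  then have "summable (\<lambda>i. (a i)\<^sup>2)" by simp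
  then have L: "l2_nth (Abs_l2 a) = a" by (simp add: Abs_l2_inverse)
  have "X \<longlonglongrightarrow> Abs_l2 a"
  proof (rule metric_LIMSEQ_I)
    fix e :: real assume "e > 0"
    then obtain M where M: "\<And>m k. m \<ge> M \<Longrightarrow> (\<Sum>i<k. (l2_nth (X m) i - a i)\<^sup>2) \<le> (e/2)\<^sup>2"
      using tail[of "e/2"] by auto
    have "dist (X m) (Abs_l2 a) < e" if "m \<ge> M" for m
    proof -
      have "(norm (X m - Abs_l2 a))\<^sup>2 \<le> (e/2)\<^sup>2"
        unfolding norm_l2_square l2_nth_diff L
        using M[OF that] by (intro suminf_le_const summ) auto
      then have "norm (X m - Abs_l2 a) \<le> e/2"
        by (rule power2_le_imp_le) (use \<open>e > 0\<close> in simp)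
      with \<open>e > 0\<close> show ?thesis by (simp add: dist_norm)
    qed
    then show "\<exists>M. \<forall>m\<ge>M. dist (X m) (Abs_l2 a) < e" by blast
  qed
  then show "convergent X" by (auto simp: convergent_def)
qed


section \<open>Groups\<close>

definition finitely_generated_group :: "('g, 'b) monoid_scheme \<Rightarrow> bool" where
  "finitely_generated_group G \<longleftrightarrow>
     (\<exists>S. finite S \<and> S \<subseteq> carrier G \<and> generate G S = carrier G)"

definition torsion_subgroup :: "('g, 'b) monoid_scheme \<Rightarrow> ('g, 'b) monoid_scheme" where
  "torsion_subgroup G =
     G\<lparr>carrier := {x \<in> carrier G. \<exists>n::nat. n > 0 \<and> x [^]\<^bsub>G\<^esub> n = \<one>\<^bsub>G\<^esub>}\<rparr>"

definition torsion_sum_of_distinct_prime_powers :: "('g, 'b) monoid_scheme \<Rightarrow> bool" where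
  "torsion_sum_of_distinct_prime_powers G \<longleftrightarrow>
     (\<exists>(m::nat) (p :: nat \<Rightarrow> nat) (\<alpha> :: nat \<Rightarrow> nat).
        (\<forall>i<m. prime (p i)) \<and> inj_on p {..<m} \<and> (\<forall>i<m. \<alpha> i \<ge> 1) \<and>
        torsion_subgroup G \<cong> sum_group {..<m} (\<lambda>i. integer_mod_group (p i ^ \<alpha> i)))"


section \<open>Group actions on topological spaces\<close>

definition neighbourhood_of :: "'x topology \<Rightarrow> 'x \<Rightarrow> 'x set \<Rightarrow> bool" where
  "neighbourhood_of X x U \<longleftrightarrow> U \<subseteq> topspace X \<and> (\<exists>W. openin X W \<and> x \<in> W \<and> W \<subseteq> U)"

definition properly_discontinuous_action ::
    "('g, 'b) monoid_scheme \<Rightarrow> 'x topology \<Rightarrow> ('g \<Rightarrow> 'x \<Rightarrow> 'x) \<Rightarrow> bool" where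
  "properly_discontinuous_action G X \<phi> \<longleftrightarrow>
     (\<forall>x\<in>topspace X. \<forall>y\<in>topspace X. y \<notin> orbit G \<phi> x \<longrightarrow>
        (\<exists>U V. neighbourhood_of X x U \<and> neighbourhood_of X y V \<and>
           (\<forall>g\<in>carrier G. \<phi> g ` U \<inter> V = {}))) \<and>
     (\<forall>x\<in>topspace X. finite (stabilizer G \<phi> x)) \<and>
     (\<forall>x\<in>topspace X. \<exists>U. neighbourhood_of X x U \<and>
        (\<forall>g\<in>stabilizer G \<phi> x. \<phi> g ` U = U) \<and>
        (\<forall>g\<in>carrier G - stabilizer G \<phi> x. \<phi> g ` U \<inter> U = {}))"

definition free_action :: "('g, 'b) monoid_scheme \<Rightarrow> 'x set \<Rightarrow> ('g \<Rightarrow> 'x \<Rightarrow> 'x) \<Rightarrow> bool" where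
  "free_action G E \<phi> \<longleftrightarrow> (\<forall>x\<in>E. stabilizer G \<phi> x = {\<one>\<^bsub>G\<^esub>})"


section \<open>Smooth maps between normed spaces\<close>

text \<open>A continuous \<open>k\<close>-linear map is represented by its values on lists of length \<open>k\<close>.\<close>

definition bounded_multilinear ::
    "nat \<Rightarrow> ('a::real_normed_vector list \<Rightarrow> 'b::real_normed_vector) \<Rightarrow> bool" where
  "bounded_multilinear k T \<longleftrightarrow>
     (\<forall>us vs. length us + length vs + 1 = k \<longrightarrow> linear (\<lambda>v. T (us @ v # vs))) \<and>
     (\<exists>C. \<forall>vs. length vs = k \<longrightarrow> norm (T vs) \<le> C * prod_list (map norm vs))"

text \<open>
  \<open>f\<close> is smooth if it has Frechet derivatives \<open>D k\<close> of all orders \<open>k\<close>; the derivative of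
  \<open>D k\<close> is taken with respect to the operator norm on \<open>k\<close>-linear maps, and the direction of
  the last differentiation is the first entry of the argument list of \<open>D (Suc k) x\<close>.
\<close>

definition smooth_on ::
    "'a::real_normed_vector set \<Rightarrow> ('a \<Rightarrow> 'b::real_normed_vector) \<Rightarrow> bool" where
  "smooth_on S f \<longleftrightarrow> open S \<and>
     (\<exists>D :: nat \<Rightarrow> 'a \<Rightarrow> 'a list \<Rightarrow> 'b.
        (\<forall>x\<in>S. D 0 x [] = f x) \<and>
        (\<forall>k. \<forall>x\<in>S. bounded_multilinear k (D k x) \<and>
           (\<forall>e>0. \<exists>d>0. \<forall>y\<in>S. norm (y - x) < d \<longrightarrow>
              (\<forall>vs. length vs = k \<longrightarrow>
                 norm (D k y vs - D k x vs - D (Suc k) x ((y - x) # vs))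
                   \<le> e * norm (y - x) * prod_list (map norm vs)))))"


section \<open>Isometric actions on unit spheres\<close>

text \<open>
  The Hilbert spaces inside a universe \<open>'h\<close> are its complete linear subspaces; the whole type
  is one of them if \<open>'h\<close> is complete.
\<close>

definition infinite_dim_hilbert :: "'h::real_inner set \<Rightarrow> bool" where
  "infinite_dim_hilbert H \<longleftrightarrow>
     subspace H \<and> complete H \<and> \<not> (\<exists>B. finite B \<and> B \<subseteq> H \<and> span B = H)"

definition unit_sphere :: "'h::real_inner set \<Rightarrow> 'h set" where
  "unit_sphere H = {x \<in> H. norm x = 1}"

definition sphere_tangent :: "'h::real_inner set \<Rightarrow> 'h \<Rightarrow> 'h set" where
  "sphere_tangent H x = {v \<in> H. inner x v = 0}"

text \<open>Maps on a subset \<open>S\<close> of the ambient space are smooth if they extend smoothly locally.\<close>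

definition smooth_extension_at ::
    "'h::real_inner set \<Rightarrow> ('h \<Rightarrow> 'h) \<Rightarrow> 'h \<Rightarrow> ('h \<Rightarrow> 'h) \<Rightarrow> bool" where
  "smooth_extension_at S f x F \<longleftrightarrow>
     (\<exists>W. x \<in> W \<and> smooth_on W F \<and> (\<forall>y\<in>W \<inter> S. F y = f y))"

definition smooth_self_map :: "'h::real_inner set \<Rightarrow> ('h \<Rightarrow> 'h) \<Rightarrow> bool" where
  "smooth_self_map S f \<longleftrightarrow> f ` S \<subseteq> S \<and> (\<forall>x\<in>S. \<exists>F. smooth_extension_at S f x F)"

text \<open>
  Isometries for the Riemannian metric which the unit sphere inherits from \<open>H\<close>:
  diffeomorphisms whose differential preserves inner products of tangent vectors. On tangent
  vectors, the derivative of a local extension does not depend on the extension.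
\<close>

definition riemannian_sphere_isometry :: "'h::real_inner set \<Rightarrow> ('h \<Rightarrow> 'h) \<Rightarrow> bool" where
  "riemannian_sphere_isometry H f \<longleftrightarrow>
     (let S = unit_sphere H in
        bij_betw f S S \<and> smooth_self_map S f \<and> smooth_self_map S (inv_into S f) \<and>
        (\<forall>x\<in>S. \<forall>F. smooth_extension_at S f x F \<longrightarrow>
           (\<forall>u\<in>sphere_tangent H x. \<forall>v\<in>sphere_tangent H x.
              inner (frechet_derivative F (at x) u) (frechet_derivative F (at x) v) = inner u v)))"

definition acts_freely_isometrically_pd_on_sphere ::
    "('g, 'b) monoid_scheme \<Rightarrow> 'h::real_inner set \<Rightarrow> bool" where
  "acts_freely_isometrically_pd_on_sphere G H \<longleftrightarrow>
     (\<exists>\<phi>. group_action G (unit_sphere H) \<phi> \<and>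
          free_action G (unit_sphere H) \<phi> \<and>
          (\<forall>g\<in>carrier G. riemannian_sphere_isometry H (\<phi> g)) \<and>
          properly_discontinuous_action G (top_of_set (unit_sphere H)) \<phi>)"


section \<open>Hilbert manifolds\<close>

text \<open>A chart is a pair of its domain and its coordinate map.\<close>

type_synonym ('m, 'h) chart = "'m set \<times> ('m \<Rightarrow> 'h)"

abbreviation chart_image :: "('m, 'h) chart \<Rightarrow> 'h set" where
  "chart_image c \<equiv> snd c ` fst c"

abbreviation chart_inv :: "('m, 'h) chart \<Rightarrow> 'h \<Rightarrow> 'm" where
  "chart_inv c \<equiv> inv_into (fst c) (snd c)"

definition is_chart :: "'m topology \<Rightarrow> ('m, 'h::real_normed_vector) chart \<Rightarrow> bool" where
  "is_chart X c \<longleftrightarrow> openin X (fst c) \<and> open (chart_image c) \<and>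
     homeomorphic_map (subtopology X (fst c)) (top_of_set (chart_image c)) (snd c)"

abbreviation transition :: "('m, 'h) chart \<Rightarrow> ('m, 'h) chart \<Rightarrow> 'h \<Rightarrow> 'h" where
  "transition c d \<equiv> snd d \<circ> chart_inv c"

definition smooth_manifold ::
    "'m topology \<Rightarrow> ('m, 'h::{real_inner, complete_space}) chart set \<Rightarrow> bool" where
  "smooth_manifold X A \<longleftrightarrow>
     Hausdorff_space X \<and> (\<forall>c\<in>A. is_chart X c) \<and> (\<Union>c\<in>A. fst c) = topspace X \<and>
     (\<forall>c\<in>A. \<forall>d\<in>A. smooth_on (snd c ` (fst c \<inter> fst d)) (transition c d))"

text \<open>
  A tangent vector at \<open>p\<close> is the family of its coordinate vectors in all charts around \<open>p\<close>
  (and \<open>0\<close> in the other charts). Each chart \<open>c\<close> around \<open>p\<close> identifies the tangent space at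
  \<open>p\<close> with the model space: \<open>tangent_vector A c p u\<close> is the tangent vector with coordinates \<open>u\<close>
  in \<open>c\<close>.
\<close>

type_synonym ('m, 'h) tangent = "('m, 'h) chart \<Rightarrow> 'h"

definition tangent_vector ::
    "('m, 'h::real_normed_vector) chart set \<Rightarrow> ('m, 'h) chart \<Rightarrow> 'm \<Rightarrow> 'h \<Rightarrow> ('m, 'h) tangent" where
  "tangent_vector A c p u =
     (\<lambda>d. if d \<in> A \<and> p \<in> fst d then frechet_derivative (transition c d) (at (snd c p)) u else 0)"

text \<open>
  A metric \<open>g\<close> assigns to each point a form on tangent vectors; \<open>metric_coords\<close> is its local
  expression in a chart.
\<close>

type_synonym ('m, 'h) metric_field = "'m \<Rightarrow> ('m, 'h) tangent \<Rightarrow> ('m, 'h) tangent \<Rightarrow> real"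

definition metric_coords ::
    "('m, 'h::real_normed_vector) chart set \<Rightarrow> ('m, 'h) metric_field \<Rightarrow> ('m, 'h) chart \<Rightarrow>
     'h \<Rightarrow> 'h \<Rightarrow> 'h \<Rightarrow> real" where
  "metric_coords A g c x u v =
     (let p = chart_inv c x in g p (tangent_vector A c p u) (tangent_vector A c p v))"

definition riemannian_metric ::
    "('m, 'h::{real_inner, complete_space}) chart set \<Rightarrow> ('m, 'h) metric_field \<Rightarrow> bool" where
  "riemannian_metric A g \<longleftrightarrow>
     (\<forall>c\<in>A.
        (\<exists>B :: 'h \<Rightarrow> 'h \<Rightarrow>\<^sub>L 'h \<Rightarrow>\<^sub>L real. smooth_on (chart_image c) B \<and>
           (\<forall>x\<in>chart_image c. \<forall>u v.
              metric_coords A g c x u v = blinfun_apply (blinfun_apply (B x) u) v)) \<and>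
        (\<forall>x\<in>chart_image c.
           (\<forall>u v. metric_coords A g c x u v = metric_coords A g c x v u) \<and>
           (\<exists>a>0. \<exists>b. \<forall>u. a * (norm u)\<^sup>2 \<le> metric_coords A g c x u u \<and>
                           metric_coords A g c x u u \<le> b * (norm u)\<^sup>2)))"

definition hilbert_manifold ::
    "'m topology \<Rightarrow> ('m, 'h::{real_inner, complete_space}) chart set \<Rightarrow> ('m, 'h) metric_field \<Rightarrow> bool"
    where
  "hilbert_manifold X A g \<longleftrightarrow> smooth_manifold X A \<and> riemannian_metric A g"


subsection \<open>The distance induced by the metric\<close>

definition C1_curve ::
    "'m topology \<Rightarrow> ('m, 'h::real_normed_vector) chart set \<Rightarrow> (real \<Rightarrow> 'm) \<Rightarrow> bool" where
  "C1_curve X A \<gamma> \<longleftrightarrow> pathin X \<gamma> \<and>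
     (\<forall>c\<in>A. let T = {t \<in> {0..1}. \<gamma> t \<in> fst c} in
        \<exists>\<gamma>'. continuous_on T \<gamma>' \<and>
          (\<forall>t\<in>T. ((snd c \<circ> \<gamma>) has_vector_derivative \<gamma>' t) (at t within {0..1})))"

definition velocity ::
    "('m, 'h::real_normed_vector) chart set \<Rightarrow> (real \<Rightarrow> 'm) \<Rightarrow> real \<Rightarrow> ('m, 'h) tangent" where
  "velocity A \<gamma> t =
     (\<lambda>c. if c \<in> A \<and> \<gamma> t \<in> fst c then vector_derivative (snd c \<circ> \<gamma>) (at t within {0..1}) else 0)"

definition curve_length ::
    "('m, 'h::real_normed_vector) chart set \<Rightarrow> ('m, 'h) metric_field \<Rightarrow> (real \<Rightarrow> 'm) \<Rightarrow> real" where
  "curve_length A g \<gamma> =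
     integral {0..1} (\<lambda>t. sqrt (g (\<gamma> t) (velocity A \<gamma> t) (velocity A \<gamma> t)))"

text \<open>
  \<open>piecewise_C1_joined X A g p q l\<close>: some piecewise \<open>C1\<close> curve from \<open>p\<close> to \<open>q\<close>, i.e. a
  concatenation of finitely many \<open>C1\<close> curves, has length \<open>l\<close>.
\<close>

inductive piecewise_C1_joined ::
    "'m topology \<Rightarrow> ('m, 'h::real_normed_vector) chart set \<Rightarrow> ('m, 'h) metric_field \<Rightarrow>
     'm \<Rightarrow> 'm \<Rightarrow> real \<Rightarrow> bool"
  for X A g where
  single: "C1_curve X A \<gamma> \<Longrightarrow> piecewise_C1_joined X A g (\<gamma> 0) (\<gamma> 1) (curve_length A g \<gamma>)"
| append: "piecewise_C1_joined X A g p (\<gamma> 0) l \<Longrightarrow> C1_curve X A \<gamma> \<Longrightarrow>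
           piecewise_C1_joined X A g p (\<gamma> 1) (l + curve_length A g \<gamma>)"

definition riemannian_distance ::
    "'m topology \<Rightarrow> ('m, 'h::real_normed_vector) chart set \<Rightarrow> ('m, 'h) metric_field \<Rightarrow>
     'm \<Rightarrow> 'm \<Rightarrow> real" where
  "riemannian_distance X A g p q =
     (if p \<in> topspace X \<and> q \<in> topspace X then Inf {l. piecewise_C1_joined X A g p q l} else 0)"

text \<open>
  Connectedness makes the above infimum range over a nonempty set. The value \<open>0\<close> outside the
  manifold is needed because \<open>Metric_space\<close> constrains the distance on the whole type.
\<close>

definition complete_connected_hilbert_manifold ::
    "'m topology \<Rightarrow> ('m, 'h::{real_inner, complete_space}) chart set \<Rightarrow> ('m, 'h) metric_field \<Rightarrow> bool"
    where
  "complete_connected_hilbert_manifold X A g \<longleftrightarrow>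
     hilbert_manifold X A g \<and> topspace X \<noteq> {} \<and> connected_space X \<and>
     Metric_space (topspace X) (riemannian_distance X A g) \<and>
     Metric_space.mcomplete (topspace X) (riemannian_distance X A g)"


subsection \<open>Sectional curvature\<close>

text \<open>
  The Levi-Civita connection, its curvature tensor
  \<open>R(u,v)w = \<nabla>\<^sub>u\<nabla>\<^sub>v w - \<nabla>\<^sub>v\<nabla>\<^sub>u w - \<nabla>\<^sub>[\<^sub>u\<^sub>,\<^sub>v\<^sub>] w\<close> and the sectional curvature, in a chart
  in which the metric is \<open>x \<mapsto> G x\<close>. The vectors \<open>u\<close>, \<open>v\<close>, \<open>w\<close> stand for constant coordinate
  fields, whose brackets vanish; \<open>christoffel G x u v\<close> is \<open>\<nabla>\<^sub>u v\<close>, given by the Koszul formula.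
\<close>

definition christoffel ::
    "('h::real_normed_vector \<Rightarrow> 'h \<Rightarrow> 'h \<Rightarrow> real) \<Rightarrow> 'h \<Rightarrow> 'h \<Rightarrow> 'h \<Rightarrow> 'h" where
  "christoffel G x u v =
     (THE z. \<forall>w. 2 * G x z w =
        frechet_derivative (\<lambda>y. G y v w) (at x) u +
        frechet_derivative (\<lambda>y. G y u w) (at x) v -
        frechet_derivative (\<lambda>y. G y u v) (at x) w)"

definition riemann_curvature ::
    "('h::real_normed_vector \<Rightarrow> 'h \<Rightarrow> 'h \<Rightarrow> real) \<Rightarrow> 'h \<Rightarrow> 'h \<Rightarrow> 'h \<Rightarrow> 'h \<Rightarrow> 'h" where
  "riemann_curvature G x u v w =
     frechet_derivative (\<lambda>y. christoffel G y v w) (at x) u -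
     frechet_derivative (\<lambda>y. christoffel G y u w) (at x) v +
     christoffel G x u (christoffel G x v w) - christoffel G x v (christoffel G x u w)"

definition sectional_curvature ::
    "('h::real_normed_vector \<Rightarrow> 'h \<Rightarrow> 'h \<Rightarrow> real) \<Rightarrow> 'h \<Rightarrow> 'h \<Rightarrow> 'h \<Rightarrow> real" where
  "sectional_curvature G x u v =
     G x (riemann_curvature G x u v v) u / (G x u u * G x v v - (G x u v)\<^sup>2)"

definition constant_sectional_curvature ::
    "('m, 'h::real_normed_vector) chart set \<Rightarrow> ('m, 'h) metric_field \<Rightarrow> real \<Rightarrow> bool" where
  "constant_sectional_curvature A g \<kappa> \<longleftrightarrow>
     (\<forall>c\<in>A. \<forall>x\<in>chart_image c. \<forall>u v. u \<noteq> v \<and> independent {u, v} \<longrightarrow>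
        sectional_curvature (metric_coords A g c) x u v = \<kappa>)"


section \<open>The fundamental group\<close>

definition loops_at :: "'m topology \<Rightarrow> 'm \<Rightarrow> (real \<Rightarrow> 'm) set" where
  "loops_at X p = {\<gamma>. pathin X \<gamma> \<and> \<gamma> 0 = p \<and> \<gamma> 1 = p}"

definition loop_homotopy :: "'m topology \<Rightarrow> 'm \<Rightarrow> ((real \<Rightarrow> 'm) \<times> (real \<Rightarrow> 'm)) set" where
  "loop_homotopy X p =
     {(\<gamma>, \<delta>). \<gamma> \<in> loops_at X p \<and> \<delta> \<in> loops_at X p \<and>
        homotopic_with (\<lambda>h. h 0 = p \<and> h 1 = p) (top_of_set {0..1}) X \<gamma> \<delta>}"

text \<open>The library's \<open>joinpaths\<close>, without its restriction to topological type classes.\<close>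

definition join_loops :: "(real \<Rightarrow> 'm) \<Rightarrow> (real \<Rightarrow> 'm) \<Rightarrow> real \<Rightarrow> 'm" where
  "join_loops \<gamma> \<delta> = (\<lambda>t. if t \<le> 1/2 then \<gamma> (2 * t) else \<delta> (2 * t - 1))"

definition fundamental_group :: "'m topology \<Rightarrow> 'm \<Rightarrow> (real \<Rightarrow> 'm) set monoid" where
  "fundamental_group X p =
     \<lparr>carrier = loops_at X p // loop_homotopy X p,
      monoid.mult = (\<lambda>a b. \<Union>\<gamma>\<in>a. \<Union>\<delta>\<in>b. loop_homotopy X p `` {join_loops \<gamma> \<delta>}),
      one = loop_homotopy X p `` {\<lambda>_. p}\<rparr>"

end

theory Submission
  imports Defs "HOL-Algebra.Multiplicative_Group" "HOL-Algebra.Elementary_Groups"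
begin

text \<open>
  \<^bold>\<open>Actions restrict the torsion.\<close> A Riemannian isometry of the unit sphere maps a great circle to a curve
  of unit speed, and such a curve leaves its starting point no faster than a great circle does
  (\<open>inner_ge_cos_of_unit_speed\<close>). Applied to an isometry and to its inverse, this shows that
  isometries preserve inner products, so they extend to linear maps. If \<open>\<int>\<^sub>p \<times> \<int>\<^sub>p\<close> acted
  freely by linear maps, all orbit sums of its nontrivial cyclic subgroups would vanish, since they
  are fixed vectors; adding these sums over suitable subgroups of order \<open>p\<close> gives \<open>p v = 0\<close> for every
  \<open>v\<close> (\<open>free_linear_action_rank_one\<close>). So the finite torsion subgroup has at most one subgroup of each
  prime order, and it is cyclic (\<open>torsion_cyclic\<close>). By the Chinese remainder theorem, cyclic means
  of the stated form.

  \<^bold>\<open>Construction of actions.\<close> If the torsion subgroup \<open>F\<close> is cyclic, it has an injective character, which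
  extends to a character \<open>\<chi>\<close> of \<open>G\<close> because the circle is divisible
  (\<open>unitary_character_extension\<close>). An infinite orthonormal basis of \<open>H\<close> can be indexed by
  \<open>B \<times> G/F \<times> {1, \<i>}\<close>, which makes \<open>H\<close> a sum of copies, indexed by the cosets, of one complex
  Hilbert space. Let \<open>g\<close> permute the copies by translation of cosets and multiply by \<open>\<chi> g\<close>. Only
  finitely many \<open>g\<close> carry one coset to another one, so a unit vector has only finitely many translates
  at distance less than \<open>1\<close> from a given unit vector. An element of infinite order therefore fixes no
  unit vector, and a torsion element acts as the scalar \<open>\<chi> g \<noteq> 1\<close> (\<open>free_orthogonal_action_exists\<close>).

  \<^bold>\<open>The manifold.\<close> For \<open>H = l\<^sub>2\<close> take the space of orbits of the unit sphere. Orbits are separated, so the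
  projection is a covering map. Stereographic projection of small open pieces of the sphere gives
  charts; coordinate changes are rational maps induced by elements of \<open>G\<close>, and they preserve the metric
  \<open>4 / (1 + x \<bullet> x)\<^sup>2\<close> times the inner product, because \<open>G\<close> preserves chordal distances
  (\<open>transition_isometry\<close>). A computation in these coordinates gives curvature \<open>1\<close>
  (\<open>sectional_curvature_conformal\<close>).

  Curves of class \<open>C\<^sup>1\<close> lift to curves of the same length on the sphere (\<open>C1_curve_lift\<close>). So the distance
  of two orbits is bounded below by chordal distances of their points and above by the angles between
  them, and a Cauchy sequence of orbits lifts to a Cauchy sequence of the sphere (\<open>mcomplete_rdist\<close>).
  The unit sphere of \<open>l\<^sub>2\<close> is contractible, so a loop is determined up to homotopy by the element of
  \<open>G\<close> that carries the start of a lift to its end, and the fundamental group is \<open>G\<close>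
  (\<open>fundamental_group_iso\<close>).
\<close>

section \<open>Finitely generated abelian groups\<close>

definition adjoin :: "('g, 'b) monoid_scheme \<Rightarrow> 'g set \<Rightarrow> 'g \<Rightarrow> 'g set" where
  "adjoin G K a = {x \<otimes>\<^bsub>G\<^esub> a [^]\<^bsub>G\<^esub> (i::int) | x i. x \<in> K}"

context comm_group
begin

lemma subgroup_adjoin:
  assumes K: "subgroup K G" and a: "a \<in> carrier G"
  shows "subgroup (adjoin G K a) G" "K \<subseteq> adjoin G K a" "a \<in> adjoin G K a"
proof -
  have Kc: "x \<in> carrier G" if "x \<in> K" for x
    using subgroup.mem_carrier[OF K that] .
  show "subgroup (adjoin G K a) G"
  proof (rule subgroupI)
    show "adjoin G K a \<subseteq> carrier G"
      using Kc a by (auto simp: adjoin_def)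
    show "adjoin G K a \<noteq> {}"
      using subgroup.one_closed[OF K] by (auto simp: adjoin_def)
  next
    fix u assume "u \<in> adjoin G K a"
    then obtain x i where x: "x \<in> K" and u: "u = x \<otimes> a [^] (i::int)"
      by (auto simp: adjoin_def)
    have "inv u = inv x \<otimes> a [^] (- i)"
      unfolding u using Kc[OF x] a by (simp add: inv_mult int_pow_neg)
    then show "inv u \<in> adjoin G K a"
      unfolding adjoin_def using subgroup.m_inv_closed[OF K x] by blast
  next
    fix u v assume "u \<in> adjoin G K a" "v \<in> adjoin G K a"
    then obtain x i y j where x: "x \<in> K" "y \<in> K" and u: "u = x \<otimes> a [^] (i::int)" "v = y \<otimes> a [^] (j::int)"
      by (auto simp: adjoin_def)
    have "u \<otimes> v = (x \<otimes> y) \<otimes> a [^] (i + j)"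
      unfolding u using Kc x a by (simp add: int_pow_mult m_ac)
    then show "u \<otimes> v \<in> adjoin G K a"
      unfolding adjoin_def using subgroup.m_closed[OF K x] by blast
  qed
  show "K \<subseteq> adjoin G K a"
  proof
    fix x assume "x \<in> K"
    then have "x = x \<otimes> a [^] (0::int)" using Kc by simp
    with \<open>x \<in> K\<close> show "x \<in> adjoin G K a" unfolding adjoin_def by blast
  qed
  have "a = \<one> \<otimes> a [^] (1::int)" using a by simp
  then show "a \<in> adjoin G K a"
    unfolding adjoin_def using subgroup.one_closed[OF K] by blast
qed

text \<open>
  A finitely generated group is reached from any subgroup by adjoining the generators one at a time.
\<close>

lemma subgroup_adjoin_induct [consumes 2, case_names base adjoin]:
  assumes fg: "finitely_generated_group G" and K0: "subgroup K0 G"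
    and base: "P K0"
    and step: "\<And>K a. subgroup K G \<Longrightarrow> K0 \<subseteq> K \<Longrightarrow> a \<in> carrier G \<Longrightarrow> P K \<Longrightarrow> P (adjoin G K a)"
  shows "P (carrier G)"
proof -
  obtain S where S: "finite S" "S \<subseteq> carrier G" "generate G S = carrier G"
    using fg by (auto simp: finitely_generated_group_def)
  have "\<exists>K. subgroup K G \<and> K0 \<subseteq> K \<and> S \<subseteq> K \<and> P K"
    using S(1,2)
  proof induction
    case empty
    then show ?case using K0 base by blast
  next
    case (insert a S)
    then obtain K where K: "subgroup K G" "K0 \<subseteq> K" "S \<subseteq> K" "P K" by auto
    have a: "a \<in> carrier G" using insert by simp
    from step[OF K(1,2) a K(4)] subgroup_adjoin[OF K(1) a] K(2,3)
    show ?case by (intro exI[of _ "adjoin G K a"]) auto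
  qed
  then obtain K where K: "subgroup K G" "S \<subseteq> K" "P K" by auto
  have "carrier G \<subseteq> K"
    using generate_subgroup_incl[OF K(2,1)] S(3) by simp
  with subgroup.subset[OF K(1)] have "K = carrier G" by auto
  with K(3) show ?thesis by simp
qed

lemma countable_if_finitely_generated:
  assumes "finitely_generated_group G"
  shows "countable (carrier G)"
  using assms triv_subgroup
proof (induction rule: subgroup_adjoin_induct)
  case (adjoin K a)
  have "adjoin G K a = (\<lambda>(x, i::int). x \<otimes> a [^] i) ` (K \<times> UNIV)"
    by (auto simp: adjoin_def)
  with adjoin show ?case by simp
qed simp

definition torsion_set :: "'a set" where
  "torsion_set = {x \<in> carrier G. \<exists>n::nat. n > 0 \<and> x [^] n = \<one>}"

lemma torsion_subgroup_alt: "torsion_subgroup G = G\<lparr>carrier := torsion_set\<rparr>"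
  by (simp add: torsion_subgroup_def torsion_set_def)

lemma subgroup_torsion_set: "subgroup torsion_set G"
proof (rule subgroupI)
  show "torsion_set \<subseteq> carrier G" by (auto simp: torsion_set_def)
  have "\<one> [^] (1::nat) = \<one>" by simp
  then show "torsion_set \<noteq> {}" by (fastforce simp: torsion_set_def)
next
  fix x assume "x \<in> torsion_set"
  then show "inv x \<in> torsion_set" by (auto simp: torsion_set_def nat_pow_inv)
next
  fix x y assume "x \<in> torsion_set" "y \<in> torsion_set"
  then obtain m n where mn: "x \<in> carrier G" "y \<in> carrier G" "m > 0" "n > 0"
    "x [^] (m::nat) = \<one>" "y [^] (n::nat) = \<one>"
    by (auto simp: torsion_set_def)
  have "x [^] (m * n) = \<one>" "y [^] (m * n) = \<one>"
    using mn by (metis nat_pow_one nat_pow_pow, metis nat_pow_one nat_pow_pow mult.commute)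
  then have "(x \<otimes> y) [^] (m * n) = \<one>"
    using mn by (simp add: pow_mult_distrib m_comm)
  then show "x \<otimes> y \<in> torsion_set"
    using mn by (auto simp: torsion_set_def intro!: exI[of _ "m * n"])
qed

text \<open>
  If some positive power of \<open>a\<close> lies in \<open>K\<close>, then \<open>K\<langle>a\<rangle>\<close> is covered by finitely many cosets of
  \<open>K\<close>, each of which contains at most as many torsion elements as \<open>K\<close>; otherwise a torsion
  element of \<open>K\<langle>a\<rangle>\<close> cannot involve \<open>a\<close>.
\<close>

lemma finite_torsion_set:
  assumes "finitely_generated_group G"
  shows "finite torsion_set"
proof -
  have "finite (torsion_set \<inter> carrier G)"
    using assms triv_subgroup
  proof (induction rule: subgroup_adjoin_induct)
    case base
    then show ?case by simp
  next
    case (adjoin K a)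
    have Kc: "x \<in> carrier G" if "x \<in> K" for x
      using subgroup.mem_carrier[OF adjoin(1) that] .
    show ?case
    proof (cases "\<exists>k>0. a [^] (k::int) \<in> K")
      case True
      then obtain k where k: "k > 0" "a [^] (k::int) \<in> K" by blast
      have coset: "finite (torsion_set \<inter> (\<lambda>x. x \<otimes> a [^] i) ` K)" for i :: int
      proof (cases "torsion_set \<inter> (\<lambda>x. x \<otimes> a [^] i) ` K = {}")
        case False
        then obtain x0 where x0: "x0 \<in> K" "x0 \<otimes> a [^] i \<in> torsion_set" by auto
        have "torsion_set \<inter> (\<lambda>x. x \<otimes> a [^] i) ` K \<subseteq> (\<lambda>t. t \<otimes> (x0 \<otimes> a [^] i)) ` (torsion_set \<inter> K)"
        proof clarify
          fix x assume x: "x \<in> K" "x \<otimes> a [^] i \<in> torsion_set"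
          let ?t = "(x \<otimes> a [^] i) \<otimes> inv (x0 \<otimes> a [^] i)"
          have "?t \<in> torsion_set"
            using x x0 subgroup_torsion_set by (simp add: subgroup_def)
          moreover have "?t = x \<otimes> inv x0"
            using Kc[OF x(1)] Kc[OF x0(1)] adjoin(3)
            by (smt (verit) int_pow_closed inv_closed inv_mult m_assoc m_comm m_closed r_inv r_one)
          moreover have "x \<otimes> inv x0 \<in> K"
            using adjoin(1) x x0 by (simp add: subgroup_def)
          moreover have "x \<otimes> a [^] i = ?t \<otimes> (x0 \<otimes> a [^] i)"
            using Kc[OF x(1)] Kc[OF x0(1)] adjoin(3) by (simp add: m_assoc)
          ultimately show "x \<otimes> a [^] i \<in> (\<lambda>t. t \<otimes> (x0 \<otimes> a [^] i)) ` (torsion_set \<inter> K)"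
            by auto
        qed
        then show ?thesis using adjoin(4) finite_surj by (metis Int_commute)
      qed simp
      have "torsion_set \<inter> adjoin G K a \<subseteq> (\<Union>i\<in>{0..<k}. torsion_set \<inter> (\<lambda>x. x \<otimes> a [^] i) ` K)"
      proof clarify
        fix u assume u: "u \<in> torsion_set" "u \<in> adjoin G K a"
        then obtain x i where x: "x \<in> K" "u = x \<otimes> a [^] (i::int)" by (auto simp: adjoin_def)
        have "a [^] i = a [^] (k * (i div k) + i mod k)" by simp
        also have "\<dots> = (a [^] k) [^] (i div k) \<otimes> a [^] (i mod k)"
          using adjoin(3) by (simp only: int_pow_mult int_pow_pow)
        finally have ai: "a [^] i = (a [^] k) [^] (i div k) \<otimes> a [^] (i mod k)" .
        have "(a [^] k) [^] (i div k) \<in> K"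
          using subgroup_int_pow_closed[OF adjoin(1) k(2)] .
        then have "u = (x \<otimes> (a [^] k) [^] (i div k)) \<otimes> a [^] (i mod k)"
          "x \<otimes> (a [^] k) [^] (i div k) \<in> K"
          using x Kc adjoin(1,3) ai by (simp_all add: m_assoc subgroup_def)
        then have "u \<in> (\<lambda>x. x \<otimes> a [^] (i mod k)) ` K" by blast
        with u(1) k(1) show "u \<in> (\<Union>i\<in>{0..<k}. torsion_set \<inter> (\<lambda>x. x \<otimes> a [^] i) ` K)"
          by (intro UN_I[of "i mod k"]) auto
      qed
      moreover have "finite (\<Union>i\<in>{0..<k}. torsion_set \<inter> (\<lambda>x. x \<otimes> a [^] i) ` K)"
        using coset by blast
      ultimately show ?thesis by (rule finite_subset)
    next
      case False
      have "torsion_set \<inter> adjoin G K a \<subseteq> torsion_set \<inter> K"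
      proof clarify
        fix u assume u: "u \<in> torsion_set" "u \<in> adjoin G K a"
        then obtain x i where x: "x \<in> K" "u = x \<otimes> a [^] (i::int)" by (auto simp: adjoin_def)
        obtain n where n: "n > 0" "u [^] (n::nat) = \<one>" using u by (auto simp: torsion_set_def)
        have "u [^] int n = x [^] int n \<otimes> a [^] (i * int n)"
          unfolding x(2) using Kc[OF x(1)] adjoin(3) by (simp add: int_pow_distrib int_pow_pow)
        then have "a [^] (i * int n) = inv (x [^] int n)"
          using n Kc[OF x(1)] adjoin(3) by (metis int_pow_closed int_pow_int inv_equality m_comm)
        then have "a [^] (i * int n) \<in> K"
          using subgroup_int_pow_closed[OF adjoin(1) x(1)] subgroup.m_inv_closed[OF adjoin(1)] by simp
        moreover from this have "a [^] (- (i * int n)) \<in> K"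
          using adjoin(3) subgroup.m_inv_closed[OF adjoin(1)] by (simp only: int_pow_neg)
        ultimately have "\<not> i * int n > 0" "\<not> - (i * int n) > 0" using False by blast+
        then have "i * int n = 0" by linarith
        then have "i = 0" using n by simp
        then show "u \<in> K" using x Kc by simp
      qed
      then show ?thesis using adjoin(4) finite_subset by blast
    qed
  qed
  moreover have "torsion_set \<inter> carrier G = torsion_set" by (auto simp: torsion_set_def)
  ultimately show ?thesis by simp
qed

end

definition unitary_character :: "('g, 'b) monoid_scheme \<Rightarrow> 'g set \<Rightarrow> ('g \<Rightarrow> complex) \<Rightarrow> bool" where
  "unitary_character G K \<psi> \<longleftrightarrow>
     (\<forall>x\<in>K. norm (\<psi> x) = 1) \<and> (\<forall>x\<in>K. \<forall>y\<in>K. \<psi> (x \<otimes>\<^bsub>G\<^esub> y) = \<psi> x * \<psi> y)"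

lemma unit_complex_root:
  fixes w :: complex
  assumes "norm w = 1" "d > 0"
  obtains z where "norm z = 1" "z ^ d = w"
proof
  show "norm (cis (Arg w / d)) = 1" by simp
  have "cis (Arg w / d) ^ d = cis (Arg w)" using assms by (simp add: Complex.DeMoivre)
  also have "\<dots> = w" using assms by (metis cis_Arg norm_zero sgn_eq zero_neq_one div_by_1 of_real_1)
  finally show "cis (Arg w / d) ^ d = w" .
qed

context comm_group
begin

text \<open>
  The circle is divisible: the value of an extension at \<open>a\<close> only has to be a \<open>d\<close>-th root of
  \<open>\<psi> (a\<^sup>d)\<close>, where \<open>d\<close> generates the group of all integers \<open>i\<close> with \<open>a\<^sup>i \<in> K\<close>.
\<close>

lemma unitary_character_adjoin:
  assumes K: "subgroup K G" and a: "a \<in> carrier G" and \<psi>: "unitary_character G K \<psi>"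
  obtains \<psi>' where "unitary_character G (adjoin G K a) \<psi>'" "\<And>x. x \<in> K \<Longrightarrow> \<psi>' x = \<psi> x"
proof -
  have Kc: "x \<in> carrier G" if "x \<in> K" for x
    using subgroup.mem_carrier[OF K that] .
  have mult: "\<psi> (x \<otimes> y) = \<psi> x * \<psi> y" if "x \<in> K" "y \<in> K" for x y
    using \<psi> that by (auto simp: unitary_character_def)
  have n1: "norm (\<psi> x) = 1" if "x \<in> K" for x
    using \<psi> that by (auto simp: unitary_character_def)
  have nz: "\<psi> x \<noteq> 0" if "x \<in> K" for x
    using n1[OF that] by auto
  have one: "\<psi> \<one> = 1"
    using mult[of \<one> \<one>] nz[of \<one>] subgroup.one_closed[OF K] by simp
  have npow: "\<psi> (x [^] (n::nat)) = \<psi> x ^ n" if "x \<in> K" for x n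
  proof (induction n)
    case (Suc n)
    have "x [^] n \<in> K" using subgroup_int_pow_closed[OF K that, of "int n"] by (simp add: int_pow_int)
    then show ?case using Suc mult that by simp
  qed (simp add: one)
  have invc: "\<psi> (inv x) = inverse (\<psi> x)" if "x \<in> K" for x
    using mult[of "inv x" x] that one Kc[OF that] subgroup.m_inv_closed[OF K that] nz[OF that]
    by (simp add: field_simps)
  have ipow: "\<psi> (x [^] (i::int)) = \<psi> x powi i" if "x \<in> K" for x i
  proof (cases "i \<ge> 0")
    case True
    then show ?thesis using npow[OF that, of "nat i"] by (simp add: power_int_def flip: int_pow_int)
  next
    case False
    then have i: "i = - int (nat (- i))" by simp
    have "x [^] nat (- i) \<in> K"
      using subgroup_int_pow_closed[OF K that, of "int (nat (- i))"] by (simp only: int_pow_int)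
    then have "\<psi> (x [^] i) = inverse (\<psi> x ^ nat (- i))"
      using Kc[OF that] by (subst i) (simp only: int_pow_neg_int invc npow that)
    then show ?thesis using False by (simp add: power_int_def power_inverse)
  qed
  obtain z where z: "norm z = 1" and ze: "\<And>i::int. a [^] i \<in> K \<Longrightarrow> \<psi> (a [^] i) = z powi i"
  proof (cases "\<exists>k>0. a [^] (k::nat) \<in> K")
    case False
    have "i = 0" if "a [^] (i::int) \<in> K" for i
    proof (rule ccontr)
      assume "i \<noteq> 0"
      have "a [^] (- i) \<in> K" using that subgroup.m_inv_closed[OF K] a by (simp only: int_pow_neg)
      with that have "a [^] \<bar>i\<bar> \<in> K" by (auto simp: abs_if)
      then have "a [^] int (nat \<bar>i\<bar>) \<in> K" by simp
      then have "a [^] nat \<bar>i\<bar> \<in> K" by (simp only: int_pow_int)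
      with False \<open>i \<noteq> 0\<close> show False by (metis nat_0_iff not_gr_zero abs_le_zero_iff)
    qed
    with one that[of 1] show ?thesis by fastforce
  next
    case True
    define d where "d = (LEAST k. k > 0 \<and> a [^] (k::nat) \<in> K)"
    have d: "d > 0" "a [^] d \<in> K" using LeastI_ex[OF True] by (auto simp: d_def)
    have dmin: "k = 0" if "a [^] (k::nat) \<in> K" "k < d" for k
      using not_less_Least[of k "\<lambda>k. k > 0 \<and> a [^] k \<in> K"] that by (auto simp: d_def)
    obtain z where z: "norm z = 1" "z ^ d = \<psi> (a [^] d)"
      using unit_complex_root[OF n1[OF d(2)] d(1)] .
    have "\<psi> (a [^] i) = z powi i" if i: "a [^] (i::int) \<in> K" for i
    proof -
      have split: "a [^] i = (a [^] d) [^] (i div d) \<otimes> a [^] (i mod d)"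
      proof -
        have "a [^] i = a [^] (int d * (i div d) + i mod d)" by simp
        also have "\<dots> = (a [^] int d) [^] (i div d) \<otimes> a [^] (i mod d)"
          using a by (simp only: int_pow_mult int_pow_pow)
        finally show ?thesis by (simp add: int_pow_int)
      qed
      have dK: "(a [^] d) [^] (i div d) \<in> K" using subgroup_int_pow_closed[OF K d(2)] .
      have "a [^] (i mod d) = inv ((a [^] d) [^] (i div d)) \<otimes> a [^] i"
        unfolding split using a by (simp flip: m_assoc)
      then have "a [^] (i mod d) \<in> K"
        using i dK K by (simp add: subgroup_def)
      then have "a [^] int (nat (i mod d)) \<in> K"
        using d(1) by simp
      then have "a [^] nat (i mod d) \<in> K" by (simp only: int_pow_int)
      moreover have "0 \<le> i mod d" "i mod d < d" using d(1) by simp_all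
      ultimately have "nat (i mod d) = 0" using dmin[of "nat (i mod d)"] by linarith
      then have m0: "i mod d = 0" using \<open>0 \<le> i mod d\<close> by linarith
      then have "a [^] i = (a [^] d) [^] (i div d)"
        using split a by simp
      then have "\<psi> (a [^] i) = (z ^ d) powi (i div d)"
        using ipow[OF d(2)] z by simp
      also have "\<dots> = z powi (int d * (i div d))"
        by (simp add: power_int_mult)
      finally show ?thesis using m0 by (simp add: minus_mod_eq_mult_div[symmetric])
    qed
    with z that show ?thesis by blast
  qed
  have z0: "z \<noteq> 0" using z by auto
  \<comment> \<open>The representation of \<open>u\<close> is ambiguous only by powers of \<open>a\<close> in \<open>K\<close>, on which the two characters agree by the choice of \<open>z\<close>.\<close>
  define \<psi>' where "\<psi>' u = (SOME c. \<exists>x\<in>K. \<exists>i::int. u = x \<otimes> a [^] i \<and> c = \<psi> x * z powi i)" for u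
  have \<psi>': "\<psi>' (x \<otimes> a [^] i) = \<psi> x * z powi i" if x: "x \<in> K" for x and i :: int
    unfolding \<psi>'_def
  proof (rule some_equality)
    show "\<exists>y\<in>K. \<exists>j. x \<otimes> a [^] i = y \<otimes> a [^] j \<and> \<psi> x * z powi i = \<psi> y * z powi j"
      using x by blast
    fix c assume "\<exists>y\<in>K. \<exists>j::int. x \<otimes> a [^] i = y \<otimes> a [^] j \<and> c = \<psi> y * z powi j"
    then obtain y j where y: "y \<in> K" "x \<otimes> a [^] i = y \<otimes> a [^] (j::int)" "c = \<psi> y * z powi j" by blast
    have "a [^] (i - j) = inv x \<otimes> y"
    proof -
      have "a [^] i = inv x \<otimes> (y \<otimes> a [^] j)"
        using y(2) Kc[OF x] a by (metis int_pow_closed inv_solve_left Kc y(1) m_closed)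
      also have "\<dots> = (inv x \<otimes> y) \<otimes> a [^] j" using Kc[OF x] Kc[OF y(1)] a by (simp add: m_assoc)
      finally show ?thesis
        using a Kc[OF x] Kc[OF y(1)] by (simp add: int_pow_diff m_assoc)
    qed
    moreover have xy: "inv x \<otimes> y \<in> K" using x y K by (simp add: subgroup_def)
    ultimately have "inverse (\<psi> x) * \<psi> y = z powi (i - j)"
      using ze[of "i - j"] mult[of "inv x" y] invc[OF x] x y K by (simp add: subgroup_def)
    then show "c = \<psi> x * z powi i"
      using nz[OF x] z0 y(3) by (simp add: power_int_diff field_simps)
  qed
  show ?thesis
  proof
    show "\<psi>' x = \<psi> x" if "x \<in> K" for x
      using \<psi>'[OF that, of 0] Kc[OF that] by simp
    show "unitary_character G (adjoin G K a) \<psi>'"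
      unfolding unitary_character_def
    proof (intro conjI ballI)
      fix u assume "u \<in> adjoin G K a"
      then obtain x i where x: "x \<in> K" "u = x \<otimes> a [^] (i::int)" by (auto simp: adjoin_def)
      then show "norm (\<psi>' u) = 1" using \<psi>' n1 z by (simp add: norm_mult norm_power_int)
      fix v assume "v \<in> adjoin G K a"
      then obtain y j where y: "y \<in> K" "v = y \<otimes> a [^] (j::int)" by (auto simp: adjoin_def)
      have "u \<otimes> v = (x \<otimes> y) \<otimes> a [^] (i + j)"
        unfolding x y using Kc x y a by (simp add: int_pow_mult m_ac)
      moreover have "x \<otimes> y \<in> K" using x y K by (simp add: subgroup_def)
      ultimately show "\<psi>' (u \<otimes> v) = \<psi>' u * \<psi>' v"
        using x y \<psi>' mult z0 by (simp add: power_int_add)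
    qed
  qed
qed

lemma unitary_character_extension:
  assumes "finitely_generated_group G" "subgroup K0 G" "unitary_character G K0 \<psi>0"
  obtains \<psi> where "unitary_character G (carrier G) \<psi>" "\<And>x. x \<in> K0 \<Longrightarrow> \<psi> x = \<psi>0 x"
proof -
  have "\<exists>\<psi>. unitary_character G (carrier G) \<psi> \<and> (\<forall>x\<in>K0. \<psi> x = \<psi>0 x)"
    using assms(1,2)
  proof (induction rule: subgroup_adjoin_induct)
    case base
    then show ?case using assms(3) by blast
  next
    case (adjoin K a)
    then obtain \<psi> where \<psi>: "unitary_character G K \<psi>" "\<forall>x\<in>K0. \<psi> x = \<psi>0 x" by blast
    from unitary_character_adjoin[OF adjoin(1,3) \<psi>(1)] \<psi>(2) adjoin(2) show ?case
      by (metis subsetD)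
  qed
  with that show ?thesis by blast
qed

end

lemma carrier_sum_group_finite:
  fixes q :: "nat \<Rightarrow> nat"
  assumes "\<And>i. i < m \<Longrightarrow> q i > 0"
  shows "carrier (sum_group {..<m} (\<lambda>i. integer_mod_group (q i))) = (\<Pi>\<^sub>E i\<in>{..<m}. {0..<int (q i)})"
proof -
  have "carrier (sum_group {..<m} (\<lambda>i. integer_mod_group (q i))) = (\<Pi>\<^sub>E i\<in>{..<m}. carrier (integer_mod_group (q i)))"
    by (subst carrier_sum_group) auto
  also have "\<dots> = (\<Pi>\<^sub>E i\<in>{..<m}. {0..<int (q i)})"
    using assms by (intro PiE_cong) (auto simp: carrier_integer_mod_group)
  finally show ?thesis .
qed

lemma coprime_prod_dvd:
  fixes q :: "nat \<Rightarrow> int"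
  assumes "\<And>i j. i < m \<Longrightarrow> j < m \<Longrightarrow> i \<noteq> j \<Longrightarrow> coprime (q i) (q j)" "\<And>i. i < m \<Longrightarrow> q i dvd n"
  shows "(\<Prod>i<m. q i) dvd n"
  using assms
proof (induction m)
  case (Suc m)
  have "coprime (\<Prod>i<m. q i) (q m)"
    using Suc.prems(1) by (intro prod_coprime_left) auto
  with Suc show ?case by (simp add: divides_mult)
qed simp

text \<open>Fractions with pairwise coprime denominators cannot cancel modulo \<open>1\<close>.\<close>

lemma coprime_fractions_sum_integer:
  fixes q :: "nat \<Rightarrow> nat" and f :: "nat \<Rightarrow> int"
  assumes q: "\<And>i. i < m \<Longrightarrow> q i > 0"
    and cop: "\<And>i j. i < m \<Longrightarrow> j < m \<Longrightarrow> i \<noteq> j \<Longrightarrow> coprime (q i) (q j)"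
    and s: "(\<Sum>i<m. of_int (f i) / real (q i)) \<in> \<int>" and j: "j < m"
  shows "int (q j) dvd f j"
proof -
  let ?R = "\<lambda>i. \<Prod>k\<in>{..<m} - {i}. q k"
  obtain N :: int where N: "(\<Sum>i<m. of_int (f i) / real (q i)) = of_int N"
    using s by (auto elim: Ints_cases)
  have Q: "(\<Prod>k<m. q k) = q i * ?R i" if "i < m" for i
    using that by (simp add: prod.remove[of "{..<m}" i])
  have "real_of_int (\<Sum>i<m. f i * int (?R i)) = (\<Sum>i<m. of_int (f i) / real (q i)) * real (\<Prod>k<m. q k)"
    unfolding sum_distrib_right of_int_sum
  proof (rule sum.cong)
    fix i assume "i \<in> {..<m}"
    then have "i < m" by simp
    then show "real_of_int (f i * int (?R i)) = of_int (f i) / real (q i) * real (\<Prod>k<m. q k)"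
      unfolding Q[OF \<open>i < m\<close>] using q[of i] by simp
  qed simp
  also have "\<dots> = real_of_int (N * int (\<Prod>k<m. q k))" unfolding N by simp
  finally have eq: "(\<Sum>i<m. f i * int (?R i)) = N * int (\<Prod>k<m. q k)" by linarith
  have "int (q j) dvd (\<Sum>i\<in>{..<m} - {j}. f i * int (?R i))"
  proof (rule dvd_sum)
    fix i assume "i \<in> {..<m} - {j}"
    then have "q j dvd ?R i" using j by (intro dvd_prodI) auto
    then have "int (q j) dvd int (?R i)" by (simp only: int_dvd_int_iff)
    then show "int (q j) dvd f i * int (?R i)" by (rule dvd_mult)
  qed
  moreover have "(\<Sum>i<m. f i * int (?R i)) = f j * int (?R j) + (\<Sum>i\<in>{..<m} - {j}. f i * int (?R i))"
    using j by (simp add: sum.remove[of "{..<m}" j])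
  moreover have "int (q j) dvd N * int (\<Prod>k<m. q k)"
    unfolding Q[OF j] by simp
  ultimately have "int (q j) dvd f j * int (?R j)"
    using eq dvd_add_left_iff[of "int (q j)" "\<Sum>i\<in>{..<m} - {j}. f i * int (?R i)" "f j * int (?R j)"]
    by simp
  moreover have "coprime (q j) (?R j)"
    using cop j by (intro prod_coprime_right) auto
  then have "coprime (int (q j)) (int (?R j))" by (simp only: coprime_int_iff)
  ultimately show ?thesis
    by (simp only: coprime_dvd_mult_left_iff)
qed

context comm_group
begin

text \<open>
  The tuple \<open>(k\<^sub>i)\<close> is mapped to the root of unity with angle \<open>2\<pi>\<close> times the sum of the fractions
  \<open>k\<^sub>i / q\<^sub>i\<close>. The denominators are coprime, so this sum is an integer only if each fraction is.
\<close>

lemma distinct_prime_powers_imp_faithful_character: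
  assumes "torsion_sum_of_distinct_prime_powers G"
  obtains \<psi> where "unitary_character G torsion_set \<psi>" "\<And>x. x \<in> torsion_set \<Longrightarrow> \<psi> x = 1 \<Longrightarrow> x = \<one>"
proof -
  obtain m p \<alpha> where p: "\<forall>i<m. prime (p i)" "inj_on p {..<m}" "\<forall>i<m. \<alpha> i \<ge> (1::nat)"
    and "torsion_subgroup G \<cong> sum_group {..<m::nat} (\<lambda>i. integer_mod_group (p i ^ \<alpha> i))"
    using assms unfolding torsion_sum_of_distinct_prime_powers_def by blast
  then obtain h where h: "h \<in> iso (torsion_subgroup G) (sum_group {..<m} (\<lambda>i. integer_mod_group (p i ^ \<alpha> i)))"
    by (auto simp: is_iso_def)
  define q where "q i = p i ^ \<alpha> i" for i
  have q0: "q i > 0" if "i < m" for i using p that by (simp add: q_def prime_gt_0_nat)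
  have cop: "coprime (q i) (q j)" if "i < m" "j < m" "i \<noteq> j" for i j
  proof -
    have "p i \<noteq> p j" using p that by (auto simp: inj_on_def)
    then have "coprime (p i) (p j)" using p that by (intro primes_coprime) auto
    then show ?thesis by (simp add: q_def)
  qed
  have car: "carrier (sum_group {..<m} (\<lambda>i. integer_mod_group (p i ^ \<alpha> i))) = (\<Pi>\<^sub>E i\<in>{..<m}. {0..<int (q i)})"
    using carrier_sum_group_finite[of m q] q0 by (simp add: q_def)
  have hc: "h x \<in> (\<Pi>\<^sub>E i\<in>{..<m}. {0..<int (q i)})" if "x \<in> torsion_set" for x
    using h that unfolding iso_def hom_def car[symmetric] torsion_subgroup_alt by auto
  have hm: "h (x \<otimes> y) i = (h x i + h y i) mod int (q i)" if "x \<in> torsion_set" "y \<in> torsion_set" "i < m" for x y i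
    using h that unfolding iso_def hom_def torsion_subgroup_alt by (auto simp: q_def)
  have inj: "inj_on h torsion_set"
    using h unfolding iso_def torsion_subgroup_alt bij_betw_def by auto
  have one: "\<one> \<in> torsion_set"
    using subgroup_torsion_set subgroup.one_closed by blast
  define \<psi> where "\<psi> x = cis (2 * pi * (\<Sum>i<m. of_int (h x i) / real (q i)))" for x
  show ?thesis
  proof
    have "\<psi> (x \<otimes> y) = \<psi> x * \<psi> y" if xy: "x \<in> torsion_set" "y \<in> torsion_set" for x y
    proof -
      have "of_int (h x i) / real (q i) + of_int (h y i) / real (q i)
          = of_int (h (x \<otimes> y) i) / real (q i) + of_int ((h x i + h y i) div int (q i))" if "i < m" for i
      proof -
        have "real_of_int (h x i + h y i)
            = real_of_int (int (q i) * ((h x i + h y i) div int (q i)) + (h x i + h y i) mod int (q i))"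
          by simp
        then have "of_int (h x i) + of_int (h y i) = real (q i) * of_int ((h x i + h y i) div int (q i))
            + real_of_int (h (x \<otimes> y) i)"
          unfolding hm[OF xy that] of_int_add of_int_mult of_int_of_nat_eq .
        then show ?thesis using q0[OF that] by (simp add: field_simps)
      qed
      then have "(\<Sum>i<m. of_int (h x i) / real (q i)) + (\<Sum>i<m. of_int (h y i) / real (q i))
          = (\<Sum>i<m. of_int (h (x \<otimes> y) i) / real (q i)) + of_int (\<Sum>i<m. (h x i + h y i) div int (q i))"
        by (simp add: sum.distrib[symmetric])
      then have "\<psi> x * \<psi> y = cis (2 * pi * ((\<Sum>i<m. of_int (h (x \<otimes> y) i) / real (q i))
          + of_int (\<Sum>i<m. (h x i + h y i) div int (q i))))"
        unfolding \<psi>_def cis_mult by (simp add: distrib_left[symmetric] del: of_int_sum)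
      also have "\<dots> = \<psi> (x \<otimes> y)"
        unfolding \<psi>_def distrib_left cis_mult[symmetric] by (subst cis_multiple_2pi) (simp_all del: of_int_sum)
      finally show ?thesis ..
    qed
    then show "unitary_character G torsion_set \<psi>"
      by (simp add: unitary_character_def \<psi>_def)
  next
    fix x assume x: "x \<in> torsion_set" "\<psi> x = 1"
    have zero: "h x i = 0" if i: "i < m" and x: "x \<in> torsion_set" and 1: "\<psi> x = 1" for i x
    proof -
      have "cos (2 * pi * (\<Sum>i<m. of_int (h x i) / real (q i))) = 1"
        using 1 by (simp add: \<psi>_def complex_eq_iff)
      then obtain k :: int where "2 * pi * (\<Sum>i<m. of_int (h x i) / real (q i)) = of_int k * (2 * pi)"
        by (auto simp: cos_one_2pi_int)
      then have "(\<Sum>i<m. of_int (h x i) / real (q i)) = of_int k"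
        by (simp add: field_simps)
      then have "int (q i) dvd h x i"
        by (intro coprime_fractions_sum_integer[OF q0 cop _ i]) auto
      moreover have "0 \<le> h x i" "h x i < int (q i)"
        using PiE_mem[OF hc[OF x], of i] i by auto
      ultimately show ?thesis using zdvd_not_zless[of "h x i" "int (q i)"] by linarith
    qed
    have one1: "\<psi> \<one> = 1"
    proof -
      have "h \<one> i = 0" if "i < m" for i
      proof -
        have "0 \<le> h \<one> i" "h \<one> i < int (q i)"
          using PiE_mem[OF hc[OF one], of i] that by auto
        moreover have "h \<one> i = (h \<one> i + h \<one> i) mod int (q i)" using hm[OF one one that] by simp
        ultimately show ?thesis
          by (smt (verit) mod_pos_pos_trivial minus_mod_self2)
      qed
      then show ?thesis by (simp add: \<psi>_def)
    qed
    have "h x = h \<one>"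
    proof (rule PiE_ext[OF hc[OF x(1)] hc[OF one]])
      show "h x i = h \<one> i" if "i \<in> {..<m}" for i
        using zero[of i x] zero[of i \<one>] that x one one1 by simp
    qed
    then show "x = \<one>" using inj x one by (auto dest: inj_onD)
  qed
qed

lemma ord_mult_coprime:
  assumes x: "x \<in> carrier G" and y: "y \<in> carrier G" and cop: "coprime (ord x) (ord y)"
  shows "ord (x \<otimes> y) = ord x * ord y"
proof (rule dvd_antisym)
  show "ord (x \<otimes> y) dvd ord x * ord y"
    using abelian_ord_mul_divides x y by simp
  let ?k = "ord (x \<otimes> y)"
  have k: "x [^] ?k \<otimes> y [^] ?k = \<one>"
    using x y pow_ord_eq_1[of "x \<otimes> y"] pow_mult_distrib[of x y ?k] m_comm[of x y] by simp
  have "(x [^] ?k \<otimes> y [^] ?k) [^] ord y = x [^] (?k * ord y)"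
    using x y by (simp add: pow_mult_distrib m_comm nat_pow_pow pow_eq_id)
  then have "x [^] (?k * ord y) = \<one>" unfolding k by simp
  then have "ord x dvd ?k * ord y" using pow_eq_id[OF x] by blast
  then have 1: "ord x dvd ?k" using cop coprime_dvd_mult_left_iff by blast
  have "(x [^] ?k \<otimes> y [^] ?k) [^] ord x = y [^] (?k * ord x)"
    using x y by (simp add: pow_mult_distrib m_comm nat_pow_pow pow_eq_id)
  then have "y [^] (?k * ord x) = \<one>" unfolding k by simp
  then have "ord y dvd ?k * ord x" using pow_eq_id[OF y] by blast
  then have 2: "ord y dvd ?k" using cop coprime_dvd_mult_left_iff coprime_commute by metis
  show "ord x * ord y dvd ord (x \<otimes> y)" using 1 2 cop divides_mult by blast
qed

lemma ord_pos_iff_torsion: "x \<in> torsion_set \<longleftrightarrow> x \<in> carrier G \<and> ord x > 0"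
  using ord_eq_0[of x] by (auto simp: torsion_set_def)

text \<open>
  The exponent of a finite abelian group is attained: if \<open>x\<close> has maximal order and a prime \<open>p\<close>
  occurs in the order of \<open>y\<close> with a higher power than in that of \<open>x\<close>, then replacing the
  \<open>p\<close>-part of \<open>x\<close> by that of \<open>y\<close> increases the order.
\<close>

lemma ord_dvd_maximal_ord:
  assumes x: "x \<in> torsion_set" and max: "\<And>z. z \<in> torsion_set \<Longrightarrow> ord z \<le> ord x"
    and y: "y \<in> torsion_set"
  shows "ord y dvd ord x"
proof (rule ccontr)
  assume "\<not> ord y dvd ord x"
  have xc: "x \<in> carrier G" "ord x > 0" and yc: "y \<in> carrier G" "ord y > 0"
    using x y by (auto simp: ord_pos_iff_torsion)
  obtain p where p: "prime p" "multiplicity p (ord x) < multiplicity p (ord y)"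
  proof -
    have "\<not> (\<forall>p. prime p \<longrightarrow> multiplicity p (ord y) \<le> multiplicity p (ord x))"
      using multiplicity_le_imp_dvd[of "ord y" "ord x"] \<open>\<not> ord y dvd ord x\<close> yc by blast
    with that show ?thesis by (auto simp: not_le)
  qed
  define a where "a = multiplicity p (ord x)"
  define b where "b = multiplicity p (ord y)"
  obtain u where u: "ord x = p ^ a * u" "\<not> p dvd u"
    unfolding a_def using xc p(1) by (auto intro: multiplicity_decompose'[of "ord x" p])
  obtain v where v: "ord y = p ^ b * v" "\<not> p dvd v"
    unfolding b_def using yc p(1) by (auto intro: multiplicity_decompose'[of "ord y" p])
  have pos: "p ^ a > 0" "p ^ b > 0" "u > 0" "v > 0" using u v xc yc by (auto intro: ccontr)
  define x' where "x' = x [^] (p ^ a)"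
  define y' where "y' = y [^] v"
  have c: "x' \<in> carrier G" "y' \<in> carrier G" using xc yc by (auto simp: x'_def y'_def)
  have ox: "ord x' = u" unfolding x'_def using ord_pow[of x "p ^ a"] xc u pos by simp
  have oy: "ord y' = p ^ b" unfolding y'_def using ord_pow[of y v] yc v pos by simp
  have "coprime u (p ^ b)"
    using p(1) u(2) by (simp add: prime_imp_coprime coprime_commute)
  then have o: "ord (x' \<otimes> y') = u * p ^ b" using ord_mult_coprime c ox oy by simp
  then have "x' \<otimes> y' \<in> torsion_set" using c pos by (simp add: ord_pos_iff_torsion)
  from max[OF this] have "u * p ^ b \<le> u * p ^ a" using o u by (simp add: mult.commute)
  then have "p ^ b \<le> p ^ a" using pos by simp
  then have "b \<le> a" using p(1) prime_gt_1_nat by simp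
  then show False using p(2) by (simp add: a_def b_def)
qed

text \<open>
  An element \<open>x\<close> of maximal order generates the torsion subgroup. If \<open>y\<^sup>p\<close> is a power of \<open>x\<close>, then it is
  even the \<open>p\<close>-th power of a power \<open>x\<^sup>k\<close>, because the order of \<open>y\<close> divides that of \<open>x\<close>. The quotient
  \<open>y / x\<^sup>k\<close> then has order dividing \<open>p\<close>, so it lies in the only subgroup of order \<open>p\<close>, which is generated by a power
  of \<open>x\<close>. If \<open>p\<close> does not divide the order of \<open>x\<close>, then
  \<open>y\<close> is already a power of \<open>y\<^sup>p\<close>. Iterating over the prime factors of the order of \<open>y\<close> reaches \<open>y\<close> itself.
\<close>

lemma torsion_cyclic:
  assumes fin: "finite torsion_set"
    and rank1: "\<And>p x y. prime (p::nat) \<Longrightarrow> x \<in> carrier G \<Longrightarrow> y \<in> carrier G \<Longrightarrow> x [^] p = \<one> \<Longrightarrow> y [^] p = \<one> \<Longrightarrow>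
           x \<noteq> \<one> \<Longrightarrow> \<exists>k::nat. y = x [^] k"
  obtains x where "x \<in> torsion_set" "torsion_set = range (\<lambda>k::nat. x [^] k)"
proof -
  have "torsion_set \<noteq> {}" using subgroup_torsion_set subgroup.one_closed by blast
  then obtain x where x: "x \<in> torsion_set" "\<And>z. z \<in> torsion_set \<Longrightarrow> ord z \<le> ord x"
    using Max_in[of "ord ` torsion_set"] Max_ge[of "ord ` torsion_set"] fin by fastforce
  have xc: "x \<in> carrier G" "ord x > 0" using x by (auto simp: ord_pos_iff_torsion)
  have powers: "y \<in> range (\<lambda>k::nat. x [^] k)" if "y \<in> torsion_set" "y [^] n \<in> range (\<lambda>k::nat. x [^] k)" "n > 0"
    for y and n :: nat
    using that
  proof (induction n arbitrary: y rule: prime_divisors_induct)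
    case zero
    then show ?case by simp
  next
    case (unit n)
    then show ?case by (auto simp: ord_pos_iff_torsion)
  next
    case (factor p n)
    have y: "y \<in> carrier G" "y \<in> torsion_set" using factor by (auto simp: ord_pos_iff_torsion)
    have pn: "p > 0" "n > 0" using factor.prems(3) by auto
    have yp: "y [^] p \<in> torsion_set"
      using subgroup_int_pow_closed[OF subgroup_torsion_set y(2), of "int p"] by (simp add: int_pow_int)
    have "(y [^] p) [^] n \<in> range (\<lambda>k::nat. x [^] k)"
      using factor.prems(2) y by (simp add: nat_pow_pow)
    then obtain k :: nat where k: "y [^] p = x [^] k" using factor.IH[OF yp _ pn(2)] by auto
    show ?case
    proof (cases "p dvd ord x")
      case False
      then have "coprime p (ord x)" using factor(1) by (simp add: prime_imp_coprime)
      moreover obtain d s t where "d dvd p" "d dvd ord x" "p * s = ord x * t + d"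
        using bezout_add_strong_nat[of p "ord x"] pn by auto
      ultimately have st: "s * p = t * ord x + (1::nat)"
        using coprime_common_divisor_nat[of p "ord x" d] by (simp add: mult.commute)
      have "y [^] ord x = \<one>" using ord_dvd_maximal_ord[OF x y(2)] y by (simp add: pow_eq_id)
      have "y [^] (s * p) = (y [^] ord x) [^] t \<otimes> y"
        unfolding st using y by (simp add: nat_pow_mult[symmetric] nat_pow_pow mult.commute)
      then have "y = (y [^] p) [^] s" using \<open>y [^] ord x = \<one>\<close> y by (simp add: nat_pow_pow mult.commute)
      also have "\<dots> = x [^] (k * s)" using k xc by (simp add: nat_pow_pow)
      finally show ?thesis by blast
    next
      case True
      then obtain e where e: "ord x = p * e" by blast
      have e0: "e > 0" using e xc by auto
      have "x [^] (k * e) = y [^] ord x" using k xc y e by (simp flip: nat_pow_pow)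
      also have "\<dots> = \<one>" using ord_dvd_maximal_ord[OF x y(2)] y by (simp add: pow_eq_id)
      finally have "p * e dvd k * e" using xc e by (simp add: pow_eq_id)
      then have "p dvd k" using e0 by simp
      then obtain k' where k': "k = p * k'" by blast
      define w where "w = y \<otimes> inv (x [^] k')"
      have wc: "w \<in> carrier G" using y xc by (simp add: w_def)
      have "w [^] p = y [^] p \<otimes> inv (x [^] (k' * p))"
        unfolding w_def using y xc by (simp add: pow_mult_distrib m_comm nat_pow_inv nat_pow_pow)
      also have "\<dots> = \<one>" using k k' xc by (simp add: mult.commute)
      finally have wp: "w [^] p = \<one>" .
      have "(x [^] e) [^] p = \<one>" using xc e by (simp add: nat_pow_pow mult.commute pow_eq_id)
      moreover have "x [^] e \<noteq> \<one>"
        using xc e e0 factor(1) by (auto simp: pow_eq_id dest: prime_gt_1_nat nat_dvd_not_less)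
      ultimately obtain l where "w = (x [^] e) [^] (l::nat)"
        using rank1[OF factor(1), of "x [^] e" w] wc wp xc by auto
      then have "y = x [^] (e * l) \<otimes> x [^] k'"
        using y xc by (simp add: w_def inv_solve_right' nat_pow_pow)
      then have "y = x [^] (e * l + k')" using xc by (simp add: nat_pow_mult)
      then show ?thesis by blast
    qed
  qed
  have "torsion_set = range (\<lambda>k::nat. x [^] k)"
  proof (intro equalityI subsetI)
    fix y assume y: "y \<in> torsion_set"
    then have "y \<in> carrier G" "ord y > 0" by (auto simp: ord_pos_iff_torsion)
    then show "y \<in> range (\<lambda>k::nat. x [^] k)"
      using powers[OF y, of "ord y"] rangeI[of "\<lambda>k::nat. x [^] k" 0] by simp
  next
    fix y assume "y \<in> range (\<lambda>k::nat. x [^] k)"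
    then show "y \<in> torsion_set"
      using subgroup_int_pow_closed[OF subgroup_torsion_set x(1)] by (auto simp flip: int_pow_int)
  qed
  with x(1) that show ?thesis by blast
qed

text \<open>The Chinese remainder theorem splits a finite cyclic torsion subgroup.\<close>

lemma torsion_sum_of_distinct_prime_powersI:
  assumes x: "x \<in> torsion_set" and gen: "torsion_set = range (\<lambda>k::nat. x [^] k)"
  shows "torsion_sum_of_distinct_prime_powers G"
proof -
  have xc: "x \<in> carrier G" "ord x > 0" using x by (auto simp: ord_pos_iff_torsion)
  define N where "N = ord x"
  obtain p where p: "bij_betw p {..<card (prime_factors N)} (prime_factors N)"
    using ex_bij_betw_nat_finite[of "prime_factors N"] by (auto simp: atLeast0LessThan)
  define m where "m = card (prime_factors N)"
  define \<alpha> where "\<alpha> i = multiplicity (p i) N" for i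
  define q where "q i = p i ^ \<alpha> i" for i
  have pin: "p i \<in> prime_factors N" if "i < m" for i using p that by (auto simp: bij_betw_def m_def)
  have prm: "prime (p i)" if "i < m" for i using pin[OF that] by auto
  have inj: "inj_on p {..<m}" using p by (simp add: bij_betw_def m_def)
  have \<alpha>1: "\<alpha> i \<ge> 1" if "i < m" for i
    using pin[OF that] by (simp add: \<alpha>_def prime_factors_multiplicity)
  have q0: "q i > 0" if "i < m" for i using prm[OF that] by (simp add: q_def prime_gt_0_nat)
  have cop: "coprime (q i) (q j)" if "i < m" "j < m" "i \<noteq> j" for i j
  proof -
    have "p i \<noteq> p j" using inj that by (auto simp: inj_on_def)
    then have "coprime (p i) (p j)" using prm that by (intro primes_coprime) auto
    then show ?thesis by (simp add: q_def)
  qed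
  have N: "N = (\<Prod>i<m. q i)"
  proof -
    have "N = (\<Prod>p\<in>prime_factors N. p ^ multiplicity p N)"
      using xc by (simp add: N_def prod_prime_factors)
    also have "\<dots> = (\<Prod>i<m. q i)"
      unfolding q_def \<alpha>_def m_def using prod.reindex_bij_betw[OF p, of "\<lambda>p. p ^ multiplicity p N"] by simp
    finally show ?thesis .
  qed
  have qN: "int (q i) dvd int N" if "i < m" for i
    unfolding N using that by (intro of_nat_dvd_iff[THEN iffD2] dvd_prodI) auto
  let ?S = "sum_group {..<m} (\<lambda>i. integer_mod_group (p i ^ \<alpha> i))"
  have car: "carrier ?S = (\<Pi>\<^sub>E i\<in>{..<m}. {0..<int (q i)})"
    using carrier_sum_group_finite[of m q] q0 by (simp add: q_def)
  define e where "e y = (SOME k::nat. y = x [^] k)" for y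
  have e: "x [^] e y = y" if "y \<in> torsion_set" for y
    unfolding e_def using that gen by (intro someI_ex[THEN sym]) auto
  define h where "h y = (\<lambda>i\<in>{..<m}. int (e y) mod int (q i))" for y
  have hin: "h y \<in> carrier ?S" if "y \<in> torsion_set" for y
    unfolding car h_def using q0 by (auto simp: PiE_iff)
  have hpow: "h y i = int k mod int (q i)" if "i < m" "y = x [^] k" for y k i
  proof -
    have "y \<in> torsion_set" using that gen by auto
    then have "x [^] e y = x [^] k" using e that by simp
    then have "int N dvd int k - int (e y)"
      using int_pow_eq[OF xc(1), of "int (e y)" "int k"] by (simp add: int_pow_int N_def)
    then have "int (q i) dvd int k - int (e y)" using qN[OF that(1)] dvd_trans by blast
    then show ?thesis using that(1) by (simp add: h_def mod_eq_dvd_iff dvd_diff_commute)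
  qed
  have hom: "h (y \<otimes> z) = h y \<otimes>\<^bsub>?S\<^esub> h z" if "y \<in> torsion_set" "z \<in> torsion_set" for y z
  proof -
    have yz: "y \<otimes> z = x [^] (e y + e z)" using e that xc by (simp add: nat_pow_mult[symmetric])
    have "h (y \<otimes> z) i = (h y i + h z i) mod int (q i)" if "i < m" for i
      unfolding hpow[OF that yz] using that by (simp add: h_def mod_add_eq)
    then show ?thesis by (auto simp: h_def q_def fun_eq_iff)
  qed
  have inj_h: "inj_on h torsion_set"
  proof (rule inj_onI)
    fix y z assume yz: "y \<in> torsion_set" "z \<in> torsion_set" "h y = h z"
    have "int (q i) dvd int (e z) - int (e y)" if "i < m" for i
      using fun_cong[OF yz(3), of i] that by (simp add: h_def mod_eq_dvd_iff dvd_diff_commute)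
    then have "(\<Prod>i<m. int (q i)) dvd int (e z) - int (e y)"
      using cop by (intro coprime_prod_dvd) auto
    then have "int N dvd int (e z) - int (e y)" unfolding N by simp
    then have "x [^] int (e y) = x [^] int (e z)" using int_pow_eq[OF xc(1)] by (simp add: N_def)
    then show "y = z" using e yz by (simp add: int_pow_int)
  qed
  have "card torsion_set = N"
  proof -
    have "torsion_set = (\<lambda>k. x [^] k) ` {..<N}"
    proof -
      have "x [^] k \<in> (\<lambda>k. x [^] k) ` {..<N}" for k :: nat
      proof -
        have "x [^] (k mod N) = x [^] k"
        proof -
          have "int N dvd int k - int (k mod N)" by (simp add: zmod_int flip: minus_mod_eq_mult_div)
          then show ?thesis using int_pow_eq[OF xc(1), of "int (k mod N)" "int k"] by (simp add: int_pow_int N_def)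
        qed
        then show ?thesis using xc imageI[of "k mod N" "{..<N}" "\<lambda>k. x [^] k"] by (simp add: N_def)
      qed
      then show ?thesis unfolding gen by auto
    qed
    moreover have "inj_on (\<lambda>k. x [^] k) {..<N}"
    proof (rule inj_onI)
      fix k l assume kl: "k \<in> {..<N}" "l \<in> {..<N}" "x [^] k = x [^] l"
      then have "int N dvd int l - int k"
        using int_pow_eq[OF xc(1), of "int k" "int l"] by (simp add: int_pow_int N_def)
      then have "int l mod int N = int k mod int N" by (simp add: mod_eq_dvd_iff)
      then show "k = l" using kl by simp
    qed
    ultimately show ?thesis by (simp add: card_image)
  qed
  moreover have "card (carrier ?S) = N"
    unfolding car N by (simp add: card_PiE)
  moreover have "finite (carrier ?S)" unfolding car by (intro finite_PiE) auto
  moreover have "h ` torsion_set \<subseteq> carrier ?S" using hin by auto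
  ultimately have "h ` torsion_set = carrier ?S"
    using card_image[OF inj_h] card_subset_eq by metis
  then have "h \<in> iso (torsion_subgroup G) ?S"
    using hom hin inj_h unfolding iso_def hom_def torsion_subgroup_alt bij_betw_def by (auto simp del: mult_sum_group)
  then show ?thesis
    unfolding torsion_sum_of_distinct_prime_powers_def is_iso_def
    using prm inj \<alpha>1 by blast
qed

end

section \<open>Free isometric actions force the torsion to be cyclic\<close>

lemma smooth_on_has_derivative:
  assumes "smooth_on W F" "x \<in> W"
  shows "(F has_derivative frechet_derivative F (at x)) (at x)"
proof -
  obtain D where W: "open W" and D0': "\<forall>x\<in>W. D 0 x [] = F x"
    and D': "\<forall>k. \<forall>x\<in>W. bounded_multilinear k (D k x) \<and>
           (\<forall>e>0. \<exists>d>0. \<forall>y\<in>W. norm (y - x) < d \<longrightarrow>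
              (\<forall>vs. length vs = k \<longrightarrow>
                 norm (D k y vs - D k x vs - D (Suc k) x ((y - x) # vs))
                   \<le> e * norm (y - x) * prod_list (map norm vs)))"
    using assms(1) unfolding smooth_on_def by (elim conjE exE)
  have D0: "D 0 x [] = F x" if "x \<in> W" for x using D0' that by blast
  note D = D'[rule_format]
  obtain r where r: "r > 0" "ball x r \<subseteq> W" using W assms(2) openE by blast
  have bm: "bounded_multilinear 1 (D 1 x)" using D[OF assms(2), of 1] by (rule conjunct1)
  have "linear (\<lambda>v. D 1 x [v])"
  proof -
    have "linear (\<lambda>v. D 1 x ([] @ v # []))"
      using conjunct1[OF bm[unfolded bounded_multilinear_def], rule_format, of "[]" "[]"] by simp
    then show ?thesis by simp
  qed
  moreover have "\<exists>C. \<forall>v. norm (D 1 x [v]) \<le> norm v * C"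
  proof -
    obtain C where C: "\<And>vs. length vs = 1 \<Longrightarrow> norm (D 1 x vs) \<le> C * prod_list (map norm vs)"
      using bm unfolding bounded_multilinear_def by blast
    have "norm (D 1 x [v]) \<le> norm v * C" for v using C[of "[v]"] by (simp add: mult.commute)
    then show ?thesis by blast
  qed
  ultimately have bl: "bounded_linear (\<lambda>v. D 1 x [v])"
    by (simp add: bounded_linear_def bounded_linear_axioms_def)
  have "(F has_derivative (\<lambda>v. D 1 x [v])) (at x)"
    unfolding has_derivative_at_alt
  proof (intro conjI bl allI impI)
    fix e :: real assume "e > 0"
    then obtain d where d: "d > 0" "\<And>y vs. y \<in> W \<Longrightarrow> norm (y - x) < d \<Longrightarrow> length vs = 0 \<Longrightarrow>
       norm (D 0 y vs - D 0 x vs - D 1 x ((y - x) # vs)) \<le> e * norm (y - x) * prod_list (map norm vs)"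
      using conjunct2[OF D[OF assms(2), of 0], rule_format, OF \<open>e > 0\<close>] unfolding One_nat_def by metis
    show "\<exists>d>0. \<forall>y. norm (y - x) < d \<longrightarrow> norm (F y - F x - D 1 x [y - x]) \<le> e * norm (y - x)"
    proof (intro exI[of _ "min d r"] conjI allI impI)
      fix y assume y: "norm (y - x) < min d r"
      then have "y \<in> W" using r by (auto simp: dist_norm norm_minus_commute)
      then show "norm (F y - F x - D 1 x [y - x]) \<le> e * norm (y - x)"
        using d(2)[of y "[]"] y D0 assms(2) by simp
    qed (use d r in auto)
  qed
  then show ?thesis using frechet_derivative_works differentiableI by blast
qed

text \<open>
  A curve of speed at most \<open>1\<close> on the unit sphere cannot leave its starting point faster than a great
  circle. As long as the angle \<open>arccos (y 0 \<bullet> y t)\<close> lies strictly between \<open>0\<close> and \<open>\<pi>\<close>, its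
  derivative is bounded by the component of the velocity that is orthogonal to \<open>y t\<close>.
\<close>

lemma inner_ge_cos_of_unit_speed:
  fixes y :: "real \<Rightarrow> 'a::real_inner"
  assumes sph: "\<And>t. norm (y t) = 1"
    and der: "\<And>t. \<exists>w. (y has_vector_derivative w) (at t) \<and> norm w \<le> 1"
    and t1: "0 \<le> t1" "t1 \<le> pi"
  shows "inner (y 0) (y t1) \<ge> cos t1"
proof (rule ccontr)
  assume neg: "\<not> inner (y 0) (y t1) \<ge> cos t1"
  define h where "h t = inner (y 0) (y t)" for t
  have h_ge: "h t \<ge> -1" for t
    using Cauchy_Schwarz_ineq2[of "y 0" "y t"] sph by (simp add: h_def)
  obtain w where w: "\<And>t. (y has_vector_derivative w t) (at t)" "\<And>t. norm (w t) \<le> 1"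
    using der by metis
  have hder: "(h has_real_derivative inner (y 0) (w t)) (at t)" for t
  proof -
    have "(h has_derivative (\<lambda>s. inner (y 0) (s *\<^sub>R w t))) (at t)"
      unfolding h_def using w(1)[of t] unfolding has_vector_derivative_def
      by (intro derivative_eq_intros) auto
    then show ?thesis
      by (simp add: has_field_derivative_def mult_commute_abs)
  qed
  have hcont: "continuous_on A h" for A
    using hder by (meson DERIV_isCont continuous_at_imp_continuous_on)
  have yw: "inner (y t) (w t) = 0" for t
  proof -
    have "((\<lambda>t. inner (y t) (y t)) has_derivative (\<lambda>s. inner (y t) (s *\<^sub>R w t) + inner (s *\<^sub>R w t) (y t))) (at t)"
      using w(1)[of t] unfolding has_vector_derivative_def by (intro derivative_eq_intros) auto
    moreover have "(\<lambda>t. inner (y t) (y t)) = (\<lambda>t. 1)" using sph by (simp add: norm_eq_1)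
    ultimately have "((\<lambda>t. 1::real) has_derivative (\<lambda>s. inner (y t) (s *\<^sub>R w t) + inner (s *\<^sub>R w t) (y t))) (at t)"
      by simp
    then have "(\<lambda>s. inner (y t) (s *\<^sub>R w t) + inner (s *\<^sub>R w t) (y t)) = (\<lambda>s. 0)"
      using has_derivative_unique has_derivative_const by blast
    from fun_cong[OF this, of 1] show ?thesis by (simp add: inner_commute)
  qed
  have hd_bound: "- inner (y 0) (w t) \<le> sqrt (1 - (h t)\<^sup>2)" for t
  proof -
    have "- inner (y 0) (w t) = - inner (y 0 - h t *\<^sub>R y t) (w t)"
      by (simp add: inner_diff_left yw)
    also have "\<dots> \<le> norm (y 0 - h t *\<^sub>R y t) * norm (w t)"
      using Cauchy_Schwarz_ineq2[of "y 0 - h t *\<^sub>R y t" "w t"] by linarith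
    also have "\<dots> \<le> norm (y 0 - h t *\<^sub>R y t)"
      using w(2)[of t] by (simp add: mult_left_le)
    also have "\<dots> = sqrt (1 - (h t)\<^sup>2)"
    proof -
      have "inner (y 0) (y 0) = 1" "inner (y t) (y t) = 1" using sph by (simp_all add: norm_eq_1)
      then have "inner (y 0 - h t *\<^sub>R y t) (y 0 - h t *\<^sub>R y t) = 1 - (h t)\<^sup>2"
        by (simp add: inner_diff_left inner_diff_right h_def[symmetric] inner_commute[of "y t" "y 0"] power2_eq_square)
      then show ?thesis by (simp add: norm_eq_sqrt_inner)
    qed
    finally show ?thesis .
  qed
  have t1': "t1 < pi"
    using neg h_ge[of t1] t1 by (cases "t1 = pi") (auto simp: h_def)
  define A where "A = {t \<in> {0..t1}. cos t - h t \<le> 0}"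
  have "closed A"
  proof -
    have "continuous_on {0..t1} (\<lambda>t. cos t - h t)" by (intro continuous_intros hcont)
    from continuous_closed_preimage[OF this closed_atLeastAtMost closed_atMost[of 0]]
    show ?thesis unfolding A_def by (simp add: vimage_def Int_def)
  qed
  have "0 \<in> A" using sph[of 0] t1 by (simp add: A_def h_def norm_eq_1)
  have bdd: "bdd_above A" by (auto simp: A_def bdd_above_def)
  \<comment> \<open>The last time at which the bound holds; just after \<open>t0\<close> the angle is strictly between \<open>0\<close> and \<open>\<pi>\<close>, where \<open>arccos\<close> is differentiable.\<close>
  define t0 where "t0 = Sup A"
  have "t0 \<in> A" unfolding t0_def using \<open>closed A\<close> \<open>0 \<in> A\<close> bdd closed_contains_Sup by blast
  then have t0: "0 \<le> t0" "t0 \<le> t1" "h t0 \<ge> cos t0" by (auto simp: A_def)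
  have "t0 \<noteq> t1" using t0(3) neg by (auto simp: h_def)
  then have lt: "t0 < t1" using t0 by simp
  have after: "h t < cos t" if "t0 < t" "t \<le> t1" for t
  proof (rule ccontr)
    assume "\<not> h t < cos t"
    then have "t \<in> A" using that t0 by (simp add: A_def)
    then have "t \<le> t0" unfolding t0_def using bdd by (rule cSup_upper)
    with that show False by simp
  qed
  have "cos pi < cos t0" using t0 lt t1' by (intro cos_monotone_0_pi) auto
  then have "h t0 > -1" using t0 by simp
  moreover have "isCont h t0" using hder DERIV_isCont by blast
  ultimately have "eventually (\<lambda>t. h t > -1) (at t0)"
    by (auto simp: isCont_def intro: order_tendstoD(1))
  then obtain d where d: "d > 0" "\<And>t. t \<noteq> t0 \<Longrightarrow> dist t t0 < d \<Longrightarrow> h t > -1"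
    by (auto simp: eventually_at)
  define t2 where "t2 = min t1 (t0 + d / 2)"
  have t2: "t0 < t2" "t2 \<le> t1" using lt d by (auto simp: t2_def)
  have inter: "-1 < h t" "h t < cos t" if "t0 < t" "t \<le> t2" for t
    using d(2)[of t] d(1) after[of t] that t2 by (auto simp: t2_def dist_real_def)
  define k where "k t = arccos (h t) - t" for t
  have "k t2 \<le> k t0"
  proof (rule DERIV_nonpos_imp_decreasing_open[of t0 t2 k])
    show "t0 \<le> t2" using t2 by simp
    have "h t \<le> 1" for t
      using Cauchy_Schwarz_ineq2[of "y 0" "y t"] sph by (simp add: h_def)
    then show "continuous_on {t0..t2} k"
      unfolding k_def using h_ge by (intro continuous_intros hcont) auto
    fix t assume t: "t0 < t" "t < t2"
    have "h t < 1" "-1 < h t" using inter[OF t(1) less_imp_le[OF t(2)]] cos_le_one[of t] by linarith+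
    then have "(k has_real_derivative (inverse (- sqrt (1 - (h t)\<^sup>2)) * inner (y 0) (w t) - 1)) (at t)"
      unfolding k_def by (intro DERIV_diff DERIV_chain2[OF DERIV_arccos hder] DERIV_ident)
    moreover have "(h t)\<^sup>2 < 1"
      using \<open>h t < 1\<close> \<open>-1 < h t\<close> by (simp add: abs_square_less_1)
    then have "inverse (- sqrt (1 - (h t)\<^sup>2)) * inner (y 0) (w t) - 1 \<le> 0"
      using hd_bound[of t] by (simp add: field_simps)
    ultimately show "\<exists>D. (k has_real_derivative D) (at t) \<and> D \<le> 0" by blast
  qed
  moreover have "k t0 \<le> 0"
  proof -
    have "h t0 \<le> 1" using Cauchy_Schwarz_ineq2[of "y 0" "y t0"] sph by (simp add: h_def)
    then have "arccos (h t0) \<le> arccos (cos t0)" using t0(3) by (intro arccos_le_arccos) auto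
    also have "\<dots> = t0" using t0 lt t1' by (intro arccos_cos) auto
    finally show ?thesis by (simp add: k_def)
  qed
  ultimately have "arccos (h t2) \<le> t2" by (simp add: k_def)
  moreover have ht2: "h t2 \<le> 1" using inter(2)[OF t2(1) order_refl] cos_le_one[of t2] by linarith
  ultimately have "cos t2 \<le> cos (arccos (h t2))"
    using inter[of t2] t2 t1' t0 cos_le_one[of t2] by (intro cos_monotone_0_pi_le arccos_lbound) auto
  moreover have "cos (arccos (h t2)) = h t2" using inter(1)[OF t2(1) order_refl] ht2 by simp
  ultimately show False
    using inter(2)[OF t2(1) order_refl] by linarith
qed

lemma great_circle:
  fixes x u :: "'a::real_inner"
  assumes "norm x = 1" "norm u = 1" "inner x u = 0"
  shows "norm (cos t *\<^sub>R x + sin t *\<^sub>R u) = 1"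
    and "((\<lambda>t. cos t *\<^sub>R x + sin t *\<^sub>R u) has_vector_derivative (cos t *\<^sub>R u - sin t *\<^sub>R x)) (at t)"
    and "norm (cos t *\<^sub>R u - sin t *\<^sub>R x) = 1"
    and "inner (cos t *\<^sub>R x + sin t *\<^sub>R u) (cos t *\<^sub>R u - sin t *\<^sub>R x) = 0"
proof -
  have i: "inner x x = 1" "inner u u = 1" "inner u x = 0" "inner x u = 0"
    using assms by (simp_all add: norm_eq_1 inner_commute)
  show "norm (cos t *\<^sub>R x + sin t *\<^sub>R u) = 1" "norm (cos t *\<^sub>R u - sin t *\<^sub>R x) = 1"
    by (simp_all add: norm_eq_1 inner_add_left inner_add_right inner_diff_left inner_diff_right i
        power2_eq_square[symmetric] cos_squared_eq)
  show "inner (cos t *\<^sub>R x + sin t *\<^sub>R u) (cos t *\<^sub>R u - sin t *\<^sub>R x) = 0"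
    by (simp add: inner_add_left inner_diff_right i)
  show "((\<lambda>t. cos t *\<^sub>R x + sin t *\<^sub>R u) has_vector_derivative (cos t *\<^sub>R u - sin t *\<^sub>R x)) (at t)"
    by (auto intro!: derivative_eq_intros)
qed

text \<open>
  The hypotheses exclude the two cases in which \<open>x\<close> and \<open>z\<close> are linearly dependent; \<open>u\<close> is the
  normalised component of \<open>z\<close> orthogonal to \<open>x\<close>.
\<close>

lemma great_circle_through:
  fixes x z :: "'a::real_inner"
  assumes "norm x = 1" "norm z = 1" "z \<noteq> x" "z \<noteq> - x"
  obtains u where "norm u = 1" "inner x u = 0" "z = cos (arccos (inner x z)) *\<^sub>R x + sin (arccos (inner x z)) *\<^sub>R u"
proof -
  define c where "c = inner x z"
  have i: "inner x x = 1" "inner z z = 1" using assms by (simp_all add: norm_eq_1)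
  have le: "\<bar>c\<bar> \<le> 1" using Cauchy_Schwarz_ineq2[of x z] assms by (simp add: c_def)
  have "inner (z - x) (z - x) = 2 - 2 * c" "inner (z + x) (z + x) = 2 + 2 * c"
    by (simp_all add: inner_diff_left inner_diff_right inner_add_left inner_add_right i c_def inner_commute[of z x])
  moreover have "inner (z - x) (z - x) > 0" "inner (z + x) (z + x) > 0"
    using assms(3,4) by (simp_all add: add_eq_0_iff2)
  ultimately have c: "-1 < c" "c < 1" by auto
  then have s: "1 - c\<^sup>2 > 0" by (simp add: abs_square_less_1)
  define s where "s = sqrt (1 - c\<^sup>2)"
  have s0: "s > 0" "s\<^sup>2 = 1 - c\<^sup>2" using s by (simp_all add: s_def)
  define u where "u = (z - c *\<^sub>R x) /\<^sub>R s"
  have "inner (z - c *\<^sub>R x) (z - c *\<^sub>R x) = s\<^sup>2"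
    unfolding s0 by (simp add: inner_diff_left inner_diff_right i c_def[symmetric] inner_commute[of z x] power2_eq_square)
  then have "norm (z - c *\<^sub>R x) = s" using s0(1) by (simp add: norm_eq_sqrt_inner)
  then have "norm u = 1" using s0(1) by (simp add: u_def)
  moreover have "inner x u = 0" by (simp add: u_def inner_diff_right i c_def)
  moreover have "z = c *\<^sub>R x + s *\<^sub>R u" using s0 by (simp add: u_def)
  moreover have "cos (arccos c) = c" "sin (arccos c) = s"
    using c by (simp_all add: sin_arccos s_def)
  ultimately show ?thesis using that by (simp add: c_def)
qed

text \<open>
  The image of the great circle from \<open>x\<close> to \<open>z\<close> has unit speed, so by
  \<open>inner_ge_cos_of_unit_speed\<close> the angle between \<open>f x\<close> and \<open>f z\<close> is at most the one between \<open>x\<close> and \<open>z\<close>. For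
  antipodal points any inner product is large enough.
\<close>

lemma riemannian_sphere_isometry_inner_ge:
  fixes f :: "'h::real_inner \<Rightarrow> 'h"
  assumes iso: "riemannian_sphere_isometry UNIV f" and x: "norm x = 1" and z: "norm z = 1"
  shows "inner (f x) (f z) \<ge> inner x z"
proof -
  let ?S = "unit_sphere (UNIV :: 'h set)"
  have S: "v \<in> ?S \<longleftrightarrow> norm v = 1" for v :: 'h by (simp add: unit_sphere_def)
  have fS: "norm (f v) = 1" if "norm v = 1" for v
    using iso that unfolding riemannian_sphere_isometry_def Let_def bij_betw_def S[symmetric] by blast
  consider "z = x" | "z = - x" | "z \<noteq> x" "z \<noteq> - x" by blast
  then show ?thesis
  proof cases
    case 1
    then show ?thesis using fS[OF x] x by (simp add: norm_eq_1)
  next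
    case 2
    have "inner x z = -1" using x 2 by (simp add: norm_eq_1)
    then show ?thesis
      using Cauchy_Schwarz_ineq2[of "f x" "f z"] fS[OF x] fS[OF z] by simp
  next
    case 3
    obtain u where u: "norm u = 1" "inner x u = 0"
      and zu: "z = cos (arccos (inner x z)) *\<^sub>R x + sin (arccos (inner x z)) *\<^sub>R u"
      using great_circle_through[OF x z 3] .
    define c where "c t = cos t *\<^sub>R x + sin t *\<^sub>R u" for t
    define c' where "c' t = cos t *\<^sub>R u - sin t *\<^sub>R x" for t
    note gc = great_circle[OF x u, folded c_def c'_def]
    have "\<exists>w. ((f \<circ> c) has_vector_derivative w) (at t) \<and> norm w \<le> 1" for t
    proof -
      have "c t \<in> ?S" using gc(1) S by simp
      then obtain F where F: "smooth_extension_at ?S f (c t) F"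
        using iso unfolding riemannian_sphere_isometry_def Let_def smooth_self_map_def by blast
      then obtain W where W: "c t \<in> W" "smooth_on W F" "\<And>v. v \<in> W \<Longrightarrow> norm v = 1 \<Longrightarrow> F v = f v"
        unfolding smooth_extension_at_def using S by auto
      have "open W" using W(2) by (simp add: smooth_on_def)
      let ?F' = "frechet_derivative F (at (c t))"
      have F': "(F has_derivative ?F') (at (c t))" using smooth_on_has_derivative W by blast
      have "((F \<circ> c) has_derivative (?F' \<circ> (\<lambda>s. s *\<^sub>R c' t))) (at t)"
        using gc(2)[of t] unfolding has_vector_derivative_def by (rule diff_chain_at) (rule F')
      moreover have "(?F' \<circ> (\<lambda>s. s *\<^sub>R c' t)) = (\<lambda>s. s *\<^sub>R ?F' (c' t))"
        using linear_scale[OF has_derivative_linear[OF F']] by auto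
      ultimately have Fc: "((F \<circ> c) has_vector_derivative ?F' (c' t)) (at t)"
        by (simp add: has_vector_derivative_def)
      have "isCont c t" using gc(2) has_vector_derivative_continuous by blast
      then have "eventually (\<lambda>s. c s \<in> W) (nhds t)"
        using \<open>open W\<close> W(1) by (simp add: continuous_at tendsto_def isCont_def eventually_nhds_conv_at)
      then have ev: "eventually (\<lambda>s. (F \<circ> c) s = (f \<circ> c) s) (nhds t)"
        by (rule eventually_mono) (use W(3) gc(1) in auto)
      have "((f \<circ> c) has_vector_derivative ?F' (c' t)) (at t)"
        using has_derivative_transform_eventually[OF Fc[unfolded has_vector_derivative_def]] ev
        by (auto simp: has_vector_derivative_def eventually_nhds_conv_at)
      moreover have "inner (?F' (c' t)) (?F' (c' t)) = inner (c' t) (c' t)"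
      proof -
        have "c' t \<in> sphere_tangent UNIV (c t)" using gc(4) by (simp add: sphere_tangent_def)
        then show ?thesis
          using iso F \<open>c t \<in> ?S\<close> unfolding riemannian_sphere_isometry_def Let_def by blast
      qed
      then have "norm (?F' (c' t)) = 1" using gc(3) by (simp add: norm_eq_sqrt_inner)
      ultimately show ?thesis by (metis order_refl)
    qed
    moreover have "norm ((f \<circ> c) t) = 1" for t using fS gc(1) by simp
    moreover have bd: "\<bar>inner x z\<bar> \<le> 1" using Cauchy_Schwarz_ineq2[of x z] x z by simp
    then have "0 \<le> arccos (inner x z)" "arccos (inner x z) \<le> pi"
      using arccos_lbound arccos_ubound by auto
    ultimately have "inner ((f \<circ> c) 0) ((f \<circ> c) (arccos (inner x z))) \<ge> cos (arccos (inner x z))"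
      by (intro inner_ge_cos_of_unit_speed)
    moreover have "c 0 = x" "c (arccos (inner x z)) = z"
      using zu by (simp_all add: c_def)
    moreover have "cos (arccos (inner x z)) = inner x z" using bd by (intro cos_arccos) auto
    ultimately show ?thesis by simp
  qed
qed

text \<open>
  The classical reason why \<open>\<int>\<^sub>p \<times> \<int>\<^sub>p\<close> has no free linear action: each orbit of a nontrivial
  cyclic group sums to a fixed vector, hence to \<open>0\<close>. Summing over the \<open>p\<close> cyclic groups
  generated by \<open>y x\<^sup>j\<close> counts \<open>v\<close> itself \<open>p\<close> times, while the other terms arrange into orbit sums of
  powers of \<open>x\<close>.
\<close>

lemma (in comm_group) free_linear_action_rank_one:
  fixes F :: "'a \<Rightarrow> 'v::real_vector \<Rightarrow> 'v"
  assumes lin: "\<And>g. g \<in> carrier G \<Longrightarrow> linear (F g)"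
    and one: "\<And>v. F \<one> v = v"
    and mult: "\<And>g h v. g \<in> carrier G \<Longrightarrow> h \<in> carrier G \<Longrightarrow> F (g \<otimes> h) v = F g (F h v)"
    and free: "\<And>g v. g \<in> carrier G \<Longrightarrow> F g v = v \<Longrightarrow> g \<noteq> \<one> \<Longrightarrow> v = 0"
    and nontrivial: "(v :: 'v) \<noteq> 0"
    and p: "prime (p::nat)" and x: "x \<in> carrier G" "x [^] p = \<one>" "x \<noteq> \<one>" and y: "y \<in> carrier G" "y [^] p = \<one>"
  shows "\<exists>k::nat. y = x [^] k"
proof (rule ccontr)
  assume not_pow: "\<nexists>k::nat. y = x [^] k"
  have orbit_sum: "(\<Sum>k<p. F (g [^] k) u) = 0" if g: "g \<in> carrier G" "g [^] p = \<one>" "g \<noteq> \<one>" for g u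
  proof (rule free[OF g(1) _ g(3)])
    have "F g (\<Sum>k<p. F (g [^] k) u) = (\<Sum>k<p. F (g [^] Suc k) u)"
      using g(1) by (simp add: linear_sum[OF lin] mult[symmetric] m_comm)
    also have "\<dots> = (\<Sum>k<p. F (g [^] k) u) + F (g [^] p) u - F (g [^] (0::nat)) u"
    proof -
      have "f 0 + (\<Sum>k<p. f (Suc k)) = (\<Sum>k<p. f k) + f p" for f :: "nat \<Rightarrow> 'v"
        by (simp add: sum.lessThan_Suc_shift[symmetric])
      from this[of "\<lambda>k. F (g [^] k) u"] show ?thesis by (simp only: eq_diff_eq add.commute)
    qed
    finally show "F g (\<Sum>k<p. F (g [^] k) u) = (\<Sum>k<p. F (g [^] k) u)" using g by simp
  qed
  \<comment> \<open>These are orbit sums too, since \<open>y x\<^sup>j = 1\<close> would make \<open>y\<close> a power of \<open>x\<close>.\<close>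
  have zero: "(\<Sum>k<p. F ((y \<otimes> x [^] j) [^] k) v) = 0" for j :: nat
  proof (rule orbit_sum)
    show "(y \<otimes> x [^] j) [^] p = \<one>"
    proof -
      have "(x [^] j) [^] p = (x [^] p) [^] j" using x(1) by (simp only: nat_pow_pow mult.commute)
      then show ?thesis using x y by (simp add: pow_mult_distrib m_comm)
    qed
    show "y \<otimes> x [^] j \<noteq> \<one>"
    proof
      assume "y \<otimes> x [^] j = \<one>"
      moreover have "x [^] (j * (p - 1)) \<otimes> x [^] j = \<one>"
      proof -
        have "j * (p - 1) + j = p * j" using p prime_gt_0_nat[of p] by (cases p) auto
        then have "x [^] (j * (p - 1)) \<otimes> x [^] j = (x [^] p) [^] j"
          using x(1) by (simp only: nat_pow_mult nat_pow_pow)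
        then show ?thesis using x by simp
      qed
      ultimately have "y = x [^] (j * (p - 1))"
        using x y by (metis inv_equality nat_pow_closed)
      with not_pow show False by blast
    qed
  qed (use x y in auto)
  have "(0::'v) = (\<Sum>j<p. \<Sum>k<p. F ((y \<otimes> x [^] j) [^] k) v)" using zero by simp
  also have "\<dots> = (\<Sum>k<p. \<Sum>j<p. F ((y \<otimes> x [^] j) [^] k) v)" by (rule sum.swap)
  also have "\<dots> = (\<Sum>k<p. if k = 0 then real p *\<^sub>R v else 0)"
  proof (rule sum.cong)
    fix k assume k: "k \<in> {..<p}"
    show "(\<Sum>j<p. F ((y \<otimes> x [^] j) [^] k) v) = (if k = 0 then real p *\<^sub>R v else 0)"
    proof (cases "k = 0")
      case True
      then show ?thesis by (simp add: one sum_constant_scaleR)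
    next
      case False
      have "ord x = p"
        using p x pow_eq_id[of x p] ord_eq_1[of x] prime_nat_iff[of p] by auto
      then have "x [^] k \<noteq> \<one>"
        using k False x pow_eq_id[of x k] by (auto dest: dvd_imp_le)
      have "(\<Sum>j<p. F ((y \<otimes> x [^] j) [^] k) v) = (\<Sum>j<p. F (y [^] k) (F ((x [^] k) [^] j) v))"
        using x y by (intro sum.cong) (simp_all add: pow_mult_distrib m_comm nat_pow_pow mult.commute[of k] flip: mult)
      also have "\<dots> = F (y [^] k) (\<Sum>j<p. F ((x [^] k) [^] j) v)"
        using y by (simp add: linear_sum[OF lin])
      also have "(\<Sum>j<p. F ((x [^] k) [^] j) v) = 0"
        using x \<open>x [^] k \<noteq> \<one>\<close> by (intro orbit_sum) (simp_all add: nat_pow_pow mult.commute[of k] flip: nat_pow_pow[of x p k])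
      finally show ?thesis using False y linear_0[OF lin] by simp
    qed
  qed simp
  also have "\<dots> = real p *\<^sub>R v" using p prime_gt_0_nat by (simp add: sum.delta)
  finally show False using nontrivial p prime_gt_0_nat by simp
qed

text \<open>Maps of the unit sphere that preserve inner products extend radially to linear maps.\<close>

definition radial_extension :: "('h::real_inner \<Rightarrow> 'h) \<Rightarrow> 'h \<Rightarrow> 'h" where
  "radial_extension f v = norm v *\<^sub>R f (sgn v)"

lemma inner_radial_extension:
  fixes f :: "'h::real_inner \<Rightarrow> 'h"
  assumes "\<And>x z. norm x = 1 \<Longrightarrow> norm z = 1 \<Longrightarrow> inner (f x) (f z) = inner x z"
  shows "inner (radial_extension f v) (radial_extension f w) = inner v w"
proof (cases "v = 0 \<or> w = 0")
  case True
  then show ?thesis by (auto simp: radial_extension_def)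
next
  case False
  then have "inner (f (sgn v)) (f (sgn w)) = inner (sgn v) (sgn w)"
    by (intro assms) (simp_all add: norm_sgn)
  then have "inner (radial_extension f v) (radial_extension f w) = inner (norm v *\<^sub>R sgn v) (norm w *\<^sub>R sgn w)"
    by (simp add: radial_extension_def)
  then show ?thesis using False by (simp add: sgn_div_norm)
qed

text \<open>
  The square of the norm of \<open>f (v + w) - f v - f w\<close> expands into inner products of arguments, where it vanishes.
\<close>

lemma inner_preserving_imp_linear:
  fixes f :: "'h::real_inner \<Rightarrow> 'k::real_inner"
  assumes pres: "\<And>v w. inner (f v) (f w) = inner v w"
  shows "linear f"
proof
  fix v w
  have "inner (f (v + w) - (f v + f w)) (f (v + w) - (f v + f w)) = 0"
    by (simp add: inner_diff_left inner_diff_right inner_add_left inner_add_right pres)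
  then show "f (v + w) = f v + f w" by simp
next
  fix r v
  have "inner (f (r *\<^sub>R v) - r *\<^sub>R f v) (f (r *\<^sub>R v) - r *\<^sub>R f v) = 0"
    by (simp add: inner_diff_left inner_diff_right pres)
  then show "f (r *\<^sub>R v) = r *\<^sub>R f v" by simp
qed

text \<open>
  Isometries do not decrease inner products. The same holds for their inverses, so they preserve inner
  products, and their radial extensions form a free linear action.
\<close>

lemma free_isometric_action_imp_rank_one:
  fixes G (structure)
  assumes "comm_group G" and act: "acts_freely_isometrically_pd_on_sphere G (UNIV :: 'h::{real_inner} set)"
    and nontrivial: "(v :: 'h) \<noteq> 0"
    and p: "prime (p::nat)" and x: "x \<in> carrier G" "x [^] p = \<one>" "x \<noteq> \<one>" and y: "y \<in> carrier G" "y [^] p = \<one>"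
  shows "\<exists>k::nat. y = x [^] k"
proof -
  interpret comm_group G by fact
  let ?S = "unit_sphere (UNIV :: 'h set)"
  obtain \<phi> where ga: "group_action G ?S \<phi>" and fr: "free_action G ?S \<phi>"
    and iso: "\<And>g. g \<in> carrier G \<Longrightarrow> riemannian_sphere_isometry UNIV (\<phi> g)"
    using act unfolding acts_freely_isometrically_pd_on_sphere_def by blast
  interpret group_action G ?S \<phi> by fact
  have S: "u \<in> ?S \<longleftrightarrow> norm u = 1" for u :: 'h by (simp add: unit_sphere_def)
  have \<phi>S: "norm (\<phi> g u) = 1" if "g \<in> carrier G" "norm u = 1" for g u
    using element_image that S by blast
  have pres: "inner (\<phi> g u) (\<phi> g w) = inner u w" if g: "g \<in> carrier G" and u: "norm u = 1" "norm w = 1" for g u w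
  proof (rule antisym)
    have "\<phi> (inv g) (\<phi> g u) = u" "\<phi> (inv g) (\<phi> g w) = w"
      using orbit_sym_aux[OF g] u S by auto
    then show "inner (\<phi> g u) (\<phi> g w) \<le> inner u w"
      using riemannian_sphere_isometry_inner_ge[OF iso[of "inv g"], of "\<phi> g u" "\<phi> g w"] \<phi>S[OF g] g u by simp
    show "inner u w \<le> inner (\<phi> g u) (\<phi> g w)"
      using riemannian_sphere_isometry_inner_ge[OF iso[OF g]] u by blast
  qed
  define F where "F g = radial_extension (\<phi> g)" for g
  have Fn: "norm (F g u) = norm u" if "g \<in> carrier G" for g u
    using inner_radial_extension[OF pres[OF that], of u u] by (simp add: F_def norm_eq_sqrt_inner)
  show ?thesis
  proof (rule free_linear_action_rank_one[where F = F, OF _ _ _ _ nontrivial p x y])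
    show "linear (F g)" if "g \<in> carrier G" for g
      unfolding F_def by (intro inner_preserving_imp_linear inner_radial_extension pres that)
    show "F \<one> u = u" for u
    proof (cases "u = 0")
      case False
      then have "\<phi> \<one> (sgn u) = sgn u"
        using S[of "sgn u"] id_eq_one by (metis norm_sgn restrict_apply')
      then show ?thesis using False by (simp add: F_def radial_extension_def sgn_div_norm)
    qed (simp add: F_def radial_extension_def)
    show "F (g \<otimes> h) u = F g (F h u)" if gh: "g \<in> carrier G" "h \<in> carrier G" for g h u
    proof (cases "u = 0")
      case False
      then have n: "norm (sgn u) = 1" by (simp add: norm_sgn)
      have "sgn (F h u) = \<phi> h (sgn u)"
        using False \<phi>S[OF gh(2) n] by (simp add: F_def radial_extension_def sgn_scaleR) (simp add: sgn_div_norm)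
      moreover have "\<phi> (g \<otimes> h) (sgn u) = \<phi> g (\<phi> h (sgn u))"
        using composition_rule gh n S by blast
      ultimately show ?thesis
        using Fn[OF gh(2), of u] by (simp add: F_def radial_extension_def[of "\<phi> g"] radial_extension_def[of "\<phi> (g \<otimes> h)"])
    qed (simp add: F_def radial_extension_def)
    show "u = 0" if g: "g \<in> carrier G" "F g u = u" "g \<noteq> \<one>" for g u
    proof (rule ccontr)
      assume u: "u \<noteq> 0"
      then have n: "sgn u \<in> ?S" by (simp add: S norm_sgn)
      have "norm u *\<^sub>R \<phi> g (sgn u) = norm u *\<^sub>R sgn u"
        using g(2) u by (simp add: F_def radial_extension_def sgn_div_norm)
      then have "g \<in> stabilizer G \<phi> (sgn u)" using u g by (simp add: stabilizer_def)
      then show False using fr n g(3) by (auto simp: free_action_def)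
    qed
  qed
qed

section \<open>Orthonormal families and isometries of Hilbert spaces\<close>

definition orthonormal :: "('i \<Rightarrow> 'h::real_inner) \<Rightarrow> 'i set \<Rightarrow> bool" where
  "orthonormal e I \<longleftrightarrow> (\<forall>i\<in>I. \<forall>j\<in>I. inner (e i) (e j) = (if i = j then 1 else 0))"

lemma orthonormal_inner: "orthonormal e I \<Longrightarrow> i \<in> I \<Longrightarrow> j \<in> I \<Longrightarrow> inner (e i) (e j) = (if i = j then 1 else 0)"
  by (auto simp: orthonormal_def)

lemma inner_orthonormal_sums:
  assumes "orthonormal e I" "finite F" "F \<subseteq> I"
  shows "inner (\<Sum>i\<in>F. c i *\<^sub>R e i) (\<Sum>i\<in>F. d i *\<^sub>R e i) = (\<Sum>i\<in>F. c i * d i)"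
proof -
  have "inner (\<Sum>i\<in>F. c i *\<^sub>R e i) (\<Sum>i\<in>F. d i *\<^sub>R e i) = (\<Sum>i\<in>F. \<Sum>j\<in>F. c i * (d j * inner (e i) (e j)))"
    by (simp only: inner_sum_left) (simp add: inner_sum_right mult.left_commute)
  also have "\<dots> = (\<Sum>i\<in>F. \<Sum>j\<in>F. if j = i then c i * d j else 0)"
    by (intro sum.cong refl) (auto simp: orthonormal_inner[OF assms(1)] subsetD[OF assms(3)])
  also have "\<dots> = (\<Sum>i\<in>F. c i * d i)" using assms(2) by (simp add: sum.delta)
  finally show ?thesis .
qed

lemma norm_orthonormal_sum:
  assumes "orthonormal e I" "finite F" "F \<subseteq> I"
  shows "(norm (\<Sum>i\<in>F. c i *\<^sub>R e i))\<^sup>2 = (\<Sum>i\<in>F. (c i)\<^sup>2)"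
  using inner_orthonormal_sums[OF assms, of c c] unfolding power2_norm_eq_inner by (simp add: power2_eq_square)

text \<open>
  Pythagoras' theorem for \<open>x\<close> and its orthogonal projection to the span of the \<open>e i\<close>.
\<close>

lemma bessel_finite:
  assumes "orthonormal e I" "finite F" "F \<subseteq> I"
  shows "(\<Sum>i\<in>F. (inner x (e i))\<^sup>2) \<le> (norm x)\<^sup>2"
proof -
  let ?p = "\<Sum>i\<in>F. inner x (e i) *\<^sub>R e i"
  have "inner x ?p = (\<Sum>i\<in>F. (inner x (e i))\<^sup>2)" by (simp add: inner_sum_right power2_eq_square)
  moreover have "inner ?p ?p = (\<Sum>i\<in>F. (inner x (e i))\<^sup>2)"
    using norm_orthonormal_sum[OF assms, of "\<lambda>i. inner x (e i)"] by (simp add: power2_norm_eq_inner)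
  moreover have "0 \<le> inner (x - ?p) (x - ?p)" by simp
  ultimately show ?thesis
    unfolding power2_norm_eq_inner by (simp add: inner_diff_left inner_diff_right inner_commute)
qed

lemma bessel_summable:
  assumes "orthonormal e I"
  shows "(\<lambda>i. (inner x (e i))\<^sup>2) summable_on I"
  using bessel_finite[OF assms, of _ x]
  by (intro nonneg_bdd_above_summable_on) (auto simp: bdd_above_def)

text \<open>
  By Pythagoras' theorem the partial sums form a Cauchy net, as those of the squared coefficients do.
\<close>

lemma orthonormal_summable:
  fixes e :: "'i \<Rightarrow> 'h::{real_inner, complete_space}"
  assumes e: "orthonormal e I" and c: "(\<lambda>i. (c i)\<^sup>2) summable_on I"
  shows "(\<lambda>i. c i *\<^sub>R e i) summable_on I"
proof -
  let ?f = "\<lambda>i. c i *\<^sub>R e i"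
  obtain s where s: "(sum (\<lambda>i. (c i)\<^sup>2) \<longlongrightarrow> s) (finite_subsets_at_top I)"
    using c unfolding summable_on_def has_sum_def by blast
  have "\<exists>P. eventually P (finite_subsets_at_top I) \<and> (\<forall>F1 F2. P F1 \<and> P F2 \<longrightarrow> dist (sum ?f F1) (sum ?f F2) < r)"
    if "r > 0" for r
  proof -
    let ?e = "(r / 2)\<^sup>2 / 2"
    have "?e > 0" using \<open>r > 0\<close> by simp
    then have "eventually (\<lambda>F. dist (\<Sum>i\<in>F. (c i)\<^sup>2) s < ?e) (finite_subsets_at_top I)"
      using s tendstoD by blast
    then obtain F0 where F0: "finite F0" "F0 \<subseteq> I"
      and F0': "\<forall>F. finite F \<and> F0 \<subseteq> F \<and> F \<subseteq> I \<longrightarrow> dist (\<Sum>i\<in>F. (c i)\<^sup>2) s < ?e"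
      unfolding eventually_finite_subsets_at_top by (elim exE conjE)
    have near: "dist (sum ?f F) (sum ?f F0) < r / 2" if F: "finite F" "F0 \<subseteq> F" "F \<subseteq> I" for F
    proof -
      have "sum ?f F - sum ?f F0 = sum ?f (F - F0)" using F by (simp add: sum_diff)
      then have "(norm (sum ?f F - sum ?f F0))\<^sup>2 = (\<Sum>i\<in>F - F0. (c i)\<^sup>2)"
        using norm_orthonormal_sum[OF e, of "F - F0" c] F by auto
      also have "\<dots> = (\<Sum>i\<in>F. (c i)\<^sup>2) - (\<Sum>i\<in>F0. (c i)\<^sup>2)" using F by (simp add: sum_diff)
      also have "\<dots> < ?e + ?e"
      proof -
        have "dist (\<Sum>i\<in>F. (c i)\<^sup>2) s < ?e" "dist (\<Sum>i\<in>F0. (c i)\<^sup>2) s < ?e"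
          using F0'[rule_format, OF conjI[OF F(1) conjI[OF F(2,3)]]]
            F0'[rule_format, OF conjI[OF F0(1) conjI[OF order_refl F0(2)]]] by blast+
        then show ?thesis unfolding dist_real_def by linarith
      qed
      also have "\<dots> = (r / 2)\<^sup>2" by simp
      finally have "norm (sum ?f F - sum ?f F0) < r / 2"
        by (rule power_less_imp_less_base) (use \<open>r > 0\<close> in simp)
      then show ?thesis unfolding dist_norm .
    qed
    show ?thesis
    proof (intro exI[of _ "\<lambda>F. finite F \<and> F0 \<subseteq> F \<and> F \<subseteq> I"] conjI allI impI)
      show "eventually (\<lambda>F. finite F \<and> F0 \<subseteq> F \<and> F \<subseteq> I) (finite_subsets_at_top I)"
        using F0 unfolding eventually_finite_subsets_at_top by blast
      fix F1 F2 assume "(finite F1 \<and> F0 \<subseteq> F1 \<and> F1 \<subseteq> I) \<and> (finite F2 \<and> F0 \<subseteq> F2 \<and> F2 \<subseteq> I)"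
      then have "dist (sum ?f F1) (sum ?f F0) < r / 2" "dist (sum ?f F2) (sum ?f F0) < r / 2" using near by auto
      then show "dist (sum ?f F1) (sum ?f F2) < r" by (rule dist_triangle_half_l)
    qed
  qed
  then have \<open>cauchy_filter (filtermap (sum ?f) (finite_subsets_at_top I))\<close>
    by (simp add: cauchy_filter_metric_filtermap)
  moreover have "complete (UNIV::'h set)"
    by (meson Cauchy_convergent UNIV_I complete_def convergent_def)
  ultimately obtain L' where \<open>(sum ?f \<longlongrightarrow> L') (finite_subsets_at_top I)\<close>
    using complete_uniform[where S=UNIV] by (force simp add: filterlim_def)
  then show ?thesis
    using summable_on_def has_sum_def by blast
qed

text \<open>
  The partial isometry that maps the basis vector \<open>e i\<close> to \<open>f i\<close> and annihilates the orthogonal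
  complement of all \<open>e i\<close>.
\<close>

definition basis_map :: "('i \<Rightarrow> 'h::real_inner) \<Rightarrow> ('i \<Rightarrow> 'h) \<Rightarrow> 'i set \<Rightarrow> 'h \<Rightarrow> 'h" where
  "basis_map e f I x = (\<Sum>\<^sub>\<infinity>i\<in>I. inner x (e i) *\<^sub>R f i)"

text \<open>
  Completeness of the family is expressed by the absence of nonzero vectors in \<open>H\<close> orthogonal to all of
  it; this avoids closures of spans.
\<close>

definition hilbert_basis :: "('i \<Rightarrow> 'h::real_inner) \<Rightarrow> 'i set \<Rightarrow> 'h set \<Rightarrow> bool" where
  "hilbert_basis e I H \<longleftrightarrow> orthonormal e I \<and> e ` I \<subseteq> H \<and> (\<forall>x\<in>H. (\<forall>i\<in>I. inner x (e i) = 0) \<longrightarrow> x = 0)"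

context
  fixes e f :: "'i \<Rightarrow> 'h::{real_inner, complete_space}" and I
  assumes e: "orthonormal e I" and f: "orthonormal f I"
begin

lemma basis_map_has_sum: "((\<lambda>i. inner x (e i) *\<^sub>R f i) has_sum basis_map e f I x) I"
  unfolding basis_map_def
  using orthonormal_summable[OF f bessel_summable[OF e]] by (rule has_sum_infsum)

lemma inner_basis_map_has_sum: "((\<lambda>i. inner x (e i) * inner (f i) y) has_sum inner (basis_map e f I x) y) I"
  using has_sum_bounded_linear[OF bounded_linear_inner_left[of y] basis_map_has_sum[of x]] by simp

lemma linear_basis_map: "linear (basis_map e f I)"
proof
  fix x y
  show "basis_map e f I (x + y) = basis_map e f I x + basis_map e f I y"
    using has_sum_add[OF basis_map_has_sum[of x] basis_map_has_sum[of y]] basis_map_has_sum[of "x + y"]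
    by (simp add: inner_add_left scaleR_add_left has_sum_unique)
next
  fix r x
  have "((\<lambda>i. r *\<^sub>R (inner x (e i) *\<^sub>R f i)) has_sum r *\<^sub>R basis_map e f I x) I"
    using has_sum_bounded_linear[OF bounded_linear_scaleR_right basis_map_has_sum] .
  then show "basis_map e f I (r *\<^sub>R x) = r *\<^sub>R basis_map e f I x"
    using basis_map_has_sum[of "r *\<^sub>R x"] by (simp add: has_sum_unique)
qed

lemma inner_basis_map:
  assumes "i \<in> I" shows "inner (basis_map e f I x) (f i) = inner x (e i)"
proof -
  have "((\<lambda>j. inner x (e j) * inner (f j) (f i)) has_sum inner x (e i)) I"
  proof (rule has_sum_finiteI[THEN has_sum_cong_neutral[THEN iffD1, rotated -1]])
    show "finite {i}" "inner x (e i) = (\<Sum>j\<in>{i}. inner x (e j))" by simp_all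
  qed (use assms f in \<open>auto simp: orthonormal_inner\<close>)
  then show ?thesis using inner_basis_map_has_sum has_sum_unique by blast
qed

lemma basis_map_in:
  assumes "subspace H" "closed H" "f ` I \<subseteq> H"
  shows "basis_map e f I x \<in> H"
proof -
  have "(sum (\<lambda>i. inner x (e i) *\<^sub>R f i) \<longlongrightarrow> basis_map e f I x) (finite_subsets_at_top I)"
    using basis_map_has_sum unfolding has_sum_def .
  moreover have "eventually (\<lambda>F. sum (\<lambda>i. inner x (e i) *\<^sub>R f i) F \<in> H) (finite_subsets_at_top I)"
    using eventually_finite_subsets_at_top_weakI
    by (rule eventually_mono) (use assms in \<open>auto intro!: subspace_sum subspace_scale\<close>)
  ultimately show ?thesis
    using Lim_in_closed_set[OF assms(2)] finite_subsets_at_top_neq_bot by blast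
qed

end

lemma hilbert_basis_expansion:
  fixes e :: "'i \<Rightarrow> 'h::{real_inner, complete_space}"
  assumes B: "hilbert_basis e I H" and H: "subspace H" "complete H" and x: "x \<in> H"
  shows "basis_map e e I x = x"
proof -
  have e: "orthonormal e I" "e ` I \<subseteq> H" using B by (auto simp: hilbert_basis_def)
  have "basis_map e e I x \<in> H"
    using basis_map_in[OF e(1) e(1) H(1) complete_imp_closed[OF H(2)] e(2)] .
  then have "x - basis_map e e I x \<in> H" using H(1) x by (simp add: subspace_diff)
  moreover have "inner (x - basis_map e e I x) (e i) = 0" if "i \<in> I" for i
    using inner_basis_map[OF e(1) e(1) that, of x] by (simp add: inner_diff_left)
  ultimately show ?thesis using B by (auto simp: hilbert_basis_def)
qed

lemma inner_basis_map_eq: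
  fixes e f :: "'i \<Rightarrow> 'h::{real_inner, complete_space}"
  assumes e: "orthonormal e I" and f: "orthonormal f I"
  shows "((\<lambda>i. inner x (e i) * inner y (e i)) has_sum inner (basis_map e f I x) (basis_map e f I y)) I"
  using inner_basis_map_has_sum[OF e f, of x "basis_map e f I y"]
  by (rule has_sum_cong[THEN iffD1, rotated]) (simp add: inner_basis_map[OF e f] inner_commute[of "f _"])

lemma basis_map_isometry:
  fixes e f :: "'i \<Rightarrow> 'h::{real_inner, complete_space}"
  assumes B: "hilbert_basis e I H" and H: "subspace H" "complete H" and f: "orthonormal f I"
    and x: "x \<in> H" "y \<in> H"
  shows "inner (basis_map e f I x) (basis_map e f I y) = inner x y"
proof -
  have e: "orthonormal e I" using B by (auto simp: hilbert_basis_def)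
  show ?thesis
    using has_sum_unique[OF inner_basis_map_eq[OF e f, of x y] inner_basis_map_eq[OF e e, of x y]]
    by (simp add: hilbert_basis_expansion[OF B H] x)
qed

lemma bounded_linear_basis_map:
  fixes e f :: "'i \<Rightarrow> 'h::{real_inner, complete_space}"
  assumes e: "orthonormal e I" and f: "orthonormal f I"
  shows "bounded_linear (basis_map e f I)"
proof -
  have "norm (basis_map e f I x) \<le> norm x" for x
  proof -
    have "(\<Sum>\<^sub>\<infinity>i\<in>I. (inner x (e i))\<^sup>2) \<le> (norm x)\<^sup>2"
      using bessel_finite[OF e] by (intro infsum_le_finite_sums bessel_summable[OF e])
    moreover have "(\<Sum>\<^sub>\<infinity>i\<in>I. (inner x (e i))\<^sup>2) = (norm (basis_map e f I x))\<^sup>2"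
      using infsumI[OF inner_basis_map_eq[OF e f, of x x]] unfolding power2_norm_eq_inner
      by (simp only: power2_eq_square)
    ultimately have "(norm (basis_map e f I x))\<^sup>2 \<le> (norm x)\<^sup>2" by (simp only:)
    then show ?thesis by (rule power2_le_imp_le) simp
  qed
  then have "\<exists>K. \<forall>x. norm (basis_map e f I x) \<le> norm x * K" by (intro exI[of _ 1]) simp
  with linear_basis_map[OF e f] show ?thesis
    unfolding bounded_linear_def bounded_linear_axioms_def by (rule conjI)
qed

lemma basis_map_basis:
  fixes e f :: "'i \<Rightarrow> 'h::{real_inner, complete_space}"
  assumes e: "orthonormal e I" and f: "orthonormal f I" and i: "i \<in> I"
  shows "basis_map e f I (e i) = f i"
proof -
  have "((\<lambda>j. inner (e i) (e j) *\<^sub>R f j) has_sum f i) I"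
  proof (rule has_sum_finiteI[THEN has_sum_cong_neutral[THEN iffD1, rotated -1]])
    show "finite {i}" "f i = (\<Sum>j\<in>{i}. f j)" by simp_all
  qed (use i e in \<open>auto simp: orthonormal_inner\<close>)
  then show ?thesis using basis_map_has_sum[OF e f] has_sum_unique by blast
qed

lemma bounded_linear_eq_on_basis:
  fixes e :: "'i \<Rightarrow> 'h::{real_inner, complete_space}" and S T :: "'h \<Rightarrow> 'k::real_normed_vector"
  assumes B: "hilbert_basis e I H" and H: "subspace H" "complete H"
    and S: "bounded_linear S" and T: "bounded_linear T" and eq: "\<And>i. i \<in> I \<Longrightarrow> S (e i) = T (e i)"
    and x: "x \<in> H"
  shows "S x = T x"
proof -
  have e: "orthonormal e I" using B by (auto simp: hilbert_basis_def)
  have "((\<lambda>i. L (inner x (e i) *\<^sub>R e i)) has_sum L x) I" if "bounded_linear L" for L :: "'h \<Rightarrow> 'k"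
    using has_sum_bounded_linear[OF that basis_map_has_sum[OF e e, of x]] hilbert_basis_expansion[OF B H x] by simp
  from this[OF S] this[OF T] show ?thesis
    by (simp add: linear_cmul[OF bounded_linear.linear[OF S]] linear_cmul[OF bounded_linear.linear[OF T]] eq has_sum_unique cong: has_sum_cong)
qed

text \<open>
  Zorn's lemma: a vector orthogonal to a maximal orthonormal set could be normalised and added to it.
\<close>

lemma orthonormal_basis_exists:
  assumes H: "subspace H"
  obtains B :: "'h::real_inner set" where "hilbert_basis (\<lambda>b. b) B H"
proof -
  let ?A = "{B. B \<subseteq> H \<and> orthonormal (\<lambda>b. b) B}"
  have "\<exists>M\<in>?A. \<forall>X\<in>?A. M \<subseteq> X \<longrightarrow> X = M"
  proof (rule subset_Zorn')
    fix C assume C: "subset.chain ?A C"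
    have "orthonormal (\<lambda>b. b) (\<Union>C)"
      unfolding orthonormal_def
    proof (intro ballI)
      fix b c assume "b \<in> \<Union>C" "c \<in> \<Union>C"
      then obtain X Y where "X \<in> C" "Y \<in> C" "b \<in> X" "c \<in> Y" by auto
      then obtain Z where "Z \<in> C" "b \<in> Z" "c \<in> Z"
      proof -
        have "X \<subseteq> Y \<or> Y \<subseteq> X" using C \<open>X \<in> C\<close> \<open>Y \<in> C\<close> unfolding subset_chain_def by blast
        then show ?thesis
          using that[of X] that[of Y] \<open>X \<in> C\<close> \<open>Y \<in> C\<close> \<open>b \<in> X\<close> \<open>c \<in> Y\<close> by blast
      qed
      then have "orthonormal (\<lambda>b. b) Z" using C unfolding subset_chain_def by blast
      then show "inner b c = (if b = c then 1 else 0)" using \<open>b \<in> Z\<close> \<open>c \<in> Z\<close> by (auto simp: orthonormal_def)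
    qed
    then show "\<Union>C \<in> ?A" using C unfolding subset_chain_def by blast
  qed
  then obtain B where B: "B \<subseteq> H" "orthonormal (\<lambda>b. b) B"
    and max: "\<And>X. X \<subseteq> H \<Longrightarrow> orthonormal (\<lambda>b. b) X \<Longrightarrow> B \<subseteq> X \<Longrightarrow> X = B" by auto
  have "x = 0" if x: "x \<in> H" "\<And>b. b \<in> B \<Longrightarrow> inner x b = 0" for x
  proof (rule ccontr)
    assume "x \<noteq> 0"
    then have "norm (sgn x) = 1" by (simp add: norm_sgn)
    then have 1: "inner (sgn x) (sgn x) = 1" by (simp only: norm_eq_1)
    have 0: "inner (sgn x) b = 0" "inner b (sgn x) = 0" if "b \<in> B" for b
      using x(2)[OF that] by (simp_all add: sgn_div_norm inner_commute)
    then have "sgn x \<notin> B" using 1 by force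
    then have "orthonormal (\<lambda>b. b) (insert (sgn x) B)"
      unfolding orthonormal_def using B(2) 0 1 by (auto simp: orthonormal_def)
    moreover have "sgn x \<in> H" using H x(1) by (simp add: sgn_div_norm subspace_scale)
    ultimately have "insert (sgn x) B = B" using B(1) by (intro max) auto
    then show False using \<open>sgn x \<notin> B\<close> by blast
  qed
  then have "hilbert_basis (\<lambda>b. b) B H" using B by (auto simp: hilbert_basis_def)
  with that show ?thesis .
qed

section \<open>Construction of free orthogonal actions\<close>

text \<open>
  The last axiom is a quantitative form of the discreteness of orbits. The constant \<open>1\<close> is less than
  \<open>sqrt 2\<close>, the distance of orthogonal unit vectors.
\<close>

locale free_orthogonal_action = group G for G :: "('g, 'b) monoid_scheme" (structure) +
  fixes T :: "'g \<Rightarrow> 'h::real_inner \<Rightarrow> 'h" and H :: "'h set"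
  assumes bounded_linear_T: "g \<in> carrier G \<Longrightarrow> bounded_linear (T g)"
    and T_in: "g \<in> carrier G \<Longrightarrow> x \<in> H \<Longrightarrow> T g x \<in> H"
    and inner_T: "g \<in> carrier G \<Longrightarrow> x \<in> H \<Longrightarrow> y \<in> H \<Longrightarrow> inner (T g x) (T g y) = inner x y"
    and T_one: "x \<in> H \<Longrightarrow> T \<one> x = x"
    and T_mult: "g \<in> carrier G \<Longrightarrow> h \<in> carrier G \<Longrightarrow> x \<in> H \<Longrightarrow> T (g \<otimes> h) x = T g (T h x)"
    and T_free: "g \<in> carrier G \<Longrightarrow> x \<in> H \<Longrightarrow> x \<noteq> 0 \<Longrightarrow> T g x = x \<Longrightarrow> g = \<one>"
    and finite_near: "x \<in> H \<Longrightarrow> y \<in> H \<Longrightarrow> norm x = 1 \<Longrightarrow> norm y = 1 \<Longrightarrow>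
           finite {g \<in> carrier G. dist (T g x) y < 1}"

lemma infinite_hilbert_basis:
  fixes H :: "'h::{real_inner, complete_space} set"
  assumes "infinite_dim_hilbert H" "hilbert_basis (\<lambda>b. b) B H"
  shows "infinite B"
proof
  assume fin: "finite B"
  have H: "subspace H" "complete H" using assms(1) by (auto simp: infinite_dim_hilbert_def)
  have B: "orthonormal (\<lambda>b. b) B" "B \<subseteq> H" using assms(2) by (auto simp: hilbert_basis_def)
  have "x \<in> span B" if "x \<in> H" for x
  proof -
    have "x = (\<Sum>b\<in>B. inner x b *\<^sub>R b)"
      using hilbert_basis_expansion[OF assms(2) H that] fin by (simp add: basis_map_def)
    then show ?thesis by (metis (no_types, lifting) span_base span_scale span_sum)
  qed
  moreover have "span B \<subseteq> H" using B H by (simp add: span_minimal)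
  ultimately have "span B = H" by blast
  with assms(1) fin B(2) show False by (auto simp: infinite_dim_hilbert_def)
qed

text \<open>
  Infinite cardinals absorb countable factors, so an orthonormal basis of \<open>H\<close> can be indexed by
  any countable nonempty set of copies of one set of pairs; the pairs will be complexified.
\<close>

lemma hilbert_basis_indexed_by_product:
  fixes H :: "'h::{real_inner, complete_space} set" and Q :: "'q set"
  assumes H: "infinite_dim_hilbert H" and Q: "countable Q" "Q \<noteq> {}"
  obtains B :: "'h set" and e :: "'h \<times> 'q \<times> bool \<Rightarrow> 'h" where "hilbert_basis e (B \<times> Q \<times> UNIV) H"
proof -
  include cardinal_syntax
  obtain B where B: "hilbert_basis (\<lambda>b. b) B H"
    using orthonormal_basis_exists[of H] H by (auto simp: infinite_dim_hilbert_def)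
  have inf: "infinite B" using infinite_hilbert_basis[OF H B] .
  let ?Q = "Q \<times> (UNIV :: bool set)"
  have "|?Q| \<le>o |UNIV :: nat set|"
  proof -
    have "countable ?Q" using Q by simp
    then obtain f :: "'q \<times> bool \<Rightarrow> nat" where "inj_on f ?Q" by (auto simp: countable_def)
    then show ?thesis using card_of_ordLeq[of ?Q "UNIV :: nat set"] by blast
  qed
  also have "|UNIV :: nat set| \<le>o |B|" using inf infinite_iff_card_of_nat by blast
  finally have "|B \<times> ?Q| =o |B|"
    using inf Q(2) by (intro card_of_Times_infinite_simps) auto
  then obtain e where e: "bij_betw e (B \<times> ?Q) B" using card_of_ordIso by blast
  have "hilbert_basis e (B \<times> ?Q) H"
    unfolding hilbert_basis_def
  proof (intro conjI ballI impI)
    have eB: "e i \<in> B" if "i \<in> B \<times> ?Q" for i using e that by (auto simp: bij_betw_def)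
    show "orthonormal e (B \<times> ?Q)"
      unfolding orthonormal_def
    proof (intro ballI)
      fix i j assume ij: "i \<in> B \<times> ?Q" "j \<in> B \<times> ?Q"
      then have "inner (e i) (e j) = (if e i = e j then 1 else 0)"
        using B eB[OF ij(1)] eB[OF ij(2)] unfolding hilbert_basis_def by (auto simp: orthonormal_def)
      moreover have "e i = e j \<longleftrightarrow> i = j"
        using e ij inj_on_eq_iff unfolding bij_betw_def by metis
      ultimately show "inner (e i) (e j) = (if i = j then 1 else 0)" by simp
    qed
    show "e ` (B \<times> ?Q) \<subseteq> H" using eB B by (auto simp: hilbert_basis_def)
    fix x assume x: "x \<in> H" "\<forall>i\<in>B \<times> ?Q. inner x (e i) = 0"
    have "inner x b = 0" if "b \<in> B" for b
    proof -
      have "b \<in> e ` (B \<times> ?Q)" using e that by (simp add: bij_betw_def)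
      then show ?thesis using x(2) by blast
    qed
    then show "x = 0" using B x(1) by (auto simp: hilbert_basis_def)
  qed
  with that show ?thesis .
qed

text \<open>
  An orthonormal pair \<open>u\<close> is regarded as the real basis \<open>1, \<i>\<close> of a complex line; this is the vector
  of that line with complex coordinate \<open>z\<close>.
\<close>

definition complex_combination :: "(bool \<Rightarrow> 'h::real_vector) \<Rightarrow> complex \<Rightarrow> 'h" where
  "complex_combination u z = Re z *\<^sub>R u False + Im z *\<^sub>R u True"

context comm_group
begin

lemma finite_coset_transporter:
  assumes fin: "finite torsion_set" and C: "C = a <# torsion_set" "a \<in> carrier G" and D: "D = b <# torsion_set"
  shows "finite {g \<in> carrier G. g <# C = D}"
proof (rule finite_subset)
  have one: "\<one> \<in> torsion_set" using subgroup_torsion_set subgroup.one_closed by blast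
  show "{g \<in> carrier G. g <# C = D} \<subseteq> (\<lambda>d. d \<otimes> inv a) ` D"
  proof clarify
    fix g assume g: "g \<in> carrier G" "D = g <# C"
    have "a \<in> C" unfolding C l_coset_def using one C(2) by force
    then have "g \<otimes> a \<in> D" using g by (auto simp: l_coset_def)
    moreover have "g = (g \<otimes> a) \<otimes> inv a" using g C by (simp add: m_assoc)
    ultimately show "g \<in> (\<lambda>d. d \<otimes> inv a) ` (g <# C)" using g(2) by blast
  qed
  show "finite ((\<lambda>d. d \<otimes> inv a) ` D)" using fin by (simp add: D l_coset_def)
qed

text \<open>
  \<open>G\<close> permutes the copies of a Hilbert space that are indexed by the cosets of its torsion
  subgroup, and acts in each copy through a character that is injective on the torsion subgroup.
  An element of infinite order has powers that move any finite set of copies off itself, so it fixes no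
  nonzero vector; torsion elements preserve the copies and rotate all vectors by a nonzero angle.
\<close>

theorem free_orthogonal_action_exists:
  fixes H :: "'h::{real_inner, complete_space} set"
  assumes fg: "finitely_generated_group G" and tors: "torsion_sum_of_distinct_prime_powers G"
    and H: "infinite_dim_hilbert H"
  obtains T where "free_orthogonal_action G T H"
proof -
  have sH: "subspace H" "complete H" using H by (auto simp: infinite_dim_hilbert_def)
  have tc: "torsion_set \<subseteq> carrier G" by (auto simp: torsion_set_def)
  have one: "\<one> \<in> torsion_set" using subgroup_torsion_set subgroup.one_closed by blast
  obtain \<psi>0 where \<psi>0: "unitary_character G torsion_set \<psi>0" "\<And>x. x \<in> torsion_set \<Longrightarrow> \<psi>0 x = 1 \<Longrightarrow> x = \<one>"
    using distinct_prime_powers_imp_faithful_character[OF tors] by blast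
  obtain \<psi> where \<psi>: "unitary_character G (carrier G) \<psi>" "\<And>x. x \<in> torsion_set \<Longrightarrow> \<psi> x = \<psi>0 x"
    using unitary_character_extension[OF fg subgroup_torsion_set \<psi>0(1)] by blast
  have \<psi>n: "norm (\<psi> g) = 1" if "g \<in> carrier G" for g using \<psi>(1) that by (auto simp: unitary_character_def)
  have \<psi>m: "\<psi> (g \<otimes> h) = \<psi> g * \<psi> h" if "g \<in> carrier G" "h \<in> carrier G" for g h
    using \<psi>(1) that by (auto simp: unitary_character_def)
  have \<psi>1: "\<psi> \<one> = 1" using \<psi>m[of \<one> \<one>] \<psi>n[of \<one>] by auto
  have \<psi>faith: "x = \<one>" if "x \<in> torsion_set" "\<psi> x = 1" for x using \<psi>0(2) \<psi>(2) that by simp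
  define Q where "Q = (\<lambda>a. a <# torsion_set) ` carrier G"
  have Q: "countable Q" "Q \<noteq> {}"
    using countable_if_finitely_generated[OF fg] by (auto simp: Q_def)
  have QG: "C \<subseteq> carrier G" if "C \<in> Q" for C using that tc by (auto simp: Q_def l_coset_def)
  have gQ: "g <# C \<in> Q" if "g \<in> carrier G" "C \<in> Q" for g C
    using that tc by (auto simp: Q_def lcos_m_assoc)
  have Qinj: "C = D" if "g \<in> carrier G" "C \<in> Q" "D \<in> Q" "g <# C = g <# D" for g C D
  proof -
    have "inv g <# (g <# C) = C" if "C \<in> Q" for C
      using \<open>g \<in> carrier G\<close> QG[OF that] by (simp add: lcos_m_assoc lcos_mult_one)
    then show ?thesis using that by metis
  qed
  obtain B and e :: "'h \<times> 'a set \<times> bool \<Rightarrow> 'h" where B: "hilbert_basis e (B \<times> Q \<times> UNIV) H"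
    using hilbert_basis_indexed_by_product[OF H Q] .
  let ?I = "B \<times> Q \<times> (UNIV :: bool set)"
  have oe: "orthonormal e ?I" and eH: "\<And>i. i \<in> ?I \<Longrightarrow> e i \<in> H"
    and eB: "\<And>x. x \<in> H \<Longrightarrow> (\<And>i. i \<in> ?I \<Longrightarrow> inner x (e i) = 0) \<Longrightarrow> x = 0"
    using B by (auto simp: hilbert_basis_def)
  define E where "E b C = complex_combination (\<lambda>j. e (b, C, j))" for b C
  define unit where "unit j = (if j then \<i> else 1)" for j
  have e_E: "e (b, C, j) = E b C (unit j)" for b C j
    by (cases j) (simp_all add: E_def complex_combination_def unit_def)
  have inner_E: "inner (E b C z) (E b' C' w) = (if b = b' \<and> C = C' then Re (z * cnj w) else 0)"
    if "b \<in> B" "b' \<in> B" "C \<in> Q" "C' \<in> Q" for b b' C C' z w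
    using that oe by (auto simp: E_def complex_combination_def inner_add_left inner_add_right orthonormal_def)
  have E_H: "E b C z \<in> H" if "b \<in> B" "C \<in> Q" for b C z
    unfolding E_def complex_combination_def using that eH sH by (simp add: subspace_add subspace_scale)
  \<comment> \<open>The image of the basis under \<open>g\<close>: the coset is translated and the complex coordinate multiplied by the character.\<close>
  define f where "f g = (\<lambda>(b, C, j). E b (g <# C) (\<psi> g * unit j))" for g
  have of: "orthonormal (f g) ?I" if g: "g \<in> carrier G" for g
    unfolding orthonormal_def
  proof (intro ballI)
    fix i j assume "i \<in> ?I" "j \<in> ?I"
    then obtain b C k b' C' k' where ij: "i = (b, C, k)" "j = (b', C', k')" "b \<in> B" "b' \<in> B" "C \<in> Q" "C' \<in> Q" by auto
    have "(\<psi> g * unit k) * cnj (\<psi> g * unit k') = (\<psi> g * cnj (\<psi> g)) * (unit k * cnj (unit k'))"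
      by (simp add: algebra_simps)
    also have "\<psi> g * cnj (\<psi> g) = 1" using \<psi>n[OF g] by (simp add: complex_norm_square[symmetric])
    finally have "Re ((\<psi> g * unit k) * cnj (\<psi> g * unit k')) = (if k = k' then 1 else 0)"
      by (cases k; cases k') (simp_all add: unit_def)
    moreover have "inner (f g i) (f g j)
        = (if b = b' \<and> g <# C = g <# C' then Re ((\<psi> g * unit k) * cnj (\<psi> g * unit k')) else 0)"
      unfolding ij f_def prod.case using ij g gQ by (intro inner_E) auto
    moreover have "g <# C = g <# C' \<longleftrightarrow> C = C'" using Qinj[OF g ij(5,6)] by auto
    ultimately have "inner (f g i) (f g j) = (if b = b' \<and> C = C' then if k = k' then 1 else 0 else 0)"
      by (simp only:)
    then show "inner (f g i) (f g j) = (if i = j then 1 else 0)" using ij(1,2) by simp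
  qed
  have fH: "f g ` ?I \<subseteq> H" if "g \<in> carrier G" for g using that E_H gQ by (auto simp: f_def)
  define T where "T g = basis_map e (f g) ?I" for g
  have bl: "bounded_linear (T g)" if "g \<in> carrier G" for g
    unfolding T_def by (rule bounded_linear_basis_map[OF oe of[OF that]])
  have TH: "T g x \<in> H" if "g \<in> carrier G" for g x
    unfolding T_def by (rule basis_map_in[OF oe of[OF that] sH(1) complete_imp_closed[OF sH(2)] fH[OF that]])
  have iT: "inner (T g x) (T g y) = inner x y" if "g \<in> carrier G" "x \<in> H" "y \<in> H" for g x y
    unfolding T_def by (rule basis_map_isometry[OF B sH of[OF that(1)] that(2,3)])
  have Te: "T g (e i) = f g i" if "g \<in> carrier G" "i \<in> ?I" for g i
    unfolding T_def by (rule basis_map_basis[OF oe of[OF that(1)] that(2)])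
  have TE: "T g (E b C z) = E b (g <# C) (\<psi> g * z)" if g: "g \<in> carrier G" and "b \<in> B" "C \<in> Q" for g b C z
  proof -
    have "T g (E b C z) = Re z *\<^sub>R f g (b, C, False) + Im z *\<^sub>R f g (b, C, True)"
      unfolding E_def complex_combination_def using that Te
      by (simp add: linear_add[OF bounded_linear.linear[OF bl]] linear_scale[OF bounded_linear.linear[OF bl]])
    also have "\<dots> = E b (g <# C) (\<psi> g * z)"
      by (simp add: f_def unit_def E_def complex_combination_def algebra_simps)
    finally show ?thesis .
  qed
  have T1: "T \<one> x = x" if "x \<in> H" for x
  proof (rule bounded_linear_eq_on_basis[OF B sH bl bounded_linear_ident _ that])
    fix i assume "i \<in> ?I"
    then show "T \<one> (e i) = e i"
      using Te[of \<one> i] QG by (auto simp: f_def \<psi>1 e_E lcos_mult_one)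
  qed simp
  have Tm: "T (g \<otimes> h) x = T g (T h x)" if gh: "g \<in> carrier G" "h \<in> carrier G" and x: "x \<in> H" for g h x
  proof (rule bounded_linear_eq_on_basis[OF B sH bl bounded_linear_compose[OF bl bl] _ x])
    fix i assume "i \<in> ?I"
    then obtain b C k where i: "i = (b, C, k)" "b \<in> B" "C \<in> Q" by auto
    then show "T (g \<otimes> h) (e i) = T g (T h (e i))"
      using gh gQ QG by (simp add: e_E TE \<psi>m lcos_m_assoc mult.assoc)
  qed (use gh in auto)
  have approx: "\<exists>F c. finite F \<and> F \<subseteq> ?I \<and> norm (x - (\<Sum>i\<in>F. c i *\<^sub>R e i)) \<le> 1 / 8" if x: "x \<in> H" for x
  proof -
    have "((\<lambda>i. inner x (e i) *\<^sub>R e i) has_sum x) ?I"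
      using basis_map_has_sum[OF oe oe, of x] by (simp add: hilbert_basis_expansion[OF B sH x])
    from has_sum_finite_approximation[OF this, of "1/8"] obtain F where
      "finite F" "F \<subseteq> ?I" "dist (\<Sum>i\<in>F. inner x (e i) *\<^sub>R e i) x \<le> 1 / 8" by auto
    then show ?thesis
      by (intro exI[of _ F] exI[of _ "\<lambda>i. inner x (e i)"]) (simp add: dist_norm norm_minus_commute)
  qed
  \<comment> \<open>Up to a small error both vectors live on finitely many cosets. If \<open>g\<close> carries none of the cosets of \<open>x\<close> to one of \<open>y\<close>, then \<open>T g x\<close> and \<open>y\<close> are almost orthogonal and their distance is about \<open>sqrt 2\<close>.\<close>
  have near: "finite {g \<in> carrier G. dist (T g x) y < 1}" if x: "x \<in> H" "norm x = 1" and y: "y \<in> H" "norm y = 1" for x y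
  proof -
    obtain F c where F: "finite F" "F \<subseteq> ?I" "norm (x - (\<Sum>i\<in>F. c i *\<^sub>R e i)) \<le> 1 / 8"
      using approx[OF x(1)] by blast
    obtain F' c' where F': "finite F'" "F' \<subseteq> ?I" "norm (y - (\<Sum>i\<in>F'. c' i *\<^sub>R e i)) \<le> 1 / 8"
      using approx[OF y(1)] by blast
    define x0 where "x0 = (\<Sum>i\<in>F. c i *\<^sub>R e i)"
    define y0 where "y0 = (\<Sum>i\<in>F'. c' i *\<^sub>R e i)"
    have x0H: "x0 \<in> H" unfolding x0_def using F eH sH by (intro subspace_sum subspace_scale) auto
    have "{g \<in> carrier G. dist (T g x) y < 1} \<subseteq>
      (\<Union>i\<in>F. \<Union>j\<in>F'. {g \<in> carrier G. g <# fst (snd i) = fst (snd j)})"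
    proof (rule ccontr)
      assume "\<not> ?thesis"
      then obtain g where g: "g \<in> carrier G" "dist (T g x) y < 1"
        and ne: "\<And>i j. i \<in> F \<Longrightarrow> j \<in> F' \<Longrightarrow> g <# fst (snd i) \<noteq> fst (snd j)" by blast
      have "T g x0 = (\<Sum>i\<in>F. c i *\<^sub>R f g i)"
      proof -
        have "T g x0 = (\<Sum>i\<in>F. c i *\<^sub>R T g (e i))"
          unfolding x0_def using g(1)
          by (simp add: linear_sum[OF bounded_linear.linear[OF bl]] linear_scale[OF bounded_linear.linear[OF bl]])
        also have "\<dots> = (\<Sum>i\<in>F. c i *\<^sub>R f g i)"
          by (intro sum.cong refl arg_cong2[where f = scaleR] Te[OF g(1) subsetD[OF F(2)]])
        finally show ?thesis .
      qed
      moreover have "inner (f g i) (e j) = 0" if mem: "i \<in> F" "j \<in> F'" for i j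
      proof -
        obtain b C k b' D k' where ij: "i = (b, C, k)" "j = (b', D, k')" "b \<in> B" "b' \<in> B" "C \<in> Q" "D \<in> Q"
          using subsetD[OF F(2) mem(1)] subsetD[OF F'(2) mem(2)] by auto
        have "g <# C \<noteq> D" using ne[OF mem] ij by simp
        then show ?thesis
          unfolding ij f_def prod.case e_E by (subst inner_E) (use ij g(1) gQ in auto)
      qed
      ultimately have orth: "inner (T g x0) y0 = 0"
        by (simp add: y0_def inner_sum_left inner_sum_right)
      have nT: "norm (T g z) = norm z" if "z \<in> H" for z
        using iT[OF g(1) that that] by (simp add: norm_eq_sqrt_inner)
      have "inner (T g x) y = inner (T g (x - x0)) y + inner (T g x0) (y - y0)"
        using orth by (simp add: linear_diff[OF bounded_linear.linear[OF bl[OF g(1)]]] inner_diff_left inner_diff_right)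
      also have "\<dots> \<le> norm (T g (x - x0)) * norm y + norm (T g x0) * norm (y - y0)"
        by (intro add_mono norm_cauchy_schwarz)
      also have "\<dots> = norm (x - x0) * norm y + norm x0 * norm (y - y0)"
        using nT x x0H sH by (simp add: subspace_diff)
      also have "\<dots> \<le> 1 / 8 * 1 + 2 * (1 / 8)"
      proof (intro add_mono mult_mono)
        have "norm x0 \<le> norm x + norm (x - x0)" by (metis norm_triangle_sub norm_minus_commute add.commute)
        then show "norm x0 \<le> 2" using F(3) x(2) by (simp add: x0_def)
      qed (use F F' y in \<open>auto simp: x0_def y0_def\<close>)
      finally have small: "inner (T g x) y \<le> 3 / 8" by simp
      have "(dist (T g x) y)\<^sup>2 = inner (T g x - y) (T g x - y)"
        by (simp add: dist_norm power2_norm_eq_inner)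
      also have "\<dots> = inner (T g x) (T g x) + inner y y - 2 * inner (T g x) y"
        by (simp add: inner_diff_left inner_diff_right inner_commute)
      also have "\<dots> \<ge> 2 - 2 * (3 / 8)"
        using small nT[OF x(1)] x(2) y(2) by (simp add: norm_eq_1)
      finally have "(dist (T g x) y)\<^sup>2 > 1\<^sup>2" by simp
      then have "dist (T g x) y > 1" by (rule power_less_imp_less_base) simp
      with g(2) show False by simp
    qed
    moreover have "finite {g \<in> carrier G. g <# fst (snd i) = fst (snd j)}" if "i \<in> F" "j \<in> F'" for i j
    proof -
      have "fst (snd i) \<in> Q" "fst (snd j) \<in> Q" using F(2) F'(2) that by auto
      then obtain a b where "a \<in> carrier G" "fst (snd i) = a <# torsion_set" "fst (snd j) = b <# torsion_set"
        by (auto simp: Q_def)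
      then show ?thesis using finite_coset_transporter[OF finite_torsion_set[OF fg]] by blast
    qed
    ultimately show ?thesis using F(1) F'(1) by (elim finite_subset) auto
  qed
  have free: "g = \<one>" if g: "g \<in> carrier G" and x: "x \<in> H" "x \<noteq> 0" and fx: "T g x = x" for g x
  proof (cases "g \<in> torsion_set")
    case True
    show ?thesis
    proof (rule ccontr)
      assume "g \<noteq> \<one>"
      then have \<psi>g: "\<psi> g \<noteq> 1" "\<psi> g \<noteq> 0" using \<psi>faith[OF True] \<psi>n[OF g] by auto
      have gC: "g <# C = C" if "C \<in> Q" for C
      proof -
        obtain a where a: "a \<in> carrier G" "C = a <# torsion_set" using \<open>C \<in> Q\<close> by (auto simp: Q_def)
        have "g <# C = (a \<otimes> g) <# torsion_set" using a g tc by (simp add: lcos_m_assoc m_comm)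
        also have "\<dots> = a <# (g <# torsion_set)" using a g tc by (simp add: lcos_m_assoc)
        also have "g <# torsion_set = torsion_set"
          using subgroup_torsion_set True g by (simp add: coset_join3)
        finally show ?thesis using a by simp
      qed
      have inv: "inner x (E b C z) = inner x (E b C (\<psi> g * z))" if "b \<in> B" "C \<in> Q" for b C z
        using iT[OF g x(1) E_H[OF that, of z]] fx TE[OF g that, of z] gC[OF that(2)] by simp
      have "inner x (E b C w) = 0" if bC: "b \<in> B" "C \<in> Q" for b C w
      proof -
        \<comment> \<open>\<open>x\<close> is orthogonal to all vectors \<open>T g v - v\<close>, and these exhaust each line since \<open>\<psi> g \<noteq> 1\<close>.\<close>
        define z where "z = w / (\<psi> g - 1)"
        have "(\<psi> g - 1) * z = w" using \<psi>g by (simp add: z_def)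
        then have w: "w = \<psi> g * z - z" by (simp add: left_diff_distrib)
        have "E b C w = E b C (\<psi> g * z) - E b C z"
          unfolding w by (simp add: E_def complex_combination_def algebra_simps)
        then show ?thesis using inv[OF bC, of z] by (simp add: inner_diff_right)
      qed
      then have "x = 0" using x(1) by (intro eB) (auto simp: e_E)
      with x(2) show False by simp
    qed
  next
    case False
    let ?x = "sgn x"
    have xs: "?x \<in> H" "norm ?x = 1" using x sH by (simp_all add: sgn_div_norm subspace_scale)
    have "T g ?x = ?x"
      using fx by (simp add: sgn_div_norm linear_scale[OF bounded_linear.linear[OF bl[OF g]]])
    then have pw: "T (g [^] n) ?x = ?x" for n :: nat
    proof (induction n)
      case 0
      then show ?case using T1[OF xs(1)] by simp
    next
      case (Suc n)
      then show ?case using Tm[of "g [^] n" g ?x] g xs(1) by simp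
    qed
    have "inj (\<lambda>n::nat. g [^] n)"
    proof (rule injI)
      fix m n :: nat assume "g [^] m = g [^] n"
      then have "g [^] int m = g [^] int n" unfolding int_pow_int .
      then have "int (ord g) dvd int n - int m" unfolding int_pow_eq[OF g] .
      moreover have "ord g = 0" using ord_pos_iff_torsion[of g] False g by simp
      ultimately show "m = n" by simp
    qed
    then have "infinite (range (\<lambda>n::nat. g [^] n))" by (simp add: range_inj_infinite)
    moreover have "range (\<lambda>n::nat. g [^] n) \<subseteq> {h \<in> carrier G. dist (T h ?x) ?x < 1}"
      using g pw by auto
    ultimately show ?thesis using near[OF xs xs] finite_subset by blast
  qed
  have "free_orthogonal_action G T H"
    by (intro free_orthogonal_action.intro free_orthogonal_action_axioms.intro is_group)
       (assumption | rule bl TH iT T1 Tm free near)+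
  with that show ?thesis .
qed

end

section \<open>A calculus of smooth maps\<close>

text \<open>
  A field of \<open>k\<close>-linear forms has a field of \<open>(k + 1)\<close>-linear forms as its derivative, with the new direction
  as the first argument and the error uniform in the other ones, as in the definition of \<open>smooth_on\<close>.
\<close>

definition form_derivative ::
    "'a::real_normed_vector set \<Rightarrow> nat \<Rightarrow> ('a \<Rightarrow> 'a list \<Rightarrow> 'b::real_normed_vector) \<Rightarrow> ('a \<Rightarrow> 'a list \<Rightarrow> 'b) \<Rightarrow> bool" where
  "form_derivative S k T T' \<longleftrightarrow> (\<forall>x\<in>S. \<forall>e>0. \<exists>d>0. \<forall>y\<in>S. norm (y - x) < d \<longrightarrow>
     (\<forall>vs. length vs = k \<longrightarrow> norm (T y vs - T x vs - T' x ((y - x) # vs)) \<le> e * norm (y - x) * prod_list (map norm vs)))"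

text \<open>
  Smoothness by coinduction: it suffices to exhibit a class of fields of multilinear forms that
  contains the map and is closed under differentiation.
\<close>

lemma smooth_on_coinduct:
  assumes S: "open S" and P0: "P 0 T0" and f: "\<And>x. x \<in> S \<Longrightarrow> T0 x [] = f x"
    and step: "\<And>k T. P k T \<Longrightarrow> (\<forall>x\<in>S. bounded_multilinear k (T x)) \<and> (\<exists>T'. P (Suc k) T' \<and> form_derivative S k T T')"
  shows "smooth_on S f"
proof -
  have "\<exists>D. \<forall>k. (P k (D k) \<and> (k = 0 \<longrightarrow> D k = T0)) \<and> form_derivative S k (D k) (D (Suc k))"
  proof (rule dependent_nat_choice[where P = "\<lambda>k T. P k T \<and> (k = 0 \<longrightarrow> T = T0)" and Q = "\<lambda>k T T'. form_derivative S k T T'"])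
    show "\<exists>T. P 0 T \<and> (0 = (0::nat) \<longrightarrow> T = T0)" using P0 by blast
    fix T k assume "P k T \<and> (k = 0 \<longrightarrow> T = T0)"
    then obtain T' where "P (Suc k) T'" "form_derivative S k T T'" using step by blast
    then show "\<exists>T'. (P (Suc k) T' \<and> (Suc k = 0 \<longrightarrow> T' = T0)) \<and> form_derivative S k T T'" by auto
  qed
  then obtain D where "\<forall>k. (P k (D k) \<and> (k = 0 \<longrightarrow> D k = T0)) \<and> form_derivative S k (D k) (D (Suc k))" ..
  then have D: "\<forall>k. P k (D k) \<and> (k = 0 \<longrightarrow> D k = T0)" "\<forall>k. form_derivative S k (D k) (D (Suc k))"
    by simp_all
  show ?thesis
    unfolding smooth_on_def
  proof (intro conjI S exI[of _ D] ballI allI impI)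
    fix x assume "x \<in> S" then show "D 0 x [] = f x" using D(1) f by simp
  next
    fix k x assume "x \<in> S" then show "bounded_multilinear k (D k x)" using D(1) step by blast
  next
    fix k x and e :: real assume x: "x \<in> S" "e > 0"
    show "\<exists>d>0. \<forall>y\<in>S. norm (y - x) < d \<longrightarrow> (\<forall>vs. length vs = k \<longrightarrow>
       norm (D k y vs - D k x vs - D (Suc k) x ((y - x) # vs)) \<le> e * norm (y - x) * prod_list (map norm vs))"
      using D(2)[unfolded form_derivative_def, rule_format, OF x] by blast
  qed
qed

lemma prod_list_norm_nonneg [simp]: "0 \<le> prod_list (map norm vs)"
  by (induction vs) simp_all

lemma prod_list_norm_nths:
  "prod_list (map norm (nths vs I)) * prod_list (map norm (nths vs (- I))) = prod_list (map norm vs)"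
proof (induction vs arbitrary: I)
  case (Cons v vs)
  have "{j. Suc j \<in> - I} = - {j. Suc j \<in> I}" by auto
  then show ?case using Cons[of "{j. Suc j \<in> I}"] by (auto simp: nths_Cons algebra_simps)
qed simp

lemma nths_insert_0_Suc: "nths (v # vs) (insert 0 (Suc ` I)) = v # nths vs I"
  "nths (v # vs) (- insert 0 (Suc ` I)) = nths vs (- I)"
proof -
  have "{j. Suc j \<in> insert 0 (Suc ` I)} = I" "{j. Suc j \<in> - insert 0 (Suc ` I)} = - I" by auto
  then show "nths (v # vs) (insert 0 (Suc ` I)) = v # nths vs I"
    "nths (v # vs) (- insert 0 (Suc ` I)) = nths vs (- I)" by (simp_all add: nths_Cons)
qed

lemma nths_Suc: "nths (v # vs) (Suc ` I) = nths vs I" "nths (v # vs) (- (Suc ` I)) = v # nths vs (- I)"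
proof -
  have "{j. Suc j \<in> Suc ` I} = I" "{j. Suc j \<in> - (Suc ` I)} = - I" "0 \<notin> Suc ` I" by auto
  then show "nths (v # vs) (Suc ` I) = nths vs I" "nths (v # vs) (- (Suc ` I)) = v # nths vs (- I)"
    by (simp_all add: nths_Cons)
qed

lemma length_nths_split:
  assumes "length vs = k" "card (I \<inter> {..<k}) = i" "i + j = k"
  shows "length (nths vs I) = i" "length (nths vs (- I)) = j"
proof -
  have l: "length (nths vs A) = card (A \<inter> {..<k})" for A
    using assms(1) by (simp add: length_nths) (rule arg_cong[where f = card], auto)
  show "length (nths vs I) = i" using l assms by simp
  have "card (I \<inter> {..<k}) + card (- I \<inter> {..<k}) = card ({..<k})"
  proof -
    have "I \<inter> {..<k} \<union> - I \<inter> {..<k} = {..<k}" by auto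
    then show ?thesis by (subst card_Un_disjoint[symmetric]) auto
  qed
  then show "length (nths vs (- I)) = j" using l assms by simp
qed

lemma bounded_multilinear_bound:
  assumes "bounded_multilinear k T"
  obtains C where "C \<ge> 0" "\<And>vs. length vs = k \<Longrightarrow> norm (T vs) \<le> C * prod_list (map norm vs)"
proof -
  obtain C where C: "\<And>vs. length vs = k \<Longrightarrow> norm (T vs) \<le> C * prod_list (map norm vs)"
    using assms unfolding bounded_multilinear_def by blast
  have "norm (T vs) \<le> \<bar>C\<bar> * prod_list (map norm vs)" if "length vs = k" for vs
    using C[OF that] mult_right_mono[OF abs_ge_self[of C] prod_list_norm_nonneg[of vs]] by linarith
  then show ?thesis using that[of "\<bar>C\<bar>"] by simp
qed

lemma bounded_multilinear_linear:
  assumes "bounded_multilinear k T" "length us + length vs + 1 = k"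
  shows "linear (\<lambda>v. T (us @ v # vs))"
  using conjunct1[OF assms(1)[unfolded bounded_multilinear_def], rule_format, OF assms(2)] .

lemma bounded_multilinearI:
  assumes "\<And>us vs. length us + length vs + 1 = k \<Longrightarrow> linear (\<lambda>v. T (us @ v # vs))"
    and "\<And>vs. length vs = k \<Longrightarrow> norm (T vs) \<le> C * prod_list (map norm vs)"
  shows "bounded_multilinear k T"
  unfolding bounded_multilinear_def using assms by blast

lemma bounded_multilinear_zero: "bounded_multilinear k (\<lambda>vs. 0)"
  by (rule bounded_multilinearI[where C = 0]) (auto simp: linear_zero)

lemma bounded_multilinear_add:
  assumes A: "bounded_multilinear k A" and B: "bounded_multilinear k B"
  shows "bounded_multilinear k (\<lambda>vs. A vs + B vs)"
proof -
  obtain a b where ab: "\<And>vs. length vs = k \<Longrightarrow> norm (A vs) \<le> a * prod_list (map norm vs)"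
    "\<And>vs. length vs = k \<Longrightarrow> norm (B vs) \<le> b * prod_list (map norm vs)"
    using bounded_multilinear_bound A B by metis
  show ?thesis
  proof (rule bounded_multilinearI)
    show "norm (A vs + B vs) \<le> (a + b) * prod_list (map norm vs)" if "length vs = k" for vs
      using norm_triangle_ineq[of "A vs" "B vs"] ab[OF that] by (simp add: distrib_right)
  qed (intro linear_compose_add bounded_multilinear_linear[OF A] bounded_multilinear_linear[OF B])
qed

lemma bounded_multilinear_scaleR_nths:
  assumes A: "bounded_multilinear i A" and B: "bounded_multilinear j B"
    and I: "card (I \<inter> {..<k}) = i" "i + j = k"
  shows "bounded_multilinear k (\<lambda>vs. A (nths vs I) *\<^sub>R B (nths vs (- I)))"
proof -
  obtain a where a: "a \<ge> 0" "\<And>vs. length vs = i \<Longrightarrow> norm (A vs) \<le> a * prod_list (map norm vs)"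
    using bounded_multilinear_bound[OF A] by blast
  obtain b where b: "b \<ge> 0" "\<And>vs. length vs = j \<Longrightarrow> norm (B vs) \<le> b * prod_list (map norm vs)"
    using bounded_multilinear_bound[OF B] by blast
  show ?thesis
  proof (rule bounded_multilinearI)
    fix us vs :: "'a list" assume l: "length us + length vs + 1 = k"
    let ?J = "{j. j + length us \<in> I}"
    let ?K = "{j. Suc j \<in> ?J}"
    have c: "{j. j + length us \<in> - I} = - ?J" "{j. Suc j \<in> - ?J} = - ?K" by auto
    note len = length_nths_split[OF _ I, of "us @ v # vs" for v]
    show "linear (\<lambda>v. A (nths (us @ v # vs) I) *\<^sub>R B (nths (us @ v # vs) (- I)))"
    proof (cases "length us \<in> I")
      case True
      then have e: "nths (us @ v # vs) I = nths us I @ v # nths vs ?K"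
        "nths (us @ v # vs) (- I) = nths us (- I) @ nths vs (- ?K)" for v
        unfolding nths_append c by (simp_all add: nths_Cons c Collect_neg_eq)
      have "length (nths us I) + length (nths vs ?K) + 1 = i"
        using len(1)[of undefined] l unfolding e by simp
      from bounded_multilinear_linear[OF A this] show ?thesis
        unfolding e by (rule linear_compose[OF _ linear_scaleR_left, unfolded o_def])
    next
      case False
      then have e: "nths (us @ v # vs) I = nths us I @ nths vs ?K"
        "nths (us @ v # vs) (- I) = nths us (- I) @ v # nths vs (- ?K)" for v
        unfolding nths_append c by (simp_all add: nths_Cons c Collect_neg_eq)
      have "length (nths us (- I)) + length (nths vs (- ?K)) + 1 = j"
        using len(2)[of undefined] l unfolding e by simp
      from bounded_multilinear_linear[OF B this] show ?thesis
        unfolding e by (rule linear_compose_scale_right)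
    qed
  next
    fix vs :: "'a list" assume l: "length vs = k"
    have "norm (A (nths vs I)) * norm (B (nths vs (- I)))
       \<le> (a * prod_list (map norm (nths vs I))) * (b * prod_list (map norm (nths vs (- I))))"
      using a b length_nths_split[OF l I] by (intro mult_mono) simp_all
    also have "\<dots> = (a * b) * prod_list (map norm vs)"
      unfolding prod_list_norm_nths[of vs I, symmetric] by simp
    finally show "norm (A (nths vs I) *\<^sub>R B (nths vs (- I))) \<le> (a * b) * prod_list (map norm vs)" by simp
  qed
qed

lemma bounded_multilinear_Cons:
  assumes "bounded_multilinear (Suc k) T"
  shows "bounded_multilinear k (\<lambda>vs. T (x # vs))"
proof -
  obtain C where C: "\<And>vs. length vs = Suc k \<Longrightarrow> norm (T vs) \<le> C * prod_list (map norm vs)"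
    using bounded_multilinear_bound[OF assms] by blast
  show ?thesis
  proof (rule bounded_multilinearI)
    show "linear (\<lambda>v. T (x # us @ v # vs))" if "length us + length vs + 1 = k" for us vs
      using bounded_multilinear_linear[OF assms, of "x # us" vs] that by simp
    show "norm (T (x # vs)) \<le> (C * norm x) * prod_list (map norm vs)" if "length vs = k" for vs
      using C[of "x # vs"] that by (simp add: mult.assoc)
  qed
qed

lemma form_derivative_const: "form_derivative S k (\<lambda>x. M) (\<lambda>x vs. 0)"
  unfolding form_derivative_def by (auto intro!: exI[of _ 1])

lemma form_derivative_Cons:
  assumes "bounded_multilinear (Suc k) M"
  shows "form_derivative S k (\<lambda>x vs. M (x # vs)) (\<lambda>x. M)"
proof -
  have "M (y # vs) - M (x # vs) - M ((y - x) # vs) = 0" if "length vs = k" for x y vs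
    using linear_diff[OF bounded_multilinear_linear[OF assms, of "[]" vs], of y x] that by simp
  then show ?thesis unfolding form_derivative_def by (auto intro!: exI[of _ 1])
qed

lemma form_derivative_add:
  assumes A: "form_derivative S k A A'" and B: "form_derivative S k B B'"
  shows "form_derivative S k (\<lambda>x vs. A x vs + B x vs) (\<lambda>x vs. A' x vs + B' x vs)"
  unfolding form_derivative_def
proof (intro ballI allI impI)
  fix x and e :: real assume x: "x \<in> S" "e > 0"
  then have e2: "e / 2 > 0" by simp
  obtain d1 where d1: "d1 > 0" "\<And>y vs. y \<in> S \<Longrightarrow> norm (y - x) < d1 \<Longrightarrow> length vs = k \<Longrightarrow>
      norm (A y vs - A x vs - A' x ((y - x) # vs)) \<le> (e / 2) * norm (y - x) * prod_list (map norm vs)"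
    using A[unfolded form_derivative_def, rule_format, OF x(1) e2] by blast
  obtain d2 where d2: "d2 > 0" "\<And>y vs. y \<in> S \<Longrightarrow> norm (y - x) < d2 \<Longrightarrow> length vs = k \<Longrightarrow>
      norm (B y vs - B x vs - B' x ((y - x) # vs)) \<le> (e / 2) * norm (y - x) * prod_list (map norm vs)"
    using B[unfolded form_derivative_def, rule_format, OF x(1) e2] by blast
  show "\<exists>d>0. \<forall>y\<in>S. norm (y - x) < d \<longrightarrow> (\<forall>vs. length vs = k \<longrightarrow>
     norm (A y vs + B y vs - (A x vs + B x vs) - (A' x ((y - x) # vs) + B' x ((y - x) # vs)))
       \<le> e * norm (y - x) * prod_list (map norm vs))"
  proof (intro exI[of _ "min d1 d2"] conjI ballI impI allI)
    fix y and vs :: "'a list" assume y: "y \<in> S" "norm (y - x) < min d1 d2" "length vs = k"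
    have "A y vs + B y vs - (A x vs + B x vs) - (A' x ((y - x) # vs) + B' x ((y - x) # vs))
       = (A y vs - A x vs - A' x ((y - x) # vs)) + (B y vs - B x vs - B' x ((y - x) # vs))"
      by (simp add: algebra_simps)
    also have "norm \<dots> \<le> (e / 2) * norm (y - x) * prod_list (map norm vs) + (e / 2) * norm (y - x) * prod_list (map norm vs)"
      using y d1(2) d2(2) by (intro norm_triangle_mono) auto
    finally show "norm (A y vs + B y vs - (A x vs + B x vs) - (A' x ((y - x) # vs) + B' x ((y - x) # vs)))
       \<le> e * norm (y - x) * prod_list (map norm vs)" by (simp add: ac_simps)
  qed (use d1 d2 in auto)
qed

lemma form_derivative_lipschitz:
  assumes A: "form_derivative S k A A'" and b: "bounded_multilinear (Suc k) (A' x)" and x: "x \<in> S"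
  obtains K d where "K \<ge> 0" "d > 0" "\<And>y vs. y \<in> S \<Longrightarrow> norm (y - x) < d \<Longrightarrow> length vs = k \<Longrightarrow>
      norm (A y vs - A x vs) \<le> K * norm (y - x) * prod_list (map norm vs)"
proof -
  obtain d where d: "d > 0" "\<And>y vs. y \<in> S \<Longrightarrow> norm (y - x) < d \<Longrightarrow> length vs = k \<Longrightarrow>
      norm (A y vs - A x vs - A' x ((y - x) # vs)) \<le> 1 * norm (y - x) * prod_list (map norm vs)"
    using A[unfolded form_derivative_def, rule_format, OF x zero_less_one] by blast
  obtain C where C: "C \<ge> 0" "\<And>vs. length vs = Suc k \<Longrightarrow> norm (A' x vs) \<le> C * prod_list (map norm vs)"
    using bounded_multilinear_bound[OF b] by blast
  have "norm (A y vs - A x vs) \<le> (C + 1) * norm (y - x) * prod_list (map norm vs)"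
    if "y \<in> S" "norm (y - x) < d" "length vs = k" for y vs
  proof -
    have "norm (A y vs - A x vs) \<le> norm (A y vs - A x vs - A' x ((y - x) # vs)) + norm (A' x ((y - x) # vs))"
      by (metis diff_add_cancel norm_triangle_ineq)
    also have "\<dots> \<le> 1 * norm (y - x) * prod_list (map norm vs) + C * (norm (y - x) * prod_list (map norm vs))"
      using d(2)[OF that] C(2)[of "(y - x) # vs"] that(3) by (intro add_mono) simp_all
    finally show ?thesis by (simp add: algebra_simps)
  qed
  then show ?thesis using that[of "C + 1" d] C d by simp
qed

text \<open>
  The product rule. The set \<open>I\<close> selects the arguments of the first factor; the new argument at position
  \<open>0\<close> goes to the factor that is differentiated, which shifts \<open>I\<close> by one.
\<close>

lemma form_derivative_scaleR_nths:
  assumes A: "form_derivative S i A A'" and B: "form_derivative S j B B'"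
    and bA: "\<And>x. x \<in> S \<Longrightarrow> bounded_multilinear i (A x)" "\<And>x. x \<in> S \<Longrightarrow> bounded_multilinear (Suc i) (A' x)"
    and bB: "\<And>x. x \<in> S \<Longrightarrow> bounded_multilinear j (B x)" "\<And>x. x \<in> S \<Longrightarrow> bounded_multilinear (Suc j) (B' x)"
    and I: "card (I \<inter> {..<k}) = i" "i + j = k"
  shows "form_derivative S k (\<lambda>x vs. A x (nths vs I) *\<^sub>R B x (nths vs (- I)))
    (\<lambda>x vs. A' x (nths vs (insert 0 (Suc ` I))) *\<^sub>R B x (nths vs (- insert 0 (Suc ` I)))
          + A x (nths vs (Suc ` I)) *\<^sub>R B' x (nths vs (- (Suc ` I))))"
  unfolding form_derivative_def
proof (intro ballI allI impI)
  fix x and e :: real assume x: "x \<in> S" "e > 0"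
  obtain a where a: "a \<ge> 0" "\<And>vs. length vs = i \<Longrightarrow> norm (A x vs) \<le> a * prod_list (map norm vs)"
    using bounded_multilinear_bound[OF bA(1)[OF x(1)]] by blast
  obtain b where b: "b \<ge> 0" "\<And>vs. length vs = j \<Longrightarrow> norm (B x vs) \<le> b * prod_list (map norm vs)"
    using bounded_multilinear_bound[OF bB(1)[OF x(1)]] by blast
  obtain K1 d1 where K1: "K1 \<ge> 0" "d1 > 0" "\<And>y vs. y \<in> S \<Longrightarrow> norm (y - x) < d1 \<Longrightarrow> length vs = i \<Longrightarrow>
      norm (A y vs - A x vs) \<le> K1 * norm (y - x) * prod_list (map norm vs)"
    using form_derivative_lipschitz[OF A bA(2)[OF x(1)] x(1)] by blast
  obtain K2 d2 where K2: "K2 \<ge> 0" "d2 > 0" "\<And>y vs. y \<in> S \<Longrightarrow> norm (y - x) < d2 \<Longrightarrow> length vs = j \<Longrightarrow>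
      norm (B y vs - B x vs) \<le> K2 * norm (y - x) * prod_list (map norm vs)"
    using form_derivative_lipschitz[OF B bB(2)[OF x(1)] x(1)] by blast
  define e1 where "e1 = e / (2 * (a + b + 1))"
  have e1: "e1 > 0" using x a b by (simp add: e1_def)
  obtain d3 where d3: "d3 > 0" "\<And>y vs. y \<in> S \<Longrightarrow> norm (y - x) < d3 \<Longrightarrow> length vs = i \<Longrightarrow>
      norm (A y vs - A x vs - A' x ((y - x) # vs)) \<le> e1 * norm (y - x) * prod_list (map norm vs)"
    using A[unfolded form_derivative_def, rule_format, OF x(1) e1] by blast
  obtain d4 where d4: "d4 > 0" "\<And>y vs. y \<in> S \<Longrightarrow> norm (y - x) < d4 \<Longrightarrow> length vs = j \<Longrightarrow>
      norm (B y vs - B x vs - B' x ((y - x) # vs)) \<le> e1 * norm (y - x) * prod_list (map norm vs)"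
    using B[unfolded form_derivative_def, rule_format, OF x(1) e1] by blast
  define d5 where "d5 = e / (2 * (K1 * K2 + 1))"
  have d5: "d5 > 0" using x K1 K2 by (simp add: d5_def add_nonneg_pos)
  define d where "d = Min {d1, d2, d3, d4, d5}"
  have d: "d > 0" "d \<le> d1" "d \<le> d2" "d \<le> d3" "d \<le> d4" "d \<le> d5"
    unfolding d_def using K1 K2 d3 d4 d5 by auto
  show "\<exists>d>0. \<forall>y\<in>S. norm (y - x) < d \<longrightarrow> (\<forall>vs. length vs = k \<longrightarrow>
     norm (A y (nths vs I) *\<^sub>R B y (nths vs (- I)) - A x (nths vs I) *\<^sub>R B x (nths vs (- I))
       - (A' x (nths ((y - x) # vs) (insert 0 (Suc ` I))) *\<^sub>R B x (nths ((y - x) # vs) (- insert 0 (Suc ` I)))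
          + A x (nths ((y - x) # vs) (Suc ` I)) *\<^sub>R B' x (nths ((y - x) # vs) (- (Suc ` I)))))
       \<le> e * norm (y - x) * prod_list (map norm vs))"
    unfolding nths_insert_0_Suc nths_Suc
  proof (intro exI[of _ d] conjI ballI impI allI d(1))
    fix y and vs :: "'a list" assume y: "y \<in> S" "norm (y - x) < d" and l: "length vs = k"
    let ?u = "nths vs I" and ?w = "nths vs (- I)" and ?h = "norm (y - x)"
    let ?p = "prod_list (map norm ?u)" and ?q = "prod_list (map norm ?w)"
    note len = length_nths_split[OF l I]
    have pq: "?p * ?q = prod_list (map norm vs)" by (rule prod_list_norm_nths)
    have split: "A y ?u *\<^sub>R B y ?w - A x ?u *\<^sub>R B x ?w - (A' x ((y - x) # ?u) *\<^sub>R B x ?w + A x ?u *\<^sub>R B' x ((y - x) # ?w))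
      = (A y ?u - A x ?u) *\<^sub>R (B y ?w - B x ?w) + (A y ?u - A x ?u - A' x ((y - x) # ?u)) *\<^sub>R B x ?w
        + A x ?u *\<^sub>R (B y ?w - B x ?w - B' x ((y - x) # ?w))"
      by (simp add: algebra_simps)
    have t1: "norm ((A y ?u - A x ?u) *\<^sub>R (B y ?w - B x ?w)) \<le> (K1 * ?h * ?p) * (K2 * ?h * ?q)"
      unfolding norm_scaleR real_norm_def[symmetric]
      using K1(3)[OF y(1) _ len(1)] K2(3)[OF y(1) _ len(2)] y(2) d K1 K2 by (intro mult_mono) auto
    have t2: "norm ((A y ?u - A x ?u - A' x ((y - x) # ?u)) *\<^sub>R B x ?w) \<le> (e1 * ?h * ?p) * (b * ?q)"
      unfolding norm_scaleR real_norm_def[symmetric]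
      using d3(2)[OF y(1) _ len(1)] b(2)[OF len(2)] y(2) d e1 by (intro mult_mono) auto
    have t3: "norm (A x ?u *\<^sub>R (B y ?w - B x ?w - B' x ((y - x) # ?w))) \<le> (a * ?p) * (e1 * ?h * ?q)"
      unfolding norm_scaleR real_norm_def[symmetric]
      using d4(2)[OF y(1) _ len(2)] a(2)[OF len(1)] y(2) d e1 a by (intro mult_mono) auto
    have "norm (A y ?u *\<^sub>R B y ?w - A x ?u *\<^sub>R B x ?w - (A' x ((y - x) # ?u) *\<^sub>R B x ?w + A x ?u *\<^sub>R B' x ((y - x) # ?w)))
      \<le> (K1 * ?h * ?p) * (K2 * ?h * ?q) + (e1 * ?h * ?p) * (b * ?q) + (a * ?p) * (e1 * ?h * ?q)"
      unfolding split by (intro norm_triangle_mono t1 t2 t3)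
    also have "\<dots> = (K1 * K2 * ?h + e1 * (a + b)) * (?h * (?p * ?q))" by (simp add: algebra_simps)
    also have "\<dots> \<le> e * (?h * (?p * ?q))"
    proof (rule mult_right_mono)
      have "K1 * K2 * ?h \<le> K1 * K2 * d5" using y d K1 K2 by (intro mult_left_mono) auto
      also have "\<dots> = (e / 2) * (K1 * K2 / (K1 * K2 + 1))" by (simp add: d5_def)
      also have "\<dots> \<le> (e / 2) * 1"
      proof (rule mult_left_mono)
        have "0 \<le> K1 * K2" using K1 K2 by simp
        then show "K1 * K2 / (K1 * K2 + 1) \<le> 1" by (simp add: divide_le_eq_1)
      qed (use x in simp)
      finally have 1: "K1 * K2 * ?h \<le> e / 2" by simp
      have "e1 * (a + b) \<le> e / 2" unfolding e1_def using a b x by (simp add: field_simps)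
      with 1 show "K1 * K2 * ?h + e1 * (a + b) \<le> e" by simp
    qed simp
    finally show "norm (A y ?u *\<^sub>R B y ?w - A x ?u *\<^sub>R B x ?w - (A' x ((y - x) # ?u) *\<^sub>R B x ?w + A x ?u *\<^sub>R B' x ((y - x) # ?w)))
      \<le> e * ?h * prod_list (map norm vs)" unfolding pq by (simp add: mult.assoc)
  qed
qed

lemma form_derivative_0_has_derivative:
  assumes "form_derivative S 0 A A'" "x \<in> S" "bounded_multilinear 1 (A' x)"
  shows "((\<lambda>y. A y []) has_derivative (\<lambda>v. A' x [v])) (at x within S)"
  unfolding has_derivative_within_alt
proof (intro conjI allI impI)
  obtain C where C: "\<And>vs. length vs = 1 \<Longrightarrow> norm (A' x vs) \<le> C * prod_list (map norm vs)"
    using bounded_multilinear_bound[OF assms(3)] by blast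
  have "linear (\<lambda>v. A' x [v])" using bounded_multilinear_linear[OF assms(3), of "[]" "[]"] by simp
  moreover have "norm (A' x [v]) \<le> norm v * C" for v using C[of "[v]"] by (simp add: mult.commute)
  ultimately show "bounded_linear (\<lambda>v. A' x [v])"
    unfolding bounded_linear_def bounded_linear_axioms_def by blast
  fix e :: real assume "e > 0"
  from assms(1)[unfolded form_derivative_def, rule_format, OF assms(2) this]
  show "\<exists>d>0. \<forall>y\<in>S. norm (y - x) < d \<longrightarrow> norm (A y [] - A x [] - A' x [y - x]) \<le> e * norm (y - x)"
    by fastforce
qed

lemma form_derivative_0I:
  assumes "\<And>x. x \<in> S \<Longrightarrow> ((\<lambda>y. A y []) has_derivative (\<lambda>v. A' x [v])) (at x within S)"
  shows "form_derivative S 0 A A'"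
  using assms unfolding form_derivative_def has_derivative_within_alt by fastforce

text \<open>
  Rational expressions in linear and quadratic functions; a form of degree \<open>k\<close> is a \<open>k\<close>-linear
  form whose coefficients are such expressions. A product distributes the arguments of a
  form over its factors, so that the product rule does not leave this class.
\<close>

inductive rational_form :: "'a::real_inner set \<Rightarrow> nat \<Rightarrow> ('a \<Rightarrow> 'a list \<Rightarrow> real) \<Rightarrow> bool" for S where
  const: "bounded_multilinear k M \<Longrightarrow> rational_form S k (\<lambda>x. M)"
| linear: "bounded_multilinear (Suc k) M \<Longrightarrow> rational_form S k (\<lambda>x vs. M (x # vs))"
| quadratic: "rational_form S 0 (\<lambda>x vs. inner x x)"
| add: "rational_form S k A \<Longrightarrow> rational_form S k B \<Longrightarrow> rational_form S k (\<lambda>x vs. A x vs + B x vs)"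
| mult: "rational_form S i A \<Longrightarrow> rational_form S j B \<Longrightarrow> card (I \<inter> {..<k}) = i \<Longrightarrow> i + j = k \<Longrightarrow>
         rational_form S k (\<lambda>x vs. A x (nths vs I) *\<^sub>R B x (nths vs (- I)))"
| inverse: "rational_form S 0 A \<Longrightarrow> \<forall>x\<in>S. A x [] \<noteq> 0 \<Longrightarrow> rational_form S 0 (\<lambda>x vs. inverse (A x []))"

text \<open>
  The analogous class with values in a normed space; only its scalar coefficients are inverted.
\<close>

inductive rational_vector_form ::
    "'a::real_inner set \<Rightarrow> nat \<Rightarrow> ('a \<Rightarrow> 'a list \<Rightarrow> 'b::real_normed_vector) \<Rightarrow> bool" for S where
  const: "bounded_multilinear k M \<Longrightarrow> rational_vector_form S k (\<lambda>x. M)"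
| linear: "bounded_multilinear (Suc k) M \<Longrightarrow> rational_vector_form S k (\<lambda>x vs. M (x # vs))"
| add: "rational_vector_form S k A \<Longrightarrow> rational_vector_form S k B \<Longrightarrow> rational_vector_form S k (\<lambda>x vs. A x vs + B x vs)"
| scale: "rational_form S i A \<Longrightarrow> rational_vector_form S j B \<Longrightarrow> card (I \<inter> {..<k}) = i \<Longrightarrow> i + j = k \<Longrightarrow>
          rational_vector_form S k (\<lambda>x vs. A x (nths vs I) *\<^sub>R B x (nths vs (- I)))"

lemma card_insert_0_Suc:
  assumes "card (I \<inter> {..<k}) = i"
  shows "card (insert 0 (Suc ` I) \<inter> {..<Suc k}) = Suc i" "card (Suc ` I \<inter> {..<Suc k}) = i"
proof -
  have e: "Suc ` I \<inter> {..<Suc k} = Suc ` (I \<inter> {..<k})" by auto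
  then show 1: "card (Suc ` I \<inter> {..<Suc k}) = i" using assms by (simp add: card_image)
  have "insert 0 (Suc ` I) \<inter> {..<Suc k} = insert 0 (Suc ` I \<inter> {..<Suc k})" by auto
  then show "card (insert 0 (Suc ` I) \<inter> {..<Suc k}) = Suc i" using 1 e by (simp add: card_insert_if)
qed

lemma bounded_multilinear_inner_hd: "bounded_multilinear (Suc (Suc 0)) (\<lambda>vs. 2 * inner (vs ! 0) (vs ! 1))"
proof (rule bounded_multilinearI[where C = 2])
  fix us vs :: "'a list" assume "length us + length vs + 1 = Suc (Suc 0)"
  then consider w where "us = [w]" "vs = []" | w where "us = []" "vs = [w]"
    by (cases us; cases vs) auto
  then show "linear (\<lambda>v. 2 * inner ((us @ v # vs) ! 0) ((us @ v # vs) ! 1))"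
    by cases (auto intro!: linearI simp: inner_add_left inner_add_right)
next
  fix vs :: "'a list" assume "length vs = Suc (Suc 0)"
  then obtain v w where "vs = [v, w]" by (auto simp: length_Suc_conv)
  then show "norm (2 * inner (vs ! 0) (vs ! 1)) \<le> 2 * prod_list (map norm vs)"
    using Cauchy_Schwarz_ineq2[of v w] by (simp add: abs_mult)
qed

text \<open>
  The class of rational forms is closed under differentiation. The derivative of \<open>1 / A\<close> is the product of
  \<open>- 1 / A\<^sup>2\<close> with the derivative of \<open>A\<close>.
\<close>

lemma rational_form_step:
  assumes "rational_form S k T"
  shows "(\<forall>x\<in>S. bounded_multilinear k (T x)) \<and>
    (\<exists>T'. rational_form S (Suc k) T' \<and> (\<forall>x\<in>S. bounded_multilinear (Suc k) (T' x)) \<and> form_derivative S k T T')"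
  using assms
proof induction
  case (const k M)
  then show ?case
    by (intro conjI ballI exI[of _ "\<lambda>x vs. 0"] rational_form.const bounded_multilinear_zero form_derivative_const)
next
  case (linear k M)
  then show ?case
    by (intro conjI ballI exI[of _ "\<lambda>x. M"] rational_form.const form_derivative_Cons bounded_multilinear_Cons)
next
  case quadratic
  let ?M = "\<lambda>vs::'a list. 2 * inner (vs ! 0) (vs ! 1)"
  have M: "bounded_multilinear (Suc (Suc 0)) ?M" by (rule bounded_multilinear_inner_hd)
  show ?case
  proof (intro conjI ballI exI[of _ "\<lambda>x vs. ?M (x # vs)"])
    show "bounded_multilinear 0 (\<lambda>vs. inner x x)" for x :: 'a
      by (rule bounded_multilinearI[where C = "inner x x"]) auto
    show "rational_form S (Suc 0) (\<lambda>x vs. ?M (x # vs))" by (rule rational_form.linear[OF M])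
    show "bounded_multilinear (Suc 0) (\<lambda>vs. ?M (x # vs))" for x by (rule bounded_multilinear_Cons[OF M])
    show "form_derivative S 0 (\<lambda>x vs. inner x x) (\<lambda>x vs. ?M (x # vs))"
      by (rule form_derivative_0I) (auto intro!: derivative_eq_intros simp: inner_commute)
  qed
next
  case (add k A B)
  then obtain A' B' where "rational_form S (Suc k) A'" "rational_form S (Suc k) B'"
    "form_derivative S k A A'" "form_derivative S k B B'"
    "\<forall>x\<in>S. bounded_multilinear (Suc k) (A' x)" "\<forall>x\<in>S. bounded_multilinear (Suc k) (B' x)" by blast
  with add show ?case
    by (intro conjI ballI exI[of _ "\<lambda>x vs. A' x vs + B' x vs"] rational_form.add bounded_multilinear_add form_derivative_add) auto
next
  case (mult i A j B I k)
  then obtain A' B' where AB: "rational_form S (Suc i) A'" "rational_form S (Suc j) B'"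
    "form_derivative S i A A'" "form_derivative S j B B'"
    "\<forall>x\<in>S. bounded_multilinear (Suc i) (A' x)" "\<forall>x\<in>S. bounded_multilinear (Suc j) (B' x)" by blast
  let ?I = "insert 0 (Suc ` I)" and ?J = "Suc ` I"
  note c = card_insert_0_Suc[OF mult.hyps(3)]
  have s: "Suc i + j = Suc k" "i + Suc j = Suc k" using mult.hyps(4) by simp_all
  let ?T = "\<lambda>x vs. A' x (nths vs ?I) *\<^sub>R B x (nths vs (- ?I)) + A x (nths vs ?J) *\<^sub>R B' x (nths vs (- ?J))"
  show ?case
  proof (intro conjI ballI exI[of _ ?T])
    show "bounded_multilinear k (\<lambda>vs. A x (nths vs I) *\<^sub>R B x (nths vs (- I)))" if "x \<in> S" for x
      using mult that by (intro bounded_multilinear_scaleR_nths) auto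
    show "rational_form S (Suc k) ?T"
      by (intro rational_form.add rational_form.mult[OF AB(1) mult.hyps(2) c(1) s(1)]
          rational_form.mult[OF mult.hyps(1) AB(2) c(2) s(2)])
    show "bounded_multilinear (Suc k) (?T x)" if "x \<in> S" for x
      by (intro bounded_multilinear_add bounded_multilinear_scaleR_nths[OF _ _ c(1) s(1)]
          bounded_multilinear_scaleR_nths[OF _ _ c(2) s(2)]) (use mult AB that in auto)
    show "form_derivative S k (\<lambda>x vs. A x (nths vs I) *\<^sub>R B x (nths vs (- I))) ?T"
      by (rule form_derivative_scaleR_nths[OF AB(3,4)]) (use mult AB in auto)
  qed
next
  case (inverse A)
  then obtain A' where A': "rational_form S (Suc 0) A'" "form_derivative S 0 A A'"
    "\<forall>x\<in>S. bounded_multilinear (Suc 0) (A' x)" by blast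
  let ?r = "\<lambda>x (vs::'a list). inverse (A x [])"
  let ?m = "\<lambda>x. - (inverse (A x []) * inverse (A x []))"
  let ?T = "\<lambda>x vs. ?m x * A' x vs"
  have r: "rational_form S 0 ?r" using inverse by (intro rational_form.inverse) auto
  have m1: "rational_form S 0 (\<lambda>x (vs::'a list). (-1::real))"
    by (rule rational_form.const, rule bounded_multilinearI[where C = 1]) auto
  have rr: "rational_form S 0 (\<lambda>x vs. ?m x)"
    using rational_form.mult[OF m1 rational_form.mult[OF r r, of "{}" 0], of "{}" 0] by simp
  have T: "rational_form S (Suc 0) ?T"
    using rational_form.mult[OF rr A'(1), of "{}" "Suc 0"] by (simp add: nths_all)
  have b0: "bounded_multilinear 0 (\<lambda>vs. c)" for c :: real
    by (rule bounded_multilinearI[where C = "\<bar>c\<bar>"]) auto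
  show ?case
  proof (intro conjI ballI exI[of _ ?T])
    show "rational_form S (Suc 0) ?T" by (rule T)
    show "bounded_multilinear (Suc 0) (?T x)" if "x \<in> S" for x
      using bounded_multilinear_scaleR_nths[OF b0[of "?m x"] A'(3)[rule_format, OF that], of "{}" "Suc 0"]
      by (simp add: nths_all)
    show "form_derivative S 0 ?r ?T"
    proof (rule form_derivative_0I)
      fix x assume x: "x \<in> S"
      have d: "((\<lambda>y. A y []) has_derivative (\<lambda>v. A' x [v])) (at x within S)"
        using form_derivative_0_has_derivative[OF A'(2) x] A'(3) x by simp
      have "A x [] \<noteq> 0" using inverse.hyps(2) x by blast
      from Deriv.has_derivative_inverse[OF this d] show "((\<lambda>y. inverse (A y [])) has_derivative (\<lambda>v. ?m x * A' x [v])) (at x within S)"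
        by (simp add: algebra_simps)
    qed
  qed (rule b0)
qed

lemma rational_vector_form_step:
  assumes "rational_vector_form S k T"
  shows "(\<forall>x\<in>S. bounded_multilinear k (T x)) \<and>
    (\<exists>T'. rational_vector_form S (Suc k) T' \<and> (\<forall>x\<in>S. bounded_multilinear (Suc k) (T' x)) \<and> form_derivative S k T T')"
  using assms
proof induction
  case (const k M)
  then show ?case
    by (intro conjI ballI exI[of _ "\<lambda>x vs. 0"] rational_vector_form.const bounded_multilinear_zero form_derivative_const)
next
  case (linear k M)
  then show ?case
    by (intro conjI ballI exI[of _ "\<lambda>x. M"] rational_vector_form.const form_derivative_Cons bounded_multilinear_Cons)
next
  case (add k A B)
  then obtain A' B' where "rational_vector_form S (Suc k) A'" "rational_vector_form S (Suc k) B'"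
    "form_derivative S k A A'" "form_derivative S k B B'"
    "\<forall>x\<in>S. bounded_multilinear (Suc k) (A' x)" "\<forall>x\<in>S. bounded_multilinear (Suc k) (B' x)" by blast
  with add show ?case
    by (intro conjI ballI exI[of _ "\<lambda>x vs. A' x vs + B' x vs"] rational_vector_form.add bounded_multilinear_add form_derivative_add) auto
next
  case (scale i A j B I k)
  obtain A' where A: "\<forall>x\<in>S. bounded_multilinear i (A x)" "rational_form S (Suc i) A'"
    "form_derivative S i A A'" "\<forall>x\<in>S. bounded_multilinear (Suc i) (A' x)"
    using rational_form_step[OF scale.hyps(1)] by blast
  obtain B' where B: "rational_vector_form S (Suc j) B'" "form_derivative S j B B'"
    "\<forall>x\<in>S. bounded_multilinear (Suc j) (B' x)" using scale.IH by blast
  let ?I = "insert 0 (Suc ` I)" and ?J = "Suc ` I"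
  note c = card_insert_0_Suc[OF scale.hyps(3)]
  have s: "Suc i + j = Suc k" "i + Suc j = Suc k" using scale.hyps(4) by simp_all
  let ?T = "\<lambda>x vs. A' x (nths vs ?I) *\<^sub>R B x (nths vs (- ?I)) + A x (nths vs ?J) *\<^sub>R B' x (nths vs (- ?J))"
  show ?case
  proof (intro conjI ballI exI[of _ ?T])
    show "bounded_multilinear k (\<lambda>vs. A x (nths vs I) *\<^sub>R B x (nths vs (- I)))" if "x \<in> S" for x
      using scale A that by (intro bounded_multilinear_scaleR_nths) auto
    show "rational_vector_form S (Suc k) ?T"
      by (intro rational_vector_form.add rational_vector_form.scale[OF A(2) scale.hyps(2) c(1) s(1)]
          rational_vector_form.scale[OF scale.hyps(1) B(1) c(2) s(2)])
    show "bounded_multilinear (Suc k) (?T x)" if "x \<in> S" for x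
      by (intro bounded_multilinear_add bounded_multilinear_scaleR_nths[OF _ _ c(1) s(1)]
          bounded_multilinear_scaleR_nths[OF _ _ c(2) s(2)]) (use scale A B that in auto)
    show "form_derivative S k (\<lambda>x vs. A x (nths vs I) *\<^sub>R B x (nths vs (- I))) ?T"
      by (rule form_derivative_scaleR_nths[OF A(3) B(2)]) (use scale A B in auto)
  qed
qed

text \<open>Rational functions and rational maps, i.e. forms of degree zero.\<close>

definition rational_on :: "'a::real_inner set \<Rightarrow> ('a \<Rightarrow> real) \<Rightarrow> bool" where
  "rational_on S f \<longleftrightarrow> rational_form S 0 (\<lambda>x vs. f x)"

definition rational_map_on :: "'a::real_inner set \<Rightarrow> ('a \<Rightarrow> 'b::real_normed_vector) \<Rightarrow> bool" where
  "rational_map_on S f \<longleftrightarrow> rational_vector_form S 0 (\<lambda>x vs. f x)"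

lemma bounded_multilinear_0: "bounded_multilinear 0 (\<lambda>vs. c)"
  by (rule bounded_multilinearI[where C = "norm c"]) auto

lemma bounded_multilinear_hd:
  assumes "bounded_linear f" shows "bounded_multilinear (Suc 0) (\<lambda>vs. f (hd vs))"
proof -
  obtain K where K: "\<And>v. norm (f v) \<le> norm v * K" using bounded_linear.bounded[OF assms] by blast
  show ?thesis
  proof (rule bounded_multilinearI[where C = K])
    fix vs :: "'a list" assume "length vs = Suc 0"
    then obtain v where "vs = [v]" by (auto simp: length_Suc_conv)
    then show "norm (f (hd vs)) \<le> K * prod_list (map norm vs)" using K[of v] by (simp add: mult.commute)
  qed (use bounded_linear.linear[OF assms] in simp)
qed

lemma rational_on_const: "rational_on S (\<lambda>x. c)"
  unfolding rational_on_def by (rule rational_form.const[OF bounded_multilinear_0])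

lemma rational_on_linear: "bounded_linear f \<Longrightarrow> rational_on S f"
  unfolding rational_on_def using rational_form.linear[OF bounded_multilinear_hd] by simp

lemma rational_on_inner_self: "rational_on S (\<lambda>x. inner x x)"
  unfolding rational_on_def by (rule rational_form.quadratic)

lemma rational_on_add: "rational_on S f \<Longrightarrow> rational_on S g \<Longrightarrow> rational_on S (\<lambda>x. f x + g x)"
  unfolding rational_on_def by (rule rational_form.add)

lemma rational_on_mult: "rational_on S f \<Longrightarrow> rational_on S g \<Longrightarrow> rational_on S (\<lambda>x. f x * g x)"
  unfolding rational_on_def using rational_form.mult[of S 0 "\<lambda>x vs. f x" 0 "\<lambda>x vs. g x" "{}" 0] by simp

lemma rational_on_inverse: "rational_on S f \<Longrightarrow> (\<And>x. x \<in> S \<Longrightarrow> f x \<noteq> 0) \<Longrightarrow> rational_on S (\<lambda>x. inverse (f x))"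
  unfolding rational_on_def using rational_form.inverse[of S "\<lambda>x vs. f x"] by simp

lemma rational_map_on_const: "rational_map_on S (\<lambda>x. c)"
  unfolding rational_map_on_def by (rule rational_vector_form.const[OF bounded_multilinear_0])

lemma rational_map_on_linear: "bounded_linear f \<Longrightarrow> rational_map_on S f"
  unfolding rational_map_on_def using rational_vector_form.linear[OF bounded_multilinear_hd] by simp

lemma rational_map_on_add: "rational_map_on S f \<Longrightarrow> rational_map_on S g \<Longrightarrow> rational_map_on S (\<lambda>x. f x + g x)"
  unfolding rational_map_on_def by (rule rational_vector_form.add)

lemma rational_map_on_scaleR: "rational_on S f \<Longrightarrow> rational_map_on S g \<Longrightarrow> rational_map_on S (\<lambda>x. f x *\<^sub>R g x)"
  unfolding rational_on_def rational_map_on_def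
  using rational_vector_form.scale[of S 0 "\<lambda>x vs. f x" 0 "\<lambda>x vs. g x" "{}" 0] by simp

lemma rational_map_on_imp_smooth_on:
  assumes "open S" "rational_map_on S f" shows "smooth_on S f"
  using assms(1)
proof (rule smooth_on_coinduct[where P = "rational_vector_form S"])
  show "rational_vector_form S 0 (\<lambda>x vs. f x)" using assms(2) by (simp add: rational_map_on_def)
qed (use rational_vector_form_step in blast)+

text \<open>Smoothness may be checked separately on the open level sets of a locally constant function.\<close>

lemma smooth_on_open_partition:
  fixes c :: "'a::real_normed_vector \<Rightarrow> 'c"
  assumes S: "open S" and c: "\<And>i. open {x \<in> S. c x = i}" and f: "\<And>i. smooth_on {x \<in> S. c x = i} f"
  shows "smooth_on S f"
proof -
  let ?X = "\<lambda>i. {x \<in> S. c x = i}"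
  have "\<exists>D. (\<forall>x\<in>?X i. D 0 x [] = f x) \<and> (\<forall>k. \<forall>x\<in>?X i. bounded_multilinear k (D k x)) \<and>
        (\<forall>k. form_derivative (?X i) k (D k) (D (Suc k)))" for i
  proof -
    obtain D where 0: "\<forall>x\<in>?X i. D 0 x [] = f x"
      and D: "\<forall>k. \<forall>x\<in>?X i. bounded_multilinear k (D k x) \<and>
           (\<forall>e>0. \<exists>d>0. \<forall>y\<in>?X i. norm (y - x) < d \<longrightarrow>
              (\<forall>vs. length vs = k \<longrightarrow>
                 norm (D k y vs - D k x vs - D (Suc k) x ((y - x) # vs))
                   \<le> e * norm (y - x) * prod_list (map norm vs)))"
      using f[of i] unfolding smooth_on_def by (elim conjE exE)
    have "bounded_multilinear k (D k x)" if "x \<in> ?X i" for k x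
      using D[rule_format, OF that] by (rule conjunct1)
    moreover have "form_derivative (?X i) k (D k) (D (Suc k))" for k
      unfolding form_derivative_def using D[rule_format, of _ k, THEN conjunct2] by (rule ballI)
    ultimately show ?thesis using 0 by blast
  qed
  then have "\<forall>i. \<exists>D. (\<forall>x\<in>?X i. D 0 x [] = f x) \<and> (\<forall>k. \<forall>x\<in>?X i. bounded_multilinear k (D k x)) \<and>
        (\<forall>k. form_derivative (?X i) k (D k) (D (Suc k)))" by (rule allI)
  from choice[OF this] obtain D where D': "\<forall>i. (\<forall>x\<in>?X i. D i 0 x [] = f x) \<and>
      (\<forall>k. \<forall>x\<in>?X i. bounded_multilinear k (D i k x)) \<and>
      (\<forall>k. form_derivative (?X i) k (D i k) (D i (Suc k)))" ..
  have D: "D (c x) 0 x [] = f x" "bounded_multilinear k (D (c x) k x)" if "x \<in> S" for x k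
    using D' that by auto
  have Dd: "form_derivative (?X i) k (D i k) (D i (Suc k))" for i k using D' by blast
  let ?D = "\<lambda>k x. D (c x) k x"
  have fd: "form_derivative S k (?D k) (?D (Suc k))" for k
    unfolding form_derivative_def
  proof (intro ballI allI impI)
    fix x and e :: real assume x: "x \<in> S" "e > 0"
    obtain d where d: "d > 0" "\<And>y vs. y \<in> ?X (c x) \<Longrightarrow> norm (y - x) < d \<Longrightarrow> length vs = k \<Longrightarrow>
        norm (D (c x) k y vs - D (c x) k x vs - D (c x) (Suc k) x ((y - x) # vs)) \<le> e * norm (y - x) * prod_list (map norm vs)"
      using Dd[of "c x", unfolded form_derivative_def, rule_format, of x e k] x by blast
    have "x \<in> ?X (c x)" using x by simp
    then obtain r where r: "r > 0" "ball x r \<subseteq> ?X (c x)" by (rule openE[OF c])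
    have near: "y \<in> ?X (c x)" if "norm (y - x) < r" for y
    proof -
      have "y \<in> ball x r" using that by (simp add: dist_norm norm_minus_commute)
      then show ?thesis using r(2) by (rule subsetD[rotated])
    qed
    show "\<exists>d>0. \<forall>y\<in>S. norm (y - x) < d \<longrightarrow> (\<forall>vs. length vs = k \<longrightarrow>
         norm (?D k y vs - ?D k x vs - ?D (Suc k) x ((y - x) # vs)) \<le> e * norm (y - x) * prod_list (map norm vs))"
    proof (intro exI[of _ "min d r"] conjI ballI impI allI)
      fix y and vs :: "'a list" assume y: "norm (y - x) < min d r" "length vs = k"
      then have yX: "y \<in> ?X (c x)" using near by simp
      then have "c y = c x" by simp
      with d(2)[OF yX _ y(2)] y(1) show "norm (?D k y vs - ?D k x vs - ?D (Suc k) x ((y - x) # vs))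
          \<le> e * norm (y - x) * prod_list (map norm vs)" by simp
    qed (use d(1) r(1) in simp)
  qed
  show ?thesis
    by (rule smooth_on_coinduct[OF S, where P = "\<lambda>k T. T = ?D k" and ?T0.0 = "?D 0"]) (use D fd in auto)
qed

section \<open>Orthogonal actions as isometric actions on spheres\<close>

text \<open>
  The derivative along the sphere depends only on the values on the sphere: both sides are the velocity at
  \<open>x\<close> of the image of the great circle in the direction of \<open>u\<close>, if \<open>u\<close> is a unit vector.
\<close>

lemma smooth_extension_tangential_derivative:
  fixes x u :: "'h::real_inner"
  assumes H: "subspace H" and x: "x \<in> unit_sphere H" and u: "u \<in> sphere_tangent H x"
    and F: "smooth_extension_at (unit_sphere H) f x F" and L: "bounded_linear L"
    and fL: "\<And>y. y \<in> unit_sphere H \<Longrightarrow> f y = L y"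
  shows "frechet_derivative F (at x) u = L u"
proof -
  let ?F' = "frechet_derivative F (at x)"
  obtain W where W: "x \<in> W" "smooth_on W F" "\<And>y. y \<in> W \<Longrightarrow> y \<in> unit_sphere H \<Longrightarrow> F y = f y"
    using F unfolding smooth_extension_at_def by blast
  have "open W" using W(2) by (simp add: smooth_on_def)
  have F': "(F has_derivative ?F') (at x)" using smooth_on_has_derivative W by blast
  have main: "?F' w = L w" if w: "w \<in> H" "inner x w = 0" "norm w = 1" for w
  proof -
    define c where "c t = cos t *\<^sub>R x + sin t *\<^sub>R w" for t
    have nx: "norm x = 1" "x \<in> H" using x by (auto simp: unit_sphere_def)
    have cS: "c t \<in> unit_sphere H" for t
      using great_circle(1)[OF nx(1) w(3,2)] nx w H
      by (simp add: unit_sphere_def c_def subspace_add subspace_scale)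
    have c': "(c has_vector_derivative w) (at 0)" and c0: "c 0 = x"
      using great_circle(2)[OF nx(1) w(3,2), of 0] by (simp_all add: c_def[abs_def])
    have der: "((D \<circ> c) has_derivative (\<lambda>s. s *\<^sub>R D' w)) (at 0)" if D: "(D has_derivative D') (at x)" for D D' :: "'h \<Rightarrow> 'h"
    proof -
      have D0: "(D has_derivative D') (at (c 0))" using D c0 by simp
      have "((D \<circ> c) has_derivative (D' \<circ> (\<lambda>s. s *\<^sub>R w))) (at 0)"
        using c' unfolding has_vector_derivative_def by (rule diff_chain_at) (rule D0)
      moreover have "(D' \<circ> (\<lambda>s. s *\<^sub>R w)) = (\<lambda>s. s *\<^sub>R D' w)"
        using linear_scale[OF has_derivative_linear[OF D]] by auto
      ultimately show ?thesis by simp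
    qed
    have "isCont c 0" using c' has_vector_derivative_continuous by blast
    then have "eventually (\<lambda>s. c s \<in> W) (nhds 0)"
      using \<open>open W\<close> W(1) c0 by (simp add: continuous_at tendsto_def isCont_def eventually_nhds_conv_at)
    then have ev: "eventually (\<lambda>s. (F \<circ> c) s = (L \<circ> c) s) (nhds 0)"
      by (rule eventually_mono) (use W(3) cS fL in auto)
    have "((L \<circ> c) has_derivative (\<lambda>s. s *\<^sub>R ?F' w)) (at 0)"
      using has_derivative_transform_eventually[OF der[OF F']] ev
      by (auto simp: eventually_nhds_conv_at)
    then have "(\<lambda>s. s *\<^sub>R ?F' w) = (\<lambda>s::real. s *\<^sub>R L w)"
      using der[OF bounded_linear_imp_has_derivative[OF L]] has_derivative_unique by blast
    from fun_cong[OF this, of 1] show ?thesis by simp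
  qed
  show ?thesis
  proof (cases "u = 0")
    case True
    then show ?thesis using linear_0[OF has_derivative_linear[OF F']] linear_0[OF bounded_linear.linear[OF L]] by simp
  next
    case False
    have "?F' (sgn u) = L (sgn u)"
      using False u H by (intro main) (auto simp: sphere_tangent_def sgn_div_norm subspace_scale)
    then show ?thesis
      using False linear_scale[OF has_derivative_linear[OF F']] linear_scale[OF bounded_linear.linear[OF L]]
      by (simp add: sgn_div_norm)
  qed
qed

context free_orthogonal_action
begin

lemma norm_T: "g \<in> carrier G \<Longrightarrow> x \<in> H \<Longrightarrow> norm (T g x) = norm x"
  using inner_T[of g x x] by (simp add: norm_eq_sqrt_inner)

lemma dist_T:
  assumes "subspace H" "g \<in> carrier G" "x \<in> H" "y \<in> H"
  shows "dist (T g x) (T g y) = dist x y"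
  using norm_T[of g "x - y"] assms linear_diff[OF bounded_linear.linear[OF bounded_linear_T[OF assms(2)]], of x y]
  by (simp add: dist_norm subspace_diff)

lemma T_inv: "g \<in> carrier G \<Longrightarrow> x \<in> H \<Longrightarrow> T (inv g) (T g x) = x" "g \<in> carrier G \<Longrightarrow> x \<in> H \<Longrightarrow> T g (T (inv g) x) = x"
  using T_mult[of "inv g" g x] T_mult[of g "inv g" x] by (simp_all add: T_one)

lemma T_sphere: "g \<in> carrier G \<Longrightarrow> x \<in> unit_sphere H \<Longrightarrow> T g x \<in> unit_sphere H"
  by (simp add: unit_sphere_def T_in norm_T)

lemma bij_betw_T_sphere: "g \<in> carrier G \<Longrightarrow> bij_betw (T g) (unit_sphere H) (unit_sphere H)"
  by (rule bij_betw_byWitness[where f' = "T (inv g)"]) (auto simp: T_sphere, auto simp: T_inv unit_sphere_def)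

lemma T_eq_iff:
  assumes "g \<in> carrier G" "h \<in> carrier G" "x \<in> H" "x \<noteq> 0"
  shows "T g x = T h x \<longleftrightarrow> g = h"
proof
  assume "T g x = T h x"
  then have "T (inv h \<otimes> g) x = x" using assms by (simp add: T_mult T_inv)
  then have "inv h \<otimes> g = \<one>" using T_free[of "inv h \<otimes> g" x] assms by simp
  then show "g = h" using assms(1,2) by (metis inv_equality inv_inv inv_closed)
qed simp

text \<open>Only finitely many translates of \<open>x\<close> come near \<open>y\<close>, so all those that differ from \<open>y\<close> keep a distance.\<close>

lemma orbit_separated:
  assumes x: "x \<in> unit_sphere H" and y: "y \<in> unit_sphere H"
  obtains \<delta> where "\<delta> > 0" "\<And>g. g \<in> carrier G \<Longrightarrow> T g x \<noteq> y \<Longrightarrow> \<delta> \<le> dist (T g x) y"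
proof -
  define D where "D = insert 1 ((\<lambda>g. dist (T g x) y) ` {g \<in> carrier G. T g x \<noteq> y \<and> dist (T g x) y < 1})"
  have "{g \<in> carrier G. T g x \<noteq> y \<and> dist (T g x) y < 1} \<subseteq> {g \<in> carrier G. dist (T g x) y < 1}" by blast
  then have fin: "finite D"
    unfolding D_def using finite_near[of x y] x y by (auto simp: unit_sphere_def intro: finite_subset)
  show ?thesis
  proof
    show "Min D > 0" using fin by (auto simp: D_def)
    fix g assume g: "g \<in> carrier G" "T g x \<noteq> y"
    show "Min D \<le> dist (T g x) y"
    proof (cases "dist (T g x) y < 1")
      case True
      then show ?thesis using fin g by (intro Min_le) (auto simp: D_def)
    next
      case False
      moreover have "Min D \<le> 1" using fin by (intro Min_le) (auto simp: D_def)
      ultimately show ?thesis by simp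
    qed
  qed
qed

text \<open>
  Group actions take values in the bijections of the sphere that are extensional, hence the restriction.
\<close>

definition sphere_action :: "'g \<Rightarrow> 'h \<Rightarrow> 'h" where
  "sphere_action g = restrict (T g) (unit_sphere H)"

lemma sphere_action_eq: "x \<in> unit_sphere H \<Longrightarrow> sphere_action g x = T g x"
  by (simp add: sphere_action_def)

lemma group_action_sphere: "group_action G (unit_sphere H) sphere_action"
proof -
  have bij: "sphere_action g \<in> Bij (unit_sphere H)" if "g \<in> carrier G" for g
    using bij_betw_T_sphere[OF that] by (simp add: Bij_def sphere_action_def bij_betw_cong[of _ "restrict (T g) _" "T g"])
  have "sphere_action \<in> hom G (BijGroup (unit_sphere H))"
  proof (rule homI)
    fix g h assume gh: "g \<in> carrier G" "h \<in> carrier G"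
    have "sphere_action (g \<otimes> h) = compose (unit_sphere H) (sphere_action g) (sphere_action h)"
    proof (rule extensionalityI[of _ "unit_sphere H"])
      fix x assume x: "x \<in> unit_sphere H"
      then have "x \<in> H" by (simp add: unit_sphere_def)
      then show "sphere_action (g \<otimes> h) x = compose (unit_sphere H) (sphere_action g) (sphere_action h) x"
        using x gh by (simp add: compose_eq sphere_action_eq T_sphere T_mult)
    qed (simp_all add: sphere_action_def)
    then show "sphere_action (g \<otimes> h) = sphere_action g \<otimes>\<^bsub>BijGroup (unit_sphere H)\<^esub> sphere_action h"
      using bij gh by (simp add: BijGroup_def)
  qed (simp add: BijGroup_def bij)
  then show ?thesis
    by (simp add: group_action_def group_hom_def group_hom_axioms_def group_BijGroup is_group)
qed

lemma stabilizer_sphere_action: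
  assumes "x \<in> unit_sphere H" shows "stabilizer G sphere_action x = {\<one>}"
proof -
  have x: "x \<in> H" "x \<noteq> 0" using assms by (auto simp: unit_sphere_def)
  then show ?thesis
    using assms T_free[OF _ x] T_one[OF x(1)] by (auto simp: stabilizer_def sphere_action_eq)
qed

lemma isometry_sphere_action:
  assumes H: "subspace H" and g: "g \<in> carrier G"
  shows "riemannian_sphere_isometry H (sphere_action g)"
proof -
  let ?S = "unit_sphere H"
  have SH: "x \<in> H" if "x \<in> ?S" for x using that by (simp add: unit_sphere_def)
  have smooth: "smooth_self_map ?S f" if h: "h \<in> carrier G" and f: "\<And>x. x \<in> ?S \<Longrightarrow> f x = T h x" for f h
    unfolding smooth_self_map_def
  proof (intro conjI ballI)
    show "f ` ?S \<subseteq> ?S" using f T_sphere[OF h] by auto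
    fix x
    have "smooth_on UNIV (T h)"
      by (rule rational_map_on_imp_smooth_on) (simp_all add: rational_map_on_linear bounded_linear_T[OF h])
    then show "\<exists>F. smooth_extension_at ?S f x F"
      unfolding smooth_extension_at_def using f by (intro exI[of _ "T h"] exI[of _ UNIV]) auto
  qed
  have bij: "bij_betw (sphere_action g) ?S ?S"
    using bij_betw_T_sphere[OF g] by (simp add: bij_betw_cong[OF sphere_action_eq])
  have inv: "inv_into ?S (sphere_action g) x = T (inv g) x" if x: "x \<in> ?S" for x
  proof (rule inv_into_f_eq)
    show "inj_on (sphere_action g) ?S" using bij by (rule bij_betw_imp_inj_on)
    show Tx: "T (inv g) x \<in> ?S" using T_sphere g x by simp
    show "sphere_action g (T (inv g) x) = x" using T_inv(2)[OF g SH[OF x]] Tx by (simp add: sphere_action_eq)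
  qed
  show ?thesis
    unfolding riemannian_sphere_isometry_def Let_def
  proof (intro conjI ballI allI impI bij)
    show "smooth_self_map ?S (sphere_action g)" using smooth[OF g] sphere_action_eq by blast
    show "smooth_self_map ?S (inv_into ?S (sphere_action g))" using smooth[of "inv g"] inv g by blast
    fix x F u v assume x: "x \<in> ?S" and F: "smooth_extension_at ?S (sphere_action g) x F"
      and u: "u \<in> sphere_tangent H x" and v: "v \<in> sphere_tangent H x"
    have d: "frechet_derivative F (at x) w = T g w" if "w \<in> sphere_tangent H x" for w
      by (rule smooth_extension_tangential_derivative[OF H x that F bounded_linear_T[OF g] sphere_action_eq])
    show "inner (frechet_derivative F (at x) u) (frechet_derivative F (at x) v) = inner u v"
      unfolding d[OF u] d[OF v] by (rule inner_T[OF g]) (use u v in \<open>auto simp: sphere_tangent_def\<close>)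
  qed
qed

text \<open>
  If \<open>T g x\<close> and \<open>y\<close> have distance at least \<open>\<delta>\<close>, then \<open>g\<close> carries the ball of radius \<open>\<delta> / 2\<close> around
  \<open>x\<close> off the one around \<open>y\<close>; such \<open>\<delta>\<close> exist uniformly in \<open>g\<close> by \<open>orbit_separated\<close>.
\<close>

lemma properly_discontinuous_sphere_action:
  assumes H: "subspace H"
  shows "properly_discontinuous_action G (top_of_set (unit_sphere H)) sphere_action"
proof -
  let ?S = "unit_sphere H" and ?X = "top_of_set (unit_sphere H)"
  have SH: "x \<in> H" if "x \<in> ?S" for x using that by (simp add: unit_sphere_def)
  have nb: "neighbourhood_of ?X x (?S \<inter> ball x r)" if "x \<in> ?S" "r > 0" for x r
    unfolding neighbourhood_of_def using that by (auto intro!: exI[of _ "?S \<inter> ball x r"])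
  have disj: "sphere_action g ` (?S \<inter> ball x (\<delta> / 2)) \<inter> (?S \<inter> ball y (\<delta> / 2)) = {}"
    if g: "g \<in> carrier G" and d: "\<delta> \<le> dist (T g x) y" and x: "x \<in> ?S" for g x y \<delta>
  proof -
    have False if z: "z \<in> ?S" "dist x z < \<delta> / 2" "dist y (T g z) < \<delta> / 2" for z
    proof -
      have "dist (T g x) (T g z) < \<delta> / 2" using dist_T[OF H g SH[OF x] SH[OF z(1)]] z(2) by simp
      then have "dist (T g x) y < \<delta>" using z(3) dist_triangle_half_r[of "T g z"] by (simp add: dist_commute)
      with d show False by simp
    qed
    then show ?thesis by (auto simp: sphere_action_eq)
  qed
  show ?thesis
    unfolding properly_discontinuous_action_def topspace_euclidean_subtopology
  proof (intro conjI ballI impI)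
    fix x y assume x: "x \<in> ?S" and y: "y \<in> ?S" and no: "y \<notin> orbit G sphere_action x"
    obtain \<delta> where d: "\<delta> > 0" "\<And>g. g \<in> carrier G \<Longrightarrow> T g x \<noteq> y \<Longrightarrow> \<delta> \<le> dist (T g x) y"
      using orbit_separated[OF x y] by blast
    have "T g x \<noteq> y" if "g \<in> carrier G" for g
      using no that x by (auto simp: orbit_def sphere_action_eq)
    then show "\<exists>U V. neighbourhood_of ?X x U \<and> neighbourhood_of ?X y V \<and>
        (\<forall>g\<in>carrier G. sphere_action g ` U \<inter> V = {})"
      using d x y by (intro exI[of _ "?S \<inter> ball x (\<delta> / 2)"] exI[of _ "?S \<inter> ball y (\<delta> / 2)"] conjI nb ballI disj) auto
  next
    fix x assume x: "x \<in> ?S"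
    then show "finite (stabilizer G sphere_action x)" by (simp add: stabilizer_sphere_action)
    obtain \<delta> where d: "\<delta> > 0" "\<And>g. g \<in> carrier G \<Longrightarrow> T g x \<noteq> x \<Longrightarrow> \<delta> \<le> dist (T g x) x"
      using orbit_separated[OF x x] by blast
    have "x \<in> H" "x \<noteq> 0" using x by (auto simp: unit_sphere_def)
    then have "T g x \<noteq> x" if "g \<in> carrier G" "g \<noteq> \<one>" for g
      using T_free[of g x] that by blast
    moreover have "sphere_action \<one> ` U = U" if "U \<subseteq> ?S" for U
    proof -
      have "sphere_action \<one> y = y" if "y \<in> U" for y
        using that \<open>U \<subseteq> ?S\<close> SH by (auto simp: sphere_action_eq T_one subset_iff)
      then show ?thesis by simp
    qed
    ultimately show "\<exists>U. neighbourhood_of ?X x U \<and>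
        (\<forall>g\<in>stabilizer G sphere_action x. sphere_action g ` U = U) \<and>
        (\<forall>g\<in>carrier G - stabilizer G sphere_action x. sphere_action g ` U \<inter> U = {})"
      unfolding stabilizer_sphere_action[OF x]
      using d x by (intro exI[of _ "?S \<inter> ball x (\<delta> / 2)"] conjI nb ballI disj) auto
  qed
qed

lemma acts_freely_isometrically_pd:
  assumes "subspace H" shows "acts_freely_isometrically_pd_on_sphere G H"
  unfolding acts_freely_isometrically_pd_on_sphere_def free_action_def
  using group_action_sphere stabilizer_sphere_action isometry_sphere_action[OF assms]
    properly_discontinuous_sphere_action[OF assms] by blast

end

section \<open>Stereographic coordinates on the unit sphere of \<open>l\<^sub>2\<close>\<close>

lift_definition l2_e0 :: l2 is "\<lambda>n. if n = 0 then 1 else 0"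
  by (rule summable_finite[of "{0}"]) auto

lift_definition l2_shift :: "l2 \<Rightarrow> l2" is "\<lambda>f n. case n of 0 \<Rightarrow> 0 | Suc m \<Rightarrow> f m"
  by (subst summable_Suc_iff[symmetric]) simp

lift_definition l2_unshift :: "l2 \<Rightarrow> l2" is "\<lambda>f n. f (Suc n)"
  by (subst summable_Suc_iff[where f = "\<lambda>n. (f n)\<^sup>2" for f]) simp

lemma l2_eqI: "(\<And>n. l2_nth x n = l2_nth y n) \<Longrightarrow> x = y"
  by (metis ext l2_nth_inject)

lemma l2_nth_simps [simp]:
  "l2_nth l2_e0 n = (if n = 0 then 1 else 0)"
  "l2_nth (l2_shift x) n = (case n of 0 \<Rightarrow> 0 | Suc m \<Rightarrow> l2_nth x m)"
  "l2_nth (l2_unshift x) n = l2_nth x (Suc n)"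
  "l2_nth (x + y) n = l2_nth x n + l2_nth y n"
  "l2_nth (r *\<^sub>R x) n = r * l2_nth x n"
  by (simp_all add: l2_e0.rep_eq l2_shift.rep_eq l2_unshift.rep_eq plus_l2.rep_eq scaleR_l2.rep_eq)

lemma inner_l2_e0: "inner l2_e0 x = l2_nth x 0"
proof -
  have "(\<lambda>n. l2_nth l2_e0 n * l2_nth x n) sums (\<Sum>n\<in>{0}. l2_nth l2_e0 n * l2_nth x n)"
    by (rule sums_finite) auto
  then show ?thesis by (simp add: inner_l2_def sums_iff)
qed

lemma norm_l2_e0 [simp]: "norm l2_e0 = 1"
  by (simp add: norm_eq_1 inner_l2_e0)

lemma inner_l2_shift [simp]: "inner (l2_shift x) (l2_shift y) = inner x y"
proof -
  have "summable (\<lambda>n. l2_nth (l2_shift x) n * l2_nth (l2_shift y) n)"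
    by (intro summable_mult_of_squares summable_l2_nth)
  from suminf_split_head[OF this] show ?thesis by (simp add: inner_l2_def)
qed

lemma inner_l2_e0_shift [simp]: "inner l2_e0 (l2_shift x) = 0" "inner (l2_shift x) l2_e0 = 0"
  using inner_l2_e0[of "l2_shift x"] by (simp_all add: inner_commute)

lemma l2_unshift_shift [simp]: "l2_unshift (l2_shift x) = x" "l2_unshift l2_e0 = 0"
  by (auto intro!: l2_eqI simp: zero_l2.rep_eq)

lemma l2_shift_decomp: "x = inner l2_e0 x *\<^sub>R l2_e0 + l2_shift (l2_unshift x)"
  by (rule l2_eqI) (simp add: inner_l2_e0 split: nat.split)

lemma linear_l2_shift: "linear l2_shift" "linear l2_unshift"
  by (auto intro!: linearI l2_eqI split: nat.split)

lemma bounded_linear_l2_shift: "bounded_linear l2_shift" "bounded_linear l2_unshift"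
proof -
  have 1: "norm (l2_shift x) \<le> norm x * 1" for x by (simp add: norm_eq_sqrt_inner)
  have 2: "norm (l2_unshift x) \<le> norm x * 1" for x
  proof -
    let ?z = "l2_shift (l2_unshift x)"
    have "inner x x = (inner l2_e0 x)\<^sup>2 + inner ?z ?z"
      by (subst (1 2) l2_shift_decomp[of x])
         (simp add: inner_add_left inner_add_right power2_eq_square norm_eq_1[THEN iffD1])
    then have "inner (l2_unshift x) (l2_unshift x) \<le> inner x x" by simp
    then show ?thesis by (simp add: norm_eq_sqrt_inner)
  qed
  show "bounded_linear l2_shift" "bounded_linear l2_unshift"
    using linear_l2_shift 1 2 unfolding bounded_linear_def bounded_linear_axioms_def by blast+
qed

lemma square_one_mult_eq_one:
  fixes s w :: real
  assumes "s\<^sup>2 = 1" shows "s * w = 1 \<longleftrightarrow> w = s"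
proof
  assume "s * w = 1"
  then have "s\<^sup>2 * w = s" by (simp add: power2_eq_square)
  with assms show "w = s" by simp
qed (use assms in \<open>simp add: power2_eq_square\<close>)

text \<open>
  Stereographic projection from the pole \<open>s e\<^sub>0\<close>, where \<open>s = 1\<close> or \<open>s = -1\<close>. The shift identifies \<open>l\<^sub>2\<close>
  with the hyperplane orthogonal to \<open>e\<^sub>0\<close>, so that the charts take values in all of \<open>l\<^sub>2\<close>. The numerator of the
  inverse is separated because it is quadratic.
\<close>

definition stereo_num :: "real \<Rightarrow> l2 \<Rightarrow> l2" where
  "stereo_num s x = 2 *\<^sub>R l2_shift x + (s * (inner x x - 1)) *\<^sub>R l2_e0"

definition stereo_inv :: "real \<Rightarrow> l2 \<Rightarrow> l2" where
  "stereo_inv s x = inverse (1 + inner x x) *\<^sub>R stereo_num s x"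

definition stereo :: "real \<Rightarrow> l2 \<Rightarrow> l2" where
  "stereo s y = inverse (1 - s * inner l2_e0 y) *\<^sub>R l2_unshift y"

lemma one_add_inner_pos: "1 + inner x x > 0" for x :: "'a::real_inner"
  by (simp add: add_pos_nonneg)

lemma one_add_inner_neq: "1 + inner x x \<noteq> 0" for x :: "'a::real_inner"
  using one_add_inner_pos[of x] by simp

lemma inner_stereo_num:
  assumes "s\<^sup>2 = 1"
  shows "inner (stereo_num s x) (stereo_num s y) = 4 * inner x y + (inner x x - 1) * (inner y y - 1)"
proof -
  have e: "inner l2_e0 l2_e0 = 1" using norm_eq_1[of l2_e0] by simp
  have "inner (stereo_num s x) (stereo_num s y) = 4 * inner x y + (s * (inner x x - 1)) * (s * (inner y y - 1))"
    by (simp add: stereo_num_def inner_add_left inner_add_right e)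
  also have "(s * (inner x x - 1)) * (s * (inner y y - 1)) = s\<^sup>2 * ((inner x x - 1) * (inner y y - 1))"
    by (simp add: power2_eq_square)
  finally show ?thesis using assms by simp
qed

lemma inner_stereo_inv:
  assumes "s\<^sup>2 = 1"
  shows "inner (stereo_inv s x) (stereo_inv s y)
    = (4 * inner x y + (inner x x - 1) * (inner y y - 1)) / ((1 + inner x x) * (1 + inner y y))"
  by (simp add: stereo_inv_def inner_stereo_num[OF assms] divide_inverse)

lemma norm_stereo_inv:
  assumes "s\<^sup>2 = 1" shows "norm (stereo_inv s x) = 1"
proof -
  have "4 * inner x x + (inner x x - 1) * (inner x x - 1) = (1 + inner x x) * (1 + inner x x)"
    by (simp add: algebra_simps)
  then show ?thesis
    using one_add_inner_neq[of x] by (simp add: norm_eq_1 inner_stereo_inv[OF assms])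
qed

text \<open>The classical expression of the chordal distance in stereographic coordinates.\<close>

lemma chordal_distance:
  assumes "s\<^sup>2 = 1"
  shows "(dist (stereo_inv s x) (stereo_inv s y))\<^sup>2 = 4 * (dist x y)\<^sup>2 / ((1 + inner x x) * (1 + inner y y))"
proof -
  let ?P = "(1 + inner x x) * (1 + inner y y)"
  have P: "?P \<noteq> 0" using one_add_inner_neq[of x] one_add_inner_neq[of y] by simp
  have "(dist (stereo_inv s x) (stereo_inv s y))\<^sup>2 = 2 - 2 * inner (stereo_inv s x) (stereo_inv s y)"
    using norm_stereo_inv[OF assms, of x] norm_stereo_inv[OF assms, of y]
    unfolding dist_norm power2_norm_eq_inner
    by (simp add: inner_diff_left inner_diff_right norm_eq_1 inner_commute)
  also have "\<dots> = (2 * ?P - 2 * (4 * inner x y + (inner x x - 1) * (inner y y - 1))) / ?P"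
    unfolding inner_stereo_inv[OF assms] using P by (simp only: diff_divide_distrib) simp
  also have "2 * ?P - 2 * (4 * inner x y + (inner x x - 1) * (inner y y - 1)) = 4 * (dist x y)\<^sup>2"
    unfolding dist_norm power2_norm_eq_inner
    by (simp add: algebra_simps inner_diff_left inner_diff_right inner_commute)
  finally show ?thesis .
qed

lemma inner_e0_stereo_inv: "inner l2_e0 (stereo_inv s x) = s * (inner x x - 1) / (1 + inner x x)"
  using norm_eq_1[of l2_e0] by (simp add: stereo_inv_def stereo_num_def inner_add_right divide_inverse)

lemma stereo_stereo_inv:
  assumes "s\<^sup>2 = 1" shows "stereo s (stereo_inv s x) = x"
proof -
  have "1 - s * inner l2_e0 (stereo_inv s x) = 1 - (s * s) * (inner x x - 1) / (1 + inner x x)"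
    by (simp add: inner_e0_stereo_inv)
  also have "\<dots> = 2 / (1 + inner x x)"
    using assms one_add_inner_neq[of x] by (simp add: power2_eq_square field_simps)
  finally have d: "1 - s * inner l2_e0 (stereo_inv s x) = 2 / (1 + inner x x)" .
  have "l2_unshift (stereo_inv s x) = (2 / (1 + inner x x)) *\<^sub>R x"
    by (simp add: stereo_inv_def stereo_num_def linear_add[OF linear_l2_shift(2)] linear_scale[OF linear_l2_shift(2)] divide_inverse)
  moreover have "2 / (1 + inner x x) \<noteq> 0" using one_add_inner_neq[of x] by simp
  ultimately show ?thesis unfolding stereo_def d by (simp only: scaleR_scaleR left_inverse scaleR_one not_False_eq_True)
qed

lemma stereo_inv_stereo:
  assumes s: "s\<^sup>2 = 1" and y: "norm y = 1" "inner l2_e0 y \<noteq> s"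
  shows "stereo_inv s (stereo s y) = y"
proof -
  let ?w = "inner l2_e0 y"
  have d: "1 - s * ?w \<noteq> 0" using square_one_mult_eq_one[OF s, of ?w] y(2) by simp
  have "inner y y = ?w\<^sup>2 + inner (l2_unshift y) (l2_unshift y)"
    by (subst (1 2) l2_shift_decomp[of y])
       (use norm_eq_1[of l2_e0] in \<open>simp add: inner_add_left inner_add_right power2_eq_square\<close>)
  then have "inner (l2_unshift y) (l2_unshift y) = 1 - ?w\<^sup>2" using y(1) by (simp add: norm_eq_1)
  also have "\<dots> = 1 - s\<^sup>2 * ?w\<^sup>2" using s by simp
  also have "\<dots> = (1 - s * ?w) * (1 + s * ?w)"
    by (simp add: algebra_simps power2_eq_square)
  finally have un: "inner (l2_unshift y) (l2_unshift y) = (1 - s * ?w) * (1 + s * ?w)" .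
  define c where "c = 1 - s * ?w"
  have c: "c \<noteq> 0" using d by (simp add: c_def)
  have sw: "s * ?w = 1 - c" by (simp add: c_def)
  have st: "stereo s y = inverse c *\<^sub>R l2_unshift y" by (simp add: stereo_def c_def)
  have sh: "2 *\<^sub>R l2_shift (stereo s y) = (2 / c) *\<^sub>R l2_shift (l2_unshift y)"
    unfolding st by (simp only: linear_scale[OF linear_l2_shift(1)] scaleR_scaleR divide_inverse)
  have "inner (stereo s y) (stereo s y) = inverse c * inverse c * (c * (1 + s * ?w))"
    unfolding un[folded c_def, symmetric] by (simp add: stereo_def c_def)
  also have "\<dots> = (2 - c) / c" unfolding sw using c by (simp add: divide_inverse)
  finally have n: "inner (stereo s y) (stereo s y) = (2 - c) / c" .
  have 1: "1 + inner (stereo s y) (stereo s y) = 2 / c"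
    and 2: "inner (stereo s y) (stereo s y) - 1 = 2 * (s * ?w) / c"
    unfolding n sw using c by (simp_all add: field_simps)
  have "stereo_inv s (stereo s y) = (c / 2) *\<^sub>R ((2 / c) *\<^sub>R l2_shift (l2_unshift y) + (s * (2 * (s * ?w) / c)) *\<^sub>R l2_e0)"
    unfolding stereo_inv_def stereo_num_def 1 2 sh by (simp only: inverse_divide)
  also have "\<dots> = ((c / 2) * (2 / c)) *\<^sub>R l2_shift (l2_unshift y) + ((c / 2) * (s * (2 * (s * ?w) / c))) *\<^sub>R l2_e0"
    by (simp only: scaleR_add_right scaleR_scaleR)
  also have "(c / 2) * (2 / c) = 1" using c by simp
  also have "(c / 2) * (s * (2 * (s * ?w) / c)) = s\<^sup>2 * ?w" using c by (simp add: power2_eq_square)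
  also have "1 *\<^sub>R l2_shift (l2_unshift y) + (s\<^sup>2 * ?w) *\<^sub>R l2_e0 = y"
    using s l2_shift_decomp[of y] by (simp add: add.commute)
  finally show ?thesis .
qed

lemma continuous_on_stereo_inv: "continuous_on A (stereo_inv s)"
  unfolding stereo_inv_def stereo_num_def
  by (intro continuous_intros bounded_linear.continuous_on[OF bounded_linear_l2_shift(1)]) (simp add: one_add_inner_neq)

lemma continuous_on_stereo: "s\<^sup>2 = 1 \<Longrightarrow> (\<And>y. y \<in> A \<Longrightarrow> inner l2_e0 y \<noteq> s) \<Longrightarrow> continuous_on A (stereo s)"
  unfolding stereo_def
proof (intro continuous_intros bounded_linear.continuous_on[OF bounded_linear_l2_shift(2)] ballI)
  fix y assume s: "s\<^sup>2 = 1" and "\<And>y. y \<in> A \<Longrightarrow> inner l2_e0 y \<noteq> s" "y \<in> A"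
  then show "1 - s * inner l2_e0 y \<noteq> 0" using square_one_mult_eq_one[OF s, of "inner l2_e0 y"] by auto
qed

text \<open>
  Coordinate changes between stereographic charts that are rotated against each other are rational:
  the two factors \<open>1 + x \<bullet> x\<close> cancel.
\<close>

lemma smooth_on_stereo_linear_stereo_inv:
  assumes V: "open V" and L: "bounded_linear L" and s: "t\<^sup>2 = 1"
    and ne: "\<And>x. x \<in> V \<Longrightarrow> inner l2_e0 (L (stereo_inv s x)) \<noteq> t"
  shows "smooth_on V (\<lambda>x. stereo t (L (stereo_inv s x)))"
proof -
  let ?d = "\<lambda>x. (1 + inner x x) + (- t) * inner l2_e0 (L (stereo_num s x))"
  have q: "rational_on V (\<lambda>x. 1 + inner x x)" by (intro rational_on_add rational_on_const rational_on_inner_self)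
  have num: "rational_map_on V (stereo_num s)"
  proof -
    have "rational_map_on V (\<lambda>x. 2 *\<^sub>R l2_shift x + (s * (inner x x + (-1))) *\<^sub>R l2_e0)"
      by (intro rational_map_on_add rational_map_on_scaleR rational_on_const rational_map_on_linear
          bounded_linear_l2_shift rational_map_on_const rational_on_mult rational_on_add rational_on_inner_self)
    then show ?thesis by (simp add: stereo_num_def[abs_def])
  qed
  have lin: "L (stereo_num s x) = 2 *\<^sub>R L (l2_shift x) + (s * (inner x x + (-1))) *\<^sub>R L l2_e0" for x
    by (simp add: stereo_num_def linear_add[OF bounded_linear.linear[OF L]] linear_scale[OF bounded_linear.linear[OF L]])
  have e0: "rational_on V (\<lambda>x. inner l2_e0 (L (stereo_num s x)))"
  proof -
    have "rational_on V (\<lambda>x. 2 * inner l2_e0 (L (l2_shift x)) + (s * (inner x x + (-1))) * inner l2_e0 (L l2_e0))"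
      by (intro rational_on_mult rational_on_add rational_on_const rational_on_inner_self rational_on_linear
          bounded_linear_compose[OF bounded_linear_inner_right] bounded_linear_compose[OF L] bounded_linear_l2_shift)
    then show ?thesis by (simp add: lin inner_add_right)
  qed
  have un: "rational_map_on V (\<lambda>x. l2_unshift (L (stereo_num s x)))"
  proof -
    have "rational_map_on V (\<lambda>x. 2 *\<^sub>R l2_unshift (L (l2_shift x)) + (s * (inner x x + (-1))) *\<^sub>R l2_unshift (L l2_e0))"
      by (intro rational_map_on_add rational_map_on_scaleR rational_on_const rational_map_on_linear
          bounded_linear_compose[OF bounded_linear_l2_shift(2)] bounded_linear_compose[OF L] bounded_linear_l2_shift
          rational_map_on_const rational_on_mult rational_on_add rational_on_inner_self)
    then show ?thesis
      by (simp add: lin linear_add[OF linear_l2_shift(2)] linear_scale[OF linear_l2_shift(2)])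
  qed
  have Linv: "L (stereo_inv s x) = inverse (1 + inner x x) *\<^sub>R L (stereo_num s x)" for x
    by (simp add: stereo_inv_def linear_scale[OF bounded_linear.linear[OF L]])
  have d: "1 - t * inner l2_e0 (L (stereo_inv s x)) = ?d x / (1 + inner x x)" for x
    using one_add_inner_neq[of x] by (simp add: Linv field_simps)
  have "?d x \<noteq> 0" if "x \<in> V" for x
  proof
    assume "?d x = 0"
    then have "1 - t * inner l2_e0 (L (stereo_inv s x)) = 0" unfolding d by simp
    with ne[OF that] show False
      using square_one_mult_eq_one[OF s, of "inner l2_e0 (L (stereo_inv s x))"] by simp
  qed
  then have "rational_map_on V (\<lambda>x. inverse (?d x) *\<^sub>R l2_unshift (L (stereo_num s x)))"
    by (intro rational_map_on_scaleR un rational_on_inverse rational_on_add q rational_on_mult rational_on_const e0)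
  moreover have "stereo t (L (stereo_inv s x)) = inverse (?d x) *\<^sub>R l2_unshift (L (stereo_num s x))" for x
    unfolding stereo_def d using one_add_inner_neq[of x]
    by (simp add: Linv linear_scale[OF linear_l2_shift(2)] divide_inverse)
  ultimately show ?thesis using rational_map_on_imp_smooth_on[OF V] by simp
qed

text \<open>
  The metric of the sphere in stereographic coordinates. A map that preserves chordal distances
  preserves this metric, since both sides of the distance formula agree to second order.
\<close>

definition sphere_factor :: "l2 \<Rightarrow> real" where
  "sphere_factor x = 4 / (1 + inner x x)\<^sup>2"

lemma sphere_factor_pos: "sphere_factor x > 0"
  using one_add_inner_pos[of x] by (simp add: sphere_factor_def)

lemma chordal_isometry_derivative:
  fixes \<tau> :: "l2 \<Rightarrow> l2"
  assumes D: "(\<tau> has_derivative D) (at x)"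
    and iso: "eventually (\<lambda>y. (dist (\<tau> x) (\<tau> y))\<^sup>2 / ((1 + inner (\<tau> x) (\<tau> x)) * (1 + inner (\<tau> y) (\<tau> y)))
        = (dist x y)\<^sup>2 / ((1 + inner x x) * (1 + inner y y))) (nhds x)"
  shows "sphere_factor (\<tau> x) * inner (D u) (D v) = sphere_factor x * inner u v"
proof -
  have sq: "sphere_factor (\<tau> x) * (norm (D w))\<^sup>2 = sphere_factor x * (norm w)\<^sup>2" for w
  proof -
    define y where "y t = x + t *\<^sub>R w" for t :: real
    have y': "(y has_vector_derivative w) (at 0)" and y0: "y 0 = x"
      unfolding y_def by (auto intro!: derivative_eq_intros)
    have ycont: "isCont y 0" using y' has_vector_derivative_continuous by blast
    have D0: "(\<tau> has_derivative D) (at (y 0))" using D y0 by simp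
    have "((\<tau> \<circ> y) has_derivative (D \<circ> (\<lambda>s. s *\<^sub>R w))) (at 0)"
      using y' unfolding has_vector_derivative_def by (rule diff_chain_at) (rule D0)
    moreover have "(D \<circ> (\<lambda>s. s *\<^sub>R w)) = (\<lambda>s. s *\<^sub>R D w)"
      using linear_scale[OF has_derivative_linear[OF D]] by auto
    ultimately have \<tau>y': "((\<tau> \<circ> y) has_vector_derivative D w) (at 0)" by (simp add: has_vector_derivative_def)
    then have \<tau>ycont: "((\<lambda>t. \<tau> (y t)) \<longlongrightarrow> \<tau> x) (at 0)"
      using has_vector_derivative_continuous[OF \<tau>y'] y0 by (simp add: isCont_def o_def)
    have yc: "(y \<longlongrightarrow> x) (at 0)" using ycont y0 by (simp add: isCont_def)
    have quot: "((\<lambda>t. norm (\<tau> (y t) - \<tau> x) / \<bar>t\<bar>) \<longlongrightarrow> norm (D w)) (at 0)"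
    proof -
      have "((\<lambda>h. norm ((\<tau> \<circ> y) (0 + h) - (\<tau> \<circ> y) 0 - h *\<^sub>R D w) / norm h) \<longlongrightarrow> 0) (at 0)"
        using \<tau>y' unfolding has_vector_derivative_def has_derivative_at by blast
      then have "((\<lambda>t. norm (\<tau> (y t) - \<tau> x) / \<bar>t\<bar> - norm (D w)) \<longlongrightarrow> 0) (at 0)"
      proof (rule Lim_null_comparison[rotated])
        have "norm (norm (\<tau> (y t) - \<tau> x) / \<bar>t\<bar> - norm (D w)) \<le> norm ((\<tau> \<circ> y) (0 + t) - (\<tau> \<circ> y) 0 - t *\<^sub>R D w) / norm t"
          if "t \<noteq> 0" for t
        proof -
          have "\<bar>norm (\<tau> (y t) - \<tau> x) - norm (t *\<^sub>R D w)\<bar> \<le> norm (\<tau> (y t) - \<tau> x - t *\<^sub>R D w)"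
            by (rule norm_triangle_ineq3)
          then have "\<bar>norm (\<tau> (y t) - \<tau> x) - norm (t *\<^sub>R D w)\<bar> / \<bar>t\<bar> \<le> norm (\<tau> (y t) - \<tau> x - t *\<^sub>R D w) / \<bar>t\<bar>"
            by (rule divide_right_mono) simp
          moreover have "norm (\<tau> (y t) - \<tau> x) / \<bar>t\<bar> - norm (D w) = (norm (\<tau> (y t) - \<tau> x) - norm (t *\<^sub>R D w)) / \<bar>t\<bar>"
            using that by (simp add: diff_divide_distrib)
          ultimately show ?thesis using y0 by (simp add: abs_divide)
        qed
        then show "\<forall>\<^sub>F t in at 0. norm (norm (\<tau> (y t) - \<tau> x) / \<bar>t\<bar> - norm (D w))
            \<le> norm ((\<tau> \<circ> y) (0 + t) - (\<tau> \<circ> y) 0 - t *\<^sub>R D w) / norm t"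
          by (auto simp: eventually_at_filter)
      qed
      then show ?thesis by (simp only: LIM_zero_iff)
    qed
    have "((\<lambda>t. (norm (\<tau> (y t) - \<tau> x) / \<bar>t\<bar>)\<^sup>2 / ((1 + inner (\<tau> x) (\<tau> x)) * (1 + inner (\<tau> (y t)) (\<tau> (y t)))))
        \<longlongrightarrow> (norm (D w))\<^sup>2 / ((1 + inner (\<tau> x) (\<tau> x)) * (1 + inner (\<tau> x) (\<tau> x)))) (at 0)"
      by (intro tendsto_intros quot \<tau>ycont) (simp add: one_add_inner_neq)
    moreover have "((\<lambda>t. (norm w)\<^sup>2 / ((1 + inner x x) * (1 + inner (y t) (y t))))
        \<longlongrightarrow> (norm w)\<^sup>2 / ((1 + inner x x) * (1 + inner x x))) (at 0)"
      by (intro tendsto_intros yc) (simp add: one_add_inner_neq)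
    moreover have "eventually (\<lambda>t. (norm (\<tau> (y t) - \<tau> x) / \<bar>t\<bar>)\<^sup>2 / ((1 + inner (\<tau> x) (\<tau> x)) * (1 + inner (\<tau> (y t)) (\<tau> (y t))))
        = (norm w)\<^sup>2 / ((1 + inner x x) * (1 + inner (y t) (y t)))) (at 0)"
    proof -
      have ev: "eventually (\<lambda>t. (dist (\<tau> x) (\<tau> (y t)))\<^sup>2 / ((1 + inner (\<tau> x) (\<tau> x)) * (1 + inner (\<tau> (y t)) (\<tau> (y t))))
        = (dist x (y t))\<^sup>2 / ((1 + inner x x) * (1 + inner (y t) (y t)))) (at 0)"
        using filterlim_iff[THEN iffD1, OF yc, rule_format, OF iso] .
      moreover have "eventually (\<lambda>t::real. t \<noteq> 0) (at 0)" by (simp add: eventually_at_filter)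
      ultimately show ?thesis
      proof eventually_elim
        case (elim t)
        have "(norm (\<tau> (y t) - \<tau> x) / \<bar>t\<bar>)\<^sup>2 = (dist (\<tau> x) (\<tau> (y t)))\<^sup>2 / t\<^sup>2"
          by (simp add: dist_norm norm_minus_commute power_divide)
        moreover have "(norm w)\<^sup>2 = (dist x (y t))\<^sup>2 / t\<^sup>2"
          using elim(2) by (simp add: dist_norm y_def power_mult_distrib)
        ultimately show ?case using elim(1) by (simp only: divide_divide_eq_left mult.commute[of "t\<^sup>2"]) (simp only: divide_divide_eq_left[symmetric])
      qed
    qed
    ultimately have "(norm (D w))\<^sup>2 / ((1 + inner (\<tau> x) (\<tau> x)) * (1 + inner (\<tau> x) (\<tau> x)))
        = (norm w)\<^sup>2 / ((1 + inner x x) * (1 + inner x x))"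
      by (intro tendsto_unique[OF trivial_limit_at]) (auto intro: Lim_transform_eventually)
    then show ?thesis by (simp add: sphere_factor_def power2_eq_square)
  qed
  have pol: "inner a b = ((norm (a + b))\<^sup>2 - (norm a)\<^sup>2 - (norm b)\<^sup>2) / 2" for a b :: l2
    unfolding power2_norm_eq_inner by (simp add: inner_add_left inner_add_right inner_commute)
  have "sphere_factor (\<tau> x) * inner (D u) (D v)
      = (sphere_factor (\<tau> x) * (norm (D (u + v)))\<^sup>2 - sphere_factor (\<tau> x) * (norm (D u))\<^sup>2 - sphere_factor (\<tau> x) * (norm (D v))\<^sup>2) / 2"
    unfolding pol[of "D u" "D v"] linear_add[OF has_derivative_linear[OF D]] by (simp add: algebra_simps)
  also have "\<dots> = sphere_factor x * inner u v"
    unfolding sq pol[of u v] by (simp add: algebra_simps)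
  finally show ?thesis .
qed

section \<open>The orbit space as a metrizable quotient\<close>

abbreviation l2_sphere :: "l2 set" where
  "l2_sphere \<equiv> unit_sphere UNIV"

lemma mem_l2_sphere: "x \<in> l2_sphere \<longleftrightarrow> norm x = 1"
  by (simp add: unit_sphere_def)

text \<open>
  The distance to an orbit, truncated at \<open>1\<close>, is a bounded continuous function. This embeds the orbits
  into a Banach space, where path and homotopy lifting for coverings between subsets of normed spaces
  applies.
\<close>

definition profile :: "l2 set \<Rightarrow> l2 \<Rightarrow>\<^sub>C real" where
  "profile A = Bcontfun (\<lambda>y. min 1 (infdist y A))"

lemma apply_profile: "apply_bcontfun (profile A) y = min 1 (infdist y A)"
proof -
  have "(\<lambda>y. min 1 (infdist y A)) \<in> bcontfun"
    by (rule bcontfun_normI[where b = 1]) (auto intro!: continuous_intros simp: infdist_nonneg)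
  then show ?thesis by (simp add: profile_def Bcontfun_inverse)
qed

locale spherical_quotient = free_orthogonal_action G T "UNIV :: l2 set"
  for G :: "('g, 'b) monoid_scheme" (structure) and T :: "'g \<Rightarrow> l2 \<Rightarrow> l2"
begin

definition orb :: "l2 \<Rightarrow> l2 set" where
  "orb x = (\<lambda>g. T g x) ` carrier G"

definition points :: "l2 set set" where
  "points = orb ` l2_sphere"

definition space :: "l2 set topology" where
  "space = pullback_topology points profile euclidean"

definition quot :: "l2 \<Rightarrow> l2 \<Rightarrow>\<^sub>C real" where
  "quot x = profile (orb x)"

lemmas isoT = norm_T[OF _ UNIV_I] dist_T[OF subspace_UNIV _ UNIV_I UNIV_I] T_inv(1)[OF _ UNIV_I] T_inv(2)[OF _ UNIV_I]
lemmas T_one' = T_one[OF UNIV_I] and T_mult' = T_mult[OF _ _ UNIV_I]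

lemma orb_self: "x \<in> orb x"
  unfolding orb_def using T_one'[of x] by (metis image_eqI one_closed)

lemma T_in_orb: "g \<in> carrier G \<Longrightarrow> T g x \<in> orb x"
  by (simp add: orb_def)

lemma orb_T: "g \<in> carrier G \<Longrightarrow> orb (T g x) = orb x"
proof -
  assume g: "g \<in> carrier G"
  have "T h (T g x) \<in> orb x" if "h \<in> carrier G" for h
    using T_mult'[OF that g, of x] that g by (simp add: orb_def flip: T_mult')
  moreover have "T h x \<in> orb (T g x)" if "h \<in> carrier G" for h
  proof -
    have "T h x = T (h \<otimes> inv g) (T g x)" using that g by (simp add: T_mult' isoT)
    then show ?thesis using that g by (auto simp: orb_def)
  qed
  ultimately show ?thesis by (auto simp: orb_def)
qed

lemma orb_eq_iff: "orb x = orb y \<longleftrightarrow> (\<exists>g\<in>carrier G. y = T g x)"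
proof
  assume "orb x = orb y"
  then have "y \<in> orb x" using orb_self[of y] by simp
  then show "\<exists>g\<in>carrier G. y = T g x" by (auto simp: orb_def)
next
  assume "\<exists>g\<in>carrier G. y = T g x"
  then show "orb x = orb y" using orb_T by metis
qed

lemma orb_mem_sphere: "y \<in> orb x \<Longrightarrow> x \<in> l2_sphere \<Longrightarrow> y \<in> l2_sphere"
  by (auto simp: orb_def mem_l2_sphere isoT)

lemma orb_eqI:
  assumes "y \<in> orb x" shows "orb y = orb x"
proof -
  obtain g where "g \<in> carrier G" "y = T g x" using assms by (auto simp: orb_def)
  then show ?thesis by (simp add: orb_T)
qed

lemma orb_in_points: "x \<in> l2_sphere \<Longrightarrow> orb x \<in> points"
  by (simp add: points_def)

lemma infdist_orb_le: "g \<in> carrier G \<Longrightarrow> infdist y (orb x) \<le> dist (T g x) y"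
  by (metis T_in_orb dist_commute infdist_le)

lemma infdist_orb_ge:
  assumes "\<And>g. g \<in> carrier G \<Longrightarrow> c \<le> dist (T g x) y" shows "c \<le> infdist y (orb x)"
proof -
  have "orb x \<noteq> {}" using orb_self by blast
  then show ?thesis
    using assms unfolding infdist_def by (auto intro!: cINF_greatest simp: orb_def dist_commute)
qed

lemma dist_quot_le: "dist (quot x) (quot y) \<le> dist x y"
proof (rule dist_bound)
  fix z
  have le: "infdist z (orb a) \<le> infdist z (orb b) + dist a b" for a b
  proof -
    have "infdist z (orb a) - dist a b \<le> infdist z (orb b)"
    proof (rule infdist_orb_ge)
      fix g assume g: "g \<in> carrier G"
      show "infdist z (orb a) - dist a b \<le> dist (T g b) z"
        using infdist_orb_le[OF g, of z a] isoT(2)[OF g, of a b] dist_triangle[of "T g a" z "T g b"] by simp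
    qed
    then show ?thesis by simp
  qed
  show "dist (quot x z) (quot y z) \<le> dist x y"
    using le[of x y] le[of y x] zero_le_dist[of x y]
    by (simp add: quot_def apply_profile dist_real_def dist_commute[of y x] min_def abs_le_iff)
qed

lemma continuous_on_quot: "continuous_on A quot"
  unfolding continuous_on_iff using dist_quot_le by (meson le_less_trans)

text \<open>
  Evaluate the two profiles at \<open>y\<close>, where that of the orbit of \<open>y\<close> vanishes.
\<close>

lemma dist_quot_less:
  assumes "dist (quot x) (quot y) < r" "r \<le> 1"
  shows "\<exists>g\<in>carrier G. dist (T g x) y < r"
proof (rule ccontr)
  assume "\<not> ?thesis"
  then have "r \<le> infdist y (orb x)" by (intro infdist_orb_ge) (auto simp: not_less)
  moreover have "infdist y (orb y) = 0" using orb_self by simp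
  ultimately have "r \<le> dist (quot x y) (quot y y)"
    using assms(2) by (simp add: quot_def apply_profile dist_real_def)
  also have "\<dots> \<le> dist (quot x) (quot y)" by (rule dist_bounded)
  finally show False using assms(1) by simp
qed

lemma quot_eq_iff:
  assumes "x \<in> l2_sphere" "y \<in> l2_sphere"
  shows "quot x = quot y \<longleftrightarrow> orb x = orb y"
proof
  assume q: "quot x = quot y"
  obtain \<delta> where \<delta>: "\<delta> > 0" "\<And>g. g \<in> carrier G \<Longrightarrow> T g x \<noteq> y \<Longrightarrow> \<delta> \<le> dist (T g x) y"
    using orbit_separated[OF assms] by blast
  obtain g where "g \<in> carrier G" "dist (T g x) y < min 1 \<delta>"
    using dist_quot_less[of x y "min 1 \<delta>"] q \<delta>(1) by auto
  then show "orb x = orb y" using \<delta>(2)[of g] orb_eq_iff by fastforce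
qed (simp add: quot_def)

lemma inj_on_profile: "inj_on profile points"
  unfolding points_def using quot_eq_iff by (auto simp: inj_on_def quot_def)

text \<open>On a ball that is much smaller than the displacement of its centre, the projection is an isometry.\<close>

lemma injectivity_radius:
  assumes x: "x \<in> l2_sphere"
  obtains r where "r > 0" "r \<le> 1"
    "\<And>y z. dist x y < r \<Longrightarrow> dist x z < r \<Longrightarrow> dist (quot y) (quot z) = dist y z"
    "\<And>g y z. g \<in> carrier G \<Longrightarrow> g \<noteq> \<one> \<Longrightarrow> dist x y < r \<Longrightarrow> dist x z < r \<Longrightarrow> T g y \<noteq> z"
    "\<And>g. g \<in> carrier G \<Longrightarrow> g \<noteq> \<one> \<Longrightarrow> 2 * r < dist (T g x) x"
proof -
  obtain \<delta> where \<delta>: "\<delta> > 0" "\<And>g. g \<in> carrier G \<Longrightarrow> T g x \<noteq> x \<Longrightarrow> \<delta> \<le> dist (T g x) x"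
    using orbit_separated[OF x x] by blast
  \<comment> \<open>Within distance \<open>\<rho> / 4\<close> of \<open>x\<close>, points are closer to each other than to nontrivial translates, and their distances stay below the truncation.\<close>
  define \<rho> where "\<rho> = min 1 \<delta>"
  have \<rho>: "\<rho> > 0" "\<rho> \<le> 1" using \<delta> by (auto simp: \<rho>_def)
  have "x \<noteq> 0" using x by (auto simp: mem_l2_sphere)
  then have disp: "\<rho> \<le> dist (T g x) x" if "g \<in> carrier G" "g \<noteq> \<one>" for g
  proof -
    have "T g x \<noteq> x" using T_free[of g x] that \<open>x \<noteq> 0\<close> by blast
    then have "\<delta> \<le> dist (T g x) x" using \<delta>(2) that by blast
    then show ?thesis unfolding \<rho>_def by (rule min.coboundedI2)
  qed
  have far: "\<rho> / 2 < dist (T g y) z" if g: "g \<in> carrier G" "g \<noteq> \<one>" and yz: "dist x y < \<rho> / 4" "dist x z < \<rho> / 4" for g y z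
  proof -
    have "dist (T g x) x \<le> dist (T g x) (T g y) + dist (T g y) z + dist z x"
      using dist_triangle[of "T g x" x "T g y"] dist_triangle[of "T g y" x z] by simp
    then show ?thesis using disp[OF g] isoT(2)[OF g(1), of x y] yz by (simp add: dist_commute)
  qed
  show ?thesis
  proof
    show "\<rho> / 4 > 0" "\<rho> / 4 \<le> 1" using \<rho> by simp_all
    show "2 * (\<rho> / 4) < dist (T g x) x" if "g \<in> carrier G" "g \<noteq> \<one>" for g using disp[OF that] \<rho> by simp
    fix y z assume yz: "dist x y < \<rho> / 4" "dist x z < \<rho> / 4"
    show "T g y \<noteq> z" if "g \<in> carrier G" "g \<noteq> \<one>" for g using far[OF that yz] \<rho> by auto
    have d: "dist y z < \<rho> / 2" using dist_triangle3[of y z x] yz by simp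
    have "dist y z \<le> infdist z (orb y)"
    proof (rule infdist_orb_ge)
      fix g assume g: "g \<in> carrier G"
      show "dist y z \<le> dist (T g y) z"
        using far[OF g _ yz] d T_one'[of y] by (cases "g = \<one>") auto
    qed
    moreover have "infdist z (orb z) = 0" using orb_self by simp
    ultimately have "dist y z \<le> dist (quot y z) (quot z z)"
      using d \<rho> by (simp add: quot_def apply_profile dist_real_def)
    also have "\<dots> \<le> dist (quot y) (quot z)" by (rule dist_bounded)
    finally show "dist (quot y) (quot z) = dist y z" using dist_quot_le[of y z] by simp
  qed
qed

lemma quot_T: "g \<in> carrier G \<Longrightarrow> quot (T g x) = quot x"
  by (simp add: quot_def orb_T)

lemma T_in_sphere: "g \<in> carrier G \<Longrightarrow> x \<in> l2_sphere \<Longrightarrow> T g x \<in> l2_sphere"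
  by (simp add: mem_l2_sphere isoT)

text \<open>
  The preimage of the ball of radius \<open>r\<close> around the orbit of \<open>x\<close> is the union of the balls of the same
  radius around the points of the orbit. These are disjoint and are projected isometrically if \<open>r\<close> is an
  injectivity radius at \<open>x\<close>.
\<close>

lemma covering_space_quot: "covering_space l2_sphere quot (quot ` l2_sphere)"
proof
  show "continuous_on l2_sphere quot" by (rule continuous_on_quot)
  fix q assume "q \<in> quot ` l2_sphere"
  then obtain x where x: "x \<in> l2_sphere" "q = quot x" by blast
  obtain r where r: "r > 0" "r \<le> 1"
    and iso: "\<And>y z. dist x y < r \<Longrightarrow> dist x z < r \<Longrightarrow> dist (quot y) (quot z) = dist y z"
    and disp: "\<And>g. g \<in> carrier G \<Longrightarrow> g \<noteq> \<one> \<Longrightarrow> 2 * r < dist (T g x) x"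
    using injectivity_radius[OF x(1)] by metis
  let ?T = "quot ` l2_sphere \<inter> ball q r"
  let ?u = "\<lambda>g. l2_sphere \<inter> ball (T g x) r"
  have lift: "\<exists>g\<in>carrier G. dist (T g x) y < r" if "quot y \<in> ball q r" for y
    using dist_quot_less[of x y r] that r(2) x(2) by simp
  have iso': "dist (quot y) (quot z) = dist y z" if g: "g \<in> carrier G" and yz: "dist (T g x) y < r" "dist (T g x) z < r" for g y z
  proof -
    have "dist x (T (inv g) v) = dist (T g x) v" for v
      using isoT(2)[of g x "T (inv g) v"] g by (simp add: isoT)
    then have "dist (quot (T (inv g) y)) (quot (T (inv g) z)) = dist (T (inv g) y) (T (inv g) z)"
      using yz by (intro iso) simp_all
    then show ?thesis using g by (simp add: quot_T isoT)
  qed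
  have homeo: "\<exists>f. homeomorphism (?u g) ?T quot f" if g: "g \<in> carrier G" for g
  proof -
    have inj: "inj_on quot (?u g)"
    proof (rule inj_onI)
      fix y z assume "y \<in> ?u g" "z \<in> ?u g" "quot y = quot z"
      then show "y = z" using iso'[OF g, of y z] by simp
    qed
    have img: "quot ` ?u g = ?T"
    proof (intro equalityI subsetI)
      fix p assume "p \<in> quot ` ?u g"
      then obtain y where y: "y \<in> ?u g" "p = quot y" by blast
      have "dist (quot (T g x)) (quot y) \<le> dist (T g x) y" by (rule dist_quot_le)
      then show "p \<in> ?T" using y x g by (simp add: quot_T)
    next
      fix p assume p: "p \<in> ?T"
      then obtain y where y: "y \<in> l2_sphere" "p = quot y" by blast
      obtain h where h: "h \<in> carrier G" "dist (T h x) y < r" using lift[of y] p y by auto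
      let ?y = "T (g \<otimes> inv h) y"
      have "dist (T g x) ?y = dist (T h x) y"
      proof -
        have "T g x = T (g \<otimes> inv h) (T h x)" using g h by (simp add: T_mult' isoT)
        then show ?thesis using g h by (simp add: isoT)
      qed
      then have "?y \<in> ?u g" using h g y T_in_sphere by simp
      moreover have "quot ?y = p" using y g h by (simp add: quot_T)
      ultimately show "p \<in> quot ` ?u g" by blast
    qed
    have "continuous_on ?T (inv_into (?u g) quot)"
      unfolding continuous_on_iff
    proof (intro ballI allI impI)
      fix p and e :: real assume p: "p \<in> ?T" "e > 0"
      show "\<exists>d>0. \<forall>p'\<in>?T. dist p' p < d \<longrightarrow> dist (inv_into (?u g) quot p') (inv_into (?u g) quot p) < e"
      proof (intro exI[of _ e] conjI ballI impI p(2))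
        fix p' assume p': "p' \<in> ?T" "dist p' p < e"
        have i: "inv_into (?u g) quot v \<in> ?u g" "quot (inv_into (?u g) quot v) = v" if "v \<in> ?T" for v
          using that img inv_into_into[of v quot "?u g"] f_inv_into_f[of v quot "?u g"] by auto
        show "dist (inv_into (?u g) quot p') (inv_into (?u g) quot p) < e"
          using iso'[OF g, of "inv_into (?u g) quot p'" "inv_into (?u g) quot p"] i[OF p(1)] i[OF p'(1)] p'(2) by simp
      qed
    qed
    moreover have "continuous_on (?u g) quot" by (rule continuous_on_quot)
    moreover have "inv_into (?u g) quot ` ?T = ?u g"
      using inv_into_image_cancel[OF inj order_refl] unfolding img .
    moreover have "\<forall>y\<in>?u g. inv_into (?u g) quot (quot y) = y" using inv_into_f_f[OF inj] by blast
    moreover have "\<forall>p\<in>?T. quot (inv_into (?u g) quot p) = p"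
      using f_inv_into_f[of _ quot "?u g"] unfolding img by blast
    ultimately have "homeomorphism (?u g) ?T quot (inv_into (?u g) quot)"
      unfolding homeomorphism_def using img by blast
    then show ?thesis by blast
  qed
  show "\<exists>T'. q \<in> T' \<and> openin (top_of_set (quot ` l2_sphere)) T' \<and>
      (\<exists>v. \<Union>v = l2_sphere \<inter> quot -` T' \<and> (\<forall>u\<in>v. openin (top_of_set l2_sphere) u) \<and>
        pairwise disjnt v \<and> (\<forall>u\<in>v. \<exists>q. homeomorphism u T' quot q))"
  proof (intro exI[of _ ?T] conjI exI[of _ "?u ` carrier G"])
    show "q \<in> ?T" using x r by auto
    show "openin (top_of_set (quot ` l2_sphere)) ?T" by (simp add: openin_open_Int)
    show "\<Union> (?u ` carrier G) = l2_sphere \<inter> quot -` ?T"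
    proof (intro equalityI subsetI)
      fix y assume "y \<in> \<Union> (?u ` carrier G)"
      then obtain g where g: "g \<in> carrier G" "y \<in> ?u g" by blast
      have "dist (quot (T g x)) (quot y) \<le> dist (T g x) y" by (rule dist_quot_le)
      then show "y \<in> l2_sphere \<inter> quot -` ?T" using g x by (simp add: quot_T)
    next
      fix y assume "y \<in> l2_sphere \<inter> quot -` ?T"
      then show "y \<in> \<Union> (?u ` carrier G)" using lift[of y] by auto
    qed
    show "\<forall>u\<in>?u ` carrier G. openin (top_of_set l2_sphere) u" by (simp add: openin_open_Int)
    show "\<forall>u\<in>?u ` carrier G. \<exists>q. homeomorphism u ?T quot q" using homeo by blast
    show "pairwise disjnt (?u ` carrier G)"
    proof (rule pairwiseI)
      fix U V assume "U \<in> ?u ` carrier G" "V \<in> ?u ` carrier G" "U \<noteq> V"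
      then obtain g h where gh: "g \<in> carrier G" "h \<in> carrier G" "g \<noteq> h" "U = ?u g" "V = ?u h" by auto
      have ne: "inv h \<otimes> g \<noteq> \<one>"
        using gh by (metis inv_closed inv_equality inv_inv)
      have "dist (T g x) (T h x) = dist (T (inv h \<otimes> g) x) x"
        using isoT(2)[of h "T (inv h \<otimes> g) x" x] gh by (simp add: T_mult' isoT)
      then have "2 * r < dist (T g x) (T h x)" using disp[OF _ ne] gh by simp
      then show "disjnt U V"
        unfolding gh(4,5) disjnt_def using dist_triangle_less_add[of "T g x" _ r "T h x" r] by fastforce
    qed
  qed
qed simp

subsection \<open>The quotient topology\<close>

lemma topspace_space: "topspace space = points"
  by (simp add: space_def topspace_pullback_topology)

lemma continuous_map_profile: "continuous_map space euclidean profile"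
  unfolding space_def using continuous_map_pullback[OF continuous_map_id] by (simp add: o_def)

lemma continuous_map_orb: "continuous_map (top_of_set l2_sphere) space orb"
  unfolding space_def
proof (rule continuous_map_pullback')
  show "continuous_map (top_of_set l2_sphere) euclidean (profile \<circ> orb)"
    using continuous_on_quot[of l2_sphere] by (simp add: quot_def[abs_def] o_def)
qed (auto simp: points_def)

lemma Hausdorff_space_space: "Hausdorff_space space"
  using Hausdorff_space_injective_preimage[OF Hausdorff_space_euclidean continuous_map_profile]
    inj_on_profile by (simp add: topspace_space)

lemma openin_orb_image:
  assumes U: "openin (top_of_set l2_sphere) U"
  shows "openin space (orb ` U)"
proof (subst openin_subopen, intro ballI)
  fix p assume "p \<in> orb ` U"
  then obtain x where x: "x \<in> U" "p = orb x" by blast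
  obtain W where W: "open W" "U = l2_sphere \<inter> W" using U by (auto simp: openin_open)
  obtain r where r: "r > 0" "ball x r \<subseteq> W" using W x by (auto elim: openE)
  let ?r = "min 1 r" and ?V = "profile -` ball (quot x) (min 1 r) \<inter> points"
  have "openin space ?V"
    unfolding space_def openin_pullback_topology by auto
  moreover have "p \<in> ?V" using x r W by (auto simp: quot_def points_def)
  moreover have "?V \<subseteq> orb ` U"
  proof
    fix q assume "q \<in> ?V"
    then obtain y where y: "y \<in> l2_sphere" "q = orb y" "dist (quot x) (quot y) < ?r"
      by (auto simp: points_def quot_def)
    then obtain g where g: "g \<in> carrier G" "dist (T g x) y < ?r" using dist_quot_less[of x y ?r] by auto
    let ?y = "T (inv g) y"
    have "dist x ?y = dist (T g x) y" using isoT(2)[of g x ?y] g by (simp add: isoT)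
    then have "?y \<in> U" using r W g y T_in_sphere[of "inv g" y] by auto
    moreover have "orb ?y = q" using y g by (simp add: orb_T)
    ultimately show "q \<in> orb ` U" by blast
  qed
  ultimately show "\<exists>V. openin space V \<and> p \<in> V \<and> V \<subseteq> orb ` U" by blast
qed

end

section \<open>The smooth atlas and the metric of the orbit space\<close>

lemma smooth_on_cong:
  assumes "\<And>x. x \<in> S \<Longrightarrow> f x = g x"
  shows "smooth_on S f \<longleftrightarrow> smooth_on S g"
  unfolding smooth_on_def using assms by (simp cong: ball_cong)

context spherical_quotient
begin

text \<open>
  The domains of inverse charts: open pieces of the sphere that miss the pole \<open>s e\<^sub>0\<close> and are mapped
  injectively to the orbit space.
\<close>

definition admissible :: "l2 set \<Rightarrow> real \<Rightarrow> bool" where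
  "admissible U s \<longleftrightarrow> s\<^sup>2 = 1 \<and> openin (top_of_set l2_sphere) U \<and> (\<forall>x\<in>U. inner l2_e0 x \<noteq> s) \<and>
     (\<forall>x\<in>U. \<forall>y\<in>U. \<forall>g\<in>carrier G. T g x = y \<longrightarrow> g = \<one>)"

definition chart :: "l2 set \<Rightarrow> real \<Rightarrow> (l2 set, l2) chart" where
  "chart U s = (orb ` U, \<lambda>p. stereo s (inv_into U orb p))"

definition atlas :: "(l2 set, l2) chart set" where
  "atlas = {chart U s | U s. admissible U s}"

lemma admissible_at:
  assumes x: "x \<in> l2_sphere"
  obtains U s where "admissible U s" "x \<in> U"
proof -
  obtain r where r: "r > 0"
    and disp: "\<And>g y z. g \<in> carrier G \<Longrightarrow> g \<noteq> \<one> \<Longrightarrow> dist x y < r \<Longrightarrow> dist x z < r \<Longrightarrow> T g y \<noteq> z"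
    using injectivity_radius[OF x] by metis
  define s :: real where "s = (if inner l2_e0 x = 1 then -1 else 1)"
  define U where "U = l2_sphere \<inter> (ball x r \<inter> {y. inner l2_e0 y \<noteq> s})"
  have "open (ball x r \<inter> {y. inner l2_e0 y \<noteq> s})"
    by (intro open_Int open_ball open_Collect_neq continuous_intros)
  then have "admissible U s"
    unfolding admissible_def
  proof (intro conjI ballI impI)
    fix y z g assume "y \<in> U" "z \<in> U" "g \<in> carrier G" "T g y = z"
    then show "g = \<one>" using disp[of g y z] by (auto simp: U_def)
  qed (auto simp: U_def s_def openin_open_Int)
  moreover have "x \<in> U" using x r by (auto simp: U_def s_def)
  ultimately show ?thesis using that by blast
qed

context
  fixes U s assumes adm: "admissible U s"
begin

lemma admissible_s: "s\<^sup>2 = 1"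
  using adm by (simp add: admissible_def)

lemma admissible_sphere: "x \<in> U \<Longrightarrow> x \<in> l2_sphere"
  using adm openin_subset[of "top_of_set l2_sphere" U] by (auto simp: admissible_def)

lemma admissible_unique: "x \<in> U \<Longrightarrow> y \<in> U \<Longrightarrow> g \<in> carrier G \<Longrightarrow> T g x = y \<Longrightarrow> g = \<one>"
  using adm by (auto simp: admissible_def)

lemma inj_on_orb: "inj_on orb U"
proof (rule inj_onI)
  fix x y assume xy: "x \<in> U" "y \<in> U" "orb x = orb y"
  then obtain g where g: "g \<in> carrier G" "y = T g x" by (auto simp: orb_eq_iff)
  then have "g = \<one>" using admissible_unique[OF xy(1,2)] by blast
  then show "x = y" using g T_one' by simp
qed

lemma chart_dom: "fst (chart U s) = orb ` U"
  by (simp add: chart_def)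

lemma chart_orb: "x \<in> U \<Longrightarrow> snd (chart U s) (orb x) = stereo s x"
  by (simp add: chart_def inv_into_f_f[OF inj_on_orb])

lemma stereo_inv_stereo_U: "x \<in> U \<Longrightarrow> stereo_inv s (stereo s x) = x"
  using stereo_inv_stereo[OF admissible_s] admissible_sphere adm by (simp add: mem_l2_sphere admissible_def)

lemma chart_image: "chart_image (chart U s) = {v. stereo_inv s v \<in> U}"
proof -
  have "chart_image (chart U s) = stereo s ` U"
    unfolding chart_dom image_image by (intro image_cong refl chart_orb)
  also have "\<dots> = {v. stereo_inv s v \<in> U}"
  proof (intro equalityI subsetI)
    fix v assume "v \<in> {v. stereo_inv s v \<in> U}"
    then show "v \<in> stereo s ` U" using stereo_stereo_inv[OF admissible_s, of v] by (metis image_eqI mem_Collect_eq)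
  qed (auto simp: stereo_inv_stereo_U)
  finally show ?thesis .
qed

lemma inj_on_chart: "inj_on (snd (chart U s)) (fst (chart U s))"
proof (rule inj_onI)
  fix p q assume "p \<in> fst (chart U s)" "q \<in> fst (chart U s)" "snd (chart U s) p = snd (chart U s) q"
  then obtain x y where xy: "x \<in> U" "p = orb x" "y \<in> U" "q = orb y" "stereo s x = stereo s y"
    unfolding chart_dom by (auto simp: chart_orb)
  then have "x = y" using stereo_inv_stereo_U by metis
  with xy show "p = q" by simp
qed

lemma chart_inv_eq: "stereo_inv s v \<in> U \<Longrightarrow> chart_inv (chart U s) v = orb (stereo_inv s v)"
  using inv_into_f_f[OF inj_on_chart, of "orb (stereo_inv s v)"]
  by (simp add: chart_dom chart_orb stereo_stereo_inv[OF admissible_s])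

lemma open_stereo_inv_vimage:
  assumes "openin (top_of_set l2_sphere) V" "bounded_linear L" "\<And>x. norm (L x) = norm x"
  shows "open {v. L (stereo_inv s v) \<in> V}"
proof -
  obtain W where W: "open W" "V = l2_sphere \<inter> W" using assms(1) by (auto simp: openin_open)
  have "{v. L (stereo_inv s v) \<in> V} = (\<lambda>v. L (stereo_inv s v)) -` W"
    using norm_stereo_inv[OF admissible_s] assms(3) by (auto simp: W mem_l2_sphere)
  moreover have "open \<dots>"
    by (intro open_vimage W bounded_linear.continuous_on[OF assms(2)] continuous_on_stereo_inv)
  ultimately show ?thesis by simp
qed

lemma open_chart_image: "open (chart_image (chart U s))"
  unfolding chart_image using open_stereo_inv_vimage[of U "\<lambda>x. x"] adm by (simp add: admissible_def bounded_linear_ident)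

text \<open>
  The inverse is the composition of inverse stereographic projection with the continuous projection to orbits.
\<close>

lemma is_chart_chart: "is_chart space (chart U s)"
proof -
  let ?I = "chart_image (chart U s)" and ?D = "orb ` U"
  have D: "openin space ?D" using adm openin_orb_image by (simp add: admissible_def)
  have "homeomorphic_maps (subtopology space ?D) (top_of_set ?I) (snd (chart U s)) (orb \<circ> stereo_inv s)"
    unfolding homeomorphic_maps_def
  proof (intro conjI ballI)
    have "continuous_map (subtopology space ?D) euclidean (snd (chart U s))"
      unfolding continuous_map_def
    proof (intro conjI allI impI)
      fix V assume V: "openin (euclidean :: l2 topology) V"
      have "continuous_on U (stereo s)"
        using adm by (intro continuous_on_stereo admissible_s) (auto simp: admissible_def)
      then have "openin (top_of_set U) (U \<inter> stereo s -` V)" using V by (simp add: continuous_openin_preimage_gen)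
      then have "openin (top_of_set l2_sphere) (U \<inter> stereo s -` V)"
        using adm openin_trans by (auto simp: admissible_def)
      from openin_orb_image[OF this] have "openin space (orb ` (U \<inter> stereo s -` V))" .
      moreover have "{p \<in> topspace (subtopology space ?D). snd (chart U s) p \<in> V} = orb ` (U \<inter> stereo s -` V) \<inter> ?D"
        using openin_subset[OF D] by (auto simp: chart_orb)
      ultimately show "openin (subtopology space ?D) {p \<in> topspace (subtopology space ?D). snd (chart U s) p \<in> V}"
        unfolding openin_subtopology by blast
    qed simp
    then show "continuous_map (subtopology space ?D) (top_of_set ?I) (snd (chart U s))"
      by (auto simp: continuous_map_in_subtopology chart_dom)
    have "continuous_map (top_of_set ?I) (top_of_set l2_sphere) (stereo_inv s)"
      using norm_stereo_inv[OF admissible_s] continuous_on_stereo_inv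
      by (auto simp: continuous_map_in_subtopology mem_l2_sphere)
    then have "continuous_map (top_of_set ?I) space (orb \<circ> stereo_inv s)"
      using continuous_map_compose continuous_map_orb by blast
    moreover have "(orb \<circ> stereo_inv s) ` ?I \<subseteq> ?D" unfolding chart_image by auto
    ultimately show "continuous_map (top_of_set ?I) (subtopology space ?D) (orb \<circ> stereo_inv s)"
      by (auto simp: continuous_map_in_subtopology)
  next
    fix p assume "p \<in> topspace (subtopology space ?D)"
    then obtain x where "x \<in> U" "p = orb x" by auto
    then show "(orb \<circ> stereo_inv s) (snd (chart U s) p) = p" by (simp add: chart_orb stereo_inv_stereo_U)
  next
    fix v assume "v \<in> topspace (top_of_set ?I)"
    then have "stereo_inv s v \<in> U" unfolding chart_image by simp
    then show "snd (chart U s) ((orb \<circ> stereo_inv s) v) = v"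
      by (simp add: chart_orb stereo_stereo_inv[OF admissible_s])
  qed
  then show ?thesis
    unfolding is_chart_def using D open_chart_image homeomorphic_maps_imp_map by (auto simp: chart_dom)
qed

end

lemma atlasE:
  assumes "c \<in> atlas" obtains U s where "c = chart U s" "admissible U s"
  using assms by (auto simp: atlas_def)

lemma atlas_at:
  assumes "p \<in> points" obtains c where "c \<in> atlas" "p \<in> fst c"
proof -
  obtain x where "x \<in> l2_sphere" "p = orb x" using assms by (auto simp: points_def)
  moreover obtain U s where "admissible U s" "x \<in> U" using admissible_at[OF \<open>x \<in> l2_sphere\<close>] .
  ultimately show ?thesis using that[of "chart U s"] by (auto simp: atlas_def chart_def)
qed

text \<open>
  On the overlap of two charts the coordinate change is locally induced by a fixed element of the
  group: the one that carries the lift in the first chart to the lift in the second.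
\<close>

context
  fixes U s U' s' assumes a: "admissible U s" and b: "admissible U' s'"
begin

definition overlap :: "'g \<Rightarrow> l2 set" where
  "overlap g = {v. stereo_inv s v \<in> U \<and> T g (stereo_inv s v) \<in> U'}"

lemma transition_domain:
  "snd (chart U s) ` (fst (chart U s) \<inter> fst (chart U' s')) = (\<Union>g\<in>carrier G. overlap g)"
proof (intro equalityI subsetI)
  fix v assume "v \<in> snd (chart U s) ` (fst (chart U s) \<inter> fst (chart U' s'))"
  then obtain p where p: "p \<in> orb ` U" "p \<in> orb ` U'" "v = snd (chart U s) p"
    unfolding chart_dom[OF a] chart_dom[OF b] by blast
  then obtain x y where xy: "x \<in> U" "y \<in> U'" "p = orb x" "p = orb y" by blast
  then have xy: "x \<in> U" "y \<in> U'" "orb x = orb y" "v = stereo s x" using p(3) chart_orb[OF a] by simp_all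
  then obtain g where "g \<in> carrier G" "y = T g x" by (auto simp: orb_eq_iff)
  then show "v \<in> (\<Union>g\<in>carrier G. overlap g)"
    using xy stereo_inv_stereo_U[OF a xy(1)] by (auto simp: overlap_def)
next
  fix v assume "v \<in> (\<Union>g\<in>carrier G. overlap g)"
  then obtain g where g: "g \<in> carrier G" "stereo_inv s v \<in> U" "T g (stereo_inv s v) \<in> U'"
    by (auto simp: overlap_def)
  let ?p = "orb (stereo_inv s v)"
  have "?p \<in> orb ` U'" using g orb_T[OF g(1), of "stereo_inv s v"] by (metis imageI)
  then have "?p \<in> fst (chart U s) \<inter> fst (chart U' s')" using g by (simp add: chart_dom[OF a] chart_dom[OF b])
  moreover have "snd (chart U s) ?p = v"
    using g by (simp add: chart_orb[OF a] stereo_stereo_inv[OF admissible_s[OF a]])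
  ultimately show "v \<in> snd (chart U s) ` (fst (chart U s) \<inter> fst (chart U' s'))" by force
qed

lemma open_overlap: "g \<in> carrier G \<Longrightarrow> open (overlap g)"
proof -
  assume g: "g \<in> carrier G"
  have "overlap g = {v. stereo_inv s v \<in> U} \<inter> {v. T g (stereo_inv s v) \<in> U'}" by (auto simp: overlap_def)
  moreover have "open \<dots>"
    using open_stereo_inv_vimage[OF a, of U "\<lambda>x. x"] open_stereo_inv_vimage[OF a, of U' "T g"] a b g
    by (intro open_Int) (simp_all add: admissible_def bounded_linear_ident bounded_linear_T isoT)
  ultimately show ?thesis by simp
qed

lemma transition_eq:
  assumes "g \<in> carrier G" "v \<in> overlap g"
  shows "transition (chart U s) (chart U' s') v = stereo s' (T g (stereo_inv s v))"
proof -
  have v: "stereo_inv s v \<in> U" "T g (stereo_inv s v) \<in> U'" using assms by (auto simp: overlap_def)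
  have "orb (stereo_inv s v) = orb (T g (stereo_inv s v))" using orb_T assms by simp
  then show ?thesis using chart_inv_eq[OF a v(1)] chart_orb[OF b v(2)] by simp
qed

lemma overlap_unique:
  assumes "g \<in> carrier G" "h \<in> carrier G" "v \<in> overlap g" "v \<in> overlap h" shows "g = h"
proof -
  let ?x = "stereo_inv s v"
  have "T (h \<otimes> inv g) (T g ?x) = T h ?x" using assms by (simp add: T_mult' isoT)
  then have "h \<otimes> inv g = \<one>"
    using assms by (intro admissible_unique[OF b, of "T g ?x" "T h ?x"]) (auto simp: overlap_def)
  then show ?thesis using assms by (metis inv_equality inv_inv inv_closed)
qed

lemma smooth_on_overlap: "g \<in> carrier G \<Longrightarrow> smooth_on (overlap g) (transition (chart U s) (chart U' s'))"
proof -
  assume g: "g \<in> carrier G"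
  have "smooth_on (overlap g) (\<lambda>v. stereo s' (T g (stereo_inv s v)))"
    using b g by (intro smooth_on_stereo_linear_stereo_inv open_overlap bounded_linear_T)
      (auto simp: overlap_def admissible_def)
  moreover have "smooth_on (overlap g) (transition (chart U s) (chart U' s'))
      \<longleftrightarrow> smooth_on (overlap g) (\<lambda>v. stereo s' (T g (stereo_inv s v)))"
    by (rule smooth_on_cong) (rule transition_eq[OF g])
  ultimately show ?thesis by (rule iffD2[rotated])
qed

text \<open>
  Different group elements have disjoint overlaps, so the overlaps form an open partition.
\<close>

lemma smooth_transition:
  "smooth_on (snd (chart U s) ` (fst (chart U s) \<inter> fst (chart U' s'))) (transition (chart U s) (chart U' s'))"
  unfolding transition_domain
proof (rule smooth_on_open_partition[where c = "\<lambda>v. SOME g. g \<in> carrier G \<and> v \<in> overlap g"])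
  let ?c = "\<lambda>v. SOME g. g \<in> carrier G \<and> v \<in> overlap g"
  show "open (\<Union>g\<in>carrier G. overlap g)" using open_overlap by blast
  have c: "?c v = g" if "g \<in> carrier G" "v \<in> overlap g" for g v
    using that overlap_unique by (intro some_equality) auto
  have level: "{v \<in> (\<Union>g\<in>carrier G. overlap g). ?c v = g} = (if g \<in> carrier G then overlap g else {})" for g
    using c by auto
  show "open {v \<in> (\<Union>g\<in>carrier G. overlap g). ?c v = g}" for g
    unfolding level using open_overlap by simp
  have "smooth_on {} f" for f :: "l2 \<Rightarrow> l2" by (simp add: smooth_on_def)
  then show "smooth_on {v \<in> (\<Union>g\<in>carrier G. overlap g). ?c v = g} (transition (chart U s) (chart U' s'))" for g
    unfolding level using smooth_on_overlap by simp
qed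

text \<open>
  A coordinate change lifts to the action of a group element, which preserves chordal distances.
\<close>

lemma transition_isometry:
  assumes v: "v \<in> snd (chart U s) ` (fst (chart U s) \<inter> fst (chart U' s'))"
  defines "\<tau> \<equiv> transition (chart U s) (chart U' s')"
  shows "sphere_factor (\<tau> v) * inner (frechet_derivative \<tau> (at v) u) (frechet_derivative \<tau> (at v) w)
    = sphere_factor v * inner u w"
proof (rule chordal_isometry_derivative)
  show "(\<tau> has_derivative frechet_derivative \<tau> (at v)) (at v)"
    unfolding \<tau>_def by (rule smooth_on_has_derivative[OF smooth_transition v])
  obtain g where g: "g \<in> carrier G" "v \<in> overlap g" using v unfolding transition_domain by blast
  have lift: "stereo_inv s' (\<tau> y) = T g (stereo_inv s y)" if "y \<in> overlap g" for y
    unfolding \<tau>_def transition_eq[OF g(1) that]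
    using that by (intro stereo_inv_stereo_U[OF b]) (simp add: overlap_def)
  have "eventually (\<lambda>y. y \<in> overlap g) (nhds v)" using open_overlap[OF g(1)] g(2) by (rule eventually_nhds_in_open)
  then show "eventually (\<lambda>y. (dist (\<tau> v) (\<tau> y))\<^sup>2 / ((1 + inner (\<tau> v) (\<tau> v)) * (1 + inner (\<tau> y) (\<tau> y)))
        = (dist v y)\<^sup>2 / ((1 + inner v v) * (1 + inner y y))) (nhds v)"
  proof eventually_elim
    case (elim y)
    have "dist (stereo_inv s' (\<tau> v)) (stereo_inv s' (\<tau> y)) = dist (stereo_inv s v) (stereo_inv s y)"
      unfolding lift[OF g(2)] lift[OF elim] using g(1) by (simp add: isoT)
    then show ?case
      using chordal_distance[OF admissible_s[OF b], of "\<tau> v" "\<tau> y"] chordal_distance[OF admissible_s[OF a], of v y]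
      by simp
  qed
qed

end

lemma smooth_manifold_space: "smooth_manifold space atlas"
  unfolding smooth_manifold_def
proof (intro conjI ballI)
  show "Hausdorff_space space" by (rule Hausdorff_space_space)
  show "is_chart space c" if "c \<in> atlas" for c using that is_chart_chart by (metis atlasE)
  then have "fst c \<subseteq> points" if "c \<in> atlas" for c
    using that openin_subset unfolding is_chart_def topspace_space[symmetric] by blast
  then show "(\<Union>c\<in>atlas. fst c) = topspace space" unfolding topspace_space using atlas_at by blast
  fix c d assume "c \<in> atlas" "d \<in> atlas"
  then show "smooth_on (snd c ` (fst c \<inter> fst d)) (transition c d)" using smooth_transition by (metis atlasE)
qed

text \<open>
  The value in an arbitrarily chosen chart; by \<open>transition_isometry\<close> the choice does not matter.
\<close>

definition round_metric :: "(l2 set, l2) metric_field" where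
  "round_metric p \<xi> \<eta> = (let c = SOME c. c \<in> atlas \<and> p \<in> fst c in sphere_factor (snd c p) * inner (\<xi> c) (\<eta> c))"

lemma chart_inv_mem: "x \<in> chart_image c \<Longrightarrow> chart_inv c x \<in> fst c" "x \<in> chart_image c \<Longrightarrow> snd c (chart_inv c x) = x"
  by (auto intro: inv_into_into f_inv_into_f)

lemma metric_coords_round:
  assumes c: "c \<in> atlas" and x: "x \<in> chart_image c"
  shows "metric_coords atlas round_metric c x u v = sphere_factor x * inner u v"
proof -
  define p where "p = chart_inv c x"
  have p: "p \<in> fst c" "snd c p = x" using chart_inv_mem[OF x] by (simp_all add: p_def)
  define d where "d = (SOME d. d \<in> atlas \<and> p \<in> fst d)"
  have d: "d \<in> atlas" "p \<in> fst d" unfolding d_def using c p someI[of "\<lambda>d. d \<in> atlas \<and> p \<in> fst d" c] by auto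
  obtain U s where U: "c = chart U s" "admissible U s" using c by (rule atlasE)
  obtain U' s' where U': "d = chart U' s'" "admissible U' s'" using d(1) by (rule atlasE)
  have "x \<in> snd c ` (fst c \<inter> fst d)" using p d by auto
  then have "sphere_factor (transition c d x) * inner (frechet_derivative (transition c d) (at x) u) (frechet_derivative (transition c d) (at x) v)
    = sphere_factor x * inner u v"
    using transition_isometry[OF U(2) U'(2)] unfolding U U' by blast
  moreover have "transition c d x = snd d p" by (simp add: p_def)
  ultimately show ?thesis
    using d p by (simp add: metric_coords_def p_def[symmetric] Let_def round_metric_def d_def[symmetric] tangent_vector_def)
qed

lemma riemannian_metric_round: "riemannian_metric atlas round_metric"
  unfolding riemannian_metric_def
proof (intro ballI conjI)
  fix c assume c: "c \<in> atlas"
  obtain U s where U: "c = chart U s" "admissible U s" using c by (rule atlasE)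
  define ib :: "l2 \<Rightarrow>\<^sub>L l2 \<Rightarrow>\<^sub>L real" where "ib = Blinfun blinfun_inner_right"
  have ib: "blinfun_apply (blinfun_apply ib u) v = inner u v" for u v
    by (simp add: ib_def bounded_linear_Blinfun_apply bounded_linear_blinfun_inner_right)
  have "rational_map_on (chart_image c) (\<lambda>x. (4 * (inverse (1 + inner x x) * inverse (1 + inner x x))) *\<^sub>R ib)"
    by (intro rational_map_on_scaleR rational_map_on_const rational_on_mult rational_on_const rational_on_inverse
        rational_on_add rational_on_inner_self one_add_inner_neq)
  then have "rational_map_on (chart_image c) (\<lambda>x. sphere_factor x *\<^sub>R ib)"
    by (simp add: sphere_factor_def divide_inverse power2_eq_square)
  then have "smooth_on (chart_image c) (\<lambda>x. sphere_factor x *\<^sub>R ib)"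
    using open_chart_image[OF U(2)] unfolding U by (intro rational_map_on_imp_smooth_on)
  then show "\<exists>B :: l2 \<Rightarrow> l2 \<Rightarrow>\<^sub>L l2 \<Rightarrow>\<^sub>L real. smooth_on (chart_image c) B \<and>
           (\<forall>x\<in>chart_image c. \<forall>u v. metric_coords atlas round_metric c x u v = blinfun_apply (blinfun_apply (B x) u) v)"
    by (intro exI[of _ "\<lambda>x. sphere_factor x *\<^sub>R ib"]) (simp add: metric_coords_round[OF c] blinfun.scaleR_left ib)
  fix x assume x: "x \<in> chart_image c"
  show "\<forall>u v. metric_coords atlas round_metric c x u v = metric_coords atlas round_metric c x v u"
    by (simp add: metric_coords_round[OF c x] inner_commute)
  show "\<exists>a>0. \<exists>b. \<forall>u. a * (norm u)\<^sup>2 \<le> metric_coords atlas round_metric c x u u \<and>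
                           metric_coords atlas round_metric c x u u \<le> b * (norm u)\<^sup>2"
    using sphere_factor_pos[of x]
    by (intro exI[of _ "sphere_factor x"]) (auto simp: metric_coords_round[OF c x] power2_norm_eq_inner intro!: exI[of _ "sphere_factor x"])
qed

lemma hilbert_manifold_space: "hilbert_manifold space atlas round_metric"
  by (simp add: hilbert_manifold_def smooth_manifold_space riemannian_metric_round)

end

section \<open>Curvature in stereographic coordinates\<close>

lemma has_derivative_sphere_factor:
  "(sphere_factor has_derivative (\<lambda>u. sphere_factor x * (- 4 / (1 + inner x x) * inner x u))) (at x)"
proof -
  define q where "q = 1 + inner x x"
  have q: "q \<noteq> 0" using one_add_inner_neq[of x] by (simp add: q_def)
  have "((\<lambda>y. 4 * (inverse (1 + inner y y))\<^sup>2) has_derivative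
      (\<lambda>u. 4 * (2 * inverse (1 + inner x x) * (- (inverse (1 + inner x x) * (2 * inner x u) * inverse (1 + inner x x)))))) (at x)"
    using one_add_inner_neq[of x] by (auto intro!: derivative_eq_intros simp: inner_commute power2_eq_square)
  moreover have "(\<lambda>y. 4 * (inverse (1 + inner y y))\<^sup>2) = sphere_factor"
    by (simp add: sphere_factor_def[abs_def] divide_inverse power_inverse)
  moreover have "4 * (2 * inverse q * (- (inverse q * (2 * inner x u) * inverse q)))
      = 4 / q\<^sup>2 * (- 4 / q * inner x u)" for u
    using q by (simp add: divide_inverse power2_eq_square)
  ultimately show ?thesis by (simp add: q_def[symmetric] sphere_factor_def[of x])
qed

text \<open>
  The Christoffel symbols of the conformal metric \<open>sphere_factor\<close> times the inner product: the
  logarithmic derivative of the factor is \<open>- 4 / (1 + x \<bullet> x)\<close> times the inner product with \<open>x\<close>.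
\<close>

definition sphere_christoffel :: "l2 \<Rightarrow> l2 \<Rightarrow> l2 \<Rightarrow> l2" where
  "sphere_christoffel x u v = (- 2 / (1 + inner x x)) *\<^sub>R (inner x u *\<^sub>R v + inner x v *\<^sub>R u - inner u v *\<^sub>R x)"

context
  fixes M :: "l2 \<Rightarrow> l2 \<Rightarrow> l2 \<Rightarrow> real" and I :: "l2 set"
  assumes I: "open I" and M: "\<And>x u v. x \<in> I \<Longrightarrow> M x u v = sphere_factor x * inner u v"
begin

lemma frechet_derivative_conformal:
  assumes x: "x \<in> I"
  shows "frechet_derivative (\<lambda>y. M y v w) (at x) u = sphere_factor x * (- 4 / (1 + inner x x) * inner x u) * inner v w"
proof -
  have "((\<lambda>y. sphere_factor y * inner v w) has_derivative
      (\<lambda>u. sphere_factor x * (- 4 / (1 + inner x x) * inner x u) * inner v w)) (at x)"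
    by (rule has_derivative_mult_left[OF has_derivative_sphere_factor])
  then have "((\<lambda>y. M y v w) has_derivative
      (\<lambda>u. sphere_factor x * (- 4 / (1 + inner x x) * inner x u) * inner v w)) (at x)"
    by (rule has_derivative_transform_within_open[OF _ I x]) (simp add: M)
  from fun_cong[OF frechet_derivative_at[OF this], of u] show ?thesis by (rule sym)
qed

text \<open>
  The Koszul formula is satisfied by \<open>sphere_christoffel\<close>, and it determines its value since the metric is definite.
\<close>

lemma christoffel_conformal:
  assumes x: "x \<in> I"
  shows "christoffel M x u v = sphere_christoffel x u v"
  unfolding christoffel_def
proof (rule the_equality)
  define k where "k = sphere_factor x * (- 4 / (1 + inner x x))"
  have k: "sphere_factor x * (- 4 / (1 + inner x x) * inner x a) = k * inner x a" for a
    by (simp add: k_def)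
  have sc: "2 * sphere_factor x * inner (sphere_christoffel x u v) w
     = k * (inner x u * inner v w + inner x v * inner u w - inner u v * inner x w)" for w
  proof -
    have "inner (sphere_christoffel x u v) w
      = (- 2 / (1 + inner x x)) * (inner x u * inner v w + inner x v * inner u w - inner u v * inner x w)"
      by (simp add: sphere_christoffel_def inner_diff_left inner_add_left)
    then show ?thesis by (simp add: k_def)
  qed
  show eq: "\<forall>w. 2 * M x (sphere_christoffel x u v) w = frechet_derivative (\<lambda>y. M y v w) (at x) u +
      frechet_derivative (\<lambda>y. M y u w) (at x) v - frechet_derivative (\<lambda>y. M y u v) (at x) w"
    unfolding frechet_derivative_conformal[OF x] k M[OF x] using sc
    by (simp add: algebra_simps)
  fix z assume z: "\<forall>w. 2 * M x z w = frechet_derivative (\<lambda>y. M y v w) (at x) u +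
      frechet_derivative (\<lambda>y. M y u w) (at x) v - frechet_derivative (\<lambda>y. M y u v) (at x) w"
  have "inner z w = inner (sphere_christoffel x u v) w" for w
  proof -
    have "2 * M x z w = 2 * M x (sphere_christoffel x u v) w" using z eq by (simp only:)
    then show ?thesis using sphere_factor_pos[of x] by (simp add: M[OF x])
  qed
  then have "inner (z - sphere_christoffel x u v) (z - sphere_christoffel x u v) = 0"
    by (simp only: inner_diff_left diff_self)
  then show "z = sphere_christoffel x u v" by simp
qed

lemma has_derivative_sphere_christoffel:
  "((\<lambda>y. sphere_christoffel y v w) has_derivative (\<lambda>u.
      ((- 2 / (1 + inner x x))\<^sup>2 * inner x u) *\<^sub>R (inner x v *\<^sub>R w + inner x w *\<^sub>R v - inner v w *\<^sub>R x)
      + (- 2 / (1 + inner x x)) *\<^sub>R (inner u v *\<^sub>R w + inner u w *\<^sub>R v - inner v w *\<^sub>R u))) (at x)"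
proof -
  have m: "((\<lambda>y. - 2 / (1 + inner y y)) has_derivative (\<lambda>u. (- 2 / (1 + inner x x))\<^sup>2 * inner x u)) (at x)"
  proof -
    have "((\<lambda>y. (- 2) * inverse (1 + inner y y)) has_derivative
        (\<lambda>u. (- 2) * (- (inverse (1 + inner x x) * (2 * inner x u) * inverse (1 + inner x x))))) (at x)"
      using one_add_inner_neq[of x] by (auto intro!: derivative_eq_intros simp: inner_commute)
    then show ?thesis by (simp add: divide_inverse power2_eq_square algebra_simps)
  qed
  have i: "((\<lambda>y. inner y v *\<^sub>R w + inner y w *\<^sub>R v - inner v w *\<^sub>R y) has_derivative
      (\<lambda>u. inner u v *\<^sub>R w + inner u w *\<^sub>R v - inner v w *\<^sub>R u)) (at x)"
    by (auto intro!: derivative_eq_intros)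
  show ?thesis
    unfolding sphere_christoffel_def
    using has_derivative_scaleR[OF m i] by (simp add: add.commute)
qed

lemma frechet_derivative_christoffel:
  assumes x: "x \<in> I"
  shows "frechet_derivative (\<lambda>y. christoffel M y v w) (at x) u =
      ((- 2 / (1 + inner x x))\<^sup>2 * inner x u) *\<^sub>R (inner x v *\<^sub>R w + inner x w *\<^sub>R v - inner v w *\<^sub>R x)
      + (- 2 / (1 + inner x x)) *\<^sub>R (inner u v *\<^sub>R w + inner u w *\<^sub>R v - inner v w *\<^sub>R u)"
proof -
  have "((\<lambda>y. christoffel M y v w) has_derivative (\<lambda>u.
      ((- 2 / (1 + inner x x))\<^sup>2 * inner x u) *\<^sub>R (inner x v *\<^sub>R w + inner x w *\<^sub>R v - inner v w *\<^sub>R x)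
      + (- 2 / (1 + inner x x)) *\<^sub>R (inner u v *\<^sub>R w + inner u w *\<^sub>R v - inner v w *\<^sub>R u))) (at x)"
    by (rule has_derivative_transform_within_open[OF has_derivative_sphere_christoffel I x])
       (simp add: christoffel_conformal)
  from fun_cong[OF frechet_derivative_at[OF this], of u] show ?thesis by (rule sym)
qed

text \<open>
  With \<open>m = - 2 / (1 + x \<bullet> x)\<close> and the Gram determinant \<open>A\<close> of \<open>u\<close>, \<open>v\<close>, the numerator is
  \<open>- (m\<^sup>2 (x \<bullet> x) + 2 m) A\<close> times the conformal factor. The coefficient of \<open>A\<close> is again the conformal factor.
\<close>

lemma sectional_curvature_conformal:
  assumes x: "x \<in> I" and uv: "u \<noteq> v" "independent {u, v}"
  shows "sectional_curvature M x u v = 1"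
proof -
  define m where "m = - 2 / (1 + inner x x)"
  define A where "A = inner u u * inner v v - (inner u v)\<^sup>2"
  have R: "inner (riemann_curvature M x u v v) u = - (m\<^sup>2 * inner x x + 2 * m) * A"
    unfolding riemann_curvature_def frechet_derivative_christoffel[OF x] christoffel_conformal[OF x]
      sphere_christoffel_def m_def[symmetric] A_def
    by (simp add: inner_diff_left inner_diff_right inner_add_left inner_add_right algebra_simps
        power2_eq_square inner_commute)
  have mq: "- (m\<^sup>2 * inner x x + 2 * m) = sphere_factor x"
  proof -
    define q where "q = 1 + inner x x"
    have q: "q \<noteq> 0" "inner x x = q - 1" using one_add_inner_neq[of x] by (simp_all add: q_def)
    show ?thesis
      unfolding m_def sphere_factor_def q_def[symmetric] q(2) using q(1)
      by (simp add: field_simps power2_eq_square)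
  qed
  have A: "A > 0"
  proof (rule ccontr)
    assume "\<not> A > 0"
    then have "\<bar>inner u v\<bar>\<^sup>2 \<ge> (norm u * norm v)\<^sup>2"
      by (simp add: A_def power_mult_distrib power2_norm_eq_inner)
    then have "\<bar>inner u v\<bar> \<ge> norm u * norm v" by (rule power2_le_imp_le) simp
    then have "\<bar>inner u v\<bar> = norm u * norm v" using Cauchy_Schwarz_ineq2[of u v] by simp
    then have "norm u *\<^sub>R v = norm v *\<^sub>R u \<or> norm u *\<^sub>R v = - norm v *\<^sub>R u"
      using norm_cauchy_schwarz_abs_eq[of u v] by simp
    moreover have "u \<noteq> 0" using uv(2) dependent_zero by blast
    then have v: "v = inverse (norm u) *\<^sub>R (norm u *\<^sub>R v)" by simp
    ultimately have "\<exists>c. v = c *\<^sub>R u"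
    proof (elim disjE)
      assume e: "norm u *\<^sub>R v = norm v *\<^sub>R u"
      show ?thesis using v unfolding e scaleR_scaleR by blast
    next
      assume e: "norm u *\<^sub>R v = - norm v *\<^sub>R u"
      show ?thesis using v unfolding e scaleR_scaleR by blast
    qed
    then have "v \<in> span {u}" by (auto simp: span_singleton)
    moreover have "v \<notin> span ({u, v} - {v})" using uv(2) unfolding dependent_def by blast
    ultimately show False using uv(1) by (simp add: insert_Diff_if)
  qed
  have den: "M x u u * M x v v - (M x u v)\<^sup>2 = (sphere_factor x)\<^sup>2 * A"
    by (simp add: M[OF x] A_def power2_eq_square algebra_simps)
  have "sectional_curvature M x u v = sphere_factor x * (sphere_factor x * A) / ((sphere_factor x)\<^sup>2 * A)"
    unfolding sectional_curvature_def den by (simp only: M[OF x] R mq)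
  also have "\<dots> = 1" using A sphere_factor_pos[of x] by (simp add: power2_eq_square)
  finally show ?thesis .
qed

end

section \<open>The fundamental group of the orbit space\<close>

lemma l2_shift_no_eigenvector:
  assumes "x = - l2_shift x" shows "x = 0"
proof (rule l2_eqI)
  fix n
  have c: "l2_nth x m = - l2_nth (l2_shift x) m" for m
  proof -
    have "- l2_shift x = (-1) *\<^sub>R l2_shift x" by simp
    then have "l2_nth x m = l2_nth ((-1) *\<^sub>R l2_shift x) m" using assms by simp
    also have "\<dots> = - l2_nth (l2_shift x) m" by (simp only: l2_nth_simps)
    finally show ?thesis .
  qed
  have "l2_nth x n = 0"
  proof (induction n)
    case 0
    show ?case using c[of 0] by simp
  next
    case (Suc n)
    then show ?case using c[of "Suc n"] by simp
  qed
  then show "l2_nth x n = l2_nth 0 n" by (simp add: zero_l2.rep_eq)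
qed

text \<open>
  Two maps to the sphere that are never opposite are homotopic, by normalising the segments between
  them.
\<close>

lemma homotopic_on_sphere:
  fixes f g :: "l2 \<Rightarrow> l2"
  assumes f: "continuous_on l2_sphere f" "\<And>x. norm x = 1 \<Longrightarrow> norm (f x) = 1"
    and g: "continuous_on l2_sphere g" "\<And>x. norm x = 1 \<Longrightarrow> norm (g x) = 1"
    and ne: "\<And>x u. norm x = 1 \<Longrightarrow> 0 \<le> u \<Longrightarrow> u \<le> 1 \<Longrightarrow> (1 - u) *\<^sub>R f x + u *\<^sub>R g x \<noteq> 0"
  shows "homotopic_with_canon (\<lambda>_. True) l2_sphere l2_sphere f g"
proof -
  have "homotopic_with_canon (\<lambda>_. True) l2_sphere (- {0}) f g"
  proof (rule homotopic_with_linear[OF f(1) g(1)])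
    show "closed_segment (f x) (g x) \<subseteq> - {0}" if x: "x \<in> l2_sphere" for x
    proof
      fix y assume "y \<in> closed_segment (f x) (g x)"
      then obtain u where u: "0 \<le> u" "u \<le> 1" "y = (1 - u) *\<^sub>R f x + u *\<^sub>R g x"
        unfolding closed_segment_def by blast
      have "norm x = 1" using x by (simp add: mem_l2_sphere)
      from ne[OF this u(1,2)] show "y \<in> - {0}" unfolding u(3) by simp
    qed
  qed
  moreover have "continuous_on (- {0}) (sgn :: l2 \<Rightarrow> l2)"
    by (intro continuous_on_sgn continuous_on_id) auto
  moreover have "sgn \<in> - {0} \<rightarrow> l2_sphere" by (auto simp: mem_l2_sphere norm_sgn)
  ultimately have "homotopic_with_canon (\<lambda>_. True) l2_sphere l2_sphere (sgn \<circ> f) (sgn \<circ> g)"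
    by (rule homotopic_with_compose_continuous_left)
  then show ?thesis
    by (rule homotopic_with_eq) (auto simp: mem_l2_sphere sgn_div_norm f(2) g(2))
qed

text \<open>
  The identity is homotopic to the shift, because no vector is opposite to its shift, and the shift is
  homotopic to a constant map, because its image is orthogonal to \<open>e\<^sub>0\<close>.
\<close>

lemma contractible_l2_sphere: "contractible l2_sphere"
proof -
  have sn: "norm (l2_shift x) = norm x" for x by (simp add: norm_eq_sqrt_inner)
  have sc: "continuous_on l2_sphere l2_shift"
    by (rule bounded_linear.continuous_on[OF bounded_linear_l2_shift(1) continuous_on_id])
  have "homotopic_with_canon (\<lambda>_. True) l2_sphere l2_sphere id l2_shift"
  proof (rule homotopic_on_sphere)
    fix x :: l2 and u :: real assume x: "norm x = 1" and u: "0 \<le> u" "u \<le> 1"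
    show "(1 - u) *\<^sub>R id x + u *\<^sub>R l2_shift x \<noteq> 0"
    proof
      assume "(1 - u) *\<^sub>R id x + u *\<^sub>R l2_shift x = 0"
      then have e: "(1 - u) *\<^sub>R x = - (u *\<^sub>R l2_shift x)" by (simp add: eq_neg_iff_add_eq_0)
      then have "norm ((1 - u) *\<^sub>R x) = norm (u *\<^sub>R l2_shift x)" by (simp only: norm_minus_cancel)
      then have u2: "u = 1 / 2" using x u sn by simp
      have "(1 / 2) *\<^sub>R x = (1 / 2) *\<^sub>R (- l2_shift x)" using e[unfolded u2] by simp
      then have "x = - l2_shift x" unfolding scaleR_cancel_left by simp
      then show False using l2_shift_no_eigenvector x by force
    qed
  qed (simp_all add: sc sn)
  moreover have "homotopic_with_canon (\<lambda>_. True) l2_sphere l2_sphere l2_shift (\<lambda>x. l2_e0)"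
  proof (rule homotopic_on_sphere)
    fix x :: l2 and u :: real assume x: "norm x = 1" and u: "0 \<le> u" "u \<le> 1"
    show "(1 - u) *\<^sub>R l2_shift x + u *\<^sub>R l2_e0 \<noteq> 0"
    proof
      assume z: "(1 - u) *\<^sub>R l2_shift x + u *\<^sub>R l2_e0 = 0"
      then have "inner l2_e0 ((1 - u) *\<^sub>R l2_shift x + u *\<^sub>R l2_e0) = 0" by simp
      moreover have "l2_e0 \<noteq> 0" using norm_l2_e0 by (metis norm_zero zero_neq_one)
      ultimately have "u = 0" by (simp add: inner_add_right)
      then have "l2_shift x = 0" using z by simp
      then show False using x sn[of x] by simp
    qed
  qed (simp_all add: sc sn)
  ultimately show ?thesis
    unfolding contractible_def using homotopic_with_trans by blast
qed

lemma simply_connected_l2_sphere: "simply_connected l2_sphere"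
  by (rule contractible_imp_simply_connected[OF contractible_l2_sphere])

lemma path_connected_l2_sphere: "path_connected l2_sphere"
  using simply_connected_l2_sphere simply_connected_eq_homotopic_paths by blast

context spherical_quotient
begin

lemma pathin_profile:
  assumes "pathin space \<gamma>"
  shows "path (profile \<circ> \<gamma>)" "path_image (profile \<circ> \<gamma>) \<subseteq> quot ` l2_sphere"
    "t \<in> {0..1} \<Longrightarrow> \<gamma> t \<in> points"
proof -
  have c: "continuous_map (top_of_set {0..1}) space \<gamma>" using assms by (simp add: pathin_def)
  from continuous_map_compose[OF c continuous_map_profile] show "path (profile \<circ> \<gamma>)"
    by (simp add: path_def)
  show p: "\<gamma> t \<in> points" if "t \<in> {0..1}" for t
    using c that unfolding continuous_map_def topspace_space by auto
  show "path_image (profile \<circ> \<gamma>) \<subseteq> quot ` l2_sphere"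
    using p unfolding path_image_def points_def quot_def by fastforce
qed

lemma profile_eq_quot_iff:
  assumes "x \<in> l2_sphere" "p \<in> points"
  shows "quot x = profile p \<longleftrightarrow> orb x = p"
  using inj_on_profile assms orb_in_points unfolding quot_def inj_on_def by blast

definition lifts :: "(real \<Rightarrow> l2) \<Rightarrow> (real \<Rightarrow> l2 set) \<Rightarrow> bool" where
  "lifts \<sigma> \<gamma> \<longleftrightarrow> path \<sigma> \<and> path_image \<sigma> \<subseteq> l2_sphere \<and> (\<forall>t\<in>{0..1}. orb (\<sigma> t) = \<gamma> t)"

lemma lifts_sphere: "lifts \<sigma> \<gamma> \<Longrightarrow> t \<in> {0..1} \<Longrightarrow> \<sigma> t \<in> l2_sphere"
  unfolding lifts_def path_image_def by blast

lemma lift_exists: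
  assumes \<gamma>: "pathin space \<gamma>" and x: "x \<in> \<gamma> 0"
  obtains \<sigma> where "lifts \<sigma> \<gamma>" "\<sigma> 0 = x"
proof -
  have p0: "\<gamma> 0 \<in> points" using pathin_profile(3)[OF \<gamma>] by simp
  then obtain y where y: "y \<in> l2_sphere" "\<gamma> 0 = orb y" by (auto simp: points_def)
  then have xS: "x \<in> l2_sphere" and ox: "orb x = \<gamma> 0"
    using x orb_mem_sphere orb_eqI by auto
  have st: "pathstart (profile \<circ> \<gamma>) = quot x" using ox by (simp add: pathstart_def quot_def)
  obtain \<sigma> where \<sigma>: "path \<sigma>" "path_image \<sigma> \<subseteq> l2_sphere" "pathstart \<sigma> = x"
    "\<And>t. t \<in> {0..1} \<Longrightarrow> quot (\<sigma> t) = (profile \<circ> \<gamma>) t"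
    using covering_space_lift_path_strong[OF covering_space_quot xS pathin_profile(1,2)[OF \<gamma>] st] by metis
  have "orb (\<sigma> t) = \<gamma> t" if t: "t \<in> {0..1}" for t
  proof -
    have "\<sigma> t \<in> l2_sphere" using \<sigma>(2) t unfolding path_image_def by blast
    then show ?thesis using \<sigma>(4)[OF t] profile_eq_quot_iff pathin_profile(3)[OF \<gamma> t] by simp
  qed
  then show ?thesis using that[of \<sigma>] \<sigma> by (simp add: lifts_def pathstart_def)
qed

lemma lift_unique:
  assumes "lifts \<sigma>1 \<gamma>" "lifts \<sigma>2 \<gamma>" "\<sigma>1 0 = \<sigma>2 0" and t: "t \<in> {0..1}"
  shows "\<sigma>1 t = \<sigma>2 t"
proof (rule covering_space_lift_unique[where a = 0 and T = "{0..1}" and f = "quot \<circ> \<sigma>1"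
        and ?g1.0 = \<sigma>1 and ?g2.0 = \<sigma>2,
      OF covering_space_quot assms(3)])
  let ?f = "quot \<circ> \<sigma>1"
  have c: "continuous_on {0..1} \<sigma>1" "continuous_on {0..1} \<sigma>2" using assms(1,2) by (auto simp: lifts_def path_def)
  show "continuous_on {0..1} ?f" by (intro continuous_on_compose c continuous_on_quot)
  show "?f \<in> {0..1} \<rightarrow> quot ` l2_sphere" using lifts_sphere[OF assms(1)] by auto
  show "?f t = quot (\<sigma>2 t)" if "t \<in> {0..1}" for t
    using assms(1,2) that by (simp add: lifts_def quot_def)
qed (use assms lifts_sphere[OF assms(1)] lifts_sphere[OF assms(2)] in \<open>auto simp: lifts_def path_def\<close>)

lemma lifts_pathin:
  assumes "path \<sigma>" "path_image \<sigma> \<subseteq> l2_sphere"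
  shows "pathin space (orb \<circ> \<sigma>)"
proof -
  have "continuous_map (top_of_set {0..1}) (top_of_set l2_sphere) \<sigma>"
    using assms by (auto simp: path_def path_image_def continuous_map_in_subtopology)
  then show ?thesis unfolding pathin_def using continuous_map_compose continuous_map_orb by blast
qed

lemma lifts_translate:
  assumes "lifts \<sigma> \<gamma>" "g \<in> carrier G" shows "lifts (T g \<circ> \<sigma>) \<gamma>"
proof -
  have "path (T g \<circ> \<sigma>)"
    using assms(1) unfolding lifts_def path_def o_def
    by (intro bounded_linear.continuous_on[OF bounded_linear_T[OF assms(2)]]) simp
  moreover have "path_image (T g \<circ> \<sigma>) \<subseteq> l2_sphere"
    using assms(2) lifts_sphere[OF assms(1)] by (auto simp: path_image_def T_in_sphere)
  ultimately show ?thesis using assms by (simp add: lifts_def orb_T)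
qed

context
  fixes p x0 assumes p: "p \<in> points" and x0: "x0 \<in> p"
begin

lemma base_point: "x0 \<in> l2_sphere" "orb x0 = p"
proof -
  obtain y where "y \<in> l2_sphere" "p = orb y" using p by (auto simp: points_def)
  then show "x0 \<in> l2_sphere" "orb x0 = p" using x0 orb_mem_sphere orb_eqI by auto
qed

text \<open>
  The lift of a loop that starts at \<open>x0\<close> ends in the orbit of \<open>x0\<close>, hence at the translate of \<open>x0\<close> by a
  unique group element.
\<close>

definition deck :: "(real \<Rightarrow> l2 set) \<Rightarrow> 'g" where
  "deck \<gamma> = (SOME g. g \<in> carrier G \<and> (\<exists>\<sigma>. lifts \<sigma> \<gamma> \<and> \<sigma> 0 = x0 \<and> \<sigma> 1 = T g x0))"

lemma deck_lift:
  assumes "\<gamma> \<in> loops_at space p"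
  obtains \<sigma> where "deck \<gamma> \<in> carrier G" "lifts \<sigma> \<gamma>" "\<sigma> 0 = x0" "\<sigma> 1 = T (deck \<gamma>) x0"
proof -
  have \<gamma>: "pathin space \<gamma>" "\<gamma> 0 = p" "\<gamma> 1 = p" using assms by (auto simp: loops_at_def)
  obtain \<sigma> where \<sigma>: "lifts \<sigma> \<gamma>" "\<sigma> 0 = x0" using lift_exists[OF \<gamma>(1)] \<gamma>(2) x0 by metis
  have "orb x0 = orb (\<sigma> 1)" using \<sigma>(1) \<gamma>(3) base_point by (simp add: lifts_def)
  then obtain g where "g \<in> carrier G" "\<sigma> 1 = T g x0" by (auto simp: orb_eq_iff)
  with \<sigma> have "\<exists>g. g \<in> carrier G \<and> (\<exists>\<sigma>. lifts \<sigma> \<gamma> \<and> \<sigma> 0 = x0 \<and> \<sigma> 1 = T g x0)" by blast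
  from someI_ex[OF this] show ?thesis using that unfolding deck_def[symmetric] by blast
qed

lemma deck_unique:
  assumes \<gamma>: "\<gamma> \<in> loops_at space p" and g: "g \<in> carrier G" and \<sigma>: "lifts \<sigma> \<gamma>" "\<sigma> 0 = x0" "\<sigma> 1 = T g x0"
  shows "deck \<gamma> = g"
proof -
  obtain \<sigma>' where \<sigma>': "deck \<gamma> \<in> carrier G" "lifts \<sigma>' \<gamma>" "\<sigma>' 0 = x0" "\<sigma>' 1 = T (deck \<gamma>) x0"
    using deck_lift[OF \<gamma>] .
  have "\<sigma>' 1 = \<sigma> 1" by (rule lift_unique[OF \<sigma>'(2) \<sigma>(1)]) (simp_all add: \<sigma> \<sigma>')
  then have "T (deck \<gamma>) x0 = T g x0" using \<sigma> \<sigma>' by simp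
  moreover have "x0 \<noteq> 0" using base_point by (auto simp: mem_l2_sphere)
  ultimately show ?thesis using T_eq_iff[OF \<sigma>'(1) g] by simp
qed

text \<open>
  Homotopies lift, so homotopic loops have lifts with the same end; conversely two lifts with the same end are
  homotopic because the sphere is simply connected, and the homotopy can be projected.
\<close>

lemma loop_homotopy_iff:
  "(\<gamma>, \<delta>) \<in> loop_homotopy space p \<longleftrightarrow> \<gamma> \<in> loops_at space p \<and> \<delta> \<in> loops_at space p \<and> deck \<gamma> = deck \<delta>"
proof (cases "\<gamma> \<in> loops_at space p \<and> \<delta> \<in> loops_at space p")
  case True
  then have \<gamma>: "pathin space \<gamma>" "\<gamma> 0 = p" "\<gamma> 1 = p" and \<delta>: "pathin space \<delta>" "\<delta> 0 = p" "\<delta> 1 = p"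
    by (auto simp: loops_at_def)
  obtain \<sigma> where \<sigma>: "deck \<gamma> \<in> carrier G" "lifts \<sigma> \<gamma>" "\<sigma> 0 = x0" "\<sigma> 1 = T (deck \<gamma>) x0"
    using deck_lift[of \<gamma>] True by blast
  obtain \<rho> where \<rho>: "deck \<delta> \<in> carrier G" "lifts \<rho> \<delta>" "\<rho> 0 = x0" "\<rho> 1 = T (deck \<delta>) x0"
    using deck_lift[of \<delta>] True by blast
  have "homotopic_with (\<lambda>h. h 0 = p \<and> h 1 = p) (top_of_set {0..1}) space \<gamma> \<delta> \<longleftrightarrow> deck \<gamma> = deck \<delta>"
  proof
    assume "homotopic_with (\<lambda>h. h 0 = p \<and> h 1 = p) (top_of_set {0..1}) space \<gamma> \<delta>"
    from homotopic_with_compose_continuous_map_left[OF this continuous_map_profile,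
        of "\<lambda>r. pathstart r = pathstart (profile \<circ> \<gamma>) \<and> pathfinish r = pathfinish (profile \<circ> \<gamma>)"]
    have "homotopic_with (\<lambda>r. pathstart r = pathstart (profile \<circ> \<gamma>) \<and> pathfinish r = pathfinish (profile \<circ> \<gamma>))
        (top_of_set {0..1}) euclidean (profile \<circ> \<gamma>) (profile \<circ> \<delta>)"
      using \<gamma> by (simp add: pathstart_def pathfinish_def)
    then obtain h where h: "continuous_map (prod_topology (top_of_set {0..1::real}) (top_of_set {0..1})) space h"
      "\<forall>t. h (0, t) = \<gamma> t" "\<forall>t. h (1, t) = \<delta> t" "\<forall>s\<in>{0..1}. h (s, 0) = p \<and> h (s, 1) = p"
      using \<open>homotopic_with (\<lambda>h. h 0 = p \<and> h 1 = p) (top_of_set {0..1}) space \<gamma> \<delta>\<close>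
      unfolding homotopic_with_def by auto
    have im: "profile (h z) \<in> quot ` l2_sphere" if "z \<in> {0..1} \<times> {0..1}" for z
    proof -
      have "h z \<in> points" using h(1) that unfolding continuous_map_def topspace_space by auto
      then show ?thesis by (auto simp: points_def quot_def)
    qed
    have "homotopic_paths (quot ` l2_sphere) (profile \<circ> \<gamma>) (profile \<circ> \<delta>)"
      unfolding homotopic_paths_def homotopic_with_def
    proof (intro exI[of _ "profile \<circ> h"] conjI)
      have "continuous_map (prod_topology (top_of_set {0..1::real}) (top_of_set {0..1})) euclidean (profile \<circ> h)"
        using continuous_map_compose[OF h(1) continuous_map_profile] .
      then show "continuous_map (prod_topology (top_of_set {0..1}) (top_of_set {0..1})) (top_of_set (quot ` l2_sphere)) (profile \<circ> h)"
        using im by (auto simp: continuous_map_in_subtopology)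
    qed (use h \<gamma> in \<open>auto simp: pathstart_def pathfinish_def\<close>)
    then have "homotopic_paths l2_sphere \<sigma> \<rho>"
    proof (rule covering_space_lift_homotopic_paths[OF covering_space_quot, rotated 4])
      show "path (profile \<circ> \<gamma>)" "path_image (profile \<circ> \<gamma>) \<subseteq> quot ` l2_sphere" using pathin_profile[OF \<gamma>(1)] by auto
      show "path (profile \<circ> \<delta>)" "path_image (profile \<circ> \<delta>) \<subseteq> quot ` l2_sphere" using pathin_profile[OF \<delta>(1)] by auto
    qed (use \<sigma> \<rho> in \<open>auto simp: lifts_def quot_def pathstart_def\<close>)
    then have "\<sigma> 1 = \<rho> 1" using homotopic_paths_imp_pathfinish by (auto simp: pathfinish_def)
    moreover have "x0 \<noteq> 0" using base_point by (auto simp: mem_l2_sphere)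
    ultimately show "deck \<gamma> = deck \<delta>" using T_eq_iff[OF \<sigma>(1) \<rho>(1)] \<sigma>(4) \<rho>(4) by simp
  next
    assume eq: "deck \<gamma> = deck \<delta>"
    have "homotopic_paths l2_sphere \<sigma> \<rho>"
      using simply_connected_l2_sphere \<sigma> \<rho> eq unfolding simply_connected_eq_homotopic_paths
      by (auto simp: lifts_def pathstart_def pathfinish_def)
    then have "homotopic_with (\<lambda>r. pathstart r = pathstart \<sigma> \<and> pathfinish r = pathfinish \<sigma>)
        (top_of_set {0..1}) (top_of_set l2_sphere) \<sigma> \<rho>" by (simp add: homotopic_paths_def)
    then have "homotopic_with (\<lambda>h. h 0 = p \<and> h 1 = p) (top_of_set {0..1}) space (orb \<circ> \<sigma>) (orb \<circ> \<rho>)"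
    proof (rule homotopic_with_compose_continuous_map_left[OF _ continuous_map_orb])
      fix j assume "pathstart j = pathstart \<sigma> \<and> pathfinish j = pathfinish \<sigma>"
      then show "(orb \<circ> j) 0 = p \<and> (orb \<circ> j) 1 = p"
        using \<sigma> base_point by (simp add: pathstart_def pathfinish_def orb_T)
    qed
    then show "homotopic_with (\<lambda>h. h 0 = p \<and> h 1 = p) (top_of_set {0..1}) space \<gamma> \<delta>"
      by (rule homotopic_with_eq) (use \<sigma> \<rho> in \<open>auto simp: lifts_def\<close>)
  qed
  then show ?thesis using True by (simp add: loop_homotopy_def)
qed (auto simp: loop_homotopy_def)

text \<open>
  The lift of the second loop has to start where that of the first one ends, so it is translated by
  \<open>deck \<gamma>\<close> and ends at \<open>T (deck \<gamma> \<otimes> deck \<delta>) x0\<close>.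
\<close>

lemma join_loops_deck:
  assumes \<gamma>: "\<gamma> \<in> loops_at space p" and \<delta>: "\<delta> \<in> loops_at space p"
  shows "join_loops \<gamma> \<delta> \<in> loops_at space p" "deck (join_loops \<gamma> \<delta>) = deck \<gamma> \<otimes> deck \<delta>"
proof -
  obtain \<sigma> where \<sigma>: "deck \<gamma> \<in> carrier G" "lifts \<sigma> \<gamma>" "\<sigma> 0 = x0" "\<sigma> 1 = T (deck \<gamma>) x0"
    using deck_lift[OF \<gamma>] .
  obtain \<rho> where \<rho>: "deck \<delta> \<in> carrier G" "lifts \<rho> \<delta>" "\<rho> 0 = x0" "\<rho> 1 = T (deck \<delta>) x0"
    using deck_lift[OF \<delta>] .
  define \<tau> where "\<tau> = \<sigma> +++ (T (deck \<gamma>) \<circ> \<rho>)"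
  have \<rho>': "lifts (T (deck \<gamma>) \<circ> \<rho>) \<delta>" by (rule lifts_translate[OF \<rho>(2) \<sigma>(1)])
  have "pathfinish \<sigma> = pathstart (T (deck \<gamma>) \<circ> \<rho>)" using \<sigma> \<rho> by (simp add: pathfinish_def pathstart_def)
  then have pt: "path \<tau>" "path_image \<tau> \<subseteq> l2_sphere"
    using \<sigma>(2) \<rho>' unfolding \<tau>_def lifts_def by (auto simp: path_image_join)
  have eq: "orb (\<tau> t) = join_loops \<gamma> \<delta> t" if t: "t \<in> {0..1}" for t
  proof (cases "t \<le> 1 / 2")
    case True
    then have "2 * t \<in> {0..1}" using t by simp
    then show ?thesis using True \<sigma>(2) by (simp add: \<tau>_def joinpaths_def join_loops_def lifts_def)
  next
    case False
    then have "2 * t - 1 \<in> {0..1}" using t by simp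
    then show ?thesis using False \<rho>' by (simp add: \<tau>_def joinpaths_def join_loops_def lifts_def)
  qed
  then have l: "lifts \<tau> (join_loops \<gamma> \<delta>)" using pt by (simp add: lifts_def)
  have "pathin space (join_loops \<gamma> \<delta>)"
  proof -
    have "continuous_map (top_of_set {0..1}) space (orb \<circ> \<tau>)" using lifts_pathin[OF pt] by (simp add: pathin_def)
    then show ?thesis unfolding pathin_def by (rule continuous_map_eq) (simp add: eq)
  qed
  then show j: "join_loops \<gamma> \<delta> \<in> loops_at space p"
    using \<gamma> \<delta> by (simp add: loops_at_def join_loops_def)
  show "deck (join_loops \<gamma> \<delta>) = deck \<gamma> \<otimes> deck \<delta>"
    using \<sigma> \<rho> by (intro deck_unique[OF j _ l]) (simp_all add: \<tau>_def joinpaths_def T_mult')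
qed

lemma deck_surj:
  assumes g: "g \<in> carrier G" obtains \<gamma> where "\<gamma> \<in> loops_at space p" "deck \<gamma> = g"
proof -
  have "T g x0 \<in> l2_sphere" using base_point T_in_sphere g by simp
  then obtain \<sigma> where \<sigma>: "path \<sigma>" "path_image \<sigma> \<subseteq> l2_sphere" "pathstart \<sigma> = x0" "pathfinish \<sigma> = T g x0"
    using path_connected_l2_sphere base_point unfolding path_connected_def by blast
  have l: "orb \<circ> \<sigma> \<in> loops_at space p"
    using lifts_pathin[OF \<sigma>(1,2)] \<sigma>(3,4) base_point g
    by (simp add: loops_at_def pathstart_def pathfinish_def orb_T)
  moreover have "deck (orb \<circ> \<sigma>) = g"
    using \<sigma> by (intro deck_unique[OF l g, where \<sigma> = \<sigma>]) (simp_all add: lifts_def pathstart_def pathfinish_def)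
  ultimately show ?thesis using that by blast
qed

lemma fundamental_group_iso: "fundamental_group space p \<cong> G"
proof -
  let ?L = "loops_at space p" and ?R = "loop_homotopy space p"
  let ?F = "fundamental_group space p"
  have cl: "?R `` {\<gamma>} = {\<delta> \<in> ?L. deck \<delta> = deck \<gamma>}" if "\<gamma> \<in> ?L" for \<gamma>
    using that by (auto simp: loop_homotopy_iff)
  have car: "carrier ?F = (\<lambda>\<gamma>. ?R `` {\<gamma>}) ` ?L"
    by (auto simp: fundamental_group_def quotient_def)
  define h where "h a = deck (SOME \<gamma>. \<gamma> \<in> a)" for a
  have h: "h (?R `` {\<gamma>}) = deck \<gamma>" if \<gamma>: "\<gamma> \<in> ?L" for \<gamma>
  proof -
    have "\<gamma> \<in> ?R `` {\<gamma>}" using cl[OF \<gamma>] \<gamma> by simp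
    then have "(SOME \<delta>. \<delta> \<in> ?R `` {\<gamma>}) \<in> ?R `` {\<gamma>}" by (rule someI[of "\<lambda>\<delta>. \<delta> \<in> ?R `` {\<gamma>}"])
    then show ?thesis unfolding h_def using cl[OF \<gamma>] by simp
  qed
  have dc: "deck \<gamma> \<in> carrier G" if "\<gamma> \<in> ?L" for \<gamma> using deck_lift[OF that] by blast
  have mult: "(?R `` {\<gamma>}) \<otimes>\<^bsub>?F\<^esub> (?R `` {\<delta>}) = ?R `` {join_loops \<gamma> \<delta>}" if "\<gamma> \<in> ?L" "\<delta> \<in> ?L" for \<gamma> \<delta>
  proof -
    have "?R `` {join_loops \<gamma>' \<delta>'} = ?R `` {join_loops \<gamma> \<delta>}" if "\<gamma>' \<in> ?R `` {\<gamma>}" "\<delta>' \<in> ?R `` {\<delta>}" for \<gamma>' \<delta>'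
    proof -
      have "\<gamma>' \<in> ?L" "\<delta>' \<in> ?L" "deck \<gamma>' = deck \<gamma>" "deck \<delta>' = deck \<delta>" using that by (auto simp: loop_homotopy_iff)
      then show ?thesis using join_loops_deck \<open>\<gamma> \<in> ?L\<close> \<open>\<delta> \<in> ?L\<close> by (simp add: cl)
    qed
    moreover have "\<gamma> \<in> ?R `` {\<gamma>}" "\<delta> \<in> ?R `` {\<delta>}" using cl that by auto
    ultimately have "(\<Union>\<gamma>'\<in>?R `` {\<gamma>}. \<Union>\<delta>'\<in>?R `` {\<delta>}. ?R `` {join_loops \<gamma>' \<delta>'}) = ?R `` {join_loops \<gamma> \<delta>}"
      by blast
    then show ?thesis by (simp add: fundamental_group_def)
  qed
  have "h \<in> iso ?F G"
    unfolding iso_def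
  proof (intro CollectI conjI)
    show "h \<in> hom ?F G"
    proof (rule homI)
      fix a assume "a \<in> carrier ?F" then show "h a \<in> carrier G" unfolding car using h dc by auto
    next
      fix a b assume "a \<in> carrier ?F" "b \<in> carrier ?F"
      then obtain \<gamma> \<delta> where "\<gamma> \<in> ?L" "\<delta> \<in> ?L" "a = ?R `` {\<gamma>}" "b = ?R `` {\<delta>}" unfolding car by blast
      then show "h (a \<otimes>\<^bsub>?F\<^esub> b) = h a \<otimes> h b" using mult h join_loops_deck by simp
    qed
    show "bij_betw h (carrier ?F) (carrier G)"
      unfolding bij_betw_def
    proof
      show "inj_on h (carrier ?F)"
      proof (rule inj_onI)
        fix a b assume "a \<in> carrier ?F" "b \<in> carrier ?F" "h a = h b"
        then obtain \<gamma> \<delta> where "\<gamma> \<in> ?L" "\<delta> \<in> ?L" "a = ?R `` {\<gamma>}" "b = ?R `` {\<delta>}" "deck \<gamma> = deck \<delta>"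
          unfolding car using h by auto
        then show "a = b" by (simp add: cl)
      qed
      show "h ` carrier ?F = carrier G"
      proof (intro equalityI subsetI)
        fix g assume "g \<in> carrier G"
        then obtain \<gamma> where "\<gamma> \<in> ?L" "deck \<gamma> = g" using deck_surj by blast
        then show "g \<in> h ` carrier ?F" unfolding car using h by (metis image_eqI)
      qed (use h dc car in auto)
    qed
  qed
  then show ?thesis unfolding is_iso_def by blast
qed

end

lemma fundamental_group_space: "p \<in> points \<Longrightarrow> fundamental_group space p \<cong> G"
  using fundamental_group_iso orb_self by (auto simp: points_def)

end

section \<open>The distance of the orbit space and its completeness\<close>

instance l2 :: banach ..

definition stereo_inv_deriv :: "real \<Rightarrow> l2 \<Rightarrow> l2 \<Rightarrow> l2" where
  "stereo_inv_deriv s x v = (- 2 * inner x v * (inverse (1 + inner x x))\<^sup>2) *\<^sub>R stereo_num s x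
     + inverse (1 + inner x x) *\<^sub>R (2 *\<^sub>R l2_shift v + (2 * s * inner x v) *\<^sub>R l2_e0)"

definition stereo_deriv :: "real \<Rightarrow> l2 \<Rightarrow> l2 \<Rightarrow> l2" where
  "stereo_deriv s y w = (s * inner l2_e0 w * (inverse (1 - s * inner l2_e0 y))\<^sup>2) *\<^sub>R l2_unshift y
     + inverse (1 - s * inner l2_e0 y) *\<^sub>R l2_unshift w"

lemma has_derivative_stereo_inv: "(stereo_inv s has_derivative stereo_inv_deriv s x) (at x)"
proof -
  have n: "(stereo_num s has_derivative (\<lambda>v. 2 *\<^sub>R l2_shift v + (2 * s * inner x v) *\<^sub>R l2_e0)) (at x)"
    unfolding stereo_num_def
    by (auto intro!: derivative_eq_intros bounded_linear_imp_has_derivative[OF bounded_linear_l2_shift(1)] simp: inner_commute algebra_simps)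
  have i: "((\<lambda>x. inverse (1 + inner x x)) has_derivative (\<lambda>v. - 2 * inner x v * (inverse (1 + inner x x))\<^sup>2)) (at x)"
    using one_add_inner_neq[of x]
    by (auto intro!: derivative_eq_intros simp: inner_commute power2_eq_square)
  show ?thesis
    unfolding stereo_inv_def stereo_inv_deriv_def using has_derivative_scaleR[OF i n] by (simp add: add.commute)
qed

lemma has_derivative_stereo:
  assumes "1 - s * inner l2_e0 y \<noteq> 0"
  shows "(stereo s has_derivative stereo_deriv s y) (at y)"
proof -
  have n: "(l2_unshift has_derivative l2_unshift) (at y)"
    by (rule bounded_linear_imp_has_derivative[OF bounded_linear_l2_shift(2)])
  have i: "((\<lambda>y. inverse (1 - s * inner l2_e0 y)) has_derivative
      (\<lambda>w. s * inner l2_e0 w * (inverse (1 - s * inner l2_e0 y))\<^sup>2)) (at y)"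
    using assms by (auto intro!: derivative_eq_intros simp: power2_eq_square)
  show ?thesis
    unfolding stereo_def stereo_deriv_def using has_derivative_scaleR[OF i n] by (simp add: add.commute)
qed

lemma norm_stereo_inv_deriv:
  assumes s: "s\<^sup>2 = 1"
  shows "(norm (stereo_inv_deriv s x v))\<^sup>2 = sphere_factor x * (norm v)\<^sup>2"
proof -
  define k where "k = 1 + inner x x"
  define a where "a = inner x v"
  define N where "N = stereo_num s x"
  define D where "D = 2 *\<^sub>R l2_shift v + (2 * s * a) *\<^sub>R l2_e0"
  have k: "k \<noteq> 0" using one_add_inner_neq[of x] by (simp add: k_def)
  have e: "inner l2_e0 l2_e0 = 1" using norm_eq_1[of l2_e0] by simp
  have NN: "inner N N = k\<^sup>2"
    unfolding N_def inner_stereo_num[OF s] k_def by (simp add: power2_eq_square algebra_simps)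
  have "inner N D = 4 * a + (s * (inner x x - 1)) * (2 * s * a)"
    by (simp add: N_def D_def stereo_num_def inner_add_left inner_add_right e a_def)
  also have "\<dots> = 4 * a + s\<^sup>2 * ((inner x x - 1) * (2 * a))" by (simp add: power2_eq_square)
  also have "\<dots> = 2 * a * k" using s by (simp add: k_def algebra_simps)
  finally have ND: "inner N D = 2 * a * k" .
  have "inner D D = 4 * inner v v + (2 * s * a) * (2 * s * a)"
    by (simp add: D_def inner_add_left inner_add_right e)
  also have "(2 * s * a) * (2 * s * a) = s\<^sup>2 * (4 * a\<^sup>2)" by (simp add: power2_eq_square)
  finally have DD: "inner D D = 4 * inner v v + 4 * a\<^sup>2" using s by simp
  have sq: "inner (b *\<^sub>R N + c *\<^sub>R D) (b *\<^sub>R N + c *\<^sub>R D) = b\<^sup>2 * inner N N + 2 * (b * c * inner N D) + c\<^sup>2 * inner D D" for b c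
    by (simp add: inner_add_left inner_add_right inner_commute[of D N] power2_eq_square algebra_simps)
  have "stereo_inv_deriv s x v = (- 2 * a * (inverse k)\<^sup>2) *\<^sub>R N + inverse k *\<^sub>R D"
    unfolding stereo_inv_deriv_def k_def a_def N_def D_def ..
  then have "inner (stereo_inv_deriv s x v) (stereo_inv_deriv s x v)
      = (- 2 * a * (inverse k)\<^sup>2)\<^sup>2 * inner N N + 2 * ((- 2 * a * (inverse k)\<^sup>2) * inverse k * inner N D) + (inverse k)\<^sup>2 * inner D D"
    by (simp only: sq)
  also have "\<dots> = 4 * (inverse k)\<^sup>2 * inner v v"
  proof -
    define j where "j = inverse k"
    have jk: "j * k = 1" using k by (simp add: j_def)
    have "(- 2 * a * j\<^sup>2)\<^sup>2 * k\<^sup>2 = 4 * a\<^sup>2 * j\<^sup>2 * (j * k)\<^sup>2" by (simp add: power2_eq_square)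
    then have 1: "(- 2 * a * j\<^sup>2)\<^sup>2 * k\<^sup>2 = 4 * a\<^sup>2 * j\<^sup>2" unfolding jk by simp
    have "2 * ((- 2 * a * j\<^sup>2) * j * (2 * a * k)) = - 8 * a\<^sup>2 * j\<^sup>2 * (j * k)" by (simp add: power2_eq_square)
    then have 2: "2 * ((- 2 * a * j\<^sup>2) * j * (2 * a * k)) = - 8 * a\<^sup>2 * j\<^sup>2" unfolding jk by simp
    show ?thesis unfolding NN ND DD j_def[symmetric] 1 2 by (simp add: algebra_simps)
  qed
  finally show ?thesis
    unfolding power2_norm_eq_inner sphere_factor_def k_def by (simp add: divide_inverse power_inverse)
qed

lemma continuous_on_stereo_inv_deriv:
  assumes "continuous_on N f" "continuous_on N v"
  shows "continuous_on N (\<lambda>t. stereo_inv_deriv s (f t) (v t))"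
  unfolding stereo_inv_deriv_def stereo_num_def
  by (intro continuous_intros assms bounded_linear.continuous_on[OF bounded_linear_l2_shift(1)])
     (simp_all add: one_add_inner_neq)

lemma continuous_on_stereo_deriv:
  assumes "continuous_on N f" "continuous_on N v" "\<And>t. t \<in> N \<Longrightarrow> 1 - s * inner l2_e0 (f t) \<noteq> 0"
  shows "continuous_on N (\<lambda>t. stereo_deriv s (f t) (v t))"
  unfolding stereo_deriv_def
  by (intro continuous_intros assms(1,2) bounded_linear.continuous_on[OF bounded_linear_l2_shift(2)])
     (use assms(3) in simp_all)

lemma continuous_on_local:
  fixes F :: "'a::t2_space \<Rightarrow> 'b::topological_space"
  assumes "\<And>t. t \<in> I \<Longrightarrow> \<exists>W f. open W \<and> t \<in> W \<and> continuous_on (I \<inter> W) f \<and> (\<forall>s\<in>I \<inter> W. F s = f s)"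
  shows "continuous_on I F"
  unfolding continuous_on_eq_continuous_within
proof
  fix t assume t: "t \<in> I"
  obtain W f where W: "open W" "t \<in> W" "continuous_on (I \<inter> W) f" "\<forall>s\<in>I \<inter> W. F s = f s"
    using assms[OF t] by blast
  have "continuous_on (I \<inter> W) F" by (rule continuous_on_eq[OF W(3)]) (use W(4) in simp)
  then have "continuous (at t within I \<inter> W) F" using t W(2) by (simp add: continuous_on_eq_continuous_within)
  moreover have "at t within I \<inter> W = at t within I" using W(1,2) by (intro at_within_nhd[of t W]) auto
  ultimately show "continuous (at t within I) F" by simp
qed

lemma has_vector_derivative_compose:
  assumes f: "(f has_vector_derivative f') (at t within I)" and g: "(g has_derivative g') (at (f t))"
  shows "((\<lambda>t. g (f t)) has_vector_derivative g' f') (at t within I)"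
proof -
  have "((\<lambda>t. g (f t)) has_derivative (\<lambda>h. g' (h *\<^sub>R f'))) (at t within I)"
    using has_derivative_compose[OF f[unfolded has_vector_derivative_def] g] .
  then show ?thesis
    unfolding has_vector_derivative_def by (simp add: linear_scale[OF has_derivative_linear[OF g]])
qed

lemma has_vector_derivative_transform_local:
  assumes f: "(f has_vector_derivative f') (at t within I)" and W: "open W" "t \<in> W" and t: "t \<in> I"
    and eq: "\<And>s. s \<in> I \<Longrightarrow> s \<in> W \<Longrightarrow> g s = f s"
  shows "(g has_vector_derivative f') (at t within I)"
proof -
  obtain d where d: "d > 0" "ball t d \<subseteq> W" using W by (rule openE)
  show ?thesis
    unfolding has_vector_derivative_def
    by (rule has_derivative_transform_within[OF f[unfolded has_vector_derivative_def] d(1) t])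
       (use d(2) eq in \<open>auto simp: dist_commute subset_iff\<close>)
qed

text \<open>
  One-sided derivatives are meant at the ends, as for \<open>C1_curve\<close>.
\<close>

definition C1_path :: "(real \<Rightarrow> 'a::real_normed_vector) \<Rightarrow> (real \<Rightarrow> 'a) \<Rightarrow> bool" where
  "C1_path \<sigma> \<sigma>' \<longleftrightarrow> continuous_on {0..1} \<sigma>' \<and> (\<forall>t\<in>{0..1}. (\<sigma> has_vector_derivative \<sigma>' t) (at t within {0..1}))"

lemma C1_path_continuous: "C1_path \<sigma> \<sigma>' \<Longrightarrow> continuous_on {0..1} \<sigma>"
  unfolding C1_path_def continuous_on_eq_continuous_within using has_vector_derivative_continuous by blast

lemma vector_derivative_01:
  "t \<in> {0..1::real} \<Longrightarrow> (f has_vector_derivative f') (at t within {0..1}) \<Longrightarrow> vector_derivative f (at t within {0..1}) = f'"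
  using vector_derivative_within_cbox[of 0 1 t f f'] by simp

context spherical_quotient
begin

lemma preimage_window:
  assumes \<sigma>: "continuous_on {0..1} \<sigma>" "\<And>t. t \<in> {0..1} \<Longrightarrow> \<sigma> t \<in> l2_sphere"
    and U: "openin (top_of_set l2_sphere) U" and g: "g \<in> carrier G"
  obtains W where "open W" "\<And>t. t \<in> {0..1} \<Longrightarrow> t \<in> W \<longleftrightarrow> T g (\<sigma> t) \<in> U"
proof -
  obtain U0 where U0: "open U0" "U = l2_sphere \<inter> U0" using U by (auto simp: openin_open)
  have "continuous_on {0..1} (\<lambda>t. T g (\<sigma> t))"
    by (rule bounded_linear.continuous_on[OF bounded_linear_T[OF g] \<sigma>(1)])
  then have "openin (top_of_set {0..1}) ({0..1} \<inter> (\<lambda>t. T g (\<sigma> t)) -` U0)"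
    using U0(1) by (rule continuous_openin_preimage_gen)
  then obtain W where W: "open W" "{0..1} \<inter> (\<lambda>t. T g (\<sigma> t)) -` U0 = {0..1} \<inter> W" unfolding openin_open by blast
  have "t \<in> W \<longleftrightarrow> T g (\<sigma> t) \<in> U" if t: "t \<in> {0..1}" for t
  proof -
    have "t \<in> W \<longleftrightarrow> T g (\<sigma> t) \<in> U0" using W(2) t by blast
    then show ?thesis using T_in_sphere[OF g \<sigma>(2)[OF t]] U0(2) by simp
  qed
  with W(1) that show ?thesis by blast
qed

text \<open>
  Locally, a curve in the orbit space and its lift are related by a group element and
  stereographic projection, both of which are smooth and isometric.
\<close>

lemma C1_curve_lift:
  assumes C: "C1_curve space atlas \<gamma>" and x: "x \<in> \<gamma> 0"
  obtains \<sigma> \<sigma>' where "lifts \<sigma> \<gamma>" "\<sigma> 0 = x" "C1_path \<sigma> \<sigma>'"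
    "\<And>t. t \<in> {0..1} \<Longrightarrow> round_metric (\<gamma> t) (velocity atlas \<gamma> t) (velocity atlas \<gamma> t) = (norm (\<sigma>' t))\<^sup>2"
proof -
  have \<gamma>: "pathin space \<gamma>" using C by (simp add: C1_curve_def)
  obtain \<sigma> where \<sigma>: "lifts \<sigma> \<gamma>" "\<sigma> 0 = x" using lift_exists[OF \<gamma> x] .
  have \<sigma>c: "continuous_on {0..1} \<sigma>" using \<sigma>(1) by (simp add: lifts_def path_def)
  note \<sigma>S = lifts_sphere[OF \<sigma>(1)]
  have \<sigma>o: "orb (\<sigma> t) = \<gamma> t" if "t \<in> {0..1}" for t using \<sigma>(1) that by (simp add: lifts_def)
  have loc: "\<exists>W f. open W \<and> t0 \<in> W \<and> continuous_on ({0..1} \<inter> W) f \<and>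
      (\<forall>t\<in>{0..1} \<inter> W. (\<sigma> has_vector_derivative f t) (at t within {0..1})) \<and>
      (norm (f t0))\<^sup>2 = sphere_factor (snd c (\<gamma> t0)) * (norm (vector_derivative (snd c \<circ> \<gamma>) (at t0 within {0..1})))\<^sup>2"
    if t0: "t0 \<in> {0..1}" and c: "c \<in> atlas" "\<gamma> t0 \<in> fst c" for t0 c
  proof -
    obtain U s where U: "c = chart U s" "admissible U s" using c(1) by (rule atlasE)
    obtain y where y: "y \<in> U" "\<gamma> t0 = orb y" using c(2) unfolding U(1) chart_dom[OF U(2)] by blast
    have "orb y = orb (\<sigma> t0)" using \<sigma>o[OF t0] y by simp
    then obtain g where g: "g \<in> carrier G" "\<sigma> t0 = T g y" by (auto simp: orb_eq_iff)
    have ig: "inv g \<in> carrier G" using g by simp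
    have oU: "openin (top_of_set l2_sphere) U" using U(2) by (simp add: admissible_def)
    obtain W where W: "open W" "\<And>t. t \<in> {0..1} \<Longrightarrow> t \<in> W \<longleftrightarrow> T (inv g) (\<sigma> t) \<in> U"
      using preimage_window[OF \<sigma>c \<sigma>S oU ig] by blast
    have t0W: "t0 \<in> W" using W(2)[OF t0] g y by (simp add: isoT)
    have coord: "\<gamma> t \<in> fst c" "\<sigma> t = T g (stereo_inv s ((snd c \<circ> \<gamma>) t))" if t: "t \<in> {0..1}" "t \<in> W" for t
    proof -
      have z: "T (inv g) (\<sigma> t) \<in> U" using W(2) t by simp
      have e: "\<gamma> t = orb (T (inv g) (\<sigma> t))" using orb_T[OF ig] \<sigma>o[OF t(1)] by simp
      then show "\<gamma> t \<in> fst c" unfolding U(1) chart_dom[OF U(2)] using z by blast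
      have "snd c (\<gamma> t) = stereo s (T (inv g) (\<sigma> t))" unfolding U(1) e chart_orb[OF U(2) z] ..
      then show "\<sigma> t = T g (stereo_inv s ((snd c \<circ> \<gamma>) t))"
        using stereo_inv_stereo_U[OF U(2) z] g(1) by (simp add: isoT)
    qed
    define D where "D = {t \<in> {0..1}. \<gamma> t \<in> fst c}"
    obtain \<gamma>' where \<gamma>': "continuous_on D \<gamma>'"
      "\<And>t. t \<in> D \<Longrightarrow> ((snd c \<circ> \<gamma>) has_vector_derivative \<gamma>' t) (at t within {0..1})"
      using C c(1) unfolding C1_curve_def Let_def D_def by blast
    have WD: "{0..1} \<inter> W \<subseteq> D" using coord(1) by (auto simp: D_def)
    have cc: "continuous_on ({0..1} \<inter> W) (snd c \<circ> \<gamma>)"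
      unfolding continuous_on_eq_continuous_within
    proof
      fix t assume t: "t \<in> {0..1} \<inter> W"
      then have "continuous (at t within {0..1}) (snd c \<circ> \<gamma>)"
        using has_vector_derivative_continuous \<gamma>'(2) WD by blast
      then show "continuous (at t within {0..1} \<inter> W) (snd c \<circ> \<gamma>)" by (rule continuous_within_subset) auto
    qed
    define f where "f t = T g (stereo_inv_deriv s ((snd c \<circ> \<gamma>) t) (\<gamma>' t))" for t
    show ?thesis
    proof (intro exI[of _ W] exI[of _ f] conjI ballI W(1) t0W)
      show "continuous_on ({0..1} \<inter> W) f"
        unfolding f_def
        by (rule bounded_linear.continuous_on[OF bounded_linear_T[OF g(1)]
            continuous_on_stereo_inv_deriv[OF cc continuous_on_subset[OF \<gamma>'(1) WD]]])
      fix t assume t: "t \<in> {0..1} \<inter> W"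
      have "((\<lambda>t. T g (stereo_inv s ((snd c \<circ> \<gamma>) t))) has_vector_derivative f t) (at t within {0..1})"
        unfolding f_def
        by (rule has_vector_derivative_compose[OF has_vector_derivative_compose[OF \<gamma>'(2)[OF subsetD[OF WD t]]
              has_derivative_stereo_inv] bounded_linear_imp_has_derivative[OF bounded_linear_T[OF g(1)]]])
      then show "(\<sigma> has_vector_derivative f t) (at t within {0..1})"
        by (rule has_vector_derivative_transform_local[OF _ W(1)]) (use t coord(2) in auto)
    next
      have "t0 \<in> D" using t0 t0W WD by blast
      then show "(norm (f t0))\<^sup>2 = sphere_factor (snd c (\<gamma> t0)) * (norm (vector_derivative (snd c \<circ> \<gamma>) (at t0 within {0..1})))\<^sup>2"
        using vector_derivative_01[OF t0 \<gamma>'(2)] norm_stereo_inv_deriv[OF admissible_s[OF U(2)]] g(1)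
        by (simp add: f_def isoT)
    qed
  qed
  define \<sigma>' where "\<sigma>' t = vector_derivative \<sigma> (at t within {0..1})" for t
  have pts: "\<gamma> t \<in> points" if "t \<in> {0..1}" for t using pathin_profile(3)[OF \<gamma> that] .
  have "C1_path \<sigma> \<sigma>'"
    unfolding C1_path_def
  proof
    show "\<forall>t\<in>{0..1}. (\<sigma> has_vector_derivative \<sigma>' t) (at t within {0..1})"
    proof
      fix t :: real assume t: "t \<in> {0..1}"
      obtain c where "c \<in> atlas" "\<gamma> t \<in> fst c" using atlas_at[OF pts[OF t]] .
      from loc[OF t this] obtain f where "(\<sigma> has_vector_derivative f t) (at t within {0..1})" using t by blast
      then show "(\<sigma> has_vector_derivative \<sigma>' t) (at t within {0..1})"
        unfolding \<sigma>'_def by (simp only: vector_derivative_01[OF t])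
    qed
    show "continuous_on {0..1} \<sigma>'"
    proof (rule continuous_on_local)
      fix t :: real assume t: "t \<in> {0..1}"
      obtain c where "c \<in> atlas" "\<gamma> t \<in> fst c" using atlas_at[OF pts[OF t]] .
      from loc[OF t this] obtain W f where W: "open W" "t \<in> W" "continuous_on ({0..1} \<inter> W) f"
        "\<forall>t\<in>{0..1} \<inter> W. (\<sigma> has_vector_derivative f t) (at t within {0..1})" by blast
      moreover have "\<forall>t\<in>{0..1} \<inter> W. \<sigma>' t = f t"
        unfolding \<sigma>'_def using W(4) by (intro ballI vector_derivative_01) auto
      ultimately show "\<exists>W f. open W \<and> t \<in> W \<and> continuous_on ({0..1} \<inter> W) f \<and> (\<forall>s\<in>{0..1} \<inter> W. \<sigma>' s = f s)"
        by blast
    qed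
  qed
  moreover have "round_metric (\<gamma> t) (velocity atlas \<gamma> t) (velocity atlas \<gamma> t) = (norm (\<sigma>' t))\<^sup>2"
    if t: "t \<in> {0..1}" for t
  proof -
    define d where "d = (SOME d. d \<in> atlas \<and> \<gamma> t \<in> fst d)"
    obtain c where "c \<in> atlas" "\<gamma> t \<in> fst c" using atlas_at[OF pts[OF t]] .
    then have d: "d \<in> atlas" "\<gamma> t \<in> fst d" unfolding d_def using someI[of "\<lambda>d. d \<in> atlas \<and> \<gamma> t \<in> fst d" c] by auto
    from loc[OF t d] obtain f where f: "(\<sigma> has_vector_derivative f t) (at t within {0..1})"
      "(norm (f t))\<^sup>2 = sphere_factor (snd d (\<gamma> t)) * (norm (vector_derivative (snd d \<circ> \<gamma>) (at t within {0..1})))\<^sup>2"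
      using t by blast
    have "\<sigma>' t = f t" using vector_derivative_01[OF t f(1)] by (simp add: \<sigma>'_def)
    moreover have "velocity atlas \<gamma> t d = vector_derivative (snd d \<circ> \<gamma>) (at t within {0..1})"
      using d by (simp add: velocity_def)
    ultimately show ?thesis
      unfolding round_metric_def Let_def d_def[symmetric]
      by (simp only: f(2)[unfolded power2_norm_eq_inner] power2_norm_eq_inner)
  qed
  ultimately show ?thesis using that \<sigma> by blast
qed

text \<open>
  In a chart the projected curve is the stereographic projection of a translate of \<open>\<sigma>\<close>, on the open set of
  times at which the translate stays in the domain.
\<close>

lemma C1_curve_orb:
  assumes \<sigma>: "C1_path \<sigma> \<sigma>'" and S: "\<And>t. t \<in> {0..1} \<Longrightarrow> \<sigma> t \<in> l2_sphere"
  shows "C1_curve space atlas (orb \<circ> \<sigma>)" "lifts \<sigma> (orb \<circ> \<sigma>)"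
proof -
  have \<sigma>c: "continuous_on {0..1} \<sigma>" by (rule C1_path_continuous[OF \<sigma>])
  have p: "path \<sigma>" "path_image \<sigma> \<subseteq> l2_sphere" using \<sigma>c S by (auto simp: path_def path_image_def)
  then show "lifts \<sigma> (orb \<circ> \<sigma>)" by (simp add: lifts_def)
  have \<sigma>d: "(\<sigma> has_vector_derivative \<sigma>' t) (at t within {0..1})" if "t \<in> {0..1}" for t
    using \<sigma> that by (simp add: C1_path_def)
  show "C1_curve space atlas (orb \<circ> \<sigma>)"
    unfolding C1_curve_def Let_def
  proof (intro conjI ballI)
    show "pathin space (orb \<circ> \<sigma>)" by (rule lifts_pathin[OF p])
    fix c assume c: "c \<in> atlas"
    obtain U s where U: "c = chart U s" "admissible U s" using c by (rule atlasE)
    have oU: "openin (top_of_set l2_sphere) U" using U(2) by (simp add: admissible_def)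
    define D where "D = {t \<in> {0..1}. (orb \<circ> \<sigma>) t \<in> fst c}"
    have loc: "\<exists>W f. open W \<and> t0 \<in> W \<and> continuous_on ({0..1} \<inter> W) f \<and>
        (\<forall>t\<in>{0..1} \<inter> W. ((snd c \<circ> (orb \<circ> \<sigma>)) has_vector_derivative f t) (at t within {0..1}))"
      if "t0 \<in> D" for t0
    proof -
      have t0: "t0 \<in> {0..1}" "orb (\<sigma> t0) \<in> fst c" using that by (auto simp: D_def)
      obtain y where y: "y \<in> U" "orb (\<sigma> t0) = orb y" using t0(2) unfolding U(1) chart_dom[OF U(2)] by blast
      then obtain g where g: "g \<in> carrier G" "y = T g (\<sigma> t0)" by (auto simp: orb_eq_iff)
      obtain W where W: "open W" "\<And>t. t \<in> {0..1} \<Longrightarrow> t \<in> W \<longleftrightarrow> T g (\<sigma> t) \<in> U"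
        using preimage_window[OF \<sigma>c S oU g(1)] by blast
      have t0W: "t0 \<in> W" using W(2)[OF t0(1)] g y by simp
      have ne: "1 - s * inner l2_e0 z \<noteq> 0" if "z \<in> U" for z
        using that U(2) square_one_mult_eq_one[of s "inner l2_e0 z"] by (auto simp: admissible_def)
      define f where "f t = stereo_deriv s (T g (\<sigma> t)) (T g (\<sigma>' t))" for t
      show ?thesis
      proof (intro exI[of _ W] exI[of _ f] conjI ballI W(1) t0W)
        show "continuous_on ({0..1} \<inter> W) f"
          unfolding f_def
        proof (rule continuous_on_stereo_deriv)
          have "continuous_on {0..1} \<sigma>'" using \<sigma> by (simp add: C1_path_def)
          then show "continuous_on ({0..1} \<inter> W) (\<lambda>t. T g (\<sigma>' t))"
            by (intro bounded_linear.continuous_on[OF bounded_linear_T[OF g(1)]] continuous_on_subset[where t = "{0..1} \<inter> W"]) auto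
          show "continuous_on ({0..1} \<inter> W) (\<lambda>t. T g (\<sigma> t))"
            by (intro bounded_linear.continuous_on[OF bounded_linear_T[OF g(1)]] continuous_on_subset[OF \<sigma>c]) auto
          show "1 - s * inner l2_e0 (T g (\<sigma> t)) \<noteq> 0" if "t \<in> {0..1} \<inter> W" for t
            using ne W(2)[of t] that by simp
        qed
        fix t assume t: "t \<in> {0..1} \<inter> W"
        have "((\<lambda>t. stereo s (T g (\<sigma> t))) has_vector_derivative f t) (at t within {0..1})"
          unfolding f_def
        proof (rule has_vector_derivative_compose[OF has_vector_derivative_compose[OF \<sigma>d
                bounded_linear_imp_has_derivative[OF bounded_linear_T[OF g(1)]]] has_derivative_stereo])
          show "t \<in> {0..1}" using t by simp
          show "1 - s * inner l2_e0 (T g (\<sigma> t)) \<noteq> 0" using ne W(2)[of t] t by simp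
        qed
        then show "((snd c \<circ> (orb \<circ> \<sigma>)) has_vector_derivative f t) (at t within {0..1})"
        proof (rule has_vector_derivative_transform_local[OF _ W(1)])
          fix r assume r: "r \<in> {0..1}" "r \<in> W"
          then have z: "T g (\<sigma> r) \<in> U" using W(2) by simp
          have "orb (\<sigma> r) = orb (T g (\<sigma> r))" using orb_T[OF g(1)] by simp
          then show "(snd c \<circ> (orb \<circ> \<sigma>)) r = stereo s (T g (\<sigma> r))"
            unfolding U(1) using chart_orb[OF U(2) z] by simp
        qed (use t in auto)
      qed
    qed
    define \<gamma>' where "\<gamma>' t = vector_derivative (snd c \<circ> (orb \<circ> \<sigma>)) (at t within {0..1})" for t
    show "\<exists>\<gamma>'. continuous_on {t \<in> {0..1}. (orb \<circ> \<sigma>) t \<in> fst c} \<gamma>' \<and>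
        (\<forall>t\<in>{t \<in> {0..1}. (orb \<circ> \<sigma>) t \<in> fst c}. ((snd c \<circ> (orb \<circ> \<sigma>)) has_vector_derivative \<gamma>' t) (at t within {0..1}))"
      unfolding D_def[symmetric]
    proof (intro exI[of _ \<gamma>'] conjI ballI)
      fix t assume t: "t \<in> D"
      then have t1: "t \<in> {0..1}" by (simp add: D_def)
      from loc[OF t] obtain f where "((snd c \<circ> (orb \<circ> \<sigma>)) has_vector_derivative f t) (at t within {0..1})"
        using t1 by blast
      then show "((snd c \<circ> (orb \<circ> \<sigma>)) has_vector_derivative \<gamma>' t) (at t within {0..1})"
        unfolding \<gamma>'_def by (simp only: vector_derivative_01[OF t1])
    next
      show "continuous_on D \<gamma>'"
      proof (rule continuous_on_local)
        fix t assume "t \<in> D"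
        from loc[OF this] obtain W f where W: "open W" "t \<in> W" "continuous_on ({0..1} \<inter> W) f"
          "\<forall>t\<in>{0..1} \<inter> W. ((snd c \<circ> (orb \<circ> \<sigma>)) has_vector_derivative f t) (at t within {0..1})" by blast
        have "D \<inter> W \<subseteq> {0..1} \<inter> W" by (auto simp: D_def)
        then have "continuous_on (D \<inter> W) f" "\<forall>t\<in>D \<inter> W. \<gamma>' t = f t"
          using W(3,4) continuous_on_subset vector_derivative_01 unfolding \<gamma>'_def by blast+
        then show "\<exists>W f. open W \<and> t \<in> W \<and> continuous_on (D \<inter> W) f \<and> (\<forall>s\<in>D \<inter> W. \<gamma>' s = f s)"
          using W(1,2) by blast
      qed
    qed
  qed
qed

lemma curve_length_lift:
  assumes C: "C1_curve space atlas \<gamma>" and l: "lifts \<sigma> \<gamma>" and \<sigma>: "C1_path \<sigma> \<sigma>'"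
  shows "curve_length atlas round_metric \<gamma> = integral {0..1} (\<lambda>t. norm (\<sigma>' t))"
proof -
  have "\<sigma> 0 \<in> \<gamma> 0" using l orb_self[of "\<sigma> 0"] by (simp add: lifts_def)
  then obtain \<rho> \<rho>' where \<rho>: "lifts \<rho> \<gamma>" "\<rho> 0 = \<sigma> 0" "C1_path \<rho> \<rho>'"
    "\<And>t. t \<in> {0..1} \<Longrightarrow> round_metric (\<gamma> t) (velocity atlas \<gamma> t) (velocity atlas \<gamma> t) = (norm (\<rho>' t))\<^sup>2"
    using C1_curve_lift[OF C] by metis
  have "\<rho>' t = \<sigma>' t" if t: "t \<in> {0..1}" for t
  proof -
    have "(\<rho> has_vector_derivative \<rho>' t) (at t within {0..1})" "(\<sigma> has_vector_derivative \<sigma>' t) (at t within {0..1})"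
      using \<rho>(3) \<sigma> t by (auto simp: C1_path_def)
    moreover from this(1) have "(\<sigma> has_vector_derivative \<rho>' t) (at t within {0..1})"
      by (rule has_vector_derivative_transform_local[OF _ open_UNIV UNIV_I t]) (use lift_unique[OF \<rho>(1) l \<rho>(2)] in simp)
    ultimately show ?thesis using vector_derivative_01[OF t] by metis
  qed
  then show ?thesis
    unfolding curve_length_def by (intro integral_cong) (simp add: \<rho>(4))
qed

lemma dist_endpoints_le_length:
  assumes \<sigma>: "C1_path \<sigma> (\<sigma>' :: real \<Rightarrow> l2)"
  shows "dist (\<sigma> 0) (\<sigma> 1) \<le> integral {0..1} (\<lambda>t. norm (\<sigma>' t))"
proof -
  have "(\<sigma>' has_integral (\<sigma> 1 - \<sigma> 0)) {0..1}"
    using \<sigma> by (intro fundamental_theorem_of_calculus) (auto simp: C1_path_def)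
  moreover have "(\<lambda>t. norm (\<sigma>' t)) integrable_on {0..1}"
    using \<sigma> by (intro integrable_continuous_real continuous_intros) (simp add: C1_path_def)
  ultimately have "norm (\<sigma> 1 - \<sigma> 0) \<le> integral {0..1} (\<lambda>t. norm (\<sigma>' t))"
    using integral_norm_bound_integral[of \<sigma>' "{0..1}" "\<lambda>t. norm (\<sigma>' t)"] by (simp add: integral_unique has_integral_integrable)
  then show ?thesis by (simp add: dist_norm norm_minus_commute)
qed

end

text \<open>
  In contrast to \<open>great_circle_through\<close> this includes the degenerate cases \<open>y = x\<close> and \<open>y = - x\<close>, where any
  unit vector \<open>u\<close> orthogonal to \<open>x\<close> serves.
\<close>

lemma l2_great_circle:
  fixes x y :: l2
  assumes x: "norm x = 1" and y: "norm y = 1"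
  obtains u where "norm u = 1" "inner x u = 0"
    "y = cos (arccos (inner x y)) *\<^sub>R x + sin (arccos (inner x y)) *\<^sub>R u"
proof -
  obtain u where u: "norm u = 1" "inner x u = 0"
  proof -
    have "inner l2_e0 l2_e0 = 1" using norm_eq_1[of l2_e0] by simp
    then have n: "norm (l2_shift l2_e0) = 1" by (simp only: norm_eq_sqrt_inner inner_l2_shift real_sqrt_one)
    have ne: "l2_e0 \<noteq> l2_shift l2_e0" "l2_e0 \<noteq> - l2_shift l2_e0"
    proof -
      have "inner l2_e0 l2_e0 = 1" using norm_eq_1[of l2_e0] by simp
      moreover have "inner l2_e0 (l2_shift l2_e0) = 0" by simp
      ultimately show "l2_e0 \<noteq> l2_shift l2_e0" "l2_e0 \<noteq> - l2_shift l2_e0" by (metis zero_neq_one, metis inner_minus_right neg_0_equal_iff_equal zero_neq_one)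
    qed
    obtain z where z: "norm z = 1" "z \<noteq> x" "z \<noteq> - x"
    proof (cases "l2_e0 = x \<or> l2_e0 = - x")
      case True
      then have "l2_shift l2_e0 \<noteq> x" "l2_shift l2_e0 \<noteq> - x" using ne by auto
      with n that show ?thesis by blast
    next
      case False
      then show ?thesis using that[of l2_e0] by simp
    qed
    from great_circle_through[OF x this] that show ?thesis by metis
  qed
  consider "y = x" | "y = - x" | "y \<noteq> x" "y \<noteq> - x" by blast
  then show ?thesis
  proof cases
    case 1
    then have "inner x y = 1" using x by (simp add: norm_eq_1)
    then show ?thesis using that[OF u] 1 by simp
  next
    case 2
    then have "inner x y = -1" using x by (simp add: norm_eq_1)
    then show ?thesis using that[OF u] 2 by simp
  next
    case 3
    from great_circle_through[OF x y 3] that show ?thesis by metis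
  qed
qed

lemma C1_path_great_circle:
  fixes x u :: l2
  assumes "norm x = 1" "norm u = 1" "inner x u = 0"
  shows "C1_path (\<lambda>t. cos (c * t) *\<^sub>R x + sin (c * t) *\<^sub>R u) (\<lambda>t. c *\<^sub>R (cos (c * t) *\<^sub>R u - sin (c * t) *\<^sub>R x))"
  unfolding C1_path_def
proof (intro conjI ballI)
  show "continuous_on {0..1} (\<lambda>t. c *\<^sub>R (cos (c * t) *\<^sub>R u - sin (c * t) *\<^sub>R x))"
    by (intro continuous_intros)
  fix t
  have "((\<lambda>t. c * t) has_vector_derivative c) (at t within {0..1})"
    by (auto intro!: derivative_eq_intros)
  from has_vector_derivative_compose[OF this great_circle(2)[OF assms, unfolded has_vector_derivative_def]]
  show "((\<lambda>t. cos (c * t) *\<^sub>R x + sin (c * t) *\<^sub>R u) has_vector_derivative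
      c *\<^sub>R (cos (c * t) *\<^sub>R u - sin (c * t) *\<^sub>R x)) (at t within {0..1})" .
qed

lemma C1_path_reverse:
  assumes "C1_path \<sigma> \<sigma>'"
  shows "C1_path (\<lambda>t. \<sigma> (1 - t)) (\<lambda>t. - \<sigma>' (1 - t))"
  unfolding C1_path_def
proof (intro conjI ballI)
  have "continuous_on {0..1} (\<lambda>t::real. \<sigma>' (1 - t))"
    by (rule continuous_on_compose2[of "{0..1}" \<sigma>' _ "\<lambda>t. 1 - t"])
       (use assms in \<open>auto simp: C1_path_def intro!: continuous_intros\<close>)
  then show "continuous_on {0..1} (\<lambda>t. - \<sigma>' (1 - t))" by (rule continuous_on_minus)
  fix t :: real assume t: "t \<in> {0..1}"
  have img: "(\<lambda>t::real. 1 - t) ` {0..1} = {0..1}"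
    by (auto simp: image_iff intro!: bexI[of _ "1 - x" for x])
  have "(\<sigma> has_vector_derivative \<sigma>' (1 - t)) (at (1 - t) within {0..1})"
    using assms t by (simp add: C1_path_def)
  then have "(\<sigma> has_derivative (\<lambda>h. h *\<^sub>R \<sigma>' (1 - t))) (at (1 - t) within (\<lambda>t. 1 - t) ` {0..1})"
    unfolding img by (simp add: has_vector_derivative_def)
  moreover have "((\<lambda>t. 1 - t) has_derivative (\<lambda>h. - h)) (at t within {0..1})"
    by (auto intro!: derivative_eq_intros)
  ultimately have "((\<lambda>t. \<sigma> (1 - t)) has_derivative (\<lambda>h. (- h) *\<^sub>R \<sigma>' (1 - t))) (at t within {0..1})"
    using has_derivative_in_compose by blast
  then show "((\<lambda>t. \<sigma> (1 - t)) has_vector_derivative - \<sigma>' (1 - t)) (at t within {0..1})"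
    by (simp add: has_vector_derivative_def)
qed

context spherical_quotient
begin

abbreviation "joined \<equiv> piecewise_C1_joined space atlas round_metric"
abbreviation "rdist \<equiv> riemannian_distance space atlas round_metric"

lemma C1_curve_points: "C1_curve space atlas \<gamma> \<Longrightarrow> t \<in> {0..1} \<Longrightarrow> \<gamma> t \<in> points"
  using pathin_profile(3) by (simp add: C1_curve_def)

text \<open>
  Curves of the orbit space lift to curves of the same length, whose length is at least the distance
  of their endpoints in the ambient space.
\<close>

lemma C1_curve_chord:
  assumes C: "C1_curve space atlas \<gamma>" and x: "x \<in> \<gamma> 0"
  shows "\<exists>y\<in>\<gamma> 1. dist x y \<le> curve_length atlas round_metric \<gamma>"
proof -
  obtain \<sigma> \<sigma>' where \<sigma>: "lifts \<sigma> \<gamma>" "\<sigma> 0 = x" "C1_path \<sigma> \<sigma>'" using C1_curve_lift[OF C x] by metis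
  have "\<sigma> 1 \<in> \<gamma> 1" using \<sigma>(1) orb_self[of "\<sigma> 1"] by (simp add: lifts_def)
  then show ?thesis
    using dist_endpoints_le_length[OF \<sigma>(3)] curve_length_lift[OF C \<sigma>(1,3)] \<sigma>(2) by (intro bexI[of _ "\<sigma> 1"]) simp_all
qed

lemma joined_chord:
  assumes "joined p q l"
  shows "p \<in> points \<and> q \<in> points \<and> (\<forall>x\<in>p. \<exists>y\<in>q. dist x y \<le> l)"
  using assms
proof induction
  case (single \<gamma>)
  then show ?case using C1_curve_chord C1_curve_points by simp
next
  case (append p \<gamma> l)
  have "\<exists>z\<in>\<gamma> 1. dist x z \<le> l + curve_length atlas round_metric \<gamma>" if x: "x \<in> p" for x
  proof -
    obtain y where y: "y \<in> \<gamma> 0" "dist x y \<le> l" using append x by blast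
    obtain z where "z \<in> \<gamma> 1" "dist y z \<le> curve_length atlas round_metric \<gamma>"
      using C1_curve_chord[OF append(2) y(1)] by blast
    then show ?thesis using y(2) dist_triangle[of x z y] by (intro bexI[of _ z]) simp_all
  qed
  then show ?case using append C1_curve_points by simp
qed

lemma points_nonempty: "p \<in> points \<Longrightarrow> \<exists>x\<in>l2_sphere. x \<in> p \<and> p = orb x"
  using orb_self by (auto simp: points_def)

lemma joined_nonneg:
  assumes "joined p q l" shows "l \<ge> 0"
proof -
  obtain x where "x \<in> p" using joined_chord[OF assms] points_nonempty by blast
  then obtain y where "dist x y \<le> l" using joined_chord[OF assms] by blast
  then show ?thesis using zero_le_dist[of x y] by linarith
qed

lemma joined_trans: "joined q r m \<Longrightarrow> joined p q l \<Longrightarrow> joined p r (l + m)"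
proof (induction arbitrary: p l rule: piecewise_C1_joined.induct)
  case (single \<gamma>)
  show ?case by (rule piecewise_C1_joined.append[OF single.prems single.hyps])
next
  case (append q \<gamma> m)
  have "joined p (\<gamma> 1) ((l + m) + curve_length atlas round_metric \<gamma>)"
    by (rule piecewise_C1_joined.append[OF append.IH[OF append.prems] append.hyps(2)])
  then show ?case by (simp add: add.assoc)
qed

text \<open>
  Reversal is easier on the sphere than in charts, so the curve is lifted, reversed and projected.
\<close>

lemma joined_reverse_C1:
  assumes C: "C1_curve space atlas \<gamma>"
  shows "joined (\<gamma> 1) (\<gamma> 0) (curve_length atlas round_metric \<gamma>)"
proof -
  obtain x where "x \<in> \<gamma> 0" using points_nonempty[OF C1_curve_points[OF C, of 0]] by auto
  then obtain \<sigma> \<sigma>' where \<sigma>: "lifts \<sigma> \<gamma>" "C1_path \<sigma> \<sigma>'" using C1_curve_lift[OF C] by metis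
  let ?\<rho> = "\<lambda>t. \<sigma> (1 - t)"
  have \<rho>: "C1_path ?\<rho> (\<lambda>t. - \<sigma>' (1 - t))" by (rule C1_path_reverse[OF \<sigma>(2)])
  have "?\<rho> t \<in> l2_sphere" if "t \<in> {0..1}" for t using lifts_sphere[OF \<sigma>(1), of "1 - t"] that by simp
  note C' = C1_curve_orb[OF \<rho> this]
  have "curve_length atlas round_metric (orb \<circ> ?\<rho>) = integral {0..1} (\<lambda>t. norm (\<sigma>' (1 - t)))"
    using curve_length_lift[OF C' \<rho>] by simp
  also have "\<dots> = integral {0..1} (\<lambda>t. norm (\<sigma>' t))"
  proof -
    have "continuous_on {0..1} (\<lambda>t. norm (\<sigma>' t))"
      using \<sigma>(2) by (intro continuous_intros) (simp add: C1_path_def)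
    then have "((\<lambda>t. norm (\<sigma>' t)) has_integral integral {0..1} (\<lambda>t. norm (\<sigma>' t))) (cbox 0 1)"
      using integrable_continuous_real integrable_integral by auto
    from has_integral_affinity[OF this, of "-1" 1]
    have "((\<lambda>t. norm (\<sigma>' (1 - t))) has_integral integral {0..1} (\<lambda>t. norm (\<sigma>' t))) ((\<lambda>t. 1 - t) ` {0..1})"
      by (simp add: algebra_simps)
    moreover have "(\<lambda>t::real. 1 - t) ` {0..1} = {0..1}"
      by (auto simp: image_iff intro!: bexI[of _ "1 - x" for x])
    ultimately show ?thesis by (simp add: integral_unique)
  qed
  also have "\<dots> = curve_length atlas round_metric \<gamma>" using curve_length_lift[OF C \<sigma>] by simp
  finally have len: "curve_length atlas round_metric (orb \<circ> ?\<rho>) = curve_length atlas round_metric \<gamma>" .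
  have "(orb \<circ> ?\<rho>) 0 = \<gamma> 1" "(orb \<circ> ?\<rho>) 1 = \<gamma> 0" using \<sigma>(1) by (simp_all add: lifts_def)
  then show ?thesis using piecewise_C1_joined.single[OF C'(1), of round_metric] len by simp
qed

lemma joined_sym: "joined p q l \<Longrightarrow> joined q p l"
proof (induction rule: piecewise_C1_joined.induct)
  case (single \<gamma>)
  then show ?case by (rule joined_reverse_C1)
next
  case (append p \<gamma> l)
  then show ?case using joined_trans[OF append.IH joined_reverse_C1[OF append.hyps(2)]] by (simp add: add.commute)
qed

text \<open>
  The projection of the great circle arc from \<open>x\<close> to \<open>y\<close>.
\<close>

lemma joined_great_circle:
  assumes x: "x \<in> l2_sphere" and y: "y \<in> l2_sphere"
  shows "joined (orb x) (orb y) (arccos (inner x y))"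
proof -
  have n: "norm x = 1" "norm y = 1" using x y by (simp_all add: mem_l2_sphere)
  define c where "c = arccos (inner x y)"
  have "\<bar>inner x y\<bar> \<le> 1" using Cauchy_Schwarz_ineq2[of x y] n by simp
  then have c: "c \<ge> 0" unfolding c_def by (intro arccos_lbound) auto
  obtain u where u: "norm u = 1" "inner x u = 0" "y = cos c *\<^sub>R x + sin c *\<^sub>R u"
    using l2_great_circle[OF n] unfolding c_def by metis
  let ?\<sigma> = "\<lambda>t. cos (c * t) *\<^sub>R x + sin (c * t) *\<^sub>R u"
  have \<sigma>: "C1_path ?\<sigma> (\<lambda>t. c *\<^sub>R (cos (c * t) *\<^sub>R u - sin (c * t) *\<^sub>R x))"
    by (rule C1_path_great_circle[OF n(1) u(1,2)])
  have "?\<sigma> t \<in> l2_sphere" for t using great_circle(1)[OF n(1) u(1,2)] by (simp add: mem_l2_sphere)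
  note C = C1_curve_orb[OF \<sigma> this]
  have "curve_length atlas round_metric (orb \<circ> ?\<sigma>) = integral {0..1} (\<lambda>t::real. c)"
    unfolding curve_length_lift[OF C \<sigma>] using great_circle(3)[OF n(1) u(1,2)] c by simp
  then have "curve_length atlas round_metric (orb \<circ> ?\<sigma>) = c" by simp
  moreover have "(orb \<circ> ?\<sigma>) 0 = orb x" "(orb \<circ> ?\<sigma>) 1 = orb y" using u(3) by simp_all
  ultimately show ?thesis using piecewise_C1_joined.single[OF C(1), of round_metric] by (simp add: c_def)
qed

lemma joined_exists: "p \<in> points \<Longrightarrow> q \<in> points \<Longrightarrow> \<exists>l. joined p q l"
  using joined_great_circle by (auto simp: points_def)

lemma rdist_eq: "p \<in> points \<Longrightarrow> q \<in> points \<Longrightarrow> rdist p q = Inf {l. joined p q l}"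
  by (simp add: riemannian_distance_def topspace_space)

lemma rdist_le: "joined p q l \<Longrightarrow> rdist p q \<le> l"
  using joined_chord[of p q l] rdist_eq[of p q]
  by (auto intro!: cInf_lower bdd_belowI[of _ 0] joined_nonneg)

lemma rdist_ge:
  assumes "p \<in> points" "q \<in> points" "\<And>l. joined p q l \<Longrightarrow> c \<le> l" shows "c \<le> rdist p q"
  using assms joined_exists by (auto simp: rdist_eq intro!: cInf_greatest)

lemma rdist_less_chord:
  assumes "p \<in> points" "q \<in> points" "rdist p q < r" "x \<in> p"
  shows "\<exists>y\<in>q. dist x y < r"
proof -
  obtain l where l: "joined p q l" "l < r"
    using rdist_ge[OF assms(1,2), of r] assms(3) by (meson not_le)
  then obtain y where "y \<in> q" "dist x y \<le> l" using joined_chord[OF l(1)] assms(4) by blast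
  with l(2) show ?thesis by (intro bexI[of _ y]) simp_all
qed

text \<open>
  Orbits at distance \<open>0\<close> have points at arbitrarily small chordal distance, so they agree because orbits are
  separated.
\<close>

lemma Metric_space_rdist: "Metric_space points rdist"
proof
  show "0 \<le> rdist p q" for p q
  proof (cases "p \<in> points \<and> q \<in> points")
    case True
    then show ?thesis using rdist_ge joined_nonneg by blast
  qed (auto simp: riemannian_distance_def topspace_space)
  have "{l. joined p q l} = {l. joined q p l}" for p q using joined_sym by blast
  then show "rdist p q = rdist q p" for p q
    by (simp add: riemannian_distance_def conj_commute)
  fix p q r assume p: "p \<in> points" and q: "q \<in> points"
  show "rdist p q = 0 \<longleftrightarrow> p = q"
  proof
    assume d0: "rdist p q = 0"
    obtain x where x: "x \<in> l2_sphere" "x \<in> p" "p = orb x" using points_nonempty[OF p] by blast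
    obtain y where y: "y \<in> l2_sphere" "y \<in> q" "q = orb y" using points_nonempty[OF q] by blast
    obtain \<delta> where \<delta>: "\<delta> > 0" "\<And>g. g \<in> carrier G \<Longrightarrow> T g y \<noteq> x \<Longrightarrow> \<delta> \<le> dist (T g y) x"
      using orbit_separated[OF y(1) x(1)] by blast
    obtain z where z: "z \<in> q" "dist x z < \<delta>" using rdist_less_chord[OF p q _ x(2), of \<delta>] d0 \<delta>(1) by auto
    then obtain g where g: "g \<in> carrier G" "z = T g y" using y(3) by (auto simp: orb_def)
    have "T g y = x" using \<delta>(2)[OF g(1)] z(2) g(2) by (force simp: dist_commute)
    then show "p = q" using x(3) y(3) orb_T[OF g(1)] by metis
  next
    assume "p = q"
    obtain x where x: "x \<in> l2_sphere" "p = orb x" using points_nonempty[OF p] by blast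
    have "inner x x = 1" using x by (simp add: mem_l2_sphere norm_eq_1)
    then have "rdist p q \<le> 0" using rdist_le[OF joined_great_circle[OF x(1) x(1)]] x \<open>p = q\<close> by simp
    moreover have "0 \<le> rdist p q" using rdist_ge[OF p q] joined_nonneg by blast
    ultimately show "rdist p q = 0" by simp
  qed
  assume r: "r \<in> points"
  show "rdist p r \<le> rdist p q + rdist q r"
  proof -
    have "rdist p r - rdist p q \<le> m" if m: "joined q r m" for m
    proof -
      have "rdist p r - m \<le> rdist p q"
      proof (rule rdist_ge[OF p q])
        fix l assume "joined p q l"
        then show "rdist p r - m \<le> l" using rdist_le[OF joined_trans[OF m]] by fastforce
      qed
      then show ?thesis by simp
    qed
    then have "rdist p r - rdist p q \<le> rdist q r" by (intro rdist_ge[OF q r])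
    then show ?thesis by simp
  qed
qed

text \<open>
  A Cauchy sequence of orbits with quickly decreasing distances lifts to a Cauchy sequence of the
  sphere, since each lift can be chosen close to the previous one.
\<close>

lemma mcomplete_rdist: "Metric_space.mcomplete points rdist"
proof -
  interpret M: Metric_space points rdist by (rule Metric_space_rdist)
  show ?thesis
    unfolding M.mcomplete_def
  proof (intro allI impI)
    fix p :: "nat \<Rightarrow> l2 set" assume "M.MCauchy p"
    then have pM: "p n \<in> points" and cau: "\<And>e. e > 0 \<Longrightarrow> \<exists>N. \<forall>n n'. N \<le> n \<longrightarrow> N \<le> n' \<longrightarrow> rdist (p n) (p n') < e" for n
      by (auto simp: M.MCauchy_def)
    have "\<forall>k. \<exists>N. \<forall>n n'. N \<le> n \<longrightarrow> N \<le> n' \<longrightarrow> rdist (p n) (p n') < (1 / 2) ^ k"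
      using cau by simp
    then obtain N where N: "\<And>k n n'. N k \<le> n \<Longrightarrow> N k \<le> n' \<Longrightarrow> rdist (p n) (p n') < (1 / 2) ^ k" by metis
    \<comment> \<open>The maximum makes the chosen indices monotone, so that \<open>r k\<close> and \<open>r (Suc k)\<close> both exceed \<open>N k\<close>.\<close>
    define r where "r k = Max (N ` {..k})" for k :: nat
    have rN: "N i \<le> r k" if "i \<le> k" for i k unfolding r_def using that by (intro Max_ge) auto
    have "\<exists>x. (\<forall>k. x k \<in> p (r k)) \<and> (\<forall>k. dist (x k) (x (Suc k)) < (1 / 2) ^ k)"
    proof -
      have "\<exists>x. \<forall>k. x k \<in> p (r k) \<and> dist (x k) (x (Suc k)) < (1 / 2) ^ k"
      proof (rule dependent_nat_choice[where P = "\<lambda>k x. x \<in> p (r k)" and Q = "\<lambda>k x y. dist x y < (1 / 2) ^ k"])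
        show "\<exists>x. x \<in> p (r 0)" using points_nonempty[OF pM] by blast
        fix x k assume "x \<in> p (r k)"
        moreover have "rdist (p (r k)) (p (r (Suc k))) < (1 / 2) ^ k" by (intro N rN) simp_all
        ultimately show "\<exists>y. y \<in> p (r (Suc k)) \<and> dist x y < (1 / 2) ^ k" using rdist_less_chord[OF pM pM] by blast
      qed
      then show ?thesis by blast
    qed
    then obtain x where x: "\<And>k. x k \<in> p (r k)" "\<And>k. dist (x k) (x (Suc k)) < (1 / 2) ^ k" by blast
    have xS: "x k \<in> l2_sphere" and xo: "p (r k) = orb (x k)" for k
    proof -
      obtain y where "y \<in> l2_sphere" "p (r k) = orb y" using points_nonempty[OF pM] by blast
      then show "x k \<in> l2_sphere" "p (r k) = orb (x k)" using x(1)[of k] orb_mem_sphere orb_eqI by auto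
    qed
    have "summable (\<lambda>k. x (Suc k) - x k)"
    proof (rule summable_comparison_test')
      show "summable (\<lambda>k. (1 / 2 :: real) ^ k)" by (rule summable_geometric) simp
      show "norm (x (Suc k) - x k) \<le> (1 / 2) ^ k" for k using x(2)[of k] by (simp add: dist_norm norm_minus_commute)
    qed
    then obtain a where "(\<lambda>m. \<Sum>k<m. x (Suc k) - x k) \<longlonglongrightarrow> a" unfolding summable_def sums_def by blast
    then have "(\<lambda>m. x m - x 0) \<longlonglongrightarrow> a" by (simp add: sum_lessThan_telescope)
    then have "(\<lambda>m. (x m - x 0) + x 0) \<longlonglongrightarrow> a + x 0" by (intro tendsto_add tendsto_const)
    then obtain z where z: "x \<longlonglongrightarrow> z" by auto
    have zS: "z \<in> l2_sphere"
    proof -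
      have "(\<lambda>m. norm (x m)) \<longlonglongrightarrow> norm z" using z by (rule tendsto_norm)
      moreover have "(\<lambda>m. norm (x m)) = (\<lambda>m. 1)" using xS by (simp add: mem_l2_sphere)
      ultimately have "(\<lambda>m. 1) \<longlonglongrightarrow> norm z" by simp
      then have "norm z = 1" by (simp add: LIMSEQ_const_iff)
      then show ?thesis by (simp add: mem_l2_sphere)
    qed
    have "(\<lambda>m. arccos (inner (x m) z)) \<longlonglongrightarrow> arccos (inner z z)"
    proof (rule continuous_on_tendsto_compose[OF continuous_on_arccos'])
      show "(\<lambda>m. inner (x m) z) \<longlonglongrightarrow> inner z z" by (intro tendsto_intros z)
      have "\<bar>inner v z\<bar> \<le> 1" if "v \<in> l2_sphere" for v
        using Cauchy_Schwarz_ineq2[of v z] that zS by (simp add: mem_l2_sphere)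
      then show "inner z z \<in> {-1..1}" "eventually (\<lambda>m. inner (x m) z \<in> {-1..1}) sequentially"
        using zS xS by (auto simp: abs_le_iff minus_le_iff)
    qed
    moreover have "inner z z = 1" using zS by (simp add: mem_l2_sphere norm_eq_1)
    ultimately have arc: "(\<lambda>m. arccos (inner (x m) z)) \<longlonglongrightarrow> 0" by simp
    show "\<exists>q. limitin M.mtopology p q sequentially"
    proof (intro exI[of _ "orb z"])
      show "limitin M.mtopology p (orb z) sequentially"
        unfolding M.limitin_metric
      proof (intro conjI allI impI)
        show "orb z \<in> points" by (rule orb_in_points[OF zS])
        fix e :: real assume e: "e > 0"
        have "eventually (\<lambda>m. arccos (inner (x m) z) < e / 2) sequentially"
          using order_tendstoD(2)[OF arc, of "e / 2"] e by simp
        moreover have "eventually (\<lambda>m. (1 / 2 :: real) ^ m < e / 2) sequentially"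
        proof -
          have "(\<lambda>m. (1 / 2 :: real) ^ m) \<longlonglongrightarrow> 0" by (rule LIMSEQ_power_zero) simp
          from order_tendstoD(2)[OF this, of "e / 2"] e show ?thesis by simp
        qed
        ultimately obtain m where m: "arccos (inner (x m) z) < e / 2" "(1 / 2 :: real) ^ m < e / 2"
          using eventually_happens[OF eventually_conj] trivial_limit_sequentially by blast
        have "p n \<in> points \<and> rdist (p n) (orb z) < e" if n: "n \<ge> r m" for n
        proof
          show "p n \<in> points" by (rule pM)
          have "rdist (p n) (p (r m)) < (1 / 2) ^ m" by (intro N) (use rN[of m m] n in simp_all)
          moreover have "rdist (p (r m)) (orb z) \<le> arccos (inner (x m) z)"
            unfolding xo by (rule rdist_le[OF joined_great_circle[OF xS zS]])
          moreover have "rdist (p n) (orb z) \<le> rdist (p n) (p (r m)) + rdist (p (r m)) (orb z)"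
            by (rule M.triangle[OF pM pM orb_in_points[OF zS]])
          ultimately show "rdist (p n) (orb z) < e" using m by linarith
        qed
        then show "\<forall>\<^sub>F n in sequentially. p n \<in> points \<and> rdist (p n) (orb z) < e"
          unfolding eventually_sequentially by blast
      qed
    qed
  qed
qed

lemma connected_space_space: "connected_space space"
proof -
  have "connected l2_sphere" using path_connected_l2_sphere path_connected_imp_connected by blast
  then have "connectedin space (orb ` l2_sphere)"
    using connectedin_continuous_map_image[OF continuous_map_orb, of l2_sphere] by (simp add: connectedin_subtopology)
  then show ?thesis using connectedin_topspace[of space] by (simp add: topspace_space points_def)
qed

lemma complete_connected_hilbert_manifold_space: "complete_connected_hilbert_manifold space atlas round_metric"
  unfolding complete_connected_hilbert_manifold_def topspace_space
proof (intro conjI hilbert_manifold_space connected_space_space Metric_space_rdist mcomplete_rdist)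
  have "l2_e0 \<in> l2_sphere" by (simp add: mem_l2_sphere)
  then show "points \<noteq> {}" by (auto simp: points_def)
qed

end

section \<open>The characterisation\<close>

text \<open>
  The iterated shifts of \<open>e\<^sub>0\<close> form an infinite orthonormal set.
\<close>

lemma infinite_dim_hilbert_l2: "infinite_dim_hilbert (UNIV :: l2 set)"
proof -
  define e where "e n = (l2_shift ^^ n) l2_e0" for n
  have shift: "inner ((l2_shift ^^ n) x) ((l2_shift ^^ n) y) = inner x y" for n x y
    by (induction n) simp_all
  have orth: "inner (e i) (e j) = 0" if "i < j" for i j
  proof -
    have "e j = (l2_shift ^^ i) ((l2_shift ^^ (j - i)) l2_e0)"
      using that funpow_add[of i "j - i" l2_shift] by (simp add: e_def)
    moreover have "(l2_shift ^^ (j - i)) l2_e0 = l2_shift ((l2_shift ^^ (j - i - 1)) l2_e0)"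
      using that by (cases "j - i") simp_all
    ultimately show ?thesis using shift[of i l2_e0] by (simp add: e_def)
  qed
  then have orth': "inner (e i) (e j) = 0" if "i \<noteq> j" for i j
    using that by (metis inner_commute linorder_neqE_nat)
  have unit: "inner (e i) (e i) = 1" for i
    using shift[of i l2_e0 l2_e0] norm_eq_1[of l2_e0] by (simp add: e_def)
  have "inj e"
  proof (rule injI)
    fix i j assume "e i = e j"
    then show "i = j" using orth'[of i j] unit[of i] by force
  qed
  then have inf: "infinite (range e)" by (rule range_inj_infinite)
  have "independent (range e)"
  proof (rule pairwise_orthogonal_independent)
    show "pairwise orthogonal (range e)"
      unfolding pairwise_def orthogonal_def using orth' by (metis imageE)
    have "e i \<noteq> 0" for i using unit[of i] by force
    then show "0 \<notin> range e" by auto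
  qed
  then have "\<not> (finite B \<and> span B = (UNIV :: l2 set))" for B
    using independent_span_bound[of B "range e"] inf by auto
  then show ?thesis by (simp add: infinite_dim_hilbert_def complete_UNIV)
qed

context spherical_quotient
begin

lemma constant_sectional_curvature_round: "constant_sectional_curvature atlas round_metric 1"
  unfolding constant_sectional_curvature_def
proof (intro ballI allI impI)
  fix c and x u v :: l2
  assume c: "c \<in> atlas" and x: "x \<in> chart_image c" and uv: "u \<noteq> v \<and> independent {u, v}"
  obtain U s where cU: "c = chart U s" and U: "admissible U s" using atlasE[OF c] .
  show "sectional_curvature (metric_coords atlas round_metric c) x u v = 1"
  proof (rule sectional_curvature_conformal)
    show "open (chart_image c)" unfolding cU by (rule open_chart_image[OF U])
    show "metric_coords atlas round_metric c x u v = sphere_factor x * inner u v"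
      if "x \<in> chart_image c" for x u v using metric_coords_round[OF c that] .
  qed (use x uv in auto)
qed

end

theorem corollary8:
  fixes G :: "('g, 'b) monoid_scheme"
  assumes "comm_group G" and "finitely_generated_group G"
    and "infinite_dim_hilbert (UNIV :: 'h::{real_inner, complete_space} set)"
  shows
    "((\<forall>H :: 'h set. infinite_dim_hilbert H \<longrightarrow> acts_freely_isometrically_pd_on_sphere G H)
        \<longleftrightarrow> torsion_sum_of_distinct_prime_powers G) \<and>
     (torsion_sum_of_distinct_prime_powers G \<longrightarrow>
       (\<exists>(X :: l2 set topology) (A :: (l2 set, l2) chart set) (g :: (l2 set, l2) metric_field).
          complete_connected_hilbert_manifold X A g \<and>
          (\<exists>\<kappa>>0. constant_sectional_curvature A g \<kappa>) \<and>
          (\<forall>p\<in>topspace X. fundamental_group X p \<cong> G)))"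
proof (intro conjI impI iffI allI)
  interpret comm_group G by fact
  show "torsion_sum_of_distinct_prime_powers G"
    if "\<forall>H :: 'h set. infinite_dim_hilbert H \<longrightarrow> acts_freely_isometrically_pd_on_sphere G H"
  proof -
    have act: "acts_freely_isometrically_pd_on_sphere G (UNIV :: 'h set)" using that assms(3) by blast
    have "\<exists>v :: 'h. v \<noteq> 0"
    proof (rule ccontr)
      assume "\<not> (\<exists>v :: 'h. v \<noteq> 0)"
      then have "span {} = (UNIV :: 'h set)" by auto
      then show False using assms(3) unfolding infinite_dim_hilbert_def by blast
    qed
    then obtain v :: 'h where v: "v \<noteq> 0" by blast
    have rank: "\<exists>k::nat. y = x [^]\<^bsub>G\<^esub> k"
      if "prime (p::nat)" "x \<in> carrier G" "y \<in> carrier G" "x [^]\<^bsub>G\<^esub> p = \<one>\<^bsub>G\<^esub>" "y [^]\<^bsub>G\<^esub> p = \<one>\<^bsub>G\<^esub>" "x \<noteq> \<one>\<^bsub>G\<^esub>" for p x y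
      by (rule free_isometric_action_imp_rank_one[OF assms(1) act v that(1,2,4,6,3,5)])
    obtain x where "x \<in> torsion_set" "torsion_set = range (\<lambda>k::nat. x [^]\<^bsub>G\<^esub> k)"
      by (rule torsion_cyclic[OF finite_torsion_set[OF assms(2)] rank])
    then show ?thesis by (rule torsion_sum_of_distinct_prime_powersI)
  qed
  assume tors: "torsion_sum_of_distinct_prime_powers G"
  show "acts_freely_isometrically_pd_on_sphere G H" if H: "infinite_dim_hilbert H" for H :: "'h set"
  proof -
    obtain T where "free_orthogonal_action G T H" using free_orthogonal_action_exists[OF assms(2) tors H] .
    then show ?thesis
      using H by (intro free_orthogonal_action.acts_freely_isometrically_pd) (auto simp: infinite_dim_hilbert_def)
  qed
  show "\<exists>(X :: l2 set topology) (A :: (l2 set, l2) chart set) (g :: (l2 set, l2) metric_field).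
          complete_connected_hilbert_manifold X A g \<and>
          (\<exists>\<kappa>>0. constant_sectional_curvature A g \<kappa>) \<and>
          (\<forall>p\<in>topspace X. fundamental_group X p \<cong> G)"
  proof -
    obtain T where T: "free_orthogonal_action G T (UNIV :: l2 set)"
      using free_orthogonal_action_exists[OF assms(2) tors infinite_dim_hilbert_l2] .
    interpret spherical_quotient G T using T by (rule spherical_quotient.intro)
    show ?thesis
    proof (intro exI conjI)
      show "complete_connected_hilbert_manifold space atlas round_metric"
        by (rule complete_connected_hilbert_manifold_space)
      show "(0 :: real) < 1" by simp
      show "constant_sectional_curvature atlas round_metric 1" by (rule constant_sectional_curvature_round)
      show "\<forall>p\<in>topspace space. fundamental_group space p \<cong> G"
        using fundamental_group_space by (simp add: topspace_space)
    qed
  qed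
qed

end
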